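(* For sufficiently small $\varepsilon>0$ the estimate $$\|(\mathcal{H}_\varepsilon-\mathrm{i})^{-1}-(\mathcal{H}_0-\mathrm{i})^{-1}\|_{L_2(\Omega)\to W_2^1(\Omega_\varepsilon)}\leqslant C\,\varepsilon|\ln\varepsilon|^{\frac12}$$ holds true, where $C$ is a constant independent of $\varepsilon$ and $\mathrm{i}$ is the imaginary unit.
   Context: Geometry. Let $x=(x_1,x_2)$ be Cartesian coordinates in $\mathbb{R}^2$ and let $\Pi\subset\mathbb{R}^2$ be an unbounded domain with $C^3$-boundary such that: (i) $\Pi\subseteq\{x: 0<x_1<d\}$ for some $d>0$; (ii) for some $x_2^\infty>0$ and constants $a_\pm$ with $0\leqslant a_\pm<a_\pm+1\leqslant d$ one has $\Pi\cap\{x:\pm x_2>x_2^\infty\}=\{x: a_\pm<x_1<a_\pm+1,\ \pm x_2>x_2^\infty\}$ (two straight outlets of width one); (iii) for some $x_2^0>0$, $\partial\Pi\cap\{x:|x_2|<x_2^0\}=\{x: x_1=0,|x_2|<x_2^0\}\cup\{x: x_1=d,|x_2|<x_2^0\}$. Put $\Omega:=\bigcup_{k\in\mathbb{Z}}\{x:(x_1-kd,x_2)\in\Pi\}$ and, for small $\varepsilon>0$, $\Omega_\varepsilon:=\Omega\cup\bigcup_{k\in\mathbb{Z}}\{x: x_1=kd,\ |x_2|<\varepsilon\}$. The sets $\Omega$ and $\Omega_\varepsilon$ differ by a set of measure zero, so $L_2(\Omega)=L_2(\Omega_\varepsilon)$. Potential. $V$ is a real-valued function, infinitely differentiable in $\overline{\Omega}$,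 $d$-periodic in $x_1$, with $V(x)=0$ for $|x_2|>x_2^\infty$. Operators. For a domain $Q$, $\mathring{W}_2^1(Q)$ is the subspace of the Sobolev space $W_2^1(Q)$ consisting of functions with zero trace on $\partial Q$. $\mathcal{H}_\varepsilon=-\Delta+V$ with the Dirichlet condition is the self-adjoint operator in $L_2(\Omega_\varepsilon)$ associated with the closed lower-semibounded symmetric form $(\nabla u,\nabla v)_{L_2(\Omega_\varepsilon)}+(Vu,v)_{L_2(\Omega_\varepsilon)}$ on $\mathring{W}_2^1(\Omega_\varepsilon)$. $\mathcal{H}_0=-\Delta+V$ with the Dirichlet condition is the self-adjoint operator in $L_2(\Omega)$ associated with the form $(\nabla u,\nabla v)_{L_2(\Omega)}+(Vu,v)_{L_2(\Omega)}$ on $\mathring{W}_2^1(\Omega)$. $\|\cdot\|_{X\to Y}$ is the norm of a bounded operator from a Hilbert space $X$ to a Hilbert space $Y$. Elements of $\mathring{W}_2^1(\Omega)$ are regarded as elements of $\mathring{W}_2^1(\Omega_\varepsilon)$ (zero on the windows). *)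

theory Defs
  imports "HOL-Analysis.Analysis"
begin

section \<open>Functions of class C^k\<close>

primrec Ck_on :: "nat \<Rightarrow> 'a::euclidean_space set \<Rightarrow> ('a \<Rightarrow> real) \<Rightarrow> bool" where
  "Ck_on 0 U f \<longleftrightarrow> continuous_on U f"
| "Ck_on (Suc k) U f \<longleftrightarrow> continuous_on U f \<and> (\<forall>x\<in>U. f differentiable (at x)) \<and>
     (\<forall>e\<in>Basis. Ck_on k U (\<lambda>x. frechet_derivative f (at x) e))"

text \<open>All partial derivatives of order at most \<open>k\<close> exist in the open set \<open>U\<close> and extend
  continuously to its closure.\<close>

primrec Ck_upto_bdry :: "nat \<Rightarrow> 'a::euclidean_space set \<Rightarrow> ('a \<Rightarrow> real) \<Rightarrow> bool" where
  "Ck_upto_bdry 0 U f \<longleftrightarrow> (\<exists>g. continuous_on (closure U) g \<and> (\<forall>x\<in>U. g x = f x))"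
| "Ck_upto_bdry (Suc k) U f \<longleftrightarrow> (\<exists>g. continuous_on (closure U) g \<and> (\<forall>x\<in>U. g x = f x)) \<and>
     (\<forall>x\<in>U. f differentiable (at x)) \<and>
     (\<forall>e\<in>Basis. Ck_upto_bdry k U (\<lambda>x. frechet_derivative f (at x) e))"

definition smooth_on_closure :: "'a::euclidean_space set \<Rightarrow> ('a \<Rightarrow> real) \<Rightarrow> bool" where
  "smooth_on_closure U f \<longleftrightarrow> continuous_on (closure U) f \<and> (\<forall>k. Ck_upto_bdry k U f)"

definition test_function :: "'a::euclidean_space set \<Rightarrow> ('a \<Rightarrow> real) \<Rightarrow> bool" where
  "test_function Q \<phi> \<longleftrightarrow> (\<forall>k. Ck_on k UNIV \<phi>) \<and>
     compact (closure {x. \<phi> x \<noteq> 0}) \<and> closure {x. \<phi> x \<noteq> 0} \<subseteq> Q"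

text \<open>Near each boundary point, the set is the part of a disc above the graph of a \<open>C\<^sup>k\<close>
  function, in Cartesian coordinates centred at that point and directed along \<open>(n2, - n1)\<close>
  and \<open>(n1, n2)\<close>.\<close>

definition Ck_boundary :: "nat \<Rightarrow> (real \<times> real) set \<Rightarrow> bool" where
  "Ck_boundary k U \<longleftrightarrow> (\<forall>p\<in>frontier U. \<exists>r>0. \<exists>n1 n2 \<gamma>. n1\<^sup>2 + n2\<^sup>2 = 1 \<and> Ck_on k UNIV \<gamma> \<and>
     U \<inter> ball p r = {x \<in> ball p r. (x - p) \<bullet> (n1, n2) > \<gamma> ((x - p) \<bullet> (n2, - n1))})"


section \<open>The spaces \<open>L\<^sub>2\<close> and \<open>W\<^sub>2\<^sup>1\<close>\<close>

text \<open>Elements of \<open>L\<^sub>2(Q)\<close> are represented by complex functions on the whole space. Their values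
  outside \<open>Q\<close> and on null sets play no role: every notion below is invariant under
  modification of the functions there.\<close>

definition L2 :: "'a::euclidean_space set \<Rightarrow> ('a \<Rightarrow> complex) set" where
  "L2 Q = {f. f \<in> borel_measurable (lebesgue_on Q) \<and>
              integrable (lebesgue_on Q) (\<lambda>x. (cmod (f x))\<^sup>2)}"

definition L2_inner :: "'a::euclidean_space set \<Rightarrow> ('a \<Rightarrow> complex) \<Rightarrow> ('a \<Rightarrow> complex) \<Rightarrow> complex" where
  "L2_inner Q f g = (LINT x|lebesgue_on Q. f x * cnj (g x))"

definition L2_norm :: "'a::euclidean_space set \<Rightarrow> ('a \<Rightarrow> complex) \<Rightarrow> real" where
  "L2_norm Q f = sqrt (LINT x|lebesgue_on Q. (cmod (f x))\<^sup>2)"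

definition is_weak_partial ::
  "'a::euclidean_space set \<Rightarrow> 'a \<Rightarrow> ('a \<Rightarrow> complex) \<Rightarrow> ('a \<Rightarrow> complex) \<Rightarrow> bool" where
  "is_weak_partial Q e u g \<longleftrightarrow> (\<forall>\<phi>. test_function Q \<phi> \<longrightarrow>
     (LINT x|lebesgue_on Q. u x * complex_of_real (frechet_derivative \<phi> (at x) e)) =
     - (LINT x|lebesgue_on Q. g x * complex_of_real (\<phi> x)))"

definition W12 :: "'a::euclidean_space set \<Rightarrow> ('a \<Rightarrow> complex) set" where
  "W12 Q = {u \<in> L2 Q. \<forall>e\<in>Basis. \<exists>g\<in>L2 Q. is_weak_partial Q e u g}"

definition weak_partial :: "'a::euclidean_space set \<Rightarrow> 'a \<Rightarrow> ('a \<Rightarrow> complex) \<Rightarrow> 'a \<Rightarrow> complex" where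
  "weak_partial Q e u = (SOME g. g \<in> L2 Q \<and> is_weak_partial Q e u g)"

definition grad_inner ::
  "'a::euclidean_space set \<Rightarrow> ('a \<Rightarrow> complex) \<Rightarrow> ('a \<Rightarrow> complex) \<Rightarrow> complex" where
  "grad_inner Q u v = (\<Sum>e\<in>Basis. L2_inner Q (weak_partial Q e u) (weak_partial Q e v))"

definition W12_norm :: "'a::euclidean_space set \<Rightarrow> ('a \<Rightarrow> complex) \<Rightarrow> real" where
  "W12_norm Q u = sqrt ((L2_norm Q u)\<^sup>2 + (\<Sum>e\<in>Basis. (L2_norm Q (weak_partial Q e u))\<^sup>2))"


section \<open>Zero trace\<close>

text \<open>Sets of one-dimensional Hausdorff measure zero. No bound on the individual diameters is
  needed, since each of them is smaller than \<open>\<delta>\<close>.\<close>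

definition hausdorff1_null :: "'a::metric_space set \<Rightarrow> bool" where
  "hausdorff1_null N \<longleftrightarrow> (\<forall>\<delta>>0. \<exists>A :: nat \<Rightarrow> 'a set. N \<subseteq> (\<Union>i. A i) \<and> (\<forall>i. bounded (A i)) \<and>
     summable (\<lambda>i. diameter (A i)) \<and> (\<Sum>i. diameter (A i)) < \<delta>)"

text \<open>The trace of \<open>u\<close> at a boundary point, as the limit of averages over the adjacent part
  of \<open>Q\<close>. Where \<open>Q\<close> lies on both sides of its boundary, as it does along a slit, trace zero
  in this sense means that the traces from both sides vanish.\<close>

definition has_trace_at ::
  "'a::euclidean_space set \<Rightarrow> ('a \<Rightarrow> complex) \<Rightarrow> 'a \<Rightarrow> complex \<Rightarrow> bool" where
  "has_trace_at Q u x c \<longleftrightarrow>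
     ((\<lambda>r. (LINT y|lebesgue_on (ball x r \<inter> Q). cmod (u y - c)) / measure lebesgue (ball x r \<inter> Q))
        \<longlongrightarrow> 0) (at_right 0)"

definition zero_trace :: "(real \<times> real) set \<Rightarrow> (real \<times> real \<Rightarrow> complex) \<Rightarrow> bool" where
  "zero_trace Q u \<longleftrightarrow> (\<exists>N. hausdorff1_null N \<and> (\<forall>x \<in> frontier Q - N. has_trace_at Q u x 0))"

definition W12_0 :: "(real \<times> real) set \<Rightarrow> (real \<times> real \<Rightarrow> complex) set" where
  "W12_0 Q = {u \<in> W12 Q. zero_trace Q u}"

definition zero_ext :: "'a set \<Rightarrow> ('a \<Rightarrow> complex) \<Rightarrow> 'a \<Rightarrow> complex" where
  "zero_ext Q u x = (if x \<in> Q then u x else 0)"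


section \<open>Operators and resolvents\<close>

text \<open>An operator \<open>A\<close> in \<open>L\<^sub>2(Q)\<close> is given by its graph, the set of pairs \<open>(u, A u)\<close>.
  The following is the operator associated with the sesquilinear form \<open>h\<close> on the domain \<open>D\<close>
  by the first representation theorem.\<close>

definition form_operator ::
  "'a::euclidean_space set \<Rightarrow> ('a \<Rightarrow> complex) set \<Rightarrow> (('a \<Rightarrow> complex) \<Rightarrow> ('a \<Rightarrow> complex) \<Rightarrow> complex)
     \<Rightarrow> (('a \<Rightarrow> complex) \<times> ('a \<Rightarrow> complex)) set" where
  "form_operator Q D h = {(u, w). u \<in> D \<and> w \<in> L2 Q \<and> (\<forall>v\<in>D. h u v = L2_inner Q w v)}"

definition schroedinger_form ::
  "(real \<times> real) set \<Rightarrow> (real \<times> real \<Rightarrow> real) \<Rightarrow> (real \<times> real \<Rightarrow> complex) \<Rightarrow> (real \<times> real \<Rightarrow> complex)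
     \<Rightarrow> complex" where
  "schroedinger_form Q V u v = grad_inner Q u v + L2_inner Q (\<lambda>x. complex_of_real (V x) * u x) v"

definition dirichlet_schroedinger ::
  "(real \<times> real) set \<Rightarrow> (real \<times> real \<Rightarrow> real)
     \<Rightarrow> ((real \<times> real \<Rightarrow> complex) \<times> (real \<times> real \<Rightarrow> complex)) set" where
  "dirichlet_schroedinger Q V = form_operator Q (W12_0 Q) (schroedinger_form Q V)"

definition resolvent_set ::
  "'a::euclidean_space set \<Rightarrow> (('a \<Rightarrow> complex) \<times> ('a \<Rightarrow> complex)) set \<Rightarrow> complex set" where
  "resolvent_set Q A = {z.
     (\<forall>f\<in>L2 Q. \<exists>(u, w)\<in>A. AE x in lebesgue_on Q. w x - z * u x = f x) \<and>
     (\<exists>K. \<forall>(u, w)\<in>A. L2_norm Q u \<le> K * L2_norm Q (\<lambda>x. w x - z * u x))}"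

text \<open>\<open>(A - z)\<^sup>-\<^sup>1 f\<close>; for \<open>z\<close> in the resolvent set it is determined up to equality almost
  everywhere.\<close>

definition resolvent ::
  "'a::euclidean_space set \<Rightarrow> (('a \<Rightarrow> complex) \<times> ('a \<Rightarrow> complex)) set \<Rightarrow> complex
     \<Rightarrow> ('a \<Rightarrow> complex) \<Rightarrow> ('a \<Rightarrow> complex)" where
  "resolvent Q A z f = (SOME u. \<exists>w. (u, w) \<in> A \<and> (AE x in lebesgue_on Q. w x - z * u x = f x))"

text \<open>The norm of a linear operator from \<open>X\<close> to \<open>Y\<close>; it is infinite if the operator is
  unbounded or does not map the unit ball of \<open>X\<close> into \<open>Y\<close>.\<close>

definition op_norm ::
  "'a set \<Rightarrow> ('a \<Rightarrow> real) \<Rightarrow> 'b set \<Rightarrow> ('b \<Rightarrow> real) \<Rightarrow> ('a \<Rightarrow> 'b) \<Rightarrow> ennreal" where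
  "op_norm X nX Y nY T = (SUP f\<in>{f\<in>X. nX f \<le> 1}. if T f \<in> Y then ennreal (nY (T f)) else \<infinity>)"


section \<open>Periodic arrays of cells coupled by windows\<close>

definition periodic_array :: "(real \<times> real) set \<Rightarrow> real \<Rightarrow> (real \<times> real) set" where
  "periodic_array P d = (\<Union>k::int. {x. (fst x - of_int k * d, snd x) \<in> P})"

definition array_with_windows :: "(real \<times> real) set \<Rightarrow> real \<Rightarrow> real \<Rightarrow> (real \<times> real) set" where
  "array_with_windows P d \<epsilon> =
     periodic_array P d \<union> (\<Union>k::int. {x. fst x = of_int k * d \<and> \<bar>snd x\<bar> < \<epsilon>})"

end

theory Submission
  imports Defs "HOL-Computational_Algebra.Polynomial"
begin

text \<open>Let \<open>u\<close> and \<open>w\<close> be the images of \<open>f\<close> under the resolvent without windows and under the difference of the two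
resolvents, and let \<open>b\<close> be the form of the operator minus \<open>i\<close>. A cutoff \<open>h\<close>, equal to 1 near the windows and
supported at distance of order \<open>e\<close> from them, turns every \<open>v\<close> of the larger form domain into an element \<open>(1 - h) v\<close> of
the smaller one, whence \<open>b(w, v) = (f, h v) - b(u, h v)\<close>. Since \<open>v\<close> vanishes on the walls beside the windows, its norm on
the support of \<open>h\<close> is at most \<open>C e |grad v|\<close>. There the gradient of \<open>u\<close> has norm at most \<open>C e |ln e|^(1/2) |f|\<close>: odd
reflection across the wall makes \<open>u\<close> a solution in a full disc, so its gradient is of class W12 near the window, and a
logarithmic Hardy inequality applies. Multiplied by \<open>1 + i t\<close> with large \<open>t\<close> the form \<open>b\<close> is coercive; this gives the
resolvents and, with \<open>v = (1 - i t) w\<close>, the estimate of \<open>w\<close>. Vanishing traces are handled as weak differentiability of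
extensions by zero, by local arguments on the two sides of the graph describing the boundary.\<close>

text \<open>The walls have measure zero, so extending an element of the larger form domain by zero
  off the array does not see the Dirichlet condition on a wall between two cells. It becomes visible
  only when the function is cut down to one cell; for this reason the form domain is described cell
  by cell. That description is stable under L2 limits and under cutoffs, which is not apparent from
  the definition of zero trace by averages off a set of vanishing length. Inserting
  \<open>h v\<close> costs a gradient of \<open>h\<close> of order \<open>1/e\<close>, which just
  balances the factor \<open>e\<close> in the bound of \<open>v\<close>; \<open>h v\<close> is
  therefore bounded in W12 but not small there, and the smallness of \<open>b(u, h v)\<close> has to
  come from \<open>u\<close>. In the plane a function of class W12 need not be bounded, and its
  square integral over a disc of radius \<open>e\<close> is of order \<open>e^2 |ln e|\<close> at
  worst; applied to the gradient of \<open>u\<close> this is the origin of the logarithm. The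
  rotation works because \<open>(1 + i t)(V - i)\<close> has real part \<open>V + t\<close>.
  Infinitely many windows do no harm: the estimates are local, on discs that are disjoint for
  different windows, and can be summed.\<close>

type_synonym R2 = "real * real"
type_synonym C3 = "complex * complex * complex"

abbreviation lint :: "('a::euclidean_space => 'b::{banach,second_countable_topology}) => 'b" (binder "LI " 10)
 where "lint f == integral\<^sup>L lborel f"
abbreviation Li :: "('a::euclidean_space => 'b::{banach,second_countable_topology}) => bool" where "Li f == integrable lborel f"
abbreviation BB :: "('a::topological_space => 'b::topological_space) set" where "BB == borel_measurable borel"
abbreviation ind :: "'a set => 'a => 'b::zero_neq_one" where "ind == indicator"
abbreviation fd :: "('a::real_normed_vector => 'b::real_normed_vector) => 'a => 'a => 'b" where "fd f x == frechet_derivative f (at x)"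
abbreviation lim_seq :: "(nat => 'a::topological_space) => 'a => bool" (infixr "---->" 60) where "X ----> L == X \<longlonglongrightarrow> L"
notation scaleR (infixr "*R" 75)
notation inner (infixl "*." 70)

lemmas icong = Bochner_Integration.integral_cong
lemmas ibound = Bochner_Integration.integrable_bound
lemmas iadd = Bochner_Integration.integral_add
lemmas bmc = borel_measurable_continuous_onI
lemmas ind_def = indicator_def
abbreviation cr :: "real => complex" where "cr == complex_of_real"
lemmas CS2 = Cauchy_Schwarz_ineq2
lemmas p2eq = power2_eq_square
lemmas pmd = power_mult_distrib
lemmas nmc = norm_minus_commute
lemmas mlm = mult_left_mono
lemmas mrm = mult_right_mono
lemmas imi = integrable_mult_indicator
lemmas i_nn = integral_nonneg_AE
lemmas ev_mono = eventually_mono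
lemmas ev2 = eventually_elim2
lemmas idl = inner_diff_left
lemmas ial = inner_add_left
lemmas hdu = has_derivative_unique

section \<open>Smooth bump functions\<close>

text \<open>Smoothness by coinduction: a family of differentiable functions that is closed under
  partial derivatives needs no formula for iterated derivatives. It serves for the bump functions
  and for convolutions with smooth kernels.\<close>

lemma Ck_on_coinduct:
fixes S :: "('a::euclidean_space => real) set"
assumes "f : S"
	and "!!f x. f : S ==> f differentiable (at x)"
	and "!!f e. f : S ==> e : Basis ==> (%x. fd f x e) : S"
shows "Ck_on k UNIV f"
proof -
have "ALL f:S. Ck_on k UNIV f"
proof (induction k)
	case 0
	then show ?case
		using assms(2) by (auto intro!: continuous_at_imp_continuous_on differentiable_imp_continuous_within)
next
	case (Suc k)
	then show ?case
		using assms(2,3) by (auto intro!: continuous_at_imp_continuous_on differentiable_imp_continuous_within)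
qed
then show ?thesis using assms(1) by blast
qed

text \<open>Polynomials in \<open>1/t\<close> times the flat function \<open>exp (-1/t)\<close>: a
  family around the usual bump that differentiation does not leave,
  \<open>[:0,0,1:] * (p - pderiv p)\<close> being the polynomial of the derivative.\<close>

definition pe :: "real poly => real => real" where
"pe p t = (if t > 0 then poly p (inverse t) * exp (- inverse t) else 0)"

lemma poly_mult_exp_minus_tendsto:
fixes p :: "real poly"
shows "((%x. poly p x * exp (- x)) \<longlongrightarrow> 0) at_top"
proof -
have *: "((%x::real. coeff p i * x ^ i * exp (- x)) \<longlongrightarrow> 0) at_top" for i
proof -
	have "((%x::real. coeff p i * (x ^ i / exp x)) \<longlongrightarrow> coeff p i * 0) at_top"
		by (intro tendsto_mult tendsto_const tendsto_power_div_exp_0)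
	then show ?thesis by (simp add: exp_minus field_simps)
qed
show ?thesis
	unfolding poly_altdef sum_distrib_right by (intro tendsto_null_sum) (use * in auto)
qed

lemma pe_has_derivative: "(pe p has_real_derivative pe ([:0,0,1:] * (p - pderiv p)) t) (at t)"
proof -
consider "t < 0" | "t > 0" | "t = 0" by linarith
then show ?thesis
proof cases
	case 1
	have "((%_. 0) has_real_derivative 0) (at t)" by simp
	then have "(pe p has_real_derivative 0) (at t)"
		by (rule has_field_derivative_transform_within_open[where S="{..<0}"]) (use 1 in \<open>auto simp: pe_def\<close>)
	then show ?thesis using 1 by (simp add: pe_def)
next
	case 2
	have "((%t. poly p (inverse t) * exp (- inverse t)) has_real_derivative
		poly ([:0,0,1:] * (p - pderiv p)) (inverse t) * exp (- inverse t)) (at t)"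
		using 2 by (auto intro!: derivative_eq_intros DERIV_chain2[OF poly_DERIV] simp: algebra_simps p2eq)
	then have "(pe p has_real_derivative poly ([:0,0,1:] * (p - pderiv p)) (inverse t) * exp (- inverse t)) (at t)"
		by (rule has_field_derivative_transform_within_open[where S="{0<..}"]) (use 2 in \<open>auto simp: pe_def\<close>)
	then show ?thesis using 2 by (simp add: pe_def)
next
	case 3
	have 1: "((%h. pe p h / h) \<longlongrightarrow> 0) (at_left 0)"
	proof (rule tendsto_eventually)
		show "\<forall>\<^sub>F h in at_left 0. pe p h / h = 0"
			using eventually_at_left_real[of "-1" 0] by (rule ev_mono) (auto simp: pe_def)
	qed
	\<comment> \<open>For \<open>h > 0\<close> the difference quotient at zero is again of the form
	  \<open>pe\<close>, with one more power of \<open>1/h\<close>, so the exponential wins.\<close>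
	have "((%h. poly (pCons 0 p) (inverse h) * exp (- inverse h)) \<longlongrightarrow> 0) (at_right (0::real))"
		using filterlim_compose[OF poly_mult_exp_minus_tendsto[of "pCons 0 p"] filterlim_inverse_at_top_right] .
	then have 2: "((%h. pe p h / h) \<longlongrightarrow> 0) (at_right 0)"
	proof (rule Lim_transform_eventually)
		show "\<forall>\<^sub>F h in at_right 0. poly (pCons 0 p) (inverse h) * exp (- inverse h) = pe p h / h"
			using eventually_at_right_real[of 0 1] by (auto elim!: ev_mono simp: pe_def field_simps)
	qed
	have "((%h. pe p h / h) \<longlongrightarrow> 0) (at 0)"
		using 1 2 by (rule filterlim_split_at)
	then show ?thesis using 3 by (simp add: DERIV_def pe_def)
qed
qed

text \<open>Everything that differentiating a radial bump can produce: the chain rule brings in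
  linear factors and a new polynomial, the product rule sums and products. Closure under derivatives
  then is a rule induction.\<close>

inductive_set bump_algebra :: "('a::euclidean_space => real) set" where
const: "(%x. c) : bump_algebra"
| inner: "(%x. x *. e) : bump_algebra"
| pe: "(%x. pe p (a - x *. x)) : bump_algebra"
| add: "f : bump_algebra ==> g : bump_algebra ==> (%x. f x + g x) : bump_algebra"
| mult: "f : bump_algebra ==> g : bump_algebra ==> (%x. f x * g x) : bump_algebra"

lemma bump_algebra_derivative:
"f : bump_algebra ==> EX D. (ALL x. (f has_derivative D x) (at x)) & (ALL e. (%x. D x e) : bump_algebra)"
proof (induction rule: bump_algebra.induct)
case (const c)
show ?case by (rule exI[of _ "%x h. 0"]) (auto intro: bump_algebra.const)
next
case (inner e)
show ?case by (rule exI[of _ "%x h. h *. e"])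
	(auto intro!: bump_algebra.const bounded_linear_imp_has_derivative bounded_linear_inner_left)
next
case (pe p a)
let ?q = "[:0,0,1:] * (p - pderiv p)"
have "((%x. pe p (a - x *. x)) has_derivative (%h. pe ?q (a - x *. x) * (- 2 * (x *. h)))) (at x)" for x :: 'a
	by (rule has_derivative_compose[where f="%x. a - x *. x", OF _ pe_has_derivative[unfolded has_field_derivative_def],
				THEN has_derivative_eq_rhs]) (auto intro!: derivative_eq_intros simp: inner_commute)
moreover have "(%x. pe ?q (a - x *. x) * (- 2 * (x *. e))) : bump_algebra" for e :: 'a
	by (intro bump_algebra.intros)
ultimately show ?case by (intro exI[of _ "%x h. pe ?q (a - x *. x) * (- 2 * (x *. h))"]) auto
next
case (add f g)
then obtain Df Dg where "!!x. (f has_derivative Df x) (at x)" "!!e. (%x. Df x e) : bump_algebra"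
		"!!x. (g has_derivative Dg x) (at x)" "!!e. (%x. Dg x e) : bump_algebra" by metis
then show ?case by (intro exI[of _ "%x h. Df x h + Dg x h"])
	(auto intro!: derivative_eq_intros bump_algebra.add)
next
case (mult f g)
then obtain Df Dg where "!!x. (f has_derivative Df x) (at x)" "!!e. (%x. Df x e) : bump_algebra"
		"!!x. (g has_derivative Dg x) (at x)" "!!e. (%x. Dg x e) : bump_algebra" by metis
then show ?case by (intro exI[of _ "%x h. f x * Dg x h + Df x h * g x"])
	(auto intro!: has_derivative_mult bump_algebra.add bump_algebra.mult mult.hyps)
qed

lemma Ck_on_bump_algebra: "f : bump_algebra ==> Ck_on k UNIV f"
proof (rule Ck_on_coinduct[of f bump_algebra])
fix f :: "'a => real" assume "f : bump_algebra"
then obtain D where D: "!!x. (f has_derivative D x) (at x)" "!!e. (%x. D x e) : bump_algebra"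
	using bump_algebra_derivative by metis
then show "f differentiable (at x)" for x by (auto simp: differentiable_def)
have "fd f x = D x" for x
	using frechet_derivative_at[OF D(1)] by simp
then show "(%x. fd f x e) : bump_algebra" for e using D(2) by simp
qed auto

section \<open>Square integrable functions\<close>

text \<open>Elements of L2 over a set will be replaced by Borel functions on the whole space.
  Complex values are treated as a real Euclidean plane, so that scalar products are real integrals
  of \<open>*.\<close>.\<close>

definition sqi :: "('a::euclidean_space => 'b::euclidean_space) => bool" where
"sqi u \<longleftrightarrow> u : BB & Li (%x. (norm (u x))^2)"

definition N2 :: "('a::euclidean_space => 'b::euclidean_space) => real" where
"N2 u = (LI x. (norm (u x))^2)"

lemma sqi_m [measurable_dest]: "sqi u ==> u : BB"
by (simp add: sqi_def)

lemma sqi_i: "sqi u ==> Li (%x. (norm (u x))^2)"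
by (simp add: sqi_def)

lemma N2_nonneg: "0 <= N2 u" by (simp add: N2_def)

lemma sqi_bound:
assumes "u : BB" "sqi v" "!!x. norm (u x) <= C * norm (v x)"
shows "sqi u"
unfolding sqi_def
proof
show "Li (%x. (norm (u x))^2)"
proof (rule ibound)
	show "Li (%x. C^2 * (norm (v x))^2)" using assms(2) by (simp add: sqi_def)
	show "(%x. (norm (u x))^2) : borel_measurable lborel" using assms(1) by simp
	have "(norm (u x))^2 <= C^2 * (norm (v x))^2" for x
		using power_mono[OF assms(3)[of x], of 2] by (simp add: pmd)
	then show "AE x in lborel. norm ((norm (u x))^2) <= norm (C^2 * (norm (v x))^2)" by simp
qed
qed (rule assms)

lemma norm_add_sq_le: "(norm (a + b :: 'a::real_inner))^2 <= 2 * (norm a)^2 + 2 * (norm b)^2"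
proof -
have "(norm (a + b))^2 <= (norm a + norm b)^2" by (intro power_mono norm_triangle_ineq) auto
also have "... <= 2 * (norm a)^2 + 2 * (norm b)^2"
	using sum_squares_bound[of "norm a" "norm b"] by (simp add: power2_sum)
finally show ?thesis .
qed

lemma sqi_add: assumes [measurable]: "sqi u" "sqi v" shows "sqi (%x. u x + v x)"
unfolding sqi_def
proof
show "Li (%x. (norm (u x + v x))^2)"
proof (rule ibound)
	show "Li (%x. 2 * (norm (u x))^2 + 2 * (norm (v x))^2)"
		using assms by (simp add: sqi_def)
	show "AE x in lborel. norm ((norm (u x + v x))^2) <= norm (2 * (norm (u x))^2 + 2 * (norm (v x))^2)"
		using norm_add_sq_le by auto
qed measurable
qed measurable

lemma sqi_scaleR: "sqi u ==> sqi (%x. c *R u x)"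
by (rule sqi_bound[where v=u and C="abs (c)"]) auto

lemma sqi_uminus: "sqi u ==> sqi (%x. - u x)"
using sqi_scaleR[of u "-1"] by simp

lemma sqi_diff: "sqi u ==> sqi v ==> sqi (%x. u x - v x)"
using sqi_add[of u "%x. - v x"] sqi_uminus[of v] by simp

lemma sqi_zero [simp]: "sqi (%x. 0)" by (simp add: sqi_def)

lemma sqi_bm:
assumes "sqi u" "f : BB" "!!x. abs (f x) <= C"
shows "sqi (%x. f x *R u x)"
by (rule sqi_bound[where v=u and C=C]) (use assms in \<open>auto intro: mrm sqi_m\<close>)

lemma sqi_ind:
assumes "sqi u" "A : sets borel"
shows "sqi (%x. ind A x *R u x)"
by (rule sqi_bm[where C=1]) (use assms in \<open>auto simp: ind_def\<close>)

lemma sqi_ic: "sqi u ==> sqi (%x. u x *. h)"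
by (rule sqi_bound[where v=u and C="norm h"])
	(auto simp: mult.commute[of "norm h"] intro: CS2 sqi_m)

lemma N2_add_le: assumes "sqi u" "sqi v" shows "N2 (%x. u x + v x) <= 2 * N2 u + 2 * N2 v"
proof -
have "N2 (%x. u x + v x) <= (LI x. 2 * (norm (u x))^2 + 2 * (norm (v x))^2)"
	unfolding N2_def using assms sqi_add[OF assms]
	by (intro integral_mono norm_add_sq_le) (auto simp: sqi_def)
also have "... = 2 * N2 u + 2 * N2 v" using assms by (simp add: N2_def sqi_def)
finally show ?thesis .
qed

lemma N2_mono:
assumes "sqi v" "u : BB" "!!x. norm (u x) <= norm (v x)"
shows "N2 u <= N2 v"
unfolding N2_def using assms sqi_bound[OF assms(2,1), of 1]
by (intro integral_mono power_mono) (auto simp: sqi_def)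

lemma i_inner:
fixes u v :: "'a::euclidean_space => 'b::euclidean_space"
assumes [measurable]: "sqi u" "sqi v" shows "Li (%x. u x *. v x)"
proof (rule ibound)
show "Li (%x. (norm (u x))^2 + (norm (v x))^2)" using assms by (simp add: sqi_def)
have "abs (a *. b) <= (norm a)^2 + (norm b)^2" for a b :: 'b
	using CS2[of a b] sum_squares_bound[of "norm a" "norm b"]
	mult_nonneg_nonneg[OF norm_ge_zero[of a] norm_ge_zero[of b]] by linarith
then show "AE x in lborel. norm (u x *. v x) <= norm ((norm (u x))^2 + (norm (v x))^2)" by simp
qed measurable

lemma i_scaleR:
fixes f :: "'a::euclidean_space => real" and u :: "'a => 'b::euclidean_space"
assumes [measurable]: "sqi f" "sqi u" shows "Li (%x. f x *R u x)"
proof (rule ibound)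
show "Li (%x. (norm (f x))^2 + (norm (u x))^2)" using assms by (simp add: sqi_def)
have "abs (a) * norm b <= (norm a)^2 + (norm b)^2" for a and b :: 'b
	using sum_squares_bound[of "abs (a)" "norm b"] mult_nonneg_nonneg[OF abs_ge_zero[of a] norm_ge_zero[of b]]
	by (simp only: power2_abs real_norm_def)
then show "AE x in lborel. norm (f x *R u x) <= norm ((norm (f x))^2 + (norm (u x))^2)" by simp
qed measurable

lemma i_mult: "sqi u ==> sqi v ==> Li (%x. u x * v x :: real)"
using i_inner[of u v] by simp

text \<open>The discriminant argument, kept separate since it yields the Cauchy-Schwarz inequality
  and later, with the excess over an infimum in the place of \<open>a\<close>, the orthogonality
  relation of the projection.\<close>

lemma square_le_from_quadratic:
fixes a b c :: real
assumes "!!t. 0 <= a - 2 * t * b + t^2 * c" "c >= 0"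
shows "b^2 <= a * c"
proof (cases "c = 0")
case True
have "b = 0"
proof (rule ccontr)
	assume "b ~= 0"
	\<comment> \<open>With \<open>c = 0\<close> the expression is linear in \<open>t\<close>, and this
	  \<open>t\<close> gives it the value \<open>-1\<close>.\<close>
	then show False using assms(1)[of "(a + 1) / (2 * b)"] True by simp
qed
then show ?thesis using True by simp
next
case False
then show ?thesis using assms(1)[of "b / c"] assms(2)
	by (simp add: p2eq field_simps)
qed

lemma inner_integral_le:
fixes u v :: "'a::euclidean_space => 'b::euclidean_space"
assumes "sqi u" "sqi v" shows "(LI x. u x *. v x)^2 <= N2 u * N2 v"
proof (rule square_le_from_quadratic)
fix t
have "0 <= N2 (%x. u x - t *R v x)" by (rule N2_nonneg)
also have "... = (LI x. (norm (u x))^2 - 2 * t * (u x *. v x) + t^2 * (norm (v x))^2)"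
proof -
	have "(norm (a - t *R b))^2 = (norm a)^2 - 2 * t * (a *. b) + t^2 * (norm b)^2" for a b :: 'b
		unfolding power2_norm_eq_inner
		by (simp add: idl inner_diff_right inner_commute[of b a] p2eq algebra_simps)
	then show ?thesis unfolding N2_def by (simp only: )
qed
also have "... = N2 u - 2 * t * (LI x. u x *. v x) + t^2 * N2 v"
	using assms i_inner[OF assms] by (simp add: N2_def sqi_def)
finally show "0 <= N2 u - 2 * t * (LI x. u x *. v x) + t^2 * N2 v" .
qed (rule N2_nonneg)

lemma abs_int_le:
fixes u v :: "'a::euclidean_space => 'b::euclidean_space"
assumes "sqi u" "sqi v" shows "abs (LI x. u x *. v x) <= sqrt (N2 u) * sqrt (N2 v)"
using real_sqrt_le_mono[OF inner_integral_le[OF assms]] by (simp add: real_sqrt_mult)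

lemma continuous_compact_support_bounded:
fixes k :: "'a::euclidean_space => 'b::euclidean_space"
assumes "continuous_on UNIV k" "compact K" "!!x. x ~: K ==> k x = 0"
shows "EX B>0. ALL x. norm (k x) <= B"
proof -
have "bounded (k ` K)"
	using assms by (intro compact_imp_bounded compact_continuous_image) (auto intro: continuous_on_subset)
then obtain B where B: "B > 0" "!!x. x : K ==> norm (k x) <= B" by (auto simp: bounded_pos)
have "norm (k x) <= B" for x using B assms(3)[of x] by (cases "x : K") auto
then show ?thesis using B(1) by blast
qed

lemma sqi_cind: "compact K ==> sqi (%x. ind K x *R (c::'b::euclidean_space))"
unfolding sqi_def
proof
assume K: "compact K"
then have Kb: "K : sets borel" by (simp add: borel_compact)
then show "(%x. ind K x *R c) : BB" by measurable
have "Li (%x. (norm c)^2 * (ind K x :: real))"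
	using emeasure_compact_finite[OF K] Kb
	by (intro integrable_mult_right integrable_real_indicator) auto
then show "Li (%x. (norm (ind K x *R c))^2)"
	by (rule Bochner_Integration.integrable_cong[THEN iffD1, rotated 2]) (auto simp: ind_def)
qed

lemma sqi_bounded_compact:
fixes k :: "'a::euclidean_space => 'b::euclidean_space"
assumes "k : BB" "compact K" "!!x. x ~: K ==> k x = 0" "!!x. norm (k x) <= B"
shows "sqi k"
proof (rule sqi_bound[OF assms(1) sqi_cind[OF assms(2), of "1::real"], of B])
show "norm (k x) <= B * norm (ind K x *R (1::real))" for x
	using assms(3,4)[of x] by (auto simp: ind_def)
qed

lemma sqi_continuous:
fixes k :: "'a::euclidean_space => 'b::euclidean_space"
assumes "continuous_on UNIV k" "compact K" "!!x. x ~: K ==> k x = 0"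
shows "sqi k"
proof -
obtain B where B: "!!x. norm (k x) <= B" using continuous_compact_support_bounded[OF assms] by blast
show ?thesis by (rule sqi_bounded_compact[OF bmc[OF assms(1)] assms(2,3) B])
qed

section \<open>Test functions of class C1\<close>

definition c1 :: "('a::euclidean_space => real) => ('a => 'a) => bool" where
"c1 ps D \<longleftrightarrow> (ALL x. (ps has_derivative (%h. D x *. h)) (at x)) & continuous_on UNIV D"

text \<open>Test functions are only C1, with the gradient carried along as data: the cutoffs below
  are built from a piecewise quadratic step, and their products with mollified functions must be
  admissible. \<open>wgrad_of_test\<close> makes the passage from smooth test functions.\<close>

definition ctest :: "'a::euclidean_space set => ('a => real) => ('a => 'a) => bool" where
"ctest W ps D \<longleftrightarrow> c1 ps D & (EX K. compact K & K <= W & (ALL x. x ~: K --> ps x = 0))"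

lemma c1_der: "c1 ps D ==> (ps has_derivative (%h. D x *. h)) (at x)"
by (simp add: c1_def)

lemma c1_cont: "c1 ps D ==> continuous_on UNIV ps"
by (auto simp: c1_def intro!: continuous_at_imp_continuous_on has_derivative_continuous)

lemma c1_contD: "c1 ps D ==> continuous_on UNIV D"
by (simp add: c1_def)

lemma c1_const: "c1 (%x. c) (%x. 0)" by (simp add: c1_def)

lemma c1_inner: "c1 (%x. (x - p) *. e) (%x. e)"
by (auto simp: c1_def intro!: derivative_eq_intros simp: inner_commute)

lemma c1_add: "c1 f F ==> c1 g G ==> c1 (%x. f x + g x) (%x. F x + G x)"
unfolding c1_def by (auto intro!: derivative_eq_intros continuous_intros simp: ial)

lemma c1_diff: "c1 f F ==> c1 g G ==> c1 (%x. f x - g x) (%x. F x - G x)"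
unfolding c1_def by (auto intro!: derivative_eq_intros continuous_intros simp: idl)

lemma c1_mult: "c1 f F ==> c1 g G ==> c1 (%x. f x * g x) (%x. f x *R G x + g x *R F x)"
using c1_cont[of f F] c1_cont[of g G]
unfolding c1_def by (auto intro!: derivative_eq_intros continuous_intros simp: ial mult.commute)

lemma c1_compose:
assumes "c1 f F" "!!t. (k has_real_derivative k' t) (at t)" "continuous_on UNIV k'"
shows "c1 (%x. k (f x)) (%x. k' (f x) *R F x)"
proof -
have "((%x. k (f x)) has_derivative (%h. k' (f x) * (F x *. h))) (at x)" for x
	using has_derivative_compose[OF c1_der[OF assms(1)] assms(2)[unfolded has_field_derivative_def]] .
moreover have "continuous_on UNIV (%x. k' (f x) *R F x)"
	using assms c1_cont[OF assms(1)] c1_contD[OF assms(1)]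
	by (intro continuous_intros continuous_on_compose2[OF assms(3)]) auto
ultimately show ?thesis by (simp add: c1_def)
qed

lemma ctestE:
assumes "ctest W ps D"
obtains K where "compact K" "K <= W" "!!x. x ~: K ==> ps x = 0" "!!x. x ~: K ==> D x = 0"
proof -
obtain K where K: "compact K" "K <= W" "!!x. x ~: K ==> ps x = 0"
	and c: "c1 ps D" using assms unfolding ctest_def by blast
have "D x = 0" if "x ~: K" for x
proof -
	have "((%_. 0) has_derivative (%h. D x *. h)) (at x)"
		by (rule has_derivative_transform_within_open[OF c1_der[OF c], where s="- K"])
			(use that K in \<open>auto intro: compact_imp_closed\<close>)
	then have "(%h. D x *. h) = (%h. 0)" using hdu has_derivative_const by blast
	from fun_cong[OF this, of "D x"] show ?thesis by simp
qed
with K show ?thesis using that by blast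
qed

lemma ctest_c1: "ctest W ps D ==> c1 ps D" by (simp add: ctest_def)

lemma ctest_mono: "ctest W ps D ==> W <= W' ==> ctest W' ps D" unfolding ctest_def by blast

lemma ctest_sqi: assumes "ctest W ps D" shows "sqi ps" "sqi D"
using assms c1_cont[OF ctest_c1[OF assms]] c1_contD[OF ctest_c1[OF assms]]
by (auto elim!: ctestE intro: sqi_continuous)

lemma ctest_bounded:
assumes "ctest W ps D" obtains B where "B > 0" "!!x. abs (ps x) <= B" "!!x. norm (D x) <= B"
proof -
obtain K where K: "compact K" "!!x. x ~: K ==> ps x = 0" "!!x. x ~: K ==> D x = 0"
	using ctestE[OF assms] by metis
obtain B1 where B1: "B1 > 0" "!!x. norm (ps x) <= B1"
	using continuous_compact_support_bounded[OF c1_cont[OF ctest_c1[OF assms]] K(1,2)] by blast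
obtain B2 where B2: "B2 > 0" "!!x. norm (D x) <= B2"
	using continuous_compact_support_bounded[OF c1_contD[OF ctest_c1[OF assms]] K(1,3)] by blast
show ?thesis using B1 B2 by (intro that[of "max B1 B2"]) (auto simp: le_max_iff_disj)
qed

lemma ctest_mult_left: "ctest W f F ==> c1 g G ==> ctest W (%x. f x * g x) (%x. f x *R G x + g x *R F x)"
unfolding ctest_def using c1_mult by auto

lemma tf_ctest:
fixes ph :: "'a::euclidean_space => real"
assumes "test_function Q ph"
shows "ctest Q ph (%x. \<Sum>e\<in>Basis. fd ph x e *R e)"
proof -
let ?G = "%x. \<Sum>e\<in>Basis. fd ph x e *R e"
note * = assms[unfolded test_function_def]
have 1: "Ck_on (Suc 0) UNIV ph" using *[THEN conjunct1, THEN spec, of "Suc 0"] .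
have K: "compact (closure {x. ph x ~= 0})" "closure {x. ph x ~= 0} <= Q" using * by simp_all
have diff: "ph differentiable (at x)" for x using 1 by simp
have cont: "continuous_on UNIV (%x. fd ph x e)" if "e : Basis" for e
	using 1 that by simp
have d: "(ph has_derivative fd ph x) (at x)" for x
	using diff[of x] by (rule frechet_derivative_works[THEN iffD1])
have fd: "fd ph x h = ?G x *. h" for x h
proof -
	interpret linear "fd ph x" using has_derivative_linear[OF d] .
	have "fd ph x h = fd ph x (\<Sum>e\<in>Basis. (h *. e) *R e)"
		by (simp only: euclidean_representation)
	also have "... = (\<Sum>e\<in>Basis. (h *. e) *R fd ph x e)"
		by (simp only: sum scale)
	also have "... = (\<Sum>e\<in>Basis. fd ph x e * (e *. h))"
		by (intro sum.cong) (auto simp: inner_commute)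
	finally show ?thesis by (simp add: inner_sum_left)
qed
have e: "(%h. ?G x *. h) = fd ph x" for x
	by (rule ext) (rule fd[symmetric])
have "(ph has_derivative (%h. ?G x *. h)) (at x)" for x
	unfolding e by (rule d)
moreover have "continuous_on UNIV ?G"
	by (intro continuous_on_sum continuous_on_scaleR continuous_on_const cont)
ultimately have c: "c1 ph ?G" unfolding c1_def by blast
have "ph x = 0" if "x ~: closure {x. ph x ~= 0}" for x
	using that closure_subset[of "{x. ph x ~= 0}"] by blast
then show ?thesis unfolding ctest_def
	by (intro conjI exI[of _ "closure {x. ph x ~= 0}"] allI impI c K)
qed

section \<open>Convolution\<close>

text \<open>One interface for the changes of variables that occur: translations, point reflections
  and the reflection in a wall.\<close>

definition measure_pres :: "('a::euclidean_space => 'a) => bool" where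
"measure_pres T \<longleftrightarrow> T : BB & distr lborel borel T = lborel"

lemma mp_plus: "measure_pres (%x. c + x)"
by (simp add: measure_pres_def lborel_distr_plus)

lemma mp_minus: "measure_pres (%x. c - x)"
proof -
have "lborel = density (distr lborel borel (%x::'a. c + (-1) *R x)) (%_. 1)"
	using lborel_affine[of "-1" c] by simp
then show ?thesis by (simp add: measure_pres_def density_1)
qed

lemma mp_int:
assumes "measure_pres T" "f : BB"
shows "(LI x. f (T x)) = (LI x. f x :: 'b::{banach,second_countable_topology})"
using assms integral_distr[of T lborel borel f] by (simp add: measure_pres_def)

lemma measure_pres_integrable:
assumes "measure_pres T" "Li (f :: _ => 'b::{banach,second_countable_topology})"
shows "Li (%x. f (T x))"
proof -
have "integrable (distr lborel borel T) f" using assms by (simp add: measure_pres_def)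
then show ?thesis using assms by (subst (asm) integrable_distr_eq) (auto simp: measure_pres_def)
qed

lemma mp_sqi: assumes "measure_pres T" "sqi u" shows "sqi (%x. u (T x))"
using measure_pres_integrable[OF assms(1) sqi_i[OF assms(2)]] assms
unfolding sqi_def measure_pres_def by (auto intro: measurable_compose)

lemma measure_pres_N2: assumes "measure_pres T" "sqi u" shows "N2 (%x. u (T x)) = N2 u"
unfolding N2_def using assms
by (intro mp_int[where f="%x. (norm (u x))^2"]) (auto dest: sqi_m)

definition conv :: "('a::euclidean_space => real) => ('a => 'b::euclidean_space) => 'a => 'b" where
"conv k u x = (LI y. k (x - y) *R u y)"

lemma compact_support_uniformly_continuous:
fixes k :: "'a::euclidean_space => 'b::euclidean_space"
assumes "continuous_on UNIV k" "compact K" "!!x. x ~: K ==> k x = 0" "e > 0"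
obtains d where "d > 0" "d <= 1" "!!x y. dist x y < d ==> dist (k x) (k y) < e"
proof -
obtain R where R: "!!x. x : K ==> norm x <= R" using compact_imp_bounded[OF assms(2)] by (auto simp: bounded_iff)
have "uniformly_continuous_on (cball 0 (R+1)) k"
	by (intro compact_uniformly_continuous continuous_on_subset[OF assms(1)]) auto
then obtain d where d: "d > 0" "!!x y. x : cball 0 (R+1) ==> y : cball 0 (R+1) ==> dist y x < d ==> dist (k y) (k x) < e"
	unfolding uniformly_continuous_on_def using assms(4) by metis
have "dist (k x) (k y) < e" if "dist x y < min d 1" for x y
proof (cases "x : K \<or> y : K")
	case True
	have "norm x <= norm y + dist x y" "norm y <= norm x + dist x y"
		by (metis dist_norm norm_triangle_sub add.commute nmc)+
	then have "x : cball 0 (R+1)" "y : cball 0 (R+1)" using True R[of x] R[of y] that by auto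
	then show ?thesis using d(2)[of y x] that by simp
next
	case False
	then show ?thesis using assms(3)[of x] assms(3)[of y] assms(4) by simp
qed
then show ?thesis using that[of "min d 1"] d(1) by auto
qed

text \<open>Mean value theorem on the segment from \<open>z\<close> to \<open>z + h\<close>; the
  uniformity is that of the continuity of the compactly supported \<open>D\<close>.\<close>

lemma ctest_uniformly_differentiable:
assumes "ctest W ps D" "e > 0"
obtains d where "d > 0" "d <= 1" "!!z h. norm h < d ==> (abs (ps (z + h) - ps z - D z *. h)) <= e * norm h"
proof -
obtain K where K: "compact K" "!!x. x ~: K ==> D x = 0" using ctestE[OF assms(1)] by metis
have c: "c1 ps D" by (rule ctest_c1[OF assms(1)])
obtain d where d: "d > 0" "d <= 1" "!!x y. dist x y < d ==> dist (D x) (D y) < e"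
	using compact_support_uniformly_continuous[OF c1_contD[OF c] K assms(2)] by blast
have "abs (ps (z + h) - ps z - D z *. h) <= e * norm h" if h: "norm h < d" for z h
proof -
	have "((%t. ps (z + t *R h)) has_real_derivative (D (z + t *R h) *. h)) (at t)" for t
		unfolding has_field_derivative_def
		by (rule has_derivative_compose[OF _ c1_der[OF c], of "%t. z + t *R h", THEN has_derivative_eq_rhs])
			(auto intro!: derivative_eq_intros simp: mult.commute)
	then obtain t where t: "0 < t" "t < 1" "ps (z + 1 *R h) - ps (z + 0 *R h) = (1 - 0) * (D (z + t *R h) *. h)"
		using MVT2[of 0 1 "%t. ps (z + t *R h)" "%t. D (z + t *R h) *. h"] by auto
	have "abs (ps (z + h) - ps z - D z *. h) = abs ((D (z + t *R h) - D z) *. h)" using t by (simp add: idl)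
	also have "... <= norm (D (z + t *R h) - D z) * norm h" by (rule CS2)
	also have "... <= e * norm h"
	proof (rule mrm)
		have "t * norm h < d" using t h mrm[of t 1 "norm h"] by auto
		then have "dist (z + t *R h) z < d" using t by (simp add: dist_norm)
		from d(3)[OF this] show "norm (D (z + t *R h) - D z) <= e" by (simp add: dist_norm)
	qed simp
	finally show ?thesis .
qed
then show ?thesis using that[of d] d by blast
qed

lemma integrable_cball_norm: "sqi u ==> compact K ==> Li (%y. ind K y * norm (u y))"
for u :: "'a::euclidean_space => 'b::euclidean_space"
using integrable_norm[OF i_scaleR[OF sqi_cind[of K "1::real"], of u]]
by (simp add: ind_def if_distrib[of norm] cong: if_cong)

lemma norm_integral_le_on_compact:
fixes u :: "'a::euclidean_space => 'b::euclidean_space"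
assumes u: "sqi u" and K: "compact K" and A: "A : BB" and e: "0 <= e"
	and z: "!!y. y ~: K ==> A y = 0" and b: "!!y. norm (A y :: 'c::euclidean_space) <= e * norm (u y)"
shows "norm (LI y. A y) <= e * (LI y. ind K y * norm (u y))"
proof -
have i: "Li (%y. e * (ind K y * norm (u y)))"
	using integrable_cball_norm[OF u K] by simp
have le: "norm (A y) <= e * (ind K y * norm (u y))" for y using z[of y] b[of y] e by (auto simp: ind_def)
have "Li A"
	by (rule ibound[OF i]) (use A le in \<open>auto intro: order_trans[OF _ abs_ge_self]\<close>)
then have "norm (LI y. A y) <= (LI y. norm (A y))" by (intro integral_norm_bound)
also have "... <= (LI y. e * (ind K y * norm (u y)))"
	using `Li A` i le by (intro integral_mono) auto
finally show ?thesis by simp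
qed

lemma ctest_reflect:
assumes "ctest UNIV ps D" "compact K" "!!z. z ~: K ==> ps z = 0" "!!z. z : K ==> x - z : W"
shows "ctest W (%y. ps (x - y)) (%y. - D (x - y))"
proof -
have c: "c1 ps D" by (rule ctest_c1[OF assms(1)])
have "c1 (%y. ps (x - y)) (%y. - D (x - y))"
	unfolding c1_def
proof
	show "ALL y. ((%y. ps (x - y)) has_derivative (%h. - D (x - y) *. h)) (at y)"
	proof
		fix y show "((%y. ps (x - y)) has_derivative (%h. - D (x - y) *. h)) (at y)"
			by (rule has_derivative_compose[OF _ c1_der[OF c], of "%y. x - y", THEN has_derivative_eq_rhs])
				(auto intro!: derivative_eq_intros)
	qed
	show "continuous_on UNIV (%y. - D (x - y))"
		by (intro continuous_intros continuous_on_compose2[OF c1_contD[OF c]]) auto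
qed
moreover have "compact ((%z. x - z) ` K)"
	by (intro compact_continuous_image continuous_intros assms(2))
moreover have "(%z. x - z) ` K <= W" using assms(4) by auto
moreover have "ps (x - y) = 0" if "y ~: (%z. x - z) ` K" for y
proof (rule assms(3))
	show "x - y ~: K"
	proof
		assume "x - y : K"
		then have "x - (x - y) : (%z. x - z) ` K" by (rule imageI)
		then show False using that by simp
	qed
qed
ultimately show ?thesis unfolding ctest_def by blast
qed

lemma small_factor:
fixes e C :: real
assumes "e > 0" "C >= 0" obtains e' where "e' > 0" "e' * C < e"
proof
show "e / (C + 1) > 0" using assms by simp
show "e / (C + 1) * C < e" using assms by (simp add: field_simps)
qed

text \<open>Differentiation under the integral. For increments of norm at most 1 all integrands live
  in one ball around \<open>x\<close>, where \<open>u\<close> is integrable, so a uniform error in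
  the difference quotient of \<open>ps\<close> suffices.\<close>

lemma c1_conv:
assumes t: "ctest W ps D" and u: "sqi u"
shows "c1 (conv ps u) (%x. LI y. u y *R D (x - y))"
proof -
obtain K where K: "compact K" "!!x. x ~: K ==> ps x = 0" "!!x. x ~: K ==> D x = 0" using ctestE[OF t] by metis
obtain R where R: "!!x. x : K ==> norm x <= R" using compact_imp_bounded[OF K(1)] by (auto simp: bounded_iff)
have R0: "ps x = 0" "D x = 0" if "norm x > R" for x using K R[of x] that by fastforce+
have c: "c1 ps D" by (rule ctest_c1[OF t])
note cont = c1_cont[OF c] c1_contD[OF c]
have [measurable]: "ps : BB" "D : BB" "u : BB"
	using cont u by (auto intro: bmc sqi_m)
have shift: "sqi (%y. ps (x - y))" "sqi (%y. D (x - y))" for x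
	using ctest_sqi[OF t] by (auto intro: mp_sqi[OF mp_minus])
have iD: "Li (%y. u y *R D (x - y))" for x by (intro i_scaleR u shift)
have ips: "Li (%y. ps (x - y) *R u y)" for x by (intro i_scaleR u shift)
let ?C = "%x. LI y. ind (cball x (R+1)) y * norm (u y)"
have C0: "?C x >= 0" for x by (intro i_nn) auto
have far: "ps (x + h - y) = 0" "ps (x - y) = 0" "D (x - y) = 0" "D (x + h - y) = 0"
	if "y ~: cball x (R + 1)" "norm h <= 1" for x h y
proof -
	have "R + 1 < norm (x - y)" using that(1) by (simp add: dist_norm)
	moreover have "norm (x - y) <= norm (x + h - y) + norm h"
		using norm_triangle_ineq4[of "x + h - y" h] by simp
	ultimately have "norm (x + h - y) > R" "norm (x - y) > R" using that(2) by linarith+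
	then show "ps (x + h - y) = 0" "ps (x - y) = 0" "D (x - y) = 0" "D (x + h - y) = 0" using R0 by blast+
qed
have "(conv ps u has_derivative (%h. (LI y. u y *R D (x - y)) *. h)) (at x)" for x
	unfolding has_derivative_at_alt
proof (intro conjI allI impI)
	show "bounded_linear (%h. (LI y. u y *R D (x - y)) *. h)" by (rule bounded_linear_inner_right)
	fix e :: real assume e: "e > 0"
	obtain e' where e': "e' > 0" "e' * ?C x <= e" using small_factor[OF e C0[of x]] by (auto intro: less_imp_le)
	obtain d where d: "d > 0" "d <= 1" "!!z h. norm h < d ==> (abs (ps (z + h) - ps z - D z *. h)) <= e' * norm h"
		using ctest_uniformly_differentiable[OF t e'(1)] by blast
	show "EX d>0. ALL y. norm (y - x) < d -->
		norm (conv ps u y - conv ps u x - (LI z. u z *R D (x - z)) *. (y - x)) <= e * norm (y - x)"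
	proof (intro exI[of _ d] conjI allI impI d(1))
		fix x' assume x': "norm (x' - x) < d"
		define h where "h = x' - x"
		have hx: "x' = x + h" "norm h < d" "norm h <= 1" using x' d by (auto simp: h_def)
		let ?A = "%y. ps (x + h - y) *R u y - ps (x - y) *R u y - (u y *R D (x - y)) *. h"
		have "conv ps u x' - conv ps u x - (LI z. u z *R D (x - z)) *. h = (LI y. ?A y)"
			using ips[of "x + h"] ips[of x] integrable_inner_left[OF iD[of x], of h] iD[of x] unfolding conv_def hx(1)
			by (subst Bochner_Integration.integral_diff, simp, simp, subst Bochner_Integration.integral_diff, simp, simp)
				(simp add: integral_inner_left[symmetric] del: integral_inner_left inner_scaleR_left)
		moreover have "norm (LI y. ?A y) <= (e' * norm h) * ?C x"
		proof (rule norm_integral_le_on_compact[OF u])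
			fix y
			show "?A y = 0" if "y ~: cball x (R + 1)" using far[OF that hx(3)] by simp
			have "?A y = u y * (ps ((x - y) + h) - ps (x - y) - D (x - y) *. h)" by (simp add: algebra_simps)
			then show "norm (?A y) <= e' * norm h * norm (u y)"
				using mlm[OF d(3)[OF hx(2), of "x - y"], of "abs (u y)"] by (simp add: abs_mult mult.commute)
		qed (use e' in auto)
		ultimately have "norm (conv ps u x' - conv ps u x - (LI z. u z *R D (x - z)) *. h) <= (e' * ?C x) * norm h"
			by (simp add: mult_ac)
		also have "... <= e * norm h" using e' by (intro mrm) auto
		finally show "norm (conv ps u x' - conv ps u x - (LI z. u z *R D (x - z)) *. (x' - x)) <= e * norm (x' - x)"
			by (simp add: h_def)
	qed
qed
moreover have "continuous_on UNIV (%x. LI y. u y *R D (x - y))"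
	unfolding continuous_on_iff
proof (intro ballI allI impI)
	fix x :: 'a and e :: real assume e: "e > 0"
	obtain e' where e': "e' > 0" "e' * ?C x < e" using small_factor[OF e C0[of x]] by blast
	obtain d where d: "d > 0" "d <= 1" "!!x y. dist x y < d ==> dist (D x) (D y) < e'"
		using compact_support_uniformly_continuous[OF cont(2) K(1,3) e'(1)] by blast
	show "EX d>0. ALL x':UNIV. dist x' x < d -->
		dist (LI y. u y *R D (x' - y)) (LI y. u y *R D (x - y)) < e"
	proof (intro exI[of _ d] conjI ballI impI d(1))
		fix x' assume x': "dist x' x < d"
		define h where "h = x' - x"
		have hx: "x' = x + h" "norm h < d" "norm h <= 1" using x' d by (auto simp: h_def dist_norm)
		let ?A = "%y. u y *R D (x + h - y) - u y *R D (x - y)"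
		have "dist (LI y. u y *R D (x' - y)) (LI y. u y *R D (x - y)) = norm (LI y. ?A y)"
			using iD[of "x + h"] iD[of x] by (simp add: dist_norm hx(1))
		also have "... <= e' * ?C x"
		proof (rule norm_integral_le_on_compact[OF u])
			fix y
			show "?A y = 0" if "y ~: cball x (R + 1)" using far[OF that hx(3)] by simp
			have "norm (D (x + h - y) - D (x - y)) <= e'" using d(3)[of "x + h - y" "x - y"] hx by (simp add: dist_norm)
			then show "norm (?A y) <= e' * norm (u y)"
				using mlm[of "norm (D (x + h - y) - D (x - y))" e' "abs (u y)"]
				by (simp add: scaleR_diff_right[symmetric] mult.commute del: scaleR_diff_right)
		qed (use e' in auto)
		finally show "dist (LI y. u y *R D (x' - y)) (LI y. u y *R D (x - y)) < e" using e' by linarith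
	qed
qed
ultimately show ?thesis by (simp add: c1_def)
qed

lemma conv_commute:
assumes "sqi f" "sqi g"
shows "(LI y. f (x - y) *R g y) = (LI y. f y *R g (x - y))"
proof -
have [measurable]: "f : BB" "g : BB" using assms by (auto intro: sqi_m)
have "(LI y. (%y. f (x - y) *R g y) (x - y)) = (LI y. f (x - y) *R g y)"
	by (rule mp_int[OF mp_minus]) measurable
then show ?thesis by simp
qed

lemma c1_conv_right:
assumes k: "sqi k" and t: "ctest W ps D"
shows "c1 (conv k ps) (conv k D)"
proof -
have s: "sqi ps" "sqi D" using ctest_sqi[OF t] by auto
have "conv k ps = conv ps k" using conv_commute[OF k s(1)] by (auto simp: conv_def fun_eq_iff mult.commute)
moreover have "conv k D = (%x. LI y. k y *R D (x - y))" using conv_commute[OF k s(2)] by (auto simp: conv_def fun_eq_iff)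
ultimately show ?thesis using c1_conv[OF t k] by simp
qed

lemma conv_eq_0:
assumes "!!z. z ~: cball 0 s ==> k z = 0" "!!y. dist x y <= s ==> u y = 0"
shows "conv k u x = 0"
proof -
have "k (x - y) *R u y = 0" for y using assms(1)[of "x - y", unfolded mem_cball_0] assms(2)[of y, unfolded dist_norm] by (cases "norm (x - y) <= s") auto
then have "(%y. k (x - y) *R u y) = (%y. 0)" by (intro ext)
then show ?thesis unfolding conv_def by (simp only: integral_zero)
qed

lemma test_function_frechet:
assumes "test_function UNIV ph" "e : Basis"
shows "test_function UNIV (%x. fd ph x e)"
proof -
have ck: "Ck_on k UNIV ph" for k using assms(1) unfolding test_function_def by (rule conjunct1[THEN spec])
have K: "compact (closure {x. ph x ~= 0})" using assms(1) by (simp add: test_function_def)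
have 1: "Ck_on k UNIV (%x. fd ph x e)" for k using ck[of "Suc k"] assms(2) by simp
have sub: "{x. fd ph x e ~= 0} <= closure {x. ph x ~= 0}"
proof (rule ccontr)
	assume "\<not> ?thesis"
	then obtain x where x: "fd ph x e ~= 0" "x ~: closure {x. ph x ~= 0}" by blast
	have "(ph has_derivative (%h. 0)) (at x)"
		by (rule has_derivative_transform_within_open[of "%_. 0" _ _ _ "- closure {x. ph x ~= 0}"])
			(use x closure_subset[of "{x. ph x ~= 0}"] in auto)
	then show False using x frechet_derivative_at by metis
qed
then have "closure {x. fd ph x e ~= 0} <= closure {x. ph x ~= 0}"
	by (simp add: closure_minimal)
then have "compact (closure {x. fd ph x e ~= 0})"
	using K bounded_subset[OF _ sub] bounded_subset[OF _ closure_subset] by (metis compact_closure compact_imp_bounded)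
then show ?thesis unfolding test_function_def by (intro conjI allI 1) auto
qed

text \<open>The coinductive family consists of the convolutions of \<open>u\<close> with all test
  functions: a partial derivative falls on the kernel, which remains a test function.\<close>

lemma Ck_on_conv:
assumes "test_function UNIV k" "sqi u"
shows "Ck_on n UNIV (conv k u)"
proof (rule Ck_on_coinduct[where S="{conv ka u |ka. test_function UNIV ka}"])
have fd: "frechet_derivative (conv ka u) (at x) = (%h. (LI y. u y *R (\<Sum>e\<in>Basis. frechet_derivative ka (at (x - y)) e *R e)) *. h)"
	and df: "conv ka u differentiable (at x)"
	if "test_function UNIV ka" for ka x
	using frechet_derivative_at[OF c1_der[OF c1_conv[OF tf_ctest[OF that] assms(2)]]]
		c1_der[OF c1_conv[OF tf_ctest[OF that] assms(2)]] unfolding differentiable_def by metis+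
show "f differentiable (at x)" if "f : {conv ka u |ka. test_function UNIV ka}" for f x using that df by auto
show "(%x. fd f x e) : {conv ka u |ka. test_function UNIV ka}"
	if f: "f : {conv ka u |ka. test_function UNIV ka}" and e: "e : Basis" for f e
proof -
	obtain ka where ka: "f = conv ka u" "test_function UNIV ka" using f by blast
	have "frechet_derivative (conv ka u) (at x) e = conv (%z. fd ka z e) u x" for x
	proof -
		have "Li (%y. u y *R (\<Sum>e\<in>Basis. frechet_derivative ka (at (x - y)) e *R e))"
			by (intro i_scaleR assms(2) mp_sqi[OF mp_minus] ctest_sqi(2)[OF tf_ctest[OF ka(2)]])
		moreover have "(\<Sum>b\<in>Basis. fd ka z b *R b) *. e = fd ka z e" for z
			using e by (simp add: inner_sum_left inner_Basis if_distrib cong: if_cong)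
		ultimately show ?thesis
			unfolding fd[OF ka(2)] conv_def by (simp add: integral_inner_left[symmetric] mult.commute del: integral_inner_left)
	qed
	then show ?thesis using ka(1) test_function_frechet[OF ka(2) e] by auto
qed
qed (use assms in auto)

text \<open>A mollifier of radius \<open>s\<close>. Its evenness makes convolution with it
  self-adjoint and its partial derivatives odd.\<close>

definition kern :: "real => ('a::euclidean_space => real) => bool" where
"kern s k \<longleftrightarrow> test_function UNIV k & (ALL x. 0 <= k x) & (ALL x. k (- x) = k x) &
	(ALL x. x ~: cball 0 s --> k x = 0) & (LI x. k x) = 1"

lemma ex_kern:
assumes s: "s > 0" shows "EX k :: 'a::euclidean_space => real. kern s k"
proof -
define b :: "'a => real" where "b = (%x. pe 1 (s^2 - x *. x))"
have b_alg: "b : bump_algebra" unfolding b_def by (rule bump_algebra.pe)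
have cont: "continuous_on UNIV b" using Ck_on_bump_algebra[OF b_alg, of 0] by simp
have b0: "b x >= 0" for x by (simp add: b_def pe_def)
have bz: "b x = 0" if "x ~: cball 0 s" for x
proof -
	have "s^2 < (norm x)^2" using that s by (intro power_strict_mono) auto
	then show ?thesis by (simp add: b_def pe_def power2_norm_eq_inner)
qed
have bint: "Li b"
proof -
	have "Li (%x. (ind (cball 0 s) x *R (1::real)) * b x)"
		using sqi_continuous[OF cont compact_cball bz]
		by (rule i_mult[OF sqi_cind[OF compact_cball]])
	moreover have "(%x. (ind (cball 0 s) x *R (1::real)) * b x) = b"
		using bz by (intro ext) (metis indicator_simps(1,2) mult_1 mult_zero_left real_scaleR_def)
	ultimately show ?thesis by (simp only: )
qed
\<comment> \<open>A vanishing integral would turn the nonempty open set where \<open>b\<close> is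
  positive into a null set.\<close>
have "(LI x. b x) ~= 0"
proof
	assume "(LI x. b x) = 0"
	then have "AE x in lborel. b x = 0" using integral_nonneg_eq_0_iff_AE[OF bint] b0 by simp
	moreover have "open {x. b x ~= 0}"
		using cont by (simp add: open_Collect_neq)
	moreover have "{x. b x ~= 0} ~= {}" using s by (auto simp: b_def pe_def intro!: exI[of _ 0])
	moreover have "{x. b x ~= 0} : null_sets lborel"
		using AE_iff_null[of lborel "%x. b x = 0"] calculation(1,2) by simp
	ultimately show False
		using open_not_negligible[of "{x. b x ~= 0}"] negligible_iff_null_sets null_sets_completionI by blast
qed
then have c: "(LI x. b x) > 0" using b0 i_nn[where f=b and M=lborel] by fastforce
let ?c = "1 / (LI x. b x)"
let ?k = "%x. ?c * b x"
have "?k : bump_algebra" by (intro bump_algebra.mult bump_algebra.const b_alg)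
then have ck: "Ck_on n UNIV ?k" for n by (rule Ck_on_bump_algebra)
have sub: "{x. ?k x ~= 0} <= cball 0 s" using bz by (metis (mono_tags, lifting) mem_Collect_eq mult_zero_right subsetI)
have "compact (closure {x. ?k x ~= 0})"
	using bounded_subset[OF bounded_cball sub] by simp
then have "test_function UNIV ?k" unfolding test_function_def by (intro conjI allI ck) auto
then have "kern s ?k"
	unfolding kern_def
proof (intro conjI allI impI)
	show "?k x = 0" if "x ~: cball 0 s" for x using bz[OF that] by simp
	show "(LI x. ?k x) = 1" using c by simp
qed (use c b0 in \<open>auto simp: b_def\<close>)
then show ?thesis by blast
qed

lemma kern_test: "kern s k ==> test_function UNIV k" by (simp add: kern_def)
lemma kern_nonneg: "kern s k ==> 0 <= k x" by (simp add: kern_def)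
lemma kern_zero: "kern s k ==> x ~: cball 0 s ==> k x = 0" unfolding kern_def by blast
lemma kern_integral: "kern s k ==> (LI x. k x) = 1" by (simp add: kern_def)
lemma kern_sqi: "kern s k ==> sqi k" using ctest_sqi(1)[OF tf_ctest[OF kern_test]] .

lemma kern_integrable: "kern s k ==> Li k"
using kern_integral not_integrable_integral_eq by fastforce

lemma conv_near:
fixes u :: "'a::euclidean_space => 'b::euclidean_space"
assumes k: "kern s k" and u: "sqi u" and near: "!!y. dist x y <= s ==> dist (u y) (u x) <= e"
shows "dist (conv k u x) (u x) <= e"
proof -
have i1: "Li (%y. k (x - y) *R u y)"
	by (intro i_scaleR u mp_sqi[OF mp_minus] kern_sqi[OF k])
have i0: "Li (%y. k (x - y))" by (intro measure_pres_integrable[OF mp_minus] kern_integrable[OF k])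
have one: "(LI y. k (x - y)) = 1"
	using mp_int[OF mp_minus, of k x] kern_integral[OF k] sqi_m[OF kern_sqi[OF k]] by simp
have "conv k u x - u x = (LI y. k (x - y) *R u y - k (x - y) *R u x)"
	using i1 i0 one by (simp add: conv_def)
also have "norm ... <= (LI y. norm (k (x - y) *R u y - k (x - y) *R u x))"
	by (rule integral_norm_bound)
also have "... <= (LI y. k (x - y) * e)"
proof (rule integral_mono)
	fix y
	show "norm (k (x - y) *R u y - k (x - y) *R u x) <= k (x - y) * e"
	proof (cases "dist x y <= s")
		case True
		then show ?thesis using near[OF True] kern_nonneg[OF k, of "x - y"]
			by (simp add: scaleR_diff_right[symmetric] dist_norm mlm del: scaleR_diff_right)
	next
		case False
		then have "k (x - y) = 0" using kern_zero[OF k, of "x - y", unfolded mem_cball_0] by (simp add: dist_norm)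
		then show ?thesis by simp
	qed
qed (use i0 i1 in auto)
also have "... = e" using one by simp
finally show ?thesis by (simp add: dist_norm)
qed

lemma conv_measurable:
fixes u :: "'a::euclidean_space => 'b::euclidean_space"
assumes [measurable]: "k : BB" "u : BB"
shows "conv k u : BB"
unfolding conv_def[abs_def] by measurable

text \<open>Jensen's inequality for the probability density \<open>k (x - y)\<close> in
  \<open>y\<close>, obtained from the nonnegativity of the variance about the mean
  \<open>m\<close>.\<close>

lemma conv_norm_sq_le:
fixes u :: "'a::euclidean_space => 'b::euclidean_space"
assumes k: "kern s k" and u: "sqi u"
shows "Li (%y. k (x - y) * (norm (u y))^2)"
	and "(norm (conv k u x))^2 <= (LI y. k (x - y) * (norm (u y))^2)"
proof -
have [measurable]: "k : BB" "u : BB"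
	using k u by (auto intro: sqi_m kern_sqi)
obtain B where B: "!!x. abs (k x) <= B" using ctest_bounded[OF tf_ctest[OF kern_test[OF k]]] by metis
show i2: "Li (%y. k (x - y) * (norm (u y))^2)"
	by (rule ibound[OF integrable_mult_right[OF sqi_i[OF u], of B]])
		(auto simp: abs_mult intro!: mrm B order_trans[OF _ abs_ge_self])
have i1: "Li (%y. k (x - y) *R u y)"
	by (intro i_scaleR u mp_sqi[OF mp_minus] kern_sqi[OF k])
have i0: "Li (%y. k (x - y))" by (intro measure_pres_integrable[OF mp_minus] kern_integrable[OF k])
have one: "(LI y. k (x - y)) = 1"
	using mp_int[OF mp_minus, of k x] kern_integral[OF k] by simp
define m where "m = conv k u x"
have i1m: "Li (%y. (k (x - y) *R u y) *. m)" by (rule integrable_inner_left) (use i1 in simp)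
have "0 <= (LI y. k (x - y) * (norm (u y - m))^2)"
	using kern_nonneg[OF k] by (intro i_nn) auto
also have "... = (LI y. k (x - y) * (norm (u y))^2 - 2 * ((k (x - y) *R u y) *. m) + k (x - y) * (norm m)^2)"
	by (intro icong refl)
		(simp add: power2_norm_eq_inner idl inner_diff_right inner_commute algebra_simps)
also have "... = (LI y. k (x - y) * (norm (u y))^2) - 2 * ((LI y. k (x - y) *R u y) *. m) + (norm m)^2"
	using i2 i0 i1m i1 one by (simp del: inner_scaleR_left)
also have "(LI y. k (x - y) *R u y) *. m = (norm m)^2"
	by (simp add: m_def conv_def power2_norm_eq_inner)
finally show "(norm (conv k u x))^2 <= (LI y. k (x - y) * (norm (u y))^2)" by (simp add: m_def)
qed

text \<open>Jensen's inequality integrated by Tonelli's theorem: the kernel also has mass one as a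
  function of \<open>x\<close>.\<close>

lemma
fixes u :: "'a::euclidean_space => 'b::euclidean_space"
assumes k: "kern s k" and u: "sqi u"
shows sqi_conv: "sqi (conv k u)" and N2_conv_le: "N2 (conv k u) <= N2 u"
proof -
have [measurable]: "k : BB" "u : BB"
	using k u by (auto intro: sqi_m kern_sqi)
have [measurable]: "conv k u : BB" by (rule conv_measurable) measurable
have one: "(\<integral>\<^sup>+x. ennreal (k (x - y)) \<partial>lborel) = 1" for y
proof -
	have "(\<integral>\<^sup>+x. ennreal (k (x - y)) \<partial>lborel) = ennreal (LI x. k (- y + x))"
		using nn_integral_eq_integral[OF measure_pres_integrable[OF mp_plus kern_integrable[OF k], of "- y"]]
			kern_nonneg[OF k] by simp
	also have "(LI x. k (- y + x)) = 1"
		using mp_int[OF mp_plus, of k "- y"] kern_integral[OF k] by simp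
	finally show ?thesis by simp
qed
have "(\<integral>\<^sup>+x. ennreal ((norm (conv k u x))^2) \<partial>lborel) <= (\<integral>\<^sup>+x. \<integral>\<^sup>+y. ennreal (k (x - y) * (norm (u y))^2) \<partial>lborel \<partial>lborel)"
proof (rule nn_integral_mono)
	fix x
	have "(\<integral>\<^sup>+y. ennreal (k (x - y) * (norm (u y))^2) \<partial>lborel) = ennreal (LI y. k (x - y) * (norm (u y))^2)"
		by (rule nn_integral_eq_integral[OF conv_norm_sq_le(1)[OF k u]]) (use kern_nonneg[OF k] in auto)
	then show "ennreal ((norm (conv k u x))^2) <= (\<integral>\<^sup>+y. ennreal (k (x - y) * (norm (u y))^2) \<partial>lborel)"
		using conv_norm_sq_le(2)[OF k u, of x] by (simp add: ennreal_leI)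
qed
also have "... = (\<integral>\<^sup>+y. \<integral>\<^sup>+x. ennreal (k (x - y) * (norm (u y))^2) \<partial>lborel \<partial>lborel)"
	by (rule lborel_pair.Fubini'[symmetric]) measurable
also have "... = (\<integral>\<^sup>+y. ennreal ((norm (u y))^2) \<partial>lborel)"
proof (rule nn_integral_cong)
	fix y
	have "(\<integral>\<^sup>+x. ennreal (k (x - y) * (norm (u y))^2) \<partial>lborel) = (\<integral>\<^sup>+x. ennreal (k (x - y)) * ennreal ((norm (u y))^2) \<partial>lborel)"
		using kern_nonneg[OF k] by (intro nn_integral_cong) (simp add: ennreal_mult)
	also have "... = ennreal ((norm (u y))^2)" by (subst nn_integral_multc) (auto simp: one)
	finally show "(\<integral>\<^sup>+x. ennreal (k (x - y) * (norm (u y))^2) \<partial>lborel) = ennreal ((norm (u y))^2)" .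
qed
also have "... = ennreal (N2 u)" unfolding N2_def by (rule nn_integral_eq_integral[OF sqi_i[OF u]]) simp
finally have le: "(\<integral>\<^sup>+x. ennreal ((norm (conv k u x))^2) \<partial>lborel) <= ennreal (N2 u)" .
have int: "Li (%x. (norm (conv k u x))^2)"
	by (rule integrableI_bounded) (use le in \<open>auto simp: le_less_trans[OF le ennreal_less_top]\<close>)
then show "sqi (conv k u)" by (simp add: sqi_def)
have "ennreal (N2 (conv k u)) = (\<integral>\<^sup>+x. ennreal ((norm (conv k u x))^2) \<partial>lborel)"
	unfolding N2_def by (rule nn_integral_eq_integral[OF int, symmetric]) simp
with le have "ennreal (N2 (conv k u)) <= ennreal (N2 u)" by simp
then show "N2 (conv k u) <= N2 u" using N2_nonneg[of u] by (simp add: ennreal_le_iff)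
qed

lemma N2_tendsto_zero:
fixes f :: "nat => 'a::euclidean_space => 'b::euclidean_space"
assumes [measurable]: "!!n. f n : BB" and w: "Li w"
	and b: "!!n x. (norm (f n x))^2 <= w x" and l: "AE x in lborel. (%n. f n x) ----> 0"
shows "(%n. N2 (f n)) ----> 0"
proof -
have "(%n. LI x. (norm (f n x))^2) ----> integral\<^sup>L (lborel :: 'a measure) (%_. 0 :: real)"
proof (rule integral_dominated_convergence[where w=w])
	show "AE x in lborel. (%n. (norm (f n x))^2) ----> 0"
		using l by eventually_elim (auto intro!: tendsto_eq_intros)
qed (use b w in auto)
then show ?thesis by (simp add: N2_def)
qed

text \<open>Truncation in value and in space, then the pointwise approximation by continuous
  functions that measurability provides. Clipping the approximants to values of norm at most
  \<open>B\<close> makes dominated convergence applicable.\<close>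

lemma continuous_dense:
fixes u :: "'a::euclidean_space => 'b::euclidean_space"
assumes u: "sqi u" and e: "e > 0"
obtains c R where "continuous_on UNIV c" "!!x. x ~: cball 0 R ==> c x = 0" "sqi c" "N2 (%x. u x - c x) < e"
proof -
have [measurable]: "u : BB" using u by (rule sqi_m)
define v where "v n x = (if norm (u x) <= real n & norm x <= real n then u x else 0)" for n x
have [measurable]: "v n : BB" for n unfolding v_def[abs_def] by measurable
have "(%n. N2 (%x. u x - v n x)) ----> 0"
proof (rule N2_tendsto_zero[OF _ sqi_i[OF u]])
	show "AE x in lborel. (%n. u x - v n x) ----> 0"
	proof (rule AE_I2)
		fix x
		obtain m where m: "max (norm (u x)) (norm x) <= real m" using real_arch_simple by blast
		have "u x - v n x = 0" if "m <= n" for n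
		proof -
			have "real m <= real n" using that by simp
			then have "norm (u x) <= real n" "norm x <= real n" using m by linarith+
			then show ?thesis by (simp add: v_def)
		qed
		then have "\<forall>\<^sub>F n in sequentially. u x - v n x = 0"
			unfolding eventually_sequentially by blast
		then show "(%n. u x - v n x) ----> 0" by (rule tendsto_eventually)
	qed
qed (auto simp: v_def)
then have "\<forall>\<^sub>F n in sequentially. N2 (%x. u x - v n x) < e / 4" using e by (intro order_tendstoD) auto
then obtain n where n: "N2 (%x. u x - v n x) < e / 4" using eventually_happens'[OF sequentially_bot] by blast
\<comment> \<open>The definition of \<open>measurable_on\<close> supplies continuous functions that
  converge to \<open>v n\<close> off a negligible set.\<close>
have "v n measurable_on UNIV"
	by (rule lebesgue_measurable_imp_measurable_on) (auto simp: measurable_completion)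
then obtain N g where N: "negligible N" and g: "!!i. continuous_on UNIV (g i)"
	and lim: "!!x. x ~: N ==> (%i. g i x) ----> v n x"
	unfolding measurable_on_def by (elim exE conjE) (simp only: UNIV_I if_True, blast)
define B where "B = real n + 1"
have B: "B > 0" by (simp add: B_def)
define clip :: "'b => 'b" where "clip w = (B / max B (norm w)) *R w" for w
have clip_cont: "continuous_on UNIV clip"
proof -
	have "max B (norm w) ~= 0" for w :: 'b using B by linarith
	then show ?thesis unfolding clip_def[abs_def] by (intro continuous_intros ballI)
qed
have clip_le: "norm (clip w) <= B" for w
proof (cases "norm w <= B")
	case True
	then have "max B (norm w) = B" by simp
	then show ?thesis using True B by (simp add: clip_def)
next
	case False
	then have "max B (norm w) = norm w" by simp
	then show ?thesis using False B by (simp add: clip_def)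
qed
have clip_id: "clip w = w" if "norm w <= B" for w using that B by (simp add: clip_def max_absorb1)
define h :: "nat => 'a => 'b" where "h i x = max 0 (min 1 (B - norm x)) *R clip (g i x)" for i x
have h_cont: "continuous_on UNIV (h i)" for i
	unfolding h_def[abs_def] by (intro continuous_intros continuous_on_compose2[OF clip_cont g]) auto
have h_zero: "h i x = 0" if "x ~: cball 0 B" for i x using that by (auto simp: h_def)
have h_sqi: "sqi (h i)" for i by (rule sqi_continuous[OF h_cont compact_cball h_zero])
have v_sqi: "sqi (v n)" by (rule sqi_bound[OF _ u, of _ 1]) (auto simp: v_def)
have hB: "norm (h i x) <= B" for i x
	using mult_mono[OF _ clip_le[of "g i x"], of "abs (max 0 (min 1 (B - norm x)))" 1] by (simp add: h_def)
have "(%i. N2 (%x. v n x - h i x)) ----> 0"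
proof (rule N2_tendsto_zero)
	show "Li (%x. (norm (ind (cball 0 B) x *R (2 * B)))^2)"
		by (rule sqi_i[OF sqi_cind]) simp
	show "(norm (v n x - h i x))^2 <= (norm (ind (cball 0 B) x *R (2 * B)))^2" for i x
	proof (cases "x : cball 0 B")
		case True
		have "norm (v n x - h i x) <= norm (v n x) + norm (h i x)" by (rule norm_triangle_ineq4)
		also have "... <= B + B" using hB[of i x] by (intro add_mono) (auto simp: v_def B_def)
		finally show ?thesis using True by (intro power_mono) auto
	next
		case False
		then show ?thesis using h_zero[OF False] by (auto simp: v_def B_def)
	qed
	obtain N' where N': "N' : null_sets lborel" "N <= N'"
		using N[unfolded negligible_iff_null_sets null_sets_completion_iff2] by (elim bexE)
	show "AE x in lborel. (%i. v n x - h i x) ----> 0"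
	proof (rule AE_I'[OF N'(1)], rule subsetI, rule ccontr)
		fix x assume x: "x : {x : space lborel. \<not> (%i. v n x - h i x) ----> 0}" "x ~: N'"
		have "(%i. clip (g i x)) ----> clip (v n x)"
			using x N'(2) by (intro continuous_on_tendsto_compose[OF clip_cont lim]) auto
		then have "(%i. h i x) ----> max 0 (min 1 (B - norm x)) *R v n x"
			unfolding h_def using clip_id[of "v n x"] by (intro tendsto_intros) (auto simp: v_def B_def)
		also have "max 0 (min 1 (B - norm x)) *R v n x = v n x" by (auto simp: v_def B_def)
		finally have "(%i. v n x - h i x) ----> v n x - v n x" by (intro tendsto_diff tendsto_const)
		then show False using x(1) by simp
	qed
qed (use h_sqi in \<open>auto intro: sqi_m\<close>)
then have "\<forall>\<^sub>F i in sequentially. N2 (%x. v n x - h i x) < e / 4" using e by (intro order_tendstoD) auto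
then obtain i where i: "N2 (%x. v n x - h i x) < e / 4" using eventually_happens'[OF sequentially_bot] by blast
have "N2 (%x. (u x - v n x) + (v n x - h i x)) <= 2 * N2 (%x. u x - v n x) + 2 * N2 (%x. v n x - h i x)"
	by (intro N2_add_le sqi_diff u v_sqi h_sqi)
then have "N2 (%x. u x - h i x) < e" using n i by simp
then show ?thesis by (intro that[OF h_cont h_zero h_sqi])
qed

lemma conv_diff:
fixes u v :: "'a::euclidean_space => 'b::euclidean_space"
assumes "kern s k" "sqi u" "sqi v"
shows "conv k (%x. u x - v x) x = conv k u x - conv k v x"
proof -
have "Li (%y. k (x - y) *R w y)" if "sqi w" for w :: "'a => 'b"
	by (intro i_scaleR that mp_sqi[OF mp_minus] kern_sqi[OF assms(1)])
then show ?thesis using assms by (simp add: conv_def scaleR_diff_right)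
qed

lemma bound_chain: "x <= 2 * c + 2 * a ==> a <= 2 * p + 2 * q ==> x <= 2 * c + 2 * (2 * p + 2 * q :: real)"
by simp

text \<open>The threshold \<open>s0\<close> is uniform over all kernels of smaller radius: it comes
  from the modulus of continuity of a continuous approximant, and convolution does not increase the
  norm of the remainder.\<close>

lemma mollifier_L2:
fixes u :: "'a::euclidean_space => 'b::euclidean_space"
assumes u: "sqi u" and e: "e > 0"
obtains s0 where "s0 > 0" "!!s k. s < s0 ==> kern s k ==> N2 (%x. conv k u x - u x) < e"
proof -
\<comment> \<open>By \<open>bound_chain\<close> the three errors enter with the factors 2, 4 and 4,
  and \<open>2/12 + 4/8 + 4/12 = 1\<close>.\<close>
obtain c R where c: "continuous_on UNIV c" "!!x. x ~: cball 0 R ==> c x = 0" "sqi c" "N2 (%x. u x - c x) < e / 12"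
	using continuous_dense[OF u, of "e / 12"] e by auto
let ?V = "N2 (%x::'a. ind (cball 0 (R+1)) x *R (1::real))"
have "e / 8 > 0" using e by simp
then obtain e' where e': "e' > 0" "e' * ?V < e / 8" using small_factor N2_nonneg by blast
obtain d where d: "d > 0" "d <= 1" "!!x y. dist x y < d ==> dist (c x) (c y) < sqrt e'"
proof -
	have "sqrt e' > 0" using e'(1) by simp
	from compact_support_uniformly_continuous[OF c(1) compact_cball c(2) this] show ?thesis using that by metis
qed
show thesis
proof (rule that[OF d(1)])
	fix s :: real and k :: "'a => real" assume s: "s < d" and k: "kern s k"
	have b: "norm (conv k c x - c x) <= sqrt e'" for x
	proof -
		have "dist (conv k c x) (c x) <= sqrt e'"
		proof (rule conv_near[OF k c(3)])
			fix y assume "dist x y <= s"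
			then show "dist (c y) (c x) <= sqrt e'" using d(3)[of y x] s by (simp add: dist_commute)
		qed
		then show ?thesis by (simp add: dist_norm)
	qed
	have z: "conv k c x - c x = 0" if "x ~: cball 0 (R + 1)" for x
	proof -
		have x: "norm x > R + 1" using that by simp
		have "conv k c x = 0"
		proof (rule conv_eq_0)
			fix y assume "dist x y <= s"
			then have "norm y >= norm x - 1" using s d(2) norm_triangle_ineq2[of x y] by (simp add: dist_norm)
			then show "c y = 0" using c(2)[of y] x by simp
		qed (use kern_zero[OF k] in blast)
		then show ?thesis using c(2)[of x] x by simp
	qed
	have sq: "sqi (%x. conv k c x - c x)" by (intro sqi_diff sqi_conv[OF k] c)
	have "N2 (%x. conv k c x - c x) <= N2 (%x. sqrt e' *R (ind (cball 0 (R+1)) (x::'a) *R (1::real)))"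
	proof (rule N2_mono)
		show "sqi (%x. sqrt e' *R (ind (cball 0 (R+1)) (x::'a) *R (1::real)))" by (intro sqi_scaleR sqi_cind) simp
		show "norm (conv k c x - c x) <= norm (sqrt e' *R (ind (cball 0 (R+1)) (x::'a) *R (1::real)))" for x
		proof (cases "x : cball 0 (R+1)")
			case True
			then show ?thesis using b[of x] e'(1) by simp
		next
			case False
			show ?thesis unfolding z[OF False] by simp
		qed
	qed (use sq in \<open>rule sqi_m\<close>)
	also have "... = e' * ?V" using e'(1) by (simp add: N2_def pmd)
	finally have 1: "N2 (%x. conv k c x - c x) < e / 8" using e' by simp
	have 2: "N2 (conv k (%x. u x - c x)) < e / 12" using N2_conv_le[OF k sqi_diff[OF u c(3)]] c(4) by simp
	have e1: "(%x. conv k (%x. u x - c x) x + ((conv k c x - c x) - (u x - c x))) = (%x. conv k u x - u x)"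
		by (intro ext) (simp only: conv_diff[OF k u c(3)], simp)
	have e2: "(%x. (conv k c x - c x) + - (u x - c x)) = (%x. (conv k c x - c x) - (u x - c x))"
		by (intro ext) simp
	have e3: "N2 (%x. - (u x - c x)) = N2 (%x. u x - c x)" by (simp only: N2_def norm_minus_cancel)
	have A: "N2 (%x. conv k u x - u x) <= 2 * N2 (conv k (%x. u x - c x)) + 2 * N2 (%x. (conv k c x - c x) - (u x - c x))"
		using N2_add_le[OF sqi_conv[OF k sqi_diff[OF u c(3)]] sqi_diff[OF sq sqi_diff[OF u c(3)]]] unfolding e1 .
	have B: "N2 (%x. (conv k c x - c x) - (u x - c x)) <= 2 * N2 (%x. conv k c x - c x) + 2 * N2 (%x. u x - c x)"
		using N2_add_le[OF sq sqi_uminus[OF sqi_diff[OF u c(3)]]] unfolding e2 e3 .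
	note le = bound_chain[OF A B]
	from le show "N2 (%x. conv k u x - u x) < e" using 1 2 c(4) by simp
qed
qed

lemma mollifier_seq:
fixes u :: "'a::euclidean_space => 'b::euclidean_space"
assumes u: "sqi u" and k: "!!n. kern (s n) (k n)" and s: "s ----> 0"
shows "(%n. N2 (%x. conv (k n) u x - u x)) ----> 0"
proof (rule LIMSEQ_I)
fix e :: real assume "e > 0"
then obtain s0 where s0: "s0 > 0" "!!s k. s < s0 ==> kern s k ==> N2 (%x. conv k u x - u x) < e"
	using mollifier_L2[OF u] by blast
have "\<forall>\<^sub>F n in sequentially. s n < s0" using order_tendstoD(2)[OF s s0(1)] .
then obtain no where no: "!!n. n >= no ==> s n < s0" unfolding eventually_sequentially by blast
show "EX no. ALL n>=no. norm (N2 (%x. conv (k n) u x - u x) - 0) < e"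
proof (intro exI[of _ no] allI impI)
	fix n assume "no <= n"
	then show "norm (N2 (%x. conv (k n) u x - u x) - 0) < e"
		using s0(2)[OF no k] N2_nonneg[of "%x. conv (k n) u x - u x"] by simp
qed
qed

lemma int_inner_lim:
fixes f :: "'a::euclidean_space => 'b::euclidean_space"
assumes f: "sqi f" and g: "!!n. sqi (g n)" "sqi g'" and l: "(%n. N2 (%x. g n x - g' x)) ----> 0"
shows "(%n. LI x. f x *. g n x) ----> (LI x. f x *. g' x)"
proof (rule LIM_zero_cancel, rule Lim_null_comparison)
have "norm ((LI x. f x *. g n x) - (LI x. f x *. g' x)) <= sqrt (N2 f) * sqrt (N2 (%x. g n x - g' x))" for n
proof -
	have "(LI x. f x *. (g n x - g' x)) = (LI x. f x *. g n x) - (LI x. f x *. g' x)"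
		unfolding inner_diff_right
		by (rule Bochner_Integration.integral_diff[OF i_inner[OF f g(1)] i_inner[OF f g(2)]])
	then show ?thesis using abs_int_le[OF f sqi_diff[OF g(1)[of n] g(2)]] by (simp only: real_norm_def)
qed
then show "\<forall>\<^sub>F n in sequentially. norm ((LI x. f x *. g n x) - (LI x. f x *. g' x)) <= sqrt (N2 f) * sqrt (N2 (%x. g n x - g' x))"
	by (intro always_eventually allI)
have "(%n. sqrt (N2 f) * sqrt (N2 (%x. g n x - g' x))) ----> sqrt (N2 f) * sqrt 0"
	by (intro tendsto_mult tendsto_const tendsto_real_sqrt l)
then show "(%n. sqrt (N2 f) * sqrt (N2 (%x. g n x - g' x))) ----> 0"
	by (simp only: real_sqrt_zero mult_zero_right)
qed

section \<open>Weak gradients\<close>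

text \<open>The real weak gradient as one vector field. All integrals run over the whole space and
  only the support of the test function localises the relation to \<open>W\<close>; weak
  differentiability of an extension by zero is the same relation on a larger
  \<open>W\<close>.\<close>

definition wgrad :: "'a::euclidean_space set => ('a => real) => ('a => 'a) => bool" where
"wgrad W u G \<longleftrightarrow> (ALL ps D. ctest W ps D -->
	(ALL h. (LI x. u x * (D x *. h)) = - (LI x. (G x *. h) * ps x)))"

lemma wgradD: "wgrad W u G ==> ctest W ps D ==>
(LI x. u x * (D x *. h)) = - (LI x. (G x *. h) * ps x)"
by (simp add: wgrad_def)

lemma wgrad_mono: "wgrad W u G ==> W' <= W ==> wgrad W' u G"
unfolding wgrad_def using ctest_mono by blast

text \<open>The reflected kernel \<open>k (x - y)\<close> is itself a test function in
  \<open>W\<close> as soon as the ball of radius \<open>s\<close> about \<open>x\<close> lies in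
  \<open>W\<close>. There the classical gradient of the mollified function is the mollified weak
  gradient.\<close>

lemma wgrad_conv_test:
assumes w: "wgrad W u G" and u: "sqi u" "sqi G" and k: "test_function UNIV k" "!!z. z ~: cball 0 s ==> k z = 0"
	and W: "cball x s <= W" and c: "c1 (conv k u) V"
shows "V x = conv k G x"
proof -
obtain D where t: "ctest UNIV k D" using tf_ctest[OF k(1)] by blast
have tr: "ctest W (%y. k (x - y)) (%y. - D (x - y))"
proof (rule ctest_reflect[OF t compact_cball])
	show "k z = 0" if "z ~: cball 0 s" for z using k(2)[OF that] .
	show "x - z : W" if "z : cball 0 s" for z using that W by (auto simp: subset_iff dist_norm)
qed
have shift: "sqi (%y. k (x - y))" "sqi (%y. D (x - y))"
	using ctest_sqi[OF t] by (auto intro: mp_sqi[OF mp_minus])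
have eq: "(%h. V x *. h) = (%h. (LI y. u y *R D (x - y)) *. h)"
	using hdu[OF c1_der[OF c] c1_der[OF c1_conv[OF t u(1)]]] .
have "V x *. h = conv k G x *. h" for h
proof -
	have "V x *. h = (LI y. u y *R D (x - y)) *. h" using eq by (rule fun_cong)
	also have "... = (LI y. (u y *R D (x - y)) *. h)"
		by (rule integral_inner_left[symmetric]) (use i_scaleR[OF u(1) shift(2)] in simp)
	also have "... = - (LI y. u y * (- D (x - y) *. h))" by simp
	also have "... = (LI y. (G y *. h) * k (x - y))"
		using wgradD[OF w tr, of h] by simp
	also have "... = (LI y. (k (x - y) *R G y) *. h)" by (simp add: mult.commute)
	also have "... = conv k G x *. h" unfolding conv_def
		by (rule integral_inner_left) (use i_scaleR[OF shift(1) u(2)] in simp)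
	finally show ?thesis .
qed
then show ?thesis by (rule vector_eq_rdot[THEN iffD1, OF allI])
qed

text \<open>The chain rule for the square, in the form that all Poincare and Hardy inequalities
  below use. Only one factor is mollified, so that \<open>ps\<close> times it is a test function for
  the other.\<close>

lemma wgrad_square:
assumes w: "wgrad W u G" and W: "open W" and u: "sqi u" "sqi G" and t: "ctest W ps D"
shows "(LI x. (u x)^2 * (D x *. h)) = - 2 * (LI x. u x * (G x *. h) * ps x)"
proof -
obtain K where K: "compact K" "K <= W" "!!x. x ~: K ==> ps x = 0" "!!x. x ~: K ==> D x = 0" using ctestE[OF t] by metis
obtain s0 where s0': "s0 > 0" "(\<Union>x\<in>K. cball x s0) <= W"
	by (rule compact_subset_open_imp_cball_epsilon_subset[OF K(1) W K(2)])
have s0: "s0 > 0" "!!x. x : K ==> cball x s0 <= W" using s0' by auto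
define s where "s n = s0 / real (Suc n)" for n
have s: "0 < s n" "s n <= s0" for n using s0(1) by (auto simp: s_def field_simps)
have slim: "s ----> 0" unfolding s_def by (rule LIMSEQ_Suc[OF lim_const_over_n])
obtain k :: "nat => 'a => real" where k: "!!n. kern (s n) (k n)"
	using choice[of "%n k. kern (s n) k"] ex_kern[OF s(1)] by blast
obtain B where B: "B > 0" "!!x. abs (ps x) <= B" "!!x. norm (D x) <= B" using ctest_bounded[OF t] by metis
have [measurable]: "ps : BB" "D : BB" using ctest_sqi[OF t] by (auto intro: sqi_m)
have s1: "sqi (%x. (u x * ps x) *R h)"
proof (rule sqi_bound[OF _ u(1), of _ "B * norm h"])
	fix x
	have "abs (ps x) * (norm h * abs (u x)) <= B * (norm h * abs (u x))" by (intro mrm B) auto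
	then show "norm ((u x * ps x) *R h) <= B * norm h * norm (u x)" by (simp add: abs_mult mult_ac)
qed (use u in \<open>auto dest: sqi_m\<close>)
have s2: "sqi (%x. u x * (D x *. h))"
proof (rule sqi_bound[OF _ u(1), of _ "B * norm h"])
	fix x
	have "abs (D x *. h) <= B * norm h" using CS2[of "D x" h] mrm[OF B(3)[of x], of "norm h"] by simp
	then show "norm (u x * (D x *. h)) <= B * norm h * norm (u x)"
		using mlm[of "abs (D x *. h)" "B * norm h" "abs (u x)"] by (simp add: abs_mult mult_ac)
qed (use u in \<open>auto dest: sqi_m\<close>)
have s3: "sqi (%x. (G x *. h) * ps x)"
	using sqi_bm[OF sqi_ic[OF u(2), of h] _ B(2)] by (simp add: mult.commute)
note mollu = mollifier_seq[OF u(1) k slim] and mollG = mollifier_seq[OF u(2) k slim]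
have eq: "(LI x. ((u x * ps x) *R h) *. conv (k n) G x) + (LI x. (u x * (D x *. h)) *. conv (k n) u x)
	= - (LI x. ((G x *. h) * ps x) *. conv (k n) u x)" for n
proof -
	have kt: "ctest UNIV (k n) (%z. \<Sum>e\<in>Basis. frechet_derivative (k n) (at z) e *R e)"
		by (rule tf_ctest[OF kern_test[OF k]])
	obtain V where V: "c1 (conv (k n) u) V" using c1_conv[OF kt u(1)] by blast
	have VG: "V x = conv (k n) G x" if "x : K" for x
		using that s0(2)[OF that] s(2)[of n] by (intro wgrad_conv_test[OF w u kern_test[OF k] kern_zero[OF k] _ V]) auto
	\<comment> \<open>The test function is \<open>ps\<close> times the mollification of
	  \<open>u\<close>. On the support of \<open>ps\<close> the gradient \<open>V\<close> is the
	  mollified \<open>G\<close>, as the radius does not exceed \<open>s0\<close>.\<close>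
	have "(LI x. u x * ((ps x *R V x + conv (k n) u x *R D x) *. h)) = - (LI x. (G x *. h) * (ps x * conv (k n) u x))"
		by (rule wgradD[OF w ctest_mult_left[OF t V]])
	moreover have "u x * ((ps x *R V x + conv (k n) u x *R D x) *. h) =
		((u x * ps x) *R h) *. conv (k n) G x + (u x * (D x *. h)) *. conv (k n) u x" for x
		using VG[of x] K(3)[of x] by (cases "x : K") (auto simp: ial inner_commute algebra_simps)
	ultimately have 1: "(LI x. ((u x * ps x) *R h) *. conv (k n) G x + (u x * (D x *. h)) *. conv (k n) u x)
		= - (LI x. (G x *. h) * (ps x * conv (k n) u x))" by simp
	have 2: "(LI x. ((u x * ps x) *R h) *. conv (k n) G x + (u x * (D x *. h)) *. conv (k n) u x)
		= (LI x. ((u x * ps x) *R h) *. conv (k n) G x) + (LI x. (u x * (D x *. h)) *. conv (k n) u x)"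
		by (rule iadd[OF i_inner[OF s1 sqi_conv[OF k u(2), of n]] i_inner[OF s2 sqi_conv[OF k u(1), of n]]])
	have 3: "(LI x. (G x *. h) * (ps x * conv (k n) u x)) = (LI x. ((G x *. h) * ps x) *. conv (k n) u x)"
		by (intro icong) auto
	show ?thesis using 1 2 3 by (simp only: )
qed
let ?A = "%n. LI x. ((u x * ps x) *R h) *. conv (k n) G x"
	and ?B = "%n. LI x. (u x * (D x *. h)) *. conv (k n) u x"
	and ?C = "%n. LI x. ((G x *. h) * ps x) *. conv (k n) u x"
	and ?a = "LI x. ((u x * ps x) *R h) *. G x"
	and ?b = "LI x. (u x * (D x *. h)) *. u x"
	and ?c = "LI x. ((G x *. h) * ps x) *. u x"
have A: "?A ----> ?a" by (rule int_inner_lim[OF s1 sqi_conv[OF k u(2)] u(2) mollG])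
have Bl: "?B ----> ?b" by (rule int_inner_lim[OF s2 sqi_conv[OF k u(1)] u(1) mollu])
have C: "?C ----> ?c" by (rule int_inner_lim[OF s3 sqi_conv[OF k u(1)] u(1) mollu])
have "(%n. ?A n + ?B n) ----> ?a + ?b" using A Bl by (rule tendsto_add)
moreover have "(%n. ?A n + ?B n) ----> - ?c"
	unfolding eq using C by (rule tendsto_minus)
ultimately have lim: "?a + ?b = - ?c" by (rule LIMSEQ_unique)
have "?a = (LI x. u x * (G x *. h) * ps x)" "?c = (LI x. u x * (G x *. h) * ps x)"
	"?b = (LI x. (u x)^2 * (D x *. h))"
	by (auto intro!: icong simp: p2eq inner_commute)
then show ?thesis using lim by linarith
qed

text \<open>A C1 test function is mollified within \<open>W\<close>; the mollifications converge in
  L2 together with their gradients. Linearity passes from coordinate directions to every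
  \<open>h\<close>.\<close>

lemma wgrad_of_test:
assumes W: "open W" and u: "sqi u" "sqi G"
	and w: "!!ph e. test_function W ph ==> e : Basis ==>
		(LI x. u x * fd ph x e) = - (LI x. (G x *. e) * ph x)"
shows "wgrad W u G"
unfolding wgrad_def
proof (intro allI impI)
fix ps D h assume t: "ctest W ps D"
obtain K where K: "compact K" "K <= W" "!!x. x ~: K ==> ps x = 0" "!!x. x ~: K ==> D x = 0" using ctestE[OF t] by metis
obtain s0 where s0: "s0 > 0" "(\<Union>x\<in>K. cball x s0) <= W"
	by (rule compact_subset_open_imp_cball_epsilon_subset[OF K(1) W K(2)])
define s where "s n = s0 / real (Suc n)" for n
have s: "0 < s n" "s n <= s0" for n using s0(1) by (auto simp: s_def field_simps)
have slim: "s ----> 0" unfolding s_def by (rule LIMSEQ_Suc[OF lim_const_over_n])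
obtain k :: "nat => 'a => real" where k: "!!n. kern (s n) (k n)"
	using choice[of "%n k. kern (s n) k"] ex_kern[OF s(1)] by blast
note sq = ctest_sqi[OF t]
define K' where "K' = {x + y |x y. x : K & y : cball 0 s0}"
have K': "compact K'" unfolding K'_def by (rule compact_sums[OF K(1) compact_cball])
have K'W: "K' <= W"
proof
	fix z assume "z : K'"
	then obtain x y where "x : K" "y : cball 0 s0" "z = x + y" unfolding K'_def by blast
	then have "z : cball x s0" by (simp add: dist_norm)
	then show "z : W" using s0(2) `x : K` by blast
qed
have z: "conv (k n) ps x = 0" if "x ~: K'" for n x
proof (rule conv_eq_0)
	fix y assume y: "dist x y <= s n"
	show "ps y = 0"
	proof (rule K(3), rule notI)
		assume "y : K"
		moreover have "norm (x - y) <= s0" using y s(2)[of n] unfolding dist_norm by (rule order_trans)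
		then have "x - y : cball 0 s0" by (simp only: mem_cball_0)
		moreover have "x = y + (x - y)" by simp
		ultimately have "x : K'" unfolding K'_def by blast
		then show False using that by simp
	qed
qed (rule kern_zero[OF k])
have tf: "test_function W (conv (k n) ps)" for n
proof -
	have "closure {x. conv (k n) ps x ~= 0} <= K'"
		using z by (intro closure_minimal compact_imp_closed[OF K']) (metis (mono_tags, lifting) mem_Collect_eq subsetI)
	then show ?thesis
		using Ck_on_conv[OF kern_test[OF k] sq(1), of _ n] K'W compact_imp_bounded[OF K'] bounded_subset
		unfolding test_function_def by (metis bounded_subset compact_closure closure_subset order_trans)
qed
have fr: "frechet_derivative (conv (k n) ps) (at x) e = conv (k n) D x *. e" for n x e
	using frechet_derivative_at[OF c1_der[OF c1_conv_right[OF kern_sqi[OF k] t]], symmetric] by (rule fun_cong)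
have base: "(LI x. u x * (D x *. e)) = - (LI x. (G x *. e) * ps x)" if e: "e : Basis" for e
proof -
	let ?A = "%n. LI x. (u x *R e) *. conv (k n) D x" and ?B = "%n. LI x. (G x *. e) *. conv (k n) ps x"
	have A: "?A ----> (LI x. (u x *R e) *. D x)"
	proof (rule int_inner_lim[OF _ sqi_conv[OF k sq(2)] sq(2) mollifier_seq[OF sq(2) k slim]])
		show "sqi (%x. u x *R e)"
			by (rule sqi_bound[OF _ u(1), of _ 1]) (use e u in \<open>auto dest: sqi_m\<close>)
	qed
	have B: "?B ----> (LI x. (G x *. e) *. ps x)"
		by (rule int_inner_lim[OF sqi_ic[OF u(2)] sqi_conv[OF k sq(1)] sq(1) mollifier_seq[OF sq(1) k slim]])
	have "?A n = - ?B n" for n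
		using w[OF tf e, of n] unfolding fr by (simp add: inner_commute)
	then have "?A ----> - (LI x. (G x *. e) *. ps x)" using tendsto_minus[OF B] by (simp only: )
	from LIMSEQ_unique[OF A this] show ?thesis by (simp add: inner_commute)
qed
have i1: "Li (%x. u x * (D x *. e))" for e by (intro i_mult u sqi_ic sq)
have i2: "Li (%x. (G x *. e) * ps x)" for e by (intro i_mult u sqi_ic sq)
have h: "v *. h = (\<Sum>e\<in>Basis. (h *. e) * (v *. e))" for v :: 'a
	by (subst euclidean_inner) (simp add: mult.commute)
have "(LI x. u x * (D x *. h)) = (LI x. (\<Sum>e\<in>Basis. (h *. e) * (u x * (D x *. e))))"
	by (subst h) (simp add: sum_distrib_left mult_ac)
also have "... = (\<Sum>e\<in>Basis. (h *. e) * (LI x. u x * (D x *. e)))"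
	using i1 by (subst Bochner_Integration.integral_sum) auto
also have "... = - (\<Sum>e\<in>Basis. (h *. e) * (LI x. (G x *. e) * ps x))"
	using base by (simp add: sum_negf[symmetric])
also have "(\<Sum>e\<in>Basis. (h *. e) * (LI x. (G x *. e) * ps x)) = (LI x. (\<Sum>e\<in>Basis. (h *. e) * ((G x *. e) * ps x)))"
	using i2 by (subst Bochner_Integration.integral_sum) auto
also have "... = (LI x. (G x *. h) * ps x)"
	by (intro icong refl) (simp add: h[of "G _"] sum_distrib_right mult.assoc)
finally show "(LI x. u x * (D x *. h)) = - (LI x. (G x *. h) * ps x)" .
qed

lemma wgrad_eq_0:
assumes "!!x. x : W ==> u x = 0" "!!x. x : W ==> G x = 0"
shows "wgrad W u G"
unfolding wgrad_def
proof (intro allI impI)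
fix ps D h assume t: "ctest W ps D"
obtain K where K: "K <= W" "!!x. x ~: K ==> ps x = 0" "!!x. x ~: K ==> D x = 0" using ctestE[OF t] by metis
have "u x * (D x *. h) = 0" "(G x *. h) * ps x = 0" for x using K assms by (cases "x : K"; force)+
then have "(%x. u x * (D x *. h)) = (%x. 0)" "(%x. (G x *. h) * ps x) = (%x. 0)" by blast+
then show "(LI x. u x * (D x *. h)) = - (LI x. (G x *. h) * ps x)" by (simp only: integral_zero minus_zero)
qed

lemma wgrad_cong_AE:
assumes "wgrad W u G" "AE x in lborel. x : W --> u' x = u x & G' x = G x"
	and [measurable]: "u : BB" "G : BB" "u' : BB" "G' : BB"
shows "wgrad W u' G'"
unfolding wgrad_def
proof (intro allI impI)
fix ps D h assume t: "ctest W ps D"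
obtain K where K: "K <= W" "!!x. x ~: K ==> ps x = 0" "!!x. x ~: K ==> D x = 0" using ctestE[OF t] by metis
have [measurable]: "ps : BB" "D : BB" using ctest_sqi[OF t] by (auto intro: sqi_m)
have "(LI x. u' x * (D x *. h)) = (LI x. u x * (D x *. h))"
proof (rule integral_cong_AE)
	show "AE x in lborel. u' x * (D x *. h) = u x * (D x *. h)"
		using assms(2) by eventually_elim (metis K(1,3) inner_zero_left mult_zero_right subsetD)
qed measurable
moreover have "(LI x. (G' x *. h) * ps x) = (LI x. (G x *. h) * ps x)"
proof (rule integral_cong_AE)
	show "AE x in lborel. (G' x *. h) * ps x = (G x *. h) * ps x"
		using assms(2) by eventually_elim (metis K(1,2) mult_zero_right subsetD)
qed measurable
ultimately show "(LI x. u' x * (D x *. h)) = - (LI x. (G' x *. h) * ps x)"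
	using wgradD[OF assms(1) t] by simp
qed

section \<open>Cutoff functions\<close>

text \<open>A step from 1 at 0 down to 0 at 1, of class C1 with slope at least \<open>-2\<close>,
  made of two parabolic arcs that meet at \<open>1/2\<close>. Squares of positive parts avoid a case
  distinction in the derivative.\<close>

definition stp :: "real => real" where
"stp t = 1 - 2 * (max 0 t)^2 + 4 * (max 0 (t - 1/2))^2 - 2 * (max 0 (t - 1))^2"

definition stp' :: "real => real" where
"stp' t = - 4 * max 0 t + 8 * max 0 (t - 1/2) - 4 * max 0 (t - 1)"

lemma pos_square_deriv: "((%t::real. (max 0 (t - c))^2) has_real_derivative 2 * max 0 (t - c)) (at t)"
proof -
consider "t < c" | "t > c" | "t = c" by linarith
then show ?thesis
proof cases
	case 1
	have "((%_. 0) has_real_derivative 0) (at t)" by simp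
	then have "((%t::real. (max 0 (t - c))^2) has_real_derivative 0) (at t)"
		by (rule has_field_derivative_transform_within_open[where S="{..<c}"]) (use 1 in auto)
	then show ?thesis using 1 by simp
next
	case 2
	have "((%t. (t - c)^2) has_real_derivative 2 * (t - c)) (at t)" by (auto intro!: derivative_eq_intros)
	then have "((%t::real. (max 0 (t - c))^2) has_real_derivative 2 * (t - c)) (at t)"
		by (rule has_field_derivative_transform_within_open[where S="{c<..}"]) (use 2 in auto)
	then show ?thesis using 2 by simp
next
	case 3
	have "((%h::real. (max 0 h)^2 / h) \<longlongrightarrow> 0) (at 0)"
	proof (rule Lim_null_comparison)
		show "\<forall>\<^sub>F h in at 0. norm ((max 0 h)^2 / h) <= abs (h)" for h :: real
			by (rule always_eventually) (auto simp: max_def p2eq)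
		show "((%h::real. abs (h)) \<longlongrightarrow> 0) (at 0)" by (intro tendsto_eq_intros) auto
	qed
	then show ?thesis using 3 by (simp add: DERIV_def)
qed
qed

lemma stp_deriv: "(stp has_real_derivative stp' t) (at t)"
proof -
have "((%t. 1 - 2 * (max 0 (t - 0))^2 + 4 * (max 0 (t - 1/2))^2 - 2 * (max 0 (t - 1))^2) has_real_derivative
	0 - 2 * (2 * max 0 (t - 0)) + 4 * (2 * max 0 (t - 1/2)) - 2 * (2 * max 0 (t - 1))) (at t)"
	by (intro DERIV_diff DERIV_add DERIV_cmult pos_square_deriv DERIV_const)
then show ?thesis by (simp add: stp_def[abs_def] stp'_def)
qed

lemma stp'_continuous: "continuous_on UNIV stp'"
unfolding stp'_def[abs_def] by (intro continuous_intros)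

lemma stp_eq_1: "t <= 0 ==> stp t = 1" by (simp add: stp_def)

lemma stp_eq_0: "t >= 1 ==> stp t = 0" by (simp add: stp_def max_def p2eq algebra_simps)

lemma stp'_eq_0: "t <= 0 \<or> t >= 1 ==> stp' t = 0" by (auto simp: stp'_def max_def)

lemma stp_mid: "0 <= t ==> t <= 1/2 ==> stp t = 1 - 2 * t^2" "1/2 <= t ==> t <= 1 ==> stp t = 2 * (1 - t)^2"
by (simp_all add: stp_def max_def p2eq algebra_simps)

lemma stp_bounds: "0 <= stp t" "stp t <= 1"
proof -
consider "t <= 0" | "t >= 1" | "0 <= t" "t <= 1/2" | "1/2 <= t" "t <= 1" by linarith
then have "0 <= stp t & stp t <= 1"
proof cases
	case 3
	then have "t^2 <= (1/2)^2" by (intro power_mono) auto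
	then show ?thesis using stp_mid(1)[OF 3] by (simp add: p2eq)
next
	case 4
	then have "(1 - t)^2 <= (1/2)^2" by (intro power_mono) auto
	then show ?thesis using stp_mid(2)[OF 4] by (simp add: p2eq)
qed (simp_all add: stp_eq_1 stp_eq_0)
then show "0 <= stp t" "stp t <= 1" by auto
qed

lemma stp'_bounds: "stp' t <= 0" "-2 <= stp' t" by (auto simp: stp'_def max_def)

lemma c1_norm2: "c1 (%y. (y - x) *. (y - x)) (%y. 2 *R (y - x))"
unfolding c1_def by (auto intro!: derivative_eq_intros continuous_intros simp: inner_commute)

lemma c1_stp: "c1 f F ==> c1 (%x. stp (f x)) (%x. stp' (f x) *R F x)"
by (rule c1_compose[OF _ stp_deriv stp'_continuous])

lemma c1_scale: "c1 f F ==> c1 (%x. c * f x) (%x. c *R F x)"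
using c1_mult[OF c1_const[of c]] by force

lemma ball_cutoff:
fixes x :: "'a::euclidean_space"
assumes r: "r > 0"
obtains c C where "c1 c C" "!!y. y : ball x (r/2) ==> c y = 1" "!!y. y ~: cball x (3*r/4) ==> c y = 0"
	"!!y. 0 <= c y" "!!y. c y <= 1" "!!y. norm (C y) <= 12 / r"
	"!!y. y : ball x (r/2) ==> C y = 0" "!!y. y ~: cball x (3*r/4) ==> C y = 0"
proof -
\<comment> \<open>The argument of the step is at most 0 for \<open>|y - x| <= r/2\<close> and at
  least 1 beyond \<open>3r/4\<close>, because \<open>4 * 9/16 - 1 > 1\<close>. The slope 2 times
  \<open>8/r^2 * 3r/4\<close> gives the bound \<open>12/r\<close>.\<close>
let ?f = "%y::'a. 4 / r^2 * ((y - x) *. (y - x)) - 1"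
have f: "c1 ?f (%y. (4 / r^2) *R (2 *R (y - x)) - 0)" by (intro c1_diff c1_scale c1_norm2 c1_const)
have c: "c1 (%y. stp (?f y)) (%y. stp' (?f y) *R ((4 / r^2) *R (2 *R (y - x)) - 0))" by (rule c1_stp[OF f])
have nf: "?f y = 4 * (dist x y)^2 / r^2 - 1" for y 
proof -
	have "(dist x y)^2 = (y - x) *. (y - x)" unfolding dist_norm nmc[of x y] power2_norm_eq_inner ..
	then show ?thesis by simp
qed
have small: "?f y <= 0" if "y : ball x (r/2)" for y
proof -
	have "(dist x y)^2 <= (r/2)^2" using that by (intro power_mono) auto
	then show ?thesis unfolding nf using r by (simp add: field_simps p2eq)
qed
have large: "?f y >= 1" if "y ~: cball x (3*r/4)" for y
proof -
	have "(3*r/4)^2 <= (dist x y)^2" using that r by (intro power_mono) auto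
	then have "9 / 16 * r^2 <= (dist x y)^2" by (simp add: pmd power_divide)
	moreover have r2: "r^2 > 0" using r by simp
	ultimately have "2 * r^2 <= 4 * (dist x y)^2" by linarith
	then have "2 <= 4 * (dist x y)^2 / r^2" using r2 by (simp add: le_divide_eq)
	then show ?thesis unfolding nf by simp
qed
have bd: "norm (stp' (?f y) *R ((4 / r^2) *R (2 *R (y - x)) - 0)) <= 12 / r" for y
proof (cases "y : cball x (3*r/4)")
	case True
	then have n: "norm (y - x) <= 3 * r / 4" by (simp add: dist_norm nmc)
	have "norm (stp' (?f y) *R ((4 / r^2) *R (2 *R (y - x)) - 0)) = abs (stp' (?f y)) * (8 / r^2 * norm (y - x))" by (simp add: abs_mult)
	also have "... <= 2 * (8 / r^2 * (3 * r / 4))"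
		using stp'_bounds[of "?f y"] n by (intro mult_mono) auto
	also have "... = 12 / r" using r by (simp add: field_simps p2eq)
	finally show ?thesis .
next
	case False
	then show ?thesis using stp'_eq_0[of "?f y"] large[of y] r by simp
qed
show ?thesis
	by (rule that[OF c]) (use small large stp_eq_1 stp_eq_0 stp_bounds stp'_eq_0 bd in \<open>simp_all only: scaleR_zero_left simp_thms\<close>)
qed

text \<open>A partition of unity built by peeling off one ball at a time: a test function splits as
  \<open>ps * c + ps * (1 - c)\<close>, where the first part lives in one ball and the second is
  covered by the remaining ones.\<close>

lemma wgrad_local:
assumes u: "sqi u" "sqi G" and loc: "!!x. x : W ==> EX r>0. wgrad (ball x r) u G"
shows "wgrad W u G"
proof -
obtain r where r: "!!x. x : W ==> r x > 0" "!!x. x : W ==> wgrad (ball x (r x)) u G" using loc by metis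
have claim: "(LI x. u x * (D x *. h)) = - (LI x. (G x *. h) * ps x)"
	if "finite F" "F <= W" "ctest W ps D" "!!y. ps y ~= 0 ==> y : (\<Union>x\<in>F. ball x (r x / 2))" for F ps D h
	using that
proof (induction F arbitrary: ps D rule: finite_induct)
	case empty
	then have 0: "ps y = 0" for y by auto
	have "ctest {} ps D" using empty 0 unfolding ctest_def by auto
	then have "D y = 0" for y by (metis ctestE subset_empty empty_iff)
	then show ?case using 0 by simp
next
	case (insert x F)
	have x: "x : W" using insert by auto
	obtain c C where c: "c1 c C" "!!y. y : ball x (r x/2) ==> c y = 1" "!!y. y ~: cball x (3*r x/4) ==> c y = 0"
		using ball_cutoff[OF r(1)[OF x]] by metis
	note t = insert.prems(2)
	obtain K where K: "compact K" "K <= W" "!!x. x ~: K ==> ps x = 0" using ctestE[OF t] by metis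
	have t1: "ctest (ball x (r x)) (%y. ps y * c y) (%y. ps y *R C y + c y *R D y)"
		unfolding ctest_def
	proof (intro conjI exI[of _ "K Int cball x (3*r x/4)"] allI impI)
		show "c1 (%y. ps y * c y) (%y. ps y *R C y + c y *R D y)" by (rule c1_mult[OF ctest_c1[OF t] c(1)])
		show "compact (K Int cball x (3*r x/4))" by (intro compact_Int_closed K) auto
		show "K Int cball x (3*r x/4) <= ball x (r x)" using r(1)[OF x] by auto
	qed (use K c(3) in auto)
	have c': "c1 (%y. 1 - c y) (%y. 0 - C y)" by (rule c1_diff[OF c1_const c(1)])
	have t2: "ctest W (%y. ps y * (1 - c y)) (%y. ps y *R (0 - C y) + (1 - c y) *R D y)"
		by (rule ctest_mult_left[OF t c'])
	have e1: "(LI y. u y * ((ps y *R C y + c y *R D y) *. h)) = - (LI y. (G y *. h) * (ps y * c y))"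
		by (rule wgradD[OF r(2)[OF x] t1])
	have e2: "(LI y. u y * ((ps y *R (0 - C y) + (1 - c y) *R D y) *. h)) = - (LI y. (G y *. h) * (ps y * (1 - c y)))"
	proof (rule insert.IH[OF _ t2])
		show "F <= W" using insert.prems by auto
		fix y assume y: "ps y * (1 - c y) ~= 0"
		then have "y ~: ball x (r x / 2)" "ps y ~= 0" using c(2)[of y] by auto
		then show "y : (\<Union>x\<in>F. ball x (r x / 2))" using insert.prems(3)[of y] by auto
	qed
	have i: "Li (%y. u y * ((ps y *R C y + c y *R D y) *. h))"
		"Li (%y. u y * ((ps y *R (0 - C y) + (1 - c y) *R D y) *. h))"
		"Li (%y. (G y *. h) * (ps y * c y))" "Li (%y. (G y *. h) * (ps y * (1 - c y)))"
		by (intro i_mult u sqi_ic ctest_sqi[OF t1] ctest_sqi[OF t2])+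
	have "(LI y. u y * (D y *. h)) = (LI y. u y * ((ps y *R C y + c y *R D y) *. h) + u y * ((ps y *R (0 - C y) + (1 - c y) *R D y) *. h))"
		by (intro icong) (auto simp: ial idl algebra_simps)
	also have "... = - (LI y. (G y *. h) * (ps y * c y) + (G y *. h) * (ps y * (1 - c y)))"
		using iadd[OF i(1,2)] iadd[OF i(3,4)] e1 e2 by linarith
	also have "(LI y. (G y *. h) * (ps y * c y) + (G y *. h) * (ps y * (1 - c y))) = (LI y. (G y *. h) * ps y)"
		by (intro icong) (auto simp: algebra_simps)
	finally show ?case .
qed
show ?thesis
	unfolding wgrad_def
proof (intro allI impI)
	fix ps D h assume t: "ctest W ps D"
	obtain K where K: "compact K" "K <= W" "!!x. x ~: K ==> ps x = 0" using ctestE[OF t] by metis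
	have "K <= (\<Union>x\<in>K. ball x (r x / 2))" using r(1) K(2) by force
	then obtain F where F: "F <= K" "finite F" "K <= (\<Union>x\<in>F. ball x (r x / 2))"
		using compactE_image[OF K(1), of K "%x. ball x (r x / 2)"] by auto
	show "(LI x. u x * (D x *. h)) = - (LI x. (G x *. h) * ps x)"
	proof (rule claim[OF F(2) _ t])
		show "F <= W" using F K by auto
		show "y : (\<Union>x\<in>F. ball x (r x / 2))" if "ps y ~= 0" for y using that K(3)[of y] F(3) by blast
	qed
qed
qed

section \<open>A weighted Poincare inequality\<close>

text \<open>\<open>wgrad_square\<close> is applied with a test function whose derivative along
  \<open>n\<close> dominates the weight \<open>pos\<close> up to the source term \<open>z\<close>.
  Since \<open>ps^2 <= B * pos\<close>, half of the weighted integral absorbs the mixed term. The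
  two transport estimates are instances of this scheme.\<close>

lemma weighted_poincare:
fixes u :: "'a::euclidean_space => real"
assumes w: "wgrad W u G" and W: "open W" and u: "sqi u" "sqi G" and t: "ctest W ps D"
	and m[measurable]: "pos : BB" "z : BB" "A : sets borel"
	and bd: "!!x. 0 <= pos x" "!!x. pos x <= M" "!!x. 0 <= z x" "!!x. z x <= M"
	and pz: "!!x. u x ~= 0 ==> pos x <= D x *. n + z x"
	and q: "!!x. u x ~= 0 ==> (ps x)^2 <= B * pos x" and B: "B >= 0"
	and A: "!!x. x ~: A ==> ps x = 0"
shows "(LI x. (u x)^2 * pos x) <= 4 * B * (LI x. ind A x * (G x *. n)^2) + 2 * (LI x. (u x)^2 * z x)"
proof -
have [measurable]: "u : BB" "G : BB" using u by (auto intro: sqi_m)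
have [measurable]: "ps : BB" "D : BB" using ctest_sqi[OF t] by (auto intro: sqi_m)
obtain B' where B': "!!x. abs (ps x) <= B'" "!!x. norm (D x) <= B'" using ctest_bounded[OF t] by metis
have iu: "Li (%x. C * (u x)^2)" for C using sqi_i[OF u(1)] by simp
have ipos: "Li (%x. (u x)^2 * pos x)"
	by (rule ibound[OF iu[of M]])
		(use bd(1,2) in \<open>auto simp: abs_mult mult.commute[of M] intro!: mlm AE_I2 order_trans[OF _ abs_ge_self]\<close>)
have iz: "Li (%x. (u x)^2 * z x)"
	by (rule ibound[OF iu[of M]])
		(use bd(3,4) in \<open>auto simp: abs_mult mult.commute[of M] intro!: mlm AE_I2 order_trans[OF _ abs_ge_self]\<close>)
have iD: "Li (%x. (u x)^2 * (D x *. n))"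
proof (rule ibound[OF iu[of "B' * norm n"]])
	have "abs (D x *. n) <= B' * norm n" for x
		using CS2[of "D x" n] mrm[OF B'(2)[of x], of "norm n"] by simp
	then have "abs ((u x)^2 * (D x *. n)) <= B' * norm n * (u x)^2" for x
		using mlm[of "abs (D x *. n)" "B' * norm n" "(u x)^2"] by (simp add: abs_mult mult.commute)
	then show "AE x in lborel. norm ((u x)^2 * (D x *. n)) <= norm (B' * norm n * (u x)^2)"
		by (intro AE_I2) (auto intro: order_trans[OF _ abs_ge_self])
qed measurable
have sG: "sqi (%x. ind A x *R (G x *. n))" by (intro sqi_ind sqi_ic u) measurable
have iG: "Li (%x. ind A x * (G x *. n)^2)"
proof -
	have "(norm (ind A x *R (G x *. n)))^2 = ind A x * (G x *. n)^2" for x by (simp add: ind_def)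
	then show ?thesis using sqi_i[OF sG] by (simp only: )
qed
have iug: "Li (%x. u x * (G x *. n) * ps x)"
proof -
	have "sqi (%x. ps x *R (G x *. n))" by (rule sqi_bm[OF sqi_ic[OF u(2)] _ B'(1)]) measurable
	from i_mult[OF u(1) this] show ?thesis by (simp add: mult_ac)
qed
have pt: "- 2 * (u x * (G x *. n) * ps x) <= (1/2) * ((u x)^2 * pos x) + 2 * B * (ind A x * (G x *. n)^2)" for x
proof (cases "u x = 0 \<or> x ~: A")
	case True
	then show ?thesis using A[of x] B bd(1)[of x] by (auto simp: ind_def)
next
	case False
	define g where "g = G x *. n"
	define a b where "a = abs (u x) * sqrt (pos x)" and "b = abs (g) * sqrt B"
	have "abs (ps x) <= sqrt B * sqrt (pos x)"
		using real_sqrt_le_mono[OF q[of x]] False by (simp add: real_sqrt_mult)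
	then have "abs (u x) * abs (g) * abs (ps x) <= abs (u x) * abs (g) * (sqrt B * sqrt (pos x))" by (intro mlm) auto
	then have "abs (u x * g * ps x) <= a * b" by (simp add: abs_mult a_def b_def mult_ac)
	then have "- 2 * (u x * g * ps x) <= 2 * (a * b)" by linarith
	also have "... <= (1/2) * a^2 + 2 * b^2" using sum_squares_bound[of "a/2" b] by (simp add: p2eq field_simps)
	also have "a^2 = (u x)^2 * pos x" using bd(1)[of x] by (simp add: a_def pmd)
	also have "b^2 = B * g^2" using B by (simp add: b_def pmd)
	finally show ?thesis using False by (simp add: g_def)
qed
have "(LI x. (u x)^2 * pos x) <= (LI x. (u x)^2 * (D x *. n) + (u x)^2 * z x)"
proof (rule integral_mono[OF ipos])
	show "Li (%x. (u x)^2 * (D x *. n) + (u x)^2 * z x)" using iD iz by simp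
	show "(u x)^2 * pos x <= (u x)^2 * (D x *. n) + (u x)^2 * z x" for x
		using mlm[OF pz[of x], of "(u x)^2"] by (cases "u x = 0") (auto simp: algebra_simps)
qed
also have "... = - 2 * (LI x. u x * (G x *. n) * ps x) + (LI x. (u x)^2 * z x)"
	using iD iz wgrad_square[OF w W u t, of n] by simp
also have "- 2 * (LI x. u x * (G x *. n) * ps x) = (LI x. - 2 * (u x * (G x *. n) * ps x))" by simp
also have "... <= (LI x. (1/2) * ((u x)^2 * pos x) + 2 * B * (ind A x * (G x *. n)^2))"
	using pt iug ipos iG by (intro integral_mono) auto
also have "... = (1/2) * (LI x. (u x)^2 * pos x) + 2 * B * (LI x. ind A x * (G x *. n)^2)"
	using ipos iG by simp
finally show ?thesis by (simp add: algebra_simps)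
qed

lemma norm_le_norm_nonneg: "0 <= a ==> a <= b ==> norm a <= norm (b :: real)"
by simp

lemma LINT_eq_0: "(!!x. f x = 0) ==> (LINT x|M. f x) = (0::'b::{banach,second_countable_topology})"
by simp

text \<open>Control of \<open>u^2\<close> is carried along the direction \<open>n\<close>: the mass
  in the layer \<open>- l <= y <= rh\<close> is bounded by the gradient and the mass in the initial
  layer \<open>- 2 * l <= y <= - l\<close>. The profile \<open>a\<close> is constant along
  \<open>n\<close> and confines the motion to the set \<open>K\<close>, where \<open>u\<close> is
  weakly differentiable.\<close>

lemma transport:
fixes u :: "'a::euclidean_space => real" and n p :: 'a
defines "y \<equiv> %x. (x - p) *. n"
assumes w: "wgrad W u G" and W: "open W" and u: "sqi u" "sqi G" and n: "norm n = 1"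
	and a: "c1 a Da" "!!x. Da x *. n = 0" "!!x. 0 <= a x" "!!x. a x <= 1"
	and pos: "rh > 0" "l > 0" and K: "compact K" "K <= W"
	and supp: "!!x. a x ~= 0 ==> - 2 * l <= y x ==> y x <= 2 * rh ==> x : K"
shows "(LI x. (u x)^2 * (a x * ind {x. - l <= y x & y x <= rh} x)) <=
		(2 * rh + 2 * l) ^ 3 / rh * (LI x. ind K x * (norm (G x))^2) +
		2 * (2 * rh + 2 * l)^2 / (rh * l) * (LI x. (u x)^2 * (a x * ind {x. - 2 * l <= y x & y x <= - l} x))"
proof -
have [measurable]: "u : BB" "G : BB" using u by (auto intro: sqi_m)
have [measurable]: "a : BB" by (rule bmc[OF c1_cont[OF a(1)]])
have ycont: "continuous_on UNIV y" unfolding y_def by (intro continuous_intros)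
then have [measurable]: "y : BB" by (rule bmc)
have [measurable]: "K : sets borel" using K(1) by (rule borel_compact)
define m where "m = (%x. max 0 (2 * rh - y x))"
define S where "S = (%x. stp ((- l - y x) / l))"
define S' where "S' = (%x. stp' ((- l - y x) / l))"
have [measurable]: "m : BB" unfolding m_def by measurable
have stp_cont: "continuous_on UNIV stp"
	by (meson DERIV_isCont continuous_at_imp_continuous_on stp_deriv)
have [measurable]: "S : BB" unfolding S_def
	using pos by (intro bmc continuous_on_compose2[OF stp_cont] continuous_intros ycont) auto
have S01: "0 <= S x" "S x <= 1" for x unfolding S_def by (rule stp_bounds)+
have Sz: "S x = 0" if "y x <= - 2 * l" for x unfolding S_def using that pos by (intro stp_eq_0) (simp add: field_simps)
have S1: "S x = 1" if "- l <= y x" for x unfolding S_def using that pos by (intro stp_eq_1) (simp add: field_simps)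
have S'z: "S' x = 0" if "\<not> (- 2 * l <= y x & y x <= - l)" for x
	unfolding S'_def using that pos by (intro stp'_eq_0) (auto simp: field_simps)
have S'b: "S' x <= 0" "- 2 <= S' x" for x unfolding S'_def by (rule stp'_bounds)+
have m0: "m x >= 0" for x by (simp add: m_def)
have mb: "m x <= 2 * rh + 2 * l" if "- 2 * l <= y x" for x using that pos by (simp add: m_def)
let ?B = "(2 * rh + 2 * l) ^ 3 / (8 * rh)"
let ?c = "(2 * rh + 2 * l)^2 / (2 * rh * l)"
\<comment> \<open>Along \<open>n\<close> the factor \<open>- m^2 / (4 rh)\<close> has the derivative
  \<open>m / (2 rh)\<close>, at least \<open>1/2\<close> for \<open>y <= rh\<close>. The factor
  \<open>S\<close> switches the field on inside the initial layer, and its derivative is the source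
  term with constant \<open>?c\<close>. The constant \<open>?B\<close> comes from
  \<open>ps^2 = P * (a * S) * m^3 / (8 rh)\<close>.\<close>
define ps where "ps = (%x. a x * ((- 1 / (4 * rh)) * (m x)^2 * S x))"
have cy: "c1 y (%x. n)" unfolding y_def by (rule c1_inner)
have cm: "c1 (%x. (m x)^2) (%x. (- (2 * m x)) *R n)"
proof -
	have "((%t. (max 0 (2 * rh - t))^2) has_real_derivative - (2 * max 0 (2 * rh - t))) (at t)" for t
	proof -
		have "((%t. 2 * rh - t) has_real_derivative - 1) (at t)" by (auto intro!: derivative_eq_intros)
		from DERIV_chain2[where f="%t. (max 0 (t - 0))^2", OF pos_square_deriv this] show ?thesis by simp
	qed
	moreover have "continuous_on UNIV (%t. - (2 * max 0 (2 * rh - t)))" by (intro continuous_intros)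
	ultimately show ?thesis unfolding m_def by (rule c1_compose[OF cy])
qed
have cS: "c1 S (%x. S' x *R ((- 1 / l) *R n))"
proof -
	have "c1 (%x. - 1 + (- 1 / l) * y x) (%x. 0 + (- 1 / l) *R n)" by (intro c1_add c1_const c1_scale cy)
	moreover have "- 1 + (- 1 / l) * y x = (- l - y x) / l" for x using pos by (simp add: field_simps)
	ultimately have "c1 (%x. (- l - y x) / l) (%x. (- 1 / l) *R n)" by simp
	from c1_stp[OF this] show ?thesis unfolding S_def S'_def .
qed
define D where "D = (%x. a x *R (((- 1 / (4 * rh)) * (m x)^2) *R (S' x *R ((- 1 / l) *R n)) +
		S x *R ((- 1 / (4 * rh)) *R ((- (2 * m x)) *R n))) + ((- 1 / (4 * rh)) * (m x)^2 * S x) *R Da x)"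
have cps: "c1 ps D" unfolding ps_def D_def by (intro c1_mult a c1_scale cm cS)
have zero: "ps x = 0" if "x ~: K" for x
proof (rule ccontr)
	assume "ps x ~= 0"
	then have "a x ~= 0" "m x ~= 0" "S x ~= 0" by (auto simp: ps_def)
	moreover from `m x ~= 0` have "y x <= 2 * rh" by (simp add: m_def max_def split: if_splits)
	moreover have "- 2 * l <= y x"
	proof (rule ccontr)
		assume "\<not> - 2 * l <= y x"
		then have "S x = 0" by (intro Sz) linarith
		then show False using `S x ~= 0` by simp
	qed
	ultimately have "x : K" by (intro supp)
	then show False using that by simp
qed
have t: "ctest W ps D" unfolding ctest_def using cps K zero by blast
have nn: "n *. n = 1" using n by (simp add: norm_eq_1)
have Dn: "D x *. n = a x * m x / (2 * rh) * S x + a x * (m x)^2 / (4 * rh * l) * S' x" for x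
	using pos unfolding D_def ial inner_scaleR_left nn a(2) by (simp add: field_simps)
define P where "P = (%x. a x * m x / (2 * rh) * S x)"
define z where "z = (%x. ?c * (a x * ind {x. - 2 * l <= y x & y x <= - l} x))"
have P0: "0 <= P x" for x unfolding P_def using a(3) m0 S01 pos by simp
have c0: "?c >= 0" using pos by simp
have main: "(LI x. (u x)^2 * P x) <= 4 * ?B * (LI x. ind K x * (G x *. n)^2) + 2 * (LI x. (u x)^2 * z x)"
proof (rule weighted_poincare[OF w W u t, where M="max ((2 * rh + 2 * l) / (2 * rh)) ?c"])
	show "P : BB" unfolding P_def by measurable
	show "z : BB" unfolding z_def by measurable
	show "K : sets borel" by measurable
	show "0 <= P x" for x by (rule P0)
	show "P x <= max ((2 * rh + 2 * l) / (2 * rh)) ?c" for x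
	proof (cases "- 2 * l <= y x")
		case True
		have "P x = (a x * S x) * (m x / (2 * rh))" by (simp add: P_def)
		also have "... <= (1 * 1) * ((2 * rh + 2 * l) / (2 * rh))"
			using a(3,4) S01 mb[OF True] m0 pos by (intro mult_mono divide_right_mono) auto
		finally show ?thesis by simp
	next
		case False
		then have "P x = 0" using Sz[of x] by (simp add: P_def)
		then show ?thesis using pos by (simp add: le_max_iff_disj)
	qed
	show "0 <= z x" for x unfolding z_def using a(3) pos by simp
	show "z x <= max ((2 * rh + 2 * l) / (2 * rh)) ?c" for x
	proof -
		have "z x <= ?c * (1 * 1)" unfolding z_def using a(3,4) c0 by (intro mlm mult_mono) auto
		then show ?thesis by simp
	qed
	show "P x <= D x *. n + z x" for x
	proof (cases "- 2 * l <= y x & y x <= - l")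
		case True
		have "(m x)^2 * (- S' x) <= (2 * rh + 2 * l)^2 * 2"
			using mb[of x] m0[of x] S'b[of x] True by (intro mult_mono power_mono) auto
		then have "a x * ((m x)^2 * (- S' x)) / (4 * rh * l) <= a x * ((2 * rh + 2 * l)^2 * 2) / (4 * rh * l)"
			using a(3) pos by (intro divide_right_mono mlm) auto
		also have "... = z x" using True pos by (simp add: z_def field_simps)
		finally show ?thesis unfolding Dn P_def by simp
	next
		case False
		then show ?thesis unfolding Dn P_def using S'z[OF False] c0 a(3) by (simp add: z_def)
	qed
	show "(ps x)^2 <= ?B * P x" for x
	proof (cases "- 2 * l <= y x")
		case True
		have "(ps x)^2 = P x * ((a x * S x) * ((m x) ^ 3 / (8 * rh)))"
			using pos by (simp add: ps_def P_def field_simps p2eq power3_eq_cube)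
		also have "... <= P x * ((1 * 1) * ?B)"
			using a(3,4) S01 mb[OF True] m0 pos P0 by (intro mult_mono divide_right_mono power_mono) auto
		finally show ?thesis by (simp add: mult.commute)
	next
		case False
		then show ?thesis using Sz[of x] by (simp add: P_def ps_def)
	qed
	show "?B >= 0" using pos by simp
	show "ps x = 0" if "x ~: K" for x by (rule zero[OF that])
qed
have iu: "Li (%x. C * (u x)^2)" for C using sqi_i[OF u(1)] by simp
have iGn: "Li (%x. ind K x * (norm (G x))^2)"
	using imi[OF _ sqi_i[OF u(2)], of K] by simp
have iGi: "Li (%x. ind K x * (G x *. n)^2)"
	using imi[OF _ sqi_i[OF sqi_ic[OF u(2), of n]], of K] by simp
have iP: "Li (%x. (u x)^2 * P x)"
proof (rule ibound[OF iu[of "(2 * rh + 2 * l) / (2 * rh)"]])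
	have "P x <= (2 * rh + 2 * l) / (2 * rh)" for x
	proof (cases "- 2 * l <= y x")
		case True
		have "P x = (a x * S x) * (m x / (2 * rh))" by (simp add: P_def)
		also have "... <= (1 * 1) * ((2 * rh + 2 * l) / (2 * rh))"
			using a(3,4) S01 mb[OF True] m0 pos by (intro mult_mono divide_right_mono) auto
		finally show ?thesis by simp
	next
		case False
		then show ?thesis using Sz[of x] pos by (simp add: P_def)
	qed
	then have "(u x)^2 * P x <= (2 * rh + 2 * l) / (2 * rh) * (u x)^2" for x
		by (subst mult.commute) (rule mrm, auto)
	then show "AE x in lborel. norm ((u x)^2 * P x) <= norm ((2 * rh + 2 * l) / (2 * rh) * (u x)^2)"
		using P0 by (intro AE_I2 norm_le_norm_nonneg mult_nonneg_nonneg zero_le_power2)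
	show "(%x. (u x)^2 * P x) : borel_measurable lborel" unfolding P_def by measurable
qed
have "(LI x. (u x)^2 * (a x * ind {x. - l <= y x & y x <= rh} x)) <= (LI x. 2 * ((u x)^2 * P x))"
proof (rule integral_mono)
	show "Li (%x. (u x)^2 * (a x * ind {x. - l <= y x & y x <= rh} x))"
	proof (rule ibound[OF iu[of 1]])
		show "AE x in lborel. norm ((u x)^2 * (a x * ind {x. - l <= y x & y x <= rh} x)) <= norm (1 * (u x)^2)"
			using a(3,4) by (intro AE_I2) (auto simp: ind_def abs_mult intro!: mult_left_le)
	qed measurable
	show "Li (%x. 2 * ((u x)^2 * P x))" using iP by simp
	show "(u x)^2 * (a x * ind {x. - l <= y x & y x <= rh} x) <= 2 * ((u x)^2 * P x)" for x
	proof (cases "- l <= y x & y x <= rh")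
		case True
		have "m x / (2 * rh) >= 1 / 2" using True pos by (simp add: m_def field_simps)
		then have "a x * 1 <= a x * (2 * (m x / (2 * rh)))" using a(3) by (intro mlm) auto
		then have "a x <= 2 * P x" using S1[of x] True by (simp add: P_def)
		then have "(u x)^2 * a x <= (u x)^2 * (2 * P x)" by (intro mlm) auto
		then show ?thesis using True by (simp add: mult_ac)
	next
		case False
		then have "ind {x. - l <= y x & y x <= rh} x = (0::real)" by simp
		then show ?thesis using P0[of x] by simp
	qed
qed
also have "... = 2 * (LI x. (u x)^2 * P x)" by simp
also have "... <= 2 * (4 * ?B * (LI x. ind K x * (norm (G x))^2) + 2 * (LI x. (u x)^2 * z x))"
proof -
	have "(LI x. ind K x * (G x *. n)^2) <= (LI x. ind K x * (norm (G x))^2)"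
	proof (rule integral_mono[OF iGi iGn])
		fix x
		have "abs (G x *. n) <= norm (G x)" using CS2[of "G x" n] n by simp
		then have "(G x *. n)^2 <= (norm (G x))^2" by (simp add: abs_le_square_iff[symmetric])
		then show "ind K x * (G x *. n)^2 <= ind K x * (norm (G x))^2" by (simp add: mlm)
	qed
	then have "4 * ?B * (LI x. ind K x * (G x *. n)^2) <= 4 * ?B * (LI x. ind K x * (norm (G x))^2)"
		using pos by (intro mlm) auto
	then show ?thesis using main by simp
qed
also have "(LI x. (u x)^2 * z x) = ?c * (LI x. (u x)^2 * (a x * ind {x. - 2 * l <= y x & y x <= - l} x))"
	unfolding z_def by (subst integral_mult_right_zero[symmetric]) (simp add: mult_ac)
finally show ?thesis by (simp add: algebra_simps)
qed

section \<open>Traces on a graph\<close>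

lemma integral_indicator_ball_le:
fixes p :: "R2" assumes "rh >= 0"
shows "(LI x. ind (ball p rh) x :: real) <= 4 * rh^2"
proof -
have sub: "ball p rh <= cbox (p - (rh, rh)) (p + (rh, rh))"
proof
	fix x assume x: "x : ball p rh"
	have "abs (fst (x - p)) <= norm (x - p)" "abs (snd (x - p)) <= norm (x - p)"
		using norm_fst_le[of "fst (x - p)" "snd (x - p)"] norm_snd_le[of "snd (x - p)" "fst (x - p)"]
		by (simp_all only: prod.collapse real_norm_def)
	moreover have "norm (x - p) < rh" using x by (simp add: dist_norm nmc)
	ultimately show "x : cbox (p - (rh, rh)) (p + (rh, rh))"
		by (cases x; cases p) (auto simp: cbox_def Basis_prod_def)
qed
have "(LI x. ind (ball p rh) x :: real) = measure lborel (ball p rh)" by simp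
also have "... <= measure lborel (cbox (p - (rh, rh)) (p + (rh, rh)))"
	using sub by (intro measure_mono_fmeasurable) (auto simp: fmeasurable_def emeasure_lborel_cbox_eq)
also have "... = 4 * rh^2"
	using assms by (cases p) (simp add: measure_lborel_cbox_eq Basis_prod_def p2eq prod.union_disjoint inner_prod_def)
finally show ?thesis .
qed

lemma small_ball_integral:
fixes f :: "'a::euclidean_space => real"
assumes f: "Li f" "!!x. 0 <= f x" and e: "e > 0"
obtains d where "d > 0" "(LI x. ind (cball p d) x * f x) < e"
proof -
have [measurable]: "f : BB" using f(1) by simp
have "(%i. LI x. ind (cball p (inverse (real (Suc i)))) x * f x) ----> integral\<^sup>L (lborel :: 'a measure) (%_. 0 :: real)"
proof (rule integral_dominated_convergence[OF _ _ f(1)])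
	have "AE x in lborel. x ~= p" by (rule AE_lborel_singleton)
	then show "AE x in lborel. (%i. ind (cball p (inverse (real (Suc i)))) x * f x) ----> 0"
	proof eventually_elim
		case (elim x)
		then have "dist p x > 0" by simp
		then obtain N where N: "inverse (real (Suc N)) < dist p x" using reals_Archimedean by blast
		have "ind (cball p (inverse (real (Suc i)))) x * f x = 0" if "i >= N" for i
		proof -
			have "inverse (real (Suc i)) <= inverse (real (Suc N))" using that by (intro le_imp_inverse_le) auto
			then have "x ~: cball p (inverse (real (Suc i)))" using N unfolding mem_cball by linarith
			then show ?thesis by simp
		qed
		then show ?case by (intro tendsto_eventually) (auto simp: eventually_sequentially)
	qed
	show "AE x in lborel. norm (ind (cball p (inverse (real (Suc i)))) x * f x) <= f x" for i
		using f(2) by (intro AE_I2) (auto simp: ind_def)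
	show "(%x. ind (cball p (inverse (real (Suc i)))) x * f x) : borel_measurable lborel" for i
		using f(1) by (intro borel_measurable_times borel_measurable_indicator) auto
qed simp
then have "\<forall>\<^sub>F i in sequentially. (LI x. ind (cball p (inverse (real (Suc i)))) x * f x) < e"
	using e by (intro order_tendstoD(2)) auto
then obtain i where "(LI x. ind (cball p (inverse (real (Suc i)))) x * f x) < e"
	using eventually_happens'[OF sequentially_bot] by blast
then show ?thesis by (intro that[of "inverse (real (Suc i))"]) auto
qed

lemma integral_abs_ball_le:
fixes u :: "R2 => real"
assumes u: "sqi u" and "rh >= 0"
shows "(LI x. ind (ball p rh) x * abs (u x)) <= 2 * rh * sqrt (LI x. ind (ball p rh) x * (u x)^2)"
proof -
have s1: "sqi (%x. ind (ball p rh) x *R (1::real))"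
	by (rule sqi_bounded_compact[OF _ compact_cball[of p rh], of _ 1]) (auto simp: ind_def)
have s2: "sqi (%x. ind (ball p rh) x *R (abs (u x)))"
	by (rule sqi_bound[OF _ u, of _ 1]) (use u in \<open>auto simp: ind_def dest: sqi_m\<close>)
have "(LI x. (ind (ball p rh) x *R (1::real)) *. (ind (ball p rh) x *R (abs (u x)))) <=
	sqrt (N2 (%x. ind (ball p rh) x *R (1::real))) * sqrt (N2 (%x. ind (ball p rh) x *R (abs (u x))))"
	using abs_int_le[OF s1 s2] by linarith
also have "(%x. (ind (ball p rh) x *R (1::real)) *. (ind (ball p rh) x *R (abs (u x)))) = (%x. ind (ball p rh) x * abs (u x))"
	by (auto simp: ind_def)
also have "N2 (%x. ind (ball p rh) x *R (abs (u x))) = (LI x. ind (ball p rh) x * (u x)^2)"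
	unfolding N2_def by (intro icong) (auto simp: ind_def)
also have "N2 (%x. ind (ball p rh) x *R (1::real)) = (LI x. ind (ball p rh) x :: real)"
	unfolding N2_def by (intro icong) (auto simp: ind_def)
also have "sqrt (LI x. ind (ball p rh) x :: real) * sqrt (LI x. ind (ball p rh) x * (u x)^2)
	<= sqrt (4 * rh^2) * sqrt (LI x. ind (ball p rh) x * (u x)^2)"
proof (rule mrm)
	show "sqrt (LI x. ind (ball p rh) x :: real) <= sqrt (4 * rh^2)"
		by (rule real_sqrt_le_mono[OF integral_indicator_ball_le[OF assms(2)]])
qed (auto intro!: i_nn)
finally show ?thesis using assms(2) by (simp add: real_sqrt_mult)
qed

locale graph_nbhd =
fixes P :: "(R2) set" and p :: "R2" and r n1 n2 :: real and ga ga' :: "real => real"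
assumes r: "r > 0" and unit: "n1^2 + n2^2 = 1"
	and der: "!!s. (ga has_real_derivative ga' s) (at s)" and cont: "continuous_on UNIV ga'"
	and graph: "P Int ball p r = {x : ball p r. (x - p) *. (n1, n2) > ga ((x - p) *. (n2, - n1))}"
	and frontier: "p : frontier P"
begin

text \<open>\<open>sc\<close> and \<open>yc\<close> are the tangential and normal coordinates about
  \<open>p\<close>, \<open>ht\<close> is the height over the graph measured along the normal of the
  coordinate frame, and \<open>X\<close> parametrises the graph by its tangential
  coordinate.\<close>

definition sc :: "R2 => real" where "sc x = (x - p) *. (n2, - n1)"
definition yc :: "R2 => real" where "yc x = (x - p) *. (n1, n2)"
definition ht :: "R2 => real" where "ht x = yc x - ga (sc x)"
definition ht' :: "R2 => R2" where "ht' x = (n1, n2) - ga' (sc x) *R (n2, - n1)"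
definition X :: "real => R2" where "X s = p + s *R (n2, - n1) + ga s *R (n1, n2)"

lemma inner_units: "(n1, n2) *. (n1, n2) = 1" "(n2, - n1) *. (n2, - n1) = 1" "(n2, - n1) *. (n1, n2) = 0" "(n1, n2) *. (n2, - n1) = 0"
using unit by (simp_all add: p2eq algebra_simps)

lemma norm_units: "norm (n1, n2) = 1" "norm (n2, - n1) = 1"
using inner_units(1,2) by (simp_all only: norm_eq_1)

lemma norm_coords: "(norm (x - p))^2 = (sc x)^2 + (yc x)^2"
proof -
obtain a b where ab: "x - p = (a, b)" by (cases "x - p")
have "(sc x)^2 + (yc x)^2 = (a^2 + b^2) * (n1^2 + n2^2)"
	unfolding sc_def yc_def ab by (simp add: p2eq algebra_simps)
also have "... = (norm (x - p))^2" unfolding ab by (simp add: unit norm_Pair)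
finally show ?thesis by simp
qed

lemma abs_coords_le: "abs (sc x) <= norm (x - p)" "abs (yc x) <= norm (x - p)"
proof -
have "abs (sc x)^2 <= (norm (x - p))^2" "abs (yc x)^2 <= (norm (x - p))^2" unfolding norm_coords by simp_all
from power2_le_imp_le[OF this(1) norm_ge_zero] power2_le_imp_le[OF this(2) norm_ge_zero]
show "abs (sc x) <= norm (x - p)" "abs (yc x) <= norm (x - p)" .
qed

lemma norm_le_coords: "norm (x - p) <= abs (sc x) + abs (yc x)"
proof (rule power2_le_imp_le)
show "(norm (x - p))^2 <= (abs (sc x) + abs (yc x))^2" unfolding norm_coords by (simp add: power2_sum)
qed simp

lemma mem_P_iff:
assumes "x : ball p r" shows "x : P \<longleftrightarrow> ht x > 0"
proof -
have "x : P \<longleftrightarrow> x : P Int ball p r" using assms by simp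
also have "... \<longleftrightarrow> ht x > 0" unfolding graph ht_def sc_def yc_def using assms by simp
finally show ?thesis .
qed

lemma c1_ht: "c1 ht ht'"
unfolding ht_def[abs_def] ht'_def[abs_def] sc_def[abs_def] yc_def[abs_def]
using c1_diff[OF c1_inner[of p "(n1, n2)"] c1_compose[OF c1_inner[of p "(n2, - n1)"] der cont]] .

lemma ht_continuous: "continuous_on UNIV ht" by (rule c1_cont[OF c1_ht])

lemma ht'_normal: "ht' x *. (n1, n2) = 1"
unfolding ht'_def idl inner_scaleR_left inner_units by simp

lemma p_coords: "sc p = 0" "yc p = 0" by (simp_all add: sc_def yc_def)

text \<open>With nonzero height the point \<open>p\<close> would lie in the interior or in the
  exterior of \<open>P\<close>, not on its frontier.\<close>

lemma gamma_0: "ga 0 = 0"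
proof (rule ccontr)
assume "ga 0 ~= 0"
then consider "ht p > 0" | "ht p < 0" unfolding ht_def p_coords by linarith
then show False
proof cases
	case 1
	have "open (ball p r Int {x. ht x > 0})" by (intro open_Int open_ball open_Collect_less ht_continuous continuous_intros)
	moreover have "ball p r Int {x. ht x > 0} <= P" using mem_P_iff by auto
	ultimately have "p : interior P" using 1 r by (intro interiorI[of "ball p r Int {x. ht x > 0}"]) auto
	then show False using frontier by (simp add: frontier_def)
next
	case 2
	have o: "open (ball p r Int {x. ht x < 0})" by (intro open_Int open_ball open_Collect_less ht_continuous continuous_intros)
	have "P Int (ball p r Int {x. ht x < 0}) = {}" using mem_P_iff by fastforce
	then have "p ~: closure P" using 2 r o closure_iff_nhds_not_empty[of p P] by fastforce
	then show False using frontier by (simp add: frontier_def)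
qed
qed

lemma lipschitz: obtains L where "L >= 1" "!!s s'. abs (s) <= r ==> (abs (s')) <= r ==> (abs (ga s - ga s')) <= L * abs (s - s')"
	"!!s. abs (s) <= r ==> (abs (ga' s)) <= L"
proof -
have "compact (ga' ` {-r..r})" by (intro compact_continuous_image continuous_on_subset[OF cont]) auto
then have "bounded (ga' ` {-r..r})" by (rule compact_imp_bounded)
then obtain B where "ALL x:ga' ` {-r..r}. norm x <= B" unfolding bounded_iff by (elim exE)
then have B: "norm (ga' s) <= B" if "s : {-r..r}" for s using that by blast
have d: "(ga has_field_derivative ga' s) (at s within {-r..r})" for s by (rule has_field_derivative_at_within[OF der])
have "abs (ga s - ga s') <= max 1 B * abs (s - s')" if "abs (s) <= r" "abs (s') <= r" for s s'
proof -
	have "norm (ga s - ga s') <= max 1 B * norm (s - s')"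
	proof (rule field_differentiable_bound[OF _ d])
		show "norm (ga' z) <= max 1 B" if "z : {-r..r}" for z using B[OF that] by linarith
	qed (use that in auto)
	then show ?thesis by simp
qed
moreover have "abs (ga' s) <= max 1 B" if "abs (s) <= r" for s
proof -
	have "s : {-r..r}" using that by auto
	from B[OF this] show ?thesis by simp
qed
ultimately show ?thesis by (intro that[of "max 1 B"]) auto
qed

text \<open>One half of the trace characterisation. \<open>u\<close> vanishes below the graph, so
  \<open>transport\<close> upwards from there bounds its square integral over the ball of radius
  \<open>rh\<close> by \<open>rh^2\<close> times the integral of \<open>|G|^2\<close> over a ball of
  comparable radius. After Cauchy-Schwarz the means are bounded by the root of an integral over
  shrinking balls.\<close>

lemma trace_of_extension:
assumes u: "sqi u" "sqi G" and w: "wgrad (ball p r0) u G" and r0: "r0 > 0"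
	and z: "!!x. x : ball p r0 ==> x ~: P ==> u x = 0"
shows "((%rh. (LI x. ind (ball p rh) x * abs (u x)) / rh^2) \<longlongrightarrow> 0) (at_right 0)"
proof -
obtain L where L: "L >= 1" "!!s s'. abs (s) <= r ==> (abs (s')) <= r ==> (abs (ga s - ga s')) <= L * abs (s - s')" using lipschitz by metis
define C where "C = (2 + 4 * L) ^ 3"
have C: "C > 0" using L(1) by (simp add: C_def)
let ?g = "%d. LI x. ind (cball p d) x * (norm (G x))^2"
have est: "(LI x. ind (ball p rh) x * abs (u x)) / rh^2 <= 2 * sqrt (C * ?g (8 * L * rh))"
	if rh: "0 < rh" "8 * L * rh < min r r0" for rh
proof -
	define a where "a x = stp ((1 / rh^2) * (sc x * sc x) - 1)" for x
	define Da where "Da x = stp' ((1 / rh^2) * (sc x * sc x) - 1) *R ((1 / rh^2) *R (sc x *R (n2, - n1) + sc x *R (n2, - n1)) - 0)" for x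
	have a: "c1 a Da" unfolding a_def[abs_def] Da_def[abs_def] sc_def
		by (intro c1_stp c1_diff c1_scale c1_mult c1_inner c1_const)
	have a01: "0 <= a x" "a x <= 1" for x unfolding a_def by (rule stp_bounds)+
	have Dan: "Da x *. (n1, n2) = 0" for x
		unfolding Da_def by (simp only: inner_scaleR_left idl ial inner_units) simp
	have as: "abs (sc x) <= 2 * rh" if "a x ~= 0" for x
	proof (rule ccontr)
		assume "\<not> (abs (sc x)) <= 2 * rh"
		then have "(2 * rh)^2 <= (sc x)^2" using rh(1) by (intro abs_le_square_iff[THEN iffD1]) auto
		then have "4 * rh^2 <= (sc x)^2" by (simp add: pmd)
		moreover have "rh^2 >= 0" by simp
		ultimately have "2 * rh^2 <= (sc x)^2" by linarith
		then have "(1 / rh^2) * (sc x * sc x) - 1 >= 1" using rh(1) by (simp add: field_simps p2eq)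
		then show False using that stp_eq_0 by (simp add: a_def)
	qed
	have a1: "a x = 1" if "abs (sc x) <= rh" for x
	proof -
		have "(sc x)^2 <= rh^2" using that rh(1) by (intro abs_le_square_iff[THEN iffD1]) auto
		then have "(1 / rh^2) * (sc x * sc x) - 1 <= 0" using rh(1) by (simp add: field_simps p2eq)
		then show ?thesis unfolding a_def by (rule stp_eq_1)
	qed
	\<comment> \<open>For \<open>|sc x| <= 2 * rh\<close> the graph stays above \<open>- ?l\<close>, so
	  the initial layer lies below it and carries no mass. All of the motion happens within distance
	  \<open>8 * L * rh\<close>.\<close>
	let ?l = "2 * L * rh"
	have lpos: "?l > 0" using L(1) rh(1) by simp
	have Lrh: "rh <= L * rh" using L(1) rh(1) by simp
	have Kmem: "x : cball p (8 * L * rh)" if "a x ~= 0" "- 2 * ?l <= yc x" "yc x <= 2 * rh" for x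
	proof -
		have "yc x <= 4 * (L * rh)" using that(3) Lrh rh(1) by linarith
		moreover have "- (4 * (L * rh)) <= yc x" using that(2) by (simp add: mult_ac)
		ultimately have "abs (yc x) <= 4 * (L * rh)" by linarith
		then have "norm (x - p) <= 8 * (L * rh)" using norm_le_coords[of x] as[OF that(1)] Lrh by linarith
		then show ?thesis by (simp add: dist_norm nmc)
	qed
	have tr: "(LI x. (u x)^2 * (a x * ind {x. - ?l <= yc x & yc x <= rh} x)) <=
		(2 * rh + 2 * ?l) ^ 3 / rh * ?g (8 * L * rh) +
		2 * (2 * rh + 2 * ?l)^2 / (rh * ?l) * (LI x. (u x)^2 * (a x * ind {x. - 2 * ?l <= yc x & yc x <= - ?l} x))"
		unfolding yc_def
	proof (rule transport[OF w open_ball u norm_units(1) a Dan a01 rh(1) lpos compact_cball])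
		show "cball p (8 * L * rh) <= ball p r0" using rh(2) by auto
		show "x : cball p (8 * L * rh)" if "a x ~= 0" "- 2 * ?l <= (x - p) *. (n1, n2)" "(x - p) *. (n1, n2) <= 2 * rh" for x
			using Kmem[OF that[folded yc_def]] .
	qed
	have "(u x)^2 * (a x * ind {x. - 2 * ?l <= yc x & yc x <= - ?l} x) = 0" for x
	proof (cases "a x ~= 0 & - 2 * ?l <= yc x & yc x <= - ?l")
		case True
		then have "x : cball p (8 * L * rh)" using Kmem[of x] lpos rh(1) by linarith
		then have xb: "x : ball p r" "x : ball p r0" using rh(2) by auto
		have "abs (ga (sc x) - ga 0) <= L * abs (sc x - 0)"
			using abs_coords_le(1)[of x] xb(1) r by (intro L(2)) (auto simp: dist_norm nmc)
		also have "... <= L * (2 * rh)" using as[of x] True L(1) by (intro mlm) auto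
		finally have "ga (sc x) >= - ?l" by (simp add: gamma_0 abs_le_iff mult_ac)
		then have "ht x <= 0" using True by (simp add: ht_def)
		then have "u x = 0" using mem_P_iff[OF xb(1)] z[OF xb(2)] by auto
		then show ?thesis by simp
	qed auto
	then have zero: "(LI x. (u x)^2 * (a x * ind {x. - 2 * ?l <= yc x & yc x <= - ?l} x)) = 0" by (rule LINT_eq_0)
	have B: "(2 * rh + 2 * ?l) ^ 3 / rh = C * rh^2"
	proof -
		have "2 * rh + 2 * ?l = (2 + 4 * L) * rh" by (simp add: algebra_simps)
		then show ?thesis using rh(1) by (simp add: C_def pmd p2eq power3_eq_cube)
	qed
	have [measurable]: "u : BB" "a : BB" "yc : BB"
		using u(1) c1_cont[OF a] by (auto intro: sqi_m bmc continuous_intros simp: yc_def[abs_def])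
	have "(LI x. ind (ball p rh) x * (u x)^2) <= (LI x. (u x)^2 * (a x * ind {x. - ?l <= yc x & yc x <= rh} x))"
	proof (rule integral_mono)
		show "Li (%x. ind (ball p rh) x * (u x)^2)"
			using imi[OF _ sqi_i[OF u(1)], of "ball p rh"] by simp
		show "Li (%x. (u x)^2 * (a x * ind {x. - ?l <= yc x & yc x <= rh} x))"
			by (rule ibound[OF sqi_i[OF u(1)]])
				(use a01 in \<open>auto simp: ind_def abs_mult intro!: AE_I2 mult_left_le\<close>)
		fix x
		show "ind (ball p rh) x * (u x)^2 <= (u x)^2 * (a x * ind {x. - ?l <= yc x & yc x <= rh} x)"
		proof (cases "x : ball p rh")
			case True
			then have "abs (sc x) <= rh" "abs (yc x) <= rh" using abs_coords_le[of x] by (auto simp: dist_norm nmc)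
			then have "a x = 1" "- ?l <= yc x & yc x <= rh" using a1[of x] Lrh rh(1) by linarith+
			then show ?thesis using True by simp
		qed (use a01 in \<open>simp add: ind_def\<close>)
	qed
	also have "... <= rh^2 * (C * ?g (8 * L * rh))" using tr unfolding zero B by (simp add: mult_ac)
	finally have le: "(LI x. ind (ball p rh) x * (u x)^2) <= rh^2 * (C * ?g (8 * L * rh))" .
	have "(LI x. ind (ball p rh) x * abs (u x)) <= 2 * rh * sqrt (LI x. ind (ball p rh) x * (u x)^2)"
		using rh(1) by (intro integral_abs_ball_le u) auto
	also have "... <= 2 * rh * sqrt (rh^2 * (C * ?g (8 * L * rh)))"
		using le rh(1) by (intro mlm real_sqrt_le_mono) auto
	also have "... = rh^2 * (2 * sqrt (C * ?g (8 * L * rh)))"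
		using rh(1) by (simp add: real_sqrt_mult p2eq)
	finally show ?thesis using rh(1) by (simp add: field_simps)
qed
show ?thesis
proof (rule tendstoI)
	fix e :: real assume e: "e > 0"
	have "(e / 4)^2 / C > 0" using e C by simp
	then obtain d where d: "d > 0" "?g d < (e / 4)^2 / C"
		by (rule small_ball_integral[OF sqi_i[OF u(2)] zero_le_power2])
	let ?d = "min d (min r r0) / (8 * L)"
	have "0 < ?d" using d r r0 L(1) by simp
	moreover have "dist ((LI x. ind (ball p rh) x * abs (u x)) / rh^2) 0 < e" if "0 < rh" "rh < ?d" for rh
	proof -
		have s: "8 * L * rh < min d (min r r0)" using that L(1) by (simp add: field_simps)
		have "?g (8 * L * rh) <= ?g d"
		proof (rule integral_mono)
			show "Li (%x. ind (cball p c) x * (norm (G x))^2)" for c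
				using imi[OF _ sqi_i[OF u(2)], of "cball p c"] by simp
			then show "Li (%x. ind (cball p d) x * (norm (G x))^2)" .
			show "ind (cball p (8 * L * rh)) x * (norm (G x))^2 <= ind (cball p d) x * (norm (G x))^2" for x
				using s by (auto simp: ind_def)
		qed
		then have "?g (8 * L * rh) < (e / 4)^2 / C" using d(2) by linarith
		then have "C * ?g (8 * L * rh) < (e / 4)^2" unfolding pos_less_divide_eq[OF C] by (subst mult.commute)
		from real_sqrt_less_mono[OF this] have "sqrt (C * ?g (8 * L * rh)) < e / 4" using e by simp
		then have "(LI x. ind (ball p rh) x * abs (u x)) / rh^2 < e" using est[of rh] that(1) s e by auto
		moreover have "(LI x. ind (ball p rh) x * abs (u x)) / rh^2 >= 0" by (auto intro!: i_nn divide_nonneg_nonneg)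
		ultimately show ?thesis by simp
	qed
	ultimately show "\<forall>\<^sub>F rh in at_right 0. dist ((LI x. ind (ball p rh) x * abs (u x)) / rh^2) 0 < e"
		unfolding eventually_at_right_field by blast
qed
qed

end

lemma LI_le:
fixes f :: "'a => 'b::{banach,second_countable_topology}"
assumes "integrable M f" "integrable M g" "!!x. norm (f x) <= g x"
shows "norm (LINT x|M. f x) <= (LINT x|M. g x)"
by (rule order_trans[OF integral_norm_bound integral_mono]) (use assms in auto)

section \<open>From vanishing boundary means to weak differentiability of the extension by
  zero\<close>

context graph_nbhd
begin

lemma X_coords: "sc (X s) = s" "yc (X s) = ga s"
proof -
have "X s - p = s *R (n2, - n1) + ga s *R (n1, n2)" by (simp add: X_def)
then show "sc (X s) = s" "yc (X s) = ga s"
	unfolding sc_def yc_def by (simp_all only: ial inner_scaleR_left inner_units)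
qed

lemma norm_sub_X: "norm (x - X s) <= abs (sc x - s) + abs (yc x - ga s)"
proof -
obtain a b where ab: "x - X s = (a, b)" by (cases "x - X s")
have "sc x - s = (x - X s) *. (n2, - n1)" "yc x - ga s = (x - X s) *. (n1, n2)"
	using X_coords[of s] unfolding sc_def yc_def by (simp_all only: idl)
then have *: "sc x - s = a * n2 - b * n1" "yc x - ga s = a * n1 + b * n2" by (simp_all add: ab)
have "(norm (x - X s))^2 = (a^2 + b^2) * (n1^2 + n2^2)" by (simp add: ab norm_Pair unit)
also have "... = (sc x - s)^2 + (yc x - ga s)^2" unfolding * by (simp add: p2eq algebra_simps)
also have "... <= (abs (sc x - s) + abs (yc x - ga s))^2" by (simp add: power2_sum)
finally show ?thesis by (rule power2_le_imp_le) simp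
qed

text \<open>Square integrability of traces in disguise: the test function is bounded by
  \<open>rh\<close>, whereas on the strip its normal derivative is at least \<open>1/2\<close> up to
  an error of order \<open>rh\<close>. \<open>wgrad_square\<close> then gives a bound proportional
  to the thickness.\<close>

lemma strip_L2_bound:
assumes u: "sqi u" "sqi G" and w: "wgrad (P Int ball p r) u G" and oP: "open P"
shows "EX C>=0. ALL rh>0.
	(LI x. ind (ball p (r/4) Int {x. rh <= ht x & ht x <= 2 * rh}) x * (u x)^2) <= C * rh"
proof -
have r2: "r / 2 > 0" using r by simp
obtain a Da where a: "c1 a Da" "!!y. y : ball p (r/2/2) ==> a y = 1" "!!y. y ~: cball p (3*(r/2)/4) ==> a y = 0"
	"!!y. 0 <= a y" "!!y. a y <= 1" "!!y. norm (Da y) <= 12 / (r/2)"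
	using ball_cutoff[OF r2, of p] by metis
have [measurable]: "u : BB" "G : BB" "ht : BB"
	"a : BB"
	using u ht_continuous c1_cont[OF a(1)] by (auto intro: sqi_m bmc)
have iu: "Li (%x. C * (u x)^2)" for C using sqi_i[OF u(1)] by simp
let ?n = "(n1, n2)"
let ?I = "LI x. abs (u x * (G x *. ?n))"
define C where "C = 2 * (24 / r * N2 u + 2 * ?I)"
have I0: "?I >= 0" by (intro i_nn) auto
have iI: "Li (%x. abs (u x * (G x *. ?n)))" by (intro integrable_abs i_mult u sqi_ic)
have C: "C >= 0" unfolding C_def using r N2_nonneg[of u] I0 by simp
have "(LI x. ind (ball p (r/4) Int {x. rh <= ht x & ht x <= 2 * rh}) x * (u x)^2) <= C * rh" if rh: "rh > 0" for rh
proof -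
	\<comment> \<open>The strip corresponds to \<open>e\<close> between \<open>1/4\<close> and
	  \<open>3/4\<close>, where the step has slope at most \<open>-1\<close>; the support of the test
	  function stays above the height \<open>rh / 2\<close>.\<close>
	define e where "e x = 1 / (2 * rh) * ht x - 1 / 4" for x
	have ce: "c1 e (%x. (1 / (2 * rh)) *R ht' x - 0)" unfolding e_def by (intro c1_diff c1_scale c1_ht c1_const)
	define k where "k x = rh * (1 - stp (e x))" for x
	define Dk where "Dk x = rh *R (0 - stp' (e x) *R ((1 / (2 * rh)) *R ht' x - 0))" for x
	have ck: "c1 k Dk" unfolding k_def[abs_def] Dk_def[abs_def] by (intro c1_scale c1_diff c1_const c1_stp ce)
	define ps where "ps x = a x * k x" for x
	define D where "D x = a x *R Dk x + k x *R Da x" for x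
	have c: "c1 ps D" unfolding ps_def[abs_def] D_def[abs_def] by (rule c1_mult[OF a(1) ck])
	have k0: "k x = 0" if "ht x <= rh / 2" for x
	proof -
		have "e x <= 0" using that rh by (simp add: e_def field_simps)
		then show ?thesis by (simp add: k_def stp_eq_1)
	qed
	have kb: "0 <= k x" "k x <= rh" for x
		using stp_bounds[of "e x"] rh by (auto simp: k_def mult_left_le)
	let ?K = "cball p (3*(r/2)/4) Int {x. rh / 2 <= ht x}"
	have t: "ctest (P Int ball p r) ps D"
		unfolding ctest_def
	proof (intro conjI exI[of _ ?K] allI impI c)
		show "compact ?K" by (intro compact_Int_closed compact_cball closed_Collect_le ht_continuous continuous_intros)
		show "?K <= P Int ball p r"
		proof
			fix x assume x: "x : ?K"
			then have "x : ball p r" using r by auto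
			moreover have "ht x > 0" using x rh by auto
			ultimately show "x : P Int ball p r" using mem_P_iff by auto
		qed
		fix x assume "x ~: ?K"
		then show "ps x = 0" using a(3)[of x] k0[of x] by (auto simp: ps_def)
	qed
	have Dn: "D x *. ?n = a x * (- stp' (e x) / 2) + k x * (Da x *. ?n)" for x
		unfolding D_def Dk_def ial inner_scaleR_left idl ht'_normal using rh by simp
	have "ind (ball p (r/4) Int {x. rh <= ht x & ht x <= 2 * rh}) x * (u x)^2 <= 2 * ((u x)^2 * (D x *. ?n)) + 2 * (rh * (24 / r)) * (u x)^2" for x
	proof -
		have 1: "abs (k x * (Da x *. ?n)) <= rh * (24 / r)"
		proof -
			have "abs (Da x *. ?n) <= 24 / r" using CS2[of "Da x" ?n] a(6)[of x] norm_units(1) by simp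
			then show ?thesis unfolding abs_mult using kb[of x] rh by (intro mult_mono) auto
		qed
		have s0: "- stp' (e x) >= 0" using stp'_bounds[of "e x"] by simp
		have "ind (ball p (r/4) Int {x. rh <= ht x & ht x <= 2 * rh}) x <= 2 * (D x *. ?n) + 2 * (rh * (24 / r))"
		proof (cases "x : ball p (r/4) Int {x. rh <= ht x & ht x <= 2 * rh}")
			case True
			then have "1/4 <= e x" "e x <= 3/4" using rh by (auto simp: e_def field_simps)
			then have "- stp' (e x) >= 1" by (auto simp: stp'_def max_def)
			moreover have "a x = 1" using True a(2)[of x] by simp
			ultimately show ?thesis using True 1 unfolding Dn by (simp add: abs_le_iff)
		next
			case False
			have "a x * (- stp' (e x) / 2) >= 0" using a(4) s0 by (intro mult_nonneg_nonneg) auto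
			then show ?thesis using False 1 unfolding Dn by (simp add: abs_le_iff)
		qed
		from mrm[OF this, of "(u x)^2"] show ?thesis by (simp add: algebra_simps)
	qed
	note pt = this
	obtain B where B: "!!x. norm (D x) <= B" using ctest_bounded[OF t] by metis
	have iD: "Li (%x. (u x)^2 * (D x *. ?n))"
	proof (rule ibound[OF iu[of B]])
		show "(%x. (u x)^2 * (D x *. ?n)) : borel_measurable lborel"
			using bmc[OF c1_contD[OF c]] by simp
		have "abs (D x *. ?n) <= B" for x using CS2[of "D x" ?n] B[of x] norm_units(1) by simp
		then have "norm ((u x)^2 * (D x *. ?n)) <= B * (u x)^2" for x
			using mlm[of "abs (D x *. ?n)" B "(u x)^2"] by (simp add: abs_mult mult.commute)
		then show "AE x in lborel. norm ((u x)^2 * (D x *. ?n)) <= norm (B * (u x)^2)"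
			by (intro AE_I2) (auto intro: order_trans[OF _ abs_ge_self])
	qed
	have "(LI x. ind (ball p (r/4) Int {x. rh <= ht x & ht x <= 2 * rh}) x * (u x)^2) <=
		(LI x. 2 * ((u x)^2 * (D x *. ?n)) + 2 * (rh * (24 / r)) * (u x)^2)"
	proof (rule integral_mono)
		show "Li (%x. ind (ball p (r/4) Int {x. rh <= ht x & ht x <= 2 * rh}) x * (u x)^2)"
			using imi[OF _ sqi_i[OF u(1)], of "ball p (r/4) Int {x. rh <= ht x & ht x <= 2 * rh}"] by simp
		show "Li (%x. 2 * ((u x)^2 * (D x *. ?n)) + 2 * (rh * (24 / r)) * (u x)^2)"
			using iD iu by (intro Bochner_Integration.integrable_add integrable_mult_right) auto
	qed (rule pt)
	also have "... = 2 * (LI x. (u x)^2 * (D x *. ?n)) + 2 * (rh * (24 / r)) * N2 u"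
		using iD iu[of 1] by (simp add: N2_def)
	also have "(LI x. (u x)^2 * (D x *. ?n)) = - 2 * (LI x. u x * (G x *. ?n) * ps x)"
		by (rule wgrad_square[OF w open_Int[OF oP open_ball] u t])
	also have "- 2 * (LI x. u x * (G x *. ?n) * ps x) <= 2 * (rh * ?I)"
	proof -
		have "norm (LI x. u x * (G x *. ?n) * ps x) <= (LI x. rh * abs (u x * (G x *. ?n)))"
		proof (rule LI_le)
			have psib: "abs (ps x) <= rh" for x
				using mult_mono[OF a(5)[of x] kb(2)[of x]] a(4)[of x] kb(1)[of x] by (simp add: ps_def)
			show le: "norm (u x * (G x *. ?n) * ps x) <= rh * abs (u x * (G x *. ?n))" for x
				using mlm[OF psib[of x], of "abs (u x * (G x *. ?n))"] by (simp add: abs_mult mult_ac)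
			show ir: "Li (%x. rh * abs (u x * (G x *. ?n)))" using iI by simp
			show "Li (%x. u x * (G x *. ?n) * ps x)"
			proof (rule ibound[OF ir])
				show "AE x in lborel. norm (u x * (G x *. ?n) * ps x) <= norm (rh * abs (u x * (G x *. ?n)))"
					by (intro AE_I2 order_trans[OF le]) (simp only: real_norm_def abs_ge_self)
				show "(%x. u x * (G x *. ?n) * ps x) : borel_measurable lborel"
					using bmc[OF c1_cont[OF c]] by simp
			qed
		qed
		then show ?thesis by (simp add: abs_le_iff)
	qed
	finally show ?thesis unfolding C_def by (simp add: algebra_simps)
qed
then show ?thesis using C by blast
qed

text \<open>The pointwise hypothesis at almost every boundary point is integrated along the graph.
  Dominated convergence applies to the truncation of \<open>|u|\<close> at level \<open>M\<close>;
  the excess over \<open>M\<close> is at most \<open>u^2 / M\<close>, which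
  \<open>strip_L2_bound\<close> makes small uniformly in the thickness.\<close>

lemma strip_mean_tendsto:
assumes u: "sqi u" "sqi G" and w: "wgrad (P Int ball p r) u G" and oP: "open P"
	and tr: "AE s in lborel. abs (s) < r -->
		((%rh. (LI x. ind (ball (X s) rh) x * abs (u x)) / rh^2) \<longlongrightarrow> 0) (at_right 0)"
shows "(%i. (LI x. ind (ball p (r/4) Int {x. 1 / Suc i <= ht x & ht x <= 2 / Suc i}) x * abs (u x)) * Suc i) ----> 0"
proof -
have [measurable]: "u : BB" "ht : BB" "sc : BB"
	using u ht_continuous by (auto intro!: sqi_m bmc continuous_intros simp: sc_def[abs_def])
obtain C where C: "C >= 0" "!!rh. rh > 0 ==>
	(LI x. ind (ball p (r/4) Int {x. rh <= ht x & ht x <= 2 * rh}) x * (u x)^2) <= C * rh"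
	using strip_L2_bound[OF u w oP] by blast
obtain L where L: "L >= 1" "!!s s'. abs (s) <= r ==> (abs (s')) <= r ==> (abs (ga s - ga s')) <= L * abs (s - s')" using lipschitz by metis
define rh :: "nat => real" where "rh i = 1 / Suc i" for i
have rh0: "rh i > 0" for i by (simp add: rh_def)
have rhlim: "rh ----> 0" unfolding rh_def by (rule LIMSEQ_Suc[OF lim_1_over_n])
define S where "S i = ball p (r/4) Int {x. rh i <= ht x & ht x <= 2 * rh i}" for i
have [measurable]: "S i : sets borel" for i unfolding S_def by measurable
have Sb: "S i <= cball p (r/4)" for i by (auto simp: S_def)
have trunc: "(%i. (LI x. ind (S i) x * min (abs (u x)) M) / rh i) ----> 0" if M: "M > 0" for M
proof -
	define h where "h i x = ind (S i) x * min (abs (u x)) M" for i x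
	have [measurable]: "h i : BB" for i unfolding h_def by measurable
	have h0: "0 <= h i x" "h i x <= M" "h i x <= abs (u x)" for i x using M by (auto simp: h_def ind_def)
	have hz: "h i x = 0" if "x ~: S i" for i x using that by (simp add: h_def)
	have ih: "Li (h i)" for i
	proof (rule ibound)
		show "Li (%x. M * ind (S i) x)"
			by (intro integrable_mult_right integrable_real_indicator emeasure_bounded_finite bounded_subset[OF bounded_cball Sb]) simp
	qed (use M in \<open>auto simp: h_def ind_def\<close>)
	\<comment> \<open>The part of the truncated mass within tangential distance \<open>rh i\<close> of
	  \<open>s\<close>. It lies in the ball of radius \<open>(4 + L) * rh i\<close> about the boundary
	  point \<open>X s\<close>, so it is bounded both by a constant and by the mean at
	  \<open>X s\<close>.\<close>
	define A where "A i s = (LI x. h i x * ind {x. abs (sc x - s) < rh i} x) / (rh i)^2" for i s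
	have ihs: "Li (%x. h i x * ind {x. abs (sc x - s) < rh i} x)" for i s
		by (rule ibound[OF ih[of i]]) (auto simp: ind_def)
	have A0: "A i s >= 0" for i s unfolding A_def using h0 by (intro divide_nonneg_nonneg i_nn) auto
	have near: "x : ball (X s) ((4 + L) * rh i)" if "x : S i" "abs (sc x - s) < rh i" "rh i <= r / 4" for x s i
	proof -
		have "norm (x - p) < r / 4" using that(1) by (simp add: S_def dist_norm nmc)
		then have scx: "abs (sc x) < r / 4" using abs_coords_le(1)[of x] by linarith
		then have "abs (ga (sc x) - ga s) <= L * abs (sc x - s)" using that r by (intro L(2)) linarith+
		also have "... <= L * rh i" using that(2) L(1) by (intro mlm) auto
		finally have "abs (yc x - ga s) <= 2 * rh i + L * rh i" using that(1) rh0[of i] by (auto simp: S_def ht_def)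
		then have "norm (x - X s) < (4 + L) * rh i" using norm_sub_X[of x s] that(2) rh0[of i] by (simp add: algebra_simps)
		then show ?thesis by (simp add: dist_norm nmc)
	qed
	have far: "A i s = 0" if "abs (s) >= r / 2" "rh i <= r / 4" for i s
	proof -
		have "h i x * ind {x. abs (sc x - s) < rh i} x = 0" for x
		proof (cases "x : S i")
			case True
			then have "norm (x - p) < r / 4" by (simp add: S_def dist_norm nmc)
			then have "abs (sc x) < r / 4" using abs_coords_le(1)[of x] by linarith
			then have "\<not> (abs (sc x - s)) < rh i" using that by linarith
			then show ?thesis by simp
		qed (simp add: hz)
		then show ?thesis unfolding A_def by (subst LINT_eq_0) auto
	qed
	define N where "N = (4 + L)^2"
	have ball_int: "Li (%x. ind (ball q d) x * abs (u x))" for q d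
	proof -
		have "sqi (%x. ind (ball q d) x *R (1::real))"
			by (rule sqi_bounded_compact[OF _ compact_cball[of q d], of _ 1]) (auto simp: ind_def)
		from integrable_abs[OF i_mult[OF this u(1)]] show ?thesis by (simp add: abs_mult)
	qed
	have Aup: "A i s <= 4 * M * N" "A i s <= N * ((LI x. ind (ball (X s) ((4 + L) * rh i)) x * abs (u x)) / ((4 + L) * rh i)^2)"
		if i: "rh i <= r / 4" for i s
	proof -
		have pos: "(4 + L) * rh i > 0" using L(1) rh0[of i] by simp
		have "(LI x. h i x * ind {x. abs (sc x - s) < rh i} x) <= (LI x. M * ind (ball (X s) ((4 + L) * rh i)) x)"
		proof (rule integral_mono[OF ihs])
			show "h i x * ind {x. abs (sc x - s) < rh i} x <= M * ind (ball (X s) ((4 + L) * rh i)) x" for x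
				using near[OF _ _ i, of x s] h0[of i x] hz[of x i] M by (cases "x : S i") (auto simp: ind_def)
			show "Li (%x. M * ind (ball (X s) ((4 + L) * rh i)) x)"
				by (intro integrable_mult_right integrable_real_indicator emeasure_bounded_finite) auto
		qed
		also have "... <= M * (4 * ((4 + L) * rh i)^2)"
			using integral_indicator_ball_le[of "(4 + L) * rh i" "X s"] pos M by simp
		finally have "A i s <= M * (4 * ((4 + L) * rh i)^2) / (rh i)^2" unfolding A_def by (rule divide_right_mono) simp
		also have "... = 4 * M * N" using rh0[of i] unfolding N_def pmd by simp
		finally show "A i s <= 4 * M * N" .
		have "(LI x. h i x * ind {x. abs (sc x - s) < rh i} x) <= (LI x. ind (ball (X s) ((4 + L) * rh i)) x * abs (u x))"
		proof (rule integral_mono[OF ihs ball_int])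
			show "h i x * ind {x. abs (sc x - s) < rh i} x <= ind (ball (X s) ((4 + L) * rh i)) x * abs (u x)" for x
				using near[OF _ _ i, of x s] h0[of i x] hz[of x i] by (cases "x : S i") (auto simp: ind_def)
		qed
		then have "A i s <= (LI x. ind (ball (X s) ((4 + L) * rh i)) x * abs (u x)) / (rh i)^2"
			unfolding A_def by (intro divide_right_mono) auto
		also have "... = N * ((LI x. ind (ball (X s) ((4 + L) * rh i)) x * abs (u x)) / ((4 + L) * rh i)^2)"
			using L(1) rh0[of i] by (simp add: N_def pmd)
		finally show "A i s <= N * ((LI x. ind (ball (X s) ((4 + L) * rh i)) x * abs (u x)) / ((4 + L) * rh i)^2)" .
	qed
	have [measurable]: "A i : BB" for i unfolding A_def by measurable
	have ev: "\<forall>\<^sub>F i in sequentially. rh i < r / 4" using rhlim r by (intro order_tendstoD(2)) auto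
	then obtain i0 where i0: "!!i. i >= i0 ==> rh i <= r / 4" unfolding eventually_sequentially using less_imp_le by blast
	have "(%i. LI s. A (i + i0) s) ----> integral\<^sup>L (lborel :: real measure) (%_. 0 :: real)"
	proof (rule integral_dominated_convergence)
		show "Li (%s. 4 * M * N * ind {- (r/2)..r/2} s :: real)"
			by (intro integrable_mult_right integrable_real_indicator emeasure_bounded_finite) auto
		show "AE s in lborel. norm (A (i + i0) s) <= 4 * M * N * ind {- (r/2)..r/2} s" for i
		proof (rule AE_I2)
			fix s :: real
			have "rh (i + i0) <= r / 4" by (rule i0) simp
			then show "norm (A (i + i0) s) <= 4 * M * N * ind {- (r/2)..r/2} s"
				using far[of s "i + i0"] Aup(1)[of "i + i0" s] A0[of "i + i0" s] by (cases "abs (s) < r / 2") (auto simp: ind_def)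
		qed
		show "AE s in lborel. (%i. A (i + i0) s) ----> 0"
			using tr
		proof eventually_elim
			case (elim s)
			show ?case
			proof (cases "abs (s) < r")
				case True
				let ?F = "%rh. (LI x. ind (ball (X s) rh) x * abs (u x)) / rh^2"
				have "(%i. (4 + L) * rh (i + i0)) ----> (4 + L) * 0"
					by (intro tendsto_mult tendsto_const LIMSEQ_ignore_initial_segment rhlim)
				then have "filterlim (%i. (4 + L) * rh (i + i0)) (at_right 0) sequentially"
					using L(1) rh0 unfolding filterlim_at by (simp add: always_eventually less_imp_neq[OF rh0, symmetric])
				with elim True have "(%i. ?F ((4 + L) * rh (i + i0))) ----> 0" by (auto intro: filterlim_compose)
				then have "(%i. N * ?F ((4 + L) * rh (i + i0))) ----> N * 0" by (intro tendsto_mult tendsto_const)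
				then have l: "(%i. N * ?F ((4 + L) * rh (i + i0))) ----> 0" by simp
				show ?thesis
					by (rule tendsto_sandwich[OF _ _ tendsto_const l]) (use A0 Aup(2)[OF i0] in \<open>auto intro!: always_eventually\<close>)
			next
				case False
				then have "A (i + i0) s = 0" for i using far[of s "i + i0"] i0[of "i + i0"] r by auto
				then show ?thesis by simp
			qed
		qed
	qed measurable
	then have lim: "(%i. LI s. A (i + i0) s) ----> 0" by simp
	\<comment> \<open>In the double integral each \<open>x\<close> is counted over an interval of
	  length \<open>2 * rh i\<close> in \<open>s\<close>.\<close>
	have fub: "(LI s. A i s) = 2 * ((LI x. h i x) / rh i)" for i
	proof -
		have m2: "(%(s, x). h i x * ind {x. abs (sc x - s) < rh i} x) : borel_measurable (lborel \<Otimes>\<^sub>M lborel)"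
			unfolding ind_def by measurable
		have inner: "(\<integral>\<^sup>+s. ennreal (h i x * ind {x. abs (sc x - s) < rh i} x) \<partial>lborel) = ennreal (2 * rh i * h i x)" for x
		proof -
			have "(\<integral>\<^sup>+s. ennreal (h i x * ind {x. abs (sc x - s) < rh i} x) \<partial>lborel) = (\<integral>\<^sup>+s. ennreal (h i x) * ind {sc x - rh i<..<sc x + rh i} s \<partial>lborel)"
				by (intro nn_integral_cong) (auto simp: ind_def)
			also have "... = ennreal (h i x) * ennreal (2 * rh i)"
				using rh0[of i] by (subst nn_integral_cmult_indicator) auto
			finally show ?thesis using h0(1)[of i x] rh0[of i] by (simp add: ennreal_mult mult.commute)
		qed
		have "(\<integral>\<^sup>+s. ennreal (A i s * (rh i)^2) \<partial>lborel) = (\<integral>\<^sup>+s. (\<integral>\<^sup>+x. ennreal (h i x * ind {x. abs (sc x - s) < rh i} x) \<partial>lborel) \<partial>lborel)"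
			using nn_integral_eq_integral[OF ihs] h0(1) rh0[of i] by (intro nn_integral_cong) (simp add: A_def)
		also have "... = (\<integral>\<^sup>+x. (\<integral>\<^sup>+s. ennreal (h i x * ind {x. abs (sc x - s) < rh i} x) \<partial>lborel) \<partial>lborel)"
			by (rule lborel_pair.Fubini'[symmetric]) (use m2 in measurable)
		also have "... = ennreal (2 * rh i * (LI x. h i x))"
			unfolding inner using nn_integral_eq_integral[of lborel "%x. 2 * rh i * h i x"] ih h0(1) rh0[of i] by simp
		finally have e: "(\<integral>\<^sup>+s. ennreal (A i s * (rh i)^2) \<partial>lborel) = ennreal (2 * rh i * (LI x. h i x))" .
		have "(LI s. A i s * (rh i)^2) = enn2real (\<integral>\<^sup>+s. ennreal (A i s * (rh i)^2) \<partial>lborel)"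
			by (rule integral_eq_nn_integral) (use A0 in auto)
		also have "... = 2 * rh i * (LI x. h i x)"
			unfolding e using rh0[of i] h0(1) by (intro enn2real_ennreal mult_nonneg_nonneg i_nn) auto
		finally have "(LI s. A i s) * (rh i)^2 = 2 * rh i * (LI x. h i x)" by simp
		then show ?thesis using rh0[of i] by (simp add: field_simps p2eq)
	qed
	have "(%i. (LI x. h (i + i0) x) / rh (i + i0)) ----> 0"
		using tendsto_mult[OF tendsto_const[of "1/2"] lim] unfolding fub by simp
	then show ?thesis unfolding h_def by (rule LIMSEQ_offset)
qed
have ju: "Li (%x. ind (S i) x * (u x)^2)" for i
	using imi[OF _ sqi_i[OF u(1)], of "S i"] by simp
have jt: "Li (%x. ind (S i) x * min (abs (u x)) M)" if "M > 0" for i M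
proof (rule ibound)
	show "Li (%x. M * ind (S i) x)"
		by (intro integrable_mult_right integrable_real_indicator emeasure_bounded_finite bounded_subset[OF bounded_cball Sb]) simp
qed (use that in \<open>auto simp: ind_def\<close>)
have main: "(%i. (LI x. ind (S i) x * abs (u x)) / rh i) ----> 0"
proof (rule LIMSEQ_I)
	fix e :: real assume e: "e > 0"
	\<comment> \<open>The contribution of the values above \<open>M\<close> is at most
	  \<open>C / M < e / 2\<close> for every thickness, so \<open>M\<close> can be fixed before the
	  limit.\<close>
	define M where "M = 2 * (C + 1) / e"
	have M: "M > 0" using C(1) e by (simp add: M_def)
	have CM: "C / M < e / 2" using C(1) e by (simp add: M_def field_simps)
	obtain no where no: "!!i. i >= no ==> (abs ((LI x. ind (S i) x * min (abs (u x)) M) / rh i)) < e / 2"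
		using LIMSEQ_D[OF trunc[OF M], of "e / 2"] e by auto
	show "EX no. ALL i>=no. norm ((LI x. ind (S i) x * abs (u x)) / rh i - 0) < e"
	proof (intro exI[of _ no] allI impI)
		fix i assume i: "no <= i"
		have le: "ind (S i) x * abs (u x) <= ind (S i) x * min (abs (u x)) M + (ind (S i) x * (u x)^2) / M" for x
		proof (cases "abs (u x) <= M")
			case False
			then have "abs (u x) * M <= abs (u x) * abs (u x)" by (intro mlm) auto
			then have "abs (u x) <= (u x)^2 / M" using M by (simp add: le_divide_eq p2eq)
			then show ?thesis using M by (auto simp: ind_def)
		qed (use M in \<open>auto simp: ind_def\<close>)
		have iS: "Li (%x. ind (S i) x * min (abs (u x)) M + (ind (S i) x * (u x)^2) / M)"
			using jt[OF M] ju by simp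
		have "(LI x. ind (S i) x * abs (u x)) <= (LI x. ind (S i) x * min (abs (u x)) M + (ind (S i) x * (u x)^2) / M)"
		proof (rule integral_mono[OF _ iS le])
			show "Li (%x. ind (S i) x * abs (u x))"
			proof (rule ibound[OF iS])
				show "AE x in lborel. norm (ind (S i) x * abs (u x)) <= norm (ind (S i) x * min (abs (u x)) M + (ind (S i) x * (u x)^2) / M)"
					by (intro AE_I2 norm_le_norm_nonneg le) simp
			qed measurable
		qed
		also have "... = (LI x. ind (S i) x * min (abs (u x)) M) + (LI x. ind (S i) x * (u x)^2) / M"
			using jt[OF M] ju by simp
		also have "... <= (LI x. ind (S i) x * min (abs (u x)) M) + (C * rh i) / M"
			using C(2)[OF rh0[of i]] M unfolding S_def by (intro add_left_mono divide_right_mono) auto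
		finally have "(LI x. ind (S i) x * abs (u x)) / rh i <= ((LI x. ind (S i) x * min (abs (u x)) M) + (C * rh i) / M) / rh i"
			using rh0[of i] by (intro divide_right_mono) auto
		also have "... = (LI x. ind (S i) x * min (abs (u x)) M) / rh i + C / M"
			using rh0[of i] by (simp add: field_simps)
		also have "... < e" using no[OF i] CM by linarith
		finally have "(LI x. ind (S i) x * abs (u x)) / rh i < e" .
		moreover have "(LI x. ind (S i) x * abs (u x)) / rh i >= 0"
			using rh0[of i] by (intro divide_nonneg_nonneg i_nn) auto
		ultimately show "norm ((LI x. ind (S i) x * abs (u x)) / rh i - 0) < e" by simp
	qed
qed
then show ?thesis unfolding S_def rh_def by simp
qed

text \<open>The converse half. Test functions are multiplied by a cutoff that vanishes near the
  graph, so that they are admissible inside \<open>P\<close>. The extra term contains the gradient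
  of the cutoff, of order \<open>Suc i\<close>, on a strip of thickness \<open>1 / Suc i\<close>,
  and \<open>strip_mean_tendsto\<close> makes it vanish.\<close>

lemma extension_of_trace:
assumes u: "sqi u" "sqi G" and w: "wgrad (P Int ball p r) u G" and oP: "open P"
	and z: "!!x. x ~: P ==> u x = 0" "!!x. x ~: P ==> G x = 0"
	and tr: "AE s in lborel. abs (s) < r -->
		((%rh. (LI x. ind (ball (X s) rh) x * abs (u x)) / rh^2) \<longlongrightarrow> 0) (at_right 0)"
shows "wgrad (ball p (r/4)) u G"
unfolding wgrad_def
proof (intro allI impI)
fix ps D h assume t: "ctest (ball p (r/4)) ps D"
obtain K where K: "compact K" "K <= ball p (r/4)" "!!x. x ~: K ==> ps x = 0" "!!x. x ~: K ==> D x = 0" using ctestE[OF t] by metis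
obtain L where L: "L >= 1" "!!s. abs (s) <= r ==> (abs (ga' s)) <= L" using lipschitz by metis
obtain B where B: "B > 0" "!!x. abs (ps x) <= B" "!!x. norm (D x) <= B" using ctest_bounded[OF t] by metis
have [measurable]: "u : BB" "G : BB" "ht : BB"
	"ps : BB" "D : BB"
	using u ht_continuous ctest_sqi[OF t] by (auto intro: sqi_m bmc)
note sq = ctest_sqi[OF t]
\<comment> \<open>The cutoff \<open>ze i\<close> is 0 up to the height \<open>1 / Suc i\<close> and
  1 from \<open>2 / Suc i\<close> on.\<close>
define e where "e i x = real (Suc i) * ht x - 1" for i x
define de where "de i x = real (Suc i) *R ht' x - 0" for i x
have ce: "c1 (e i) (de i)" for i unfolding e_def[abs_def] de_def[abs_def] by (intro c1_diff c1_scale c1_ht c1_const)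
define ze where "ze i x = 1 - stp (e i x)" for i x
define dze where "dze i x = 0 - stp' (e i x) *R de i x" for i x
have cze: "c1 (ze i) (dze i)" for i unfolding ze_def[abs_def] dze_def[abs_def] by (intro c1_diff c1_const c1_stp ce)
have ze01: "0 <= ze i x" "ze i x <= 1" for i x using stp_bounds[of "e i x"] by (auto simp: ze_def)
have [measurable]: "ze i : BB" "dze i : BB" for i
	using c1_cont[OF cze] c1_contD[OF cze] by (auto intro: bmc)
have t': "ctest (P Int ball p r) (%x. ps x * ze i x) (%x. ps x *R dze i x + ze i x *R D x)" for i
	unfolding ctest_def
proof (intro conjI exI[of _ "K Int {x. 1 / Suc i <= ht x}"] allI impI)
	show "c1 (%x. ps x * ze i x) (%x. ps x *R dze i x + ze i x *R D x)" by (rule c1_mult[OF ctest_c1[OF t] cze])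
	show "compact (K Int {x. 1 / Suc i <= ht x})" by (intro compact_Int_closed K closed_Collect_le ht_continuous continuous_intros)
	show "K Int {x. 1 / Suc i <= ht x} <= P Int ball p r"
	proof
		fix x assume x: "x : K Int {x. 1 / Suc i <= ht x}"
		then have "x : ball p (r/4)" using K(2) by blast
		then have xb: "x : ball p r" using r by simp
		have "0 < 1 / real (Suc i)" by simp
		also have "1 / real (Suc i) <= ht x" using x by blast
		finally have "ht x > 0" .
		then show "x : P Int ball p r" using mem_P_iff[OF xb] xb by simp
	qed
	fix x assume x: "x ~: K Int {x. 1 / Suc i <= ht x}"
	show "ps x * ze i x = 0"
	proof (cases "x : K")
		case True
		then have "ht x < 1 / real (Suc i)" using x by auto
		then have "e i x <= 0" unfolding e_def by (simp add: field_simps del: of_nat_Suc)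
		then show ?thesis by (simp add: ze_def stp_eq_1)
	qed (simp add: K)
qed
have E: "(LI x. u x * ((ps x *R dze i x + ze i x *R D x) *. h)) = - (LI x. (G x *. h) * (ps x * ze i x))" for i
	by (rule wgradD[OF w t'])
have iuD: "Li (%x. u x * (D x *. h))" by (intro i_mult u sqi_ic sq)
have iGp: "Li (%x. (G x *. h) * ps x)" by (intro i_mult u sqi_ic sq)
have zelim: "(%i. ze i x) ----> 1" if "x : P" "x : K" for x
proof -
	have "x : ball p (r/4)" using that K(2) by blast
	then have "x : ball p r" using r by simp
	then have hp: "ht x > 0" using mem_P_iff that by simp
	obtain m where m: "2 / ht x <= real m" using real_arch_simple by blast
	have "ze i x = 1" if "m <= i" for i
	proof -
		have "2 / ht x <= real (Suc i)" using m that by simp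
		then have "e i x >= 1" unfolding e_def using hp by (simp add: field_simps del: of_nat_Suc)
		then show ?thesis by (simp add: ze_def stp_eq_0)
	qed
	then show ?thesis by (intro tendsto_eventually) (auto simp: eventually_sequentially)
qed
have l1: "(%i. LI x. u x * (ze i x * (D x *. h))) ----> (LI x. u x * (D x *. h))"
proof (rule integral_dominated_convergence)
	show "Li (%x. abs (u x * (D x *. h)))" using iuD by simp
	show "AE x in lborel. (%i. u x * (ze i x * (D x *. h))) ----> u x * (D x *. h)"
	proof (rule AE_I2)
		fix x
		show "(%i. u x * (ze i x * (D x *. h))) ----> u x * (D x *. h)"
		proof (cases "x : P & x : K")
			case True
			then have "(%i. u x * (ze i x * (D x *. h))) ----> u x * (1 * (D x *. h))" by (intro tendsto_mult tendsto_const zelim) auto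
			then show ?thesis by simp
		next
			case False
			then show ?thesis using z(1)[of x] K(4)[of x] by auto
		qed
	qed
	show "AE x in lborel. norm (u x * (ze i x * (D x *. h))) <= abs (u x * (D x *. h))" for i
		using ze01 by (intro AE_I2) (auto simp: abs_mult intro!: mlm mult_left_le_one_le)
qed measurable
have l3: "(%i. LI x. (G x *. h) * (ps x * ze i x)) ----> (LI x. (G x *. h) * ps x)"
proof (rule integral_dominated_convergence)
	show "Li (%x. abs ((G x *. h) * ps x))" using iGp by simp
	show "AE x in lborel. (%i. (G x *. h) * (ps x * ze i x)) ----> (G x *. h) * ps x"
	proof (rule AE_I2)
		fix x
		show "(%i. (G x *. h) * (ps x * ze i x)) ----> (G x *. h) * ps x"
		proof (cases "x : P & x : K")
			case True
			then have "(%i. (G x *. h) * (ps x * ze i x)) ----> (G x *. h) * (ps x * 1)" by (intro tendsto_mult tendsto_const zelim) auto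
			then show ?thesis by simp
		next
			case False
			then show ?thesis using z(2)[of x] K(3)[of x] by auto
		qed
	qed
	show "AE x in lborel. norm ((G x *. h) * (ps x * ze i x)) <= abs ((G x *. h) * ps x)" for i
		using ze01 by (intro AE_I2) (auto simp: abs_mult intro!: mlm mult_left_le)
qed measurable
define Q where "Q i = ball p (r/4) Int {x. 1 / Suc i <= ht x & ht x <= 2 / Suc i}" for i
have [measurable]: "Q i : sets borel" for i unfolding Q_def by measurable
let ?c = "B * (2 * (1 + L) * norm h)"
have pt: "abs (u x * (ps x * (dze i x *. h))) <= ?c * (ind (Q i) x * abs (u x) * real (Suc i))" for i x
proof (cases "x : Q i \<or> ps x = 0")
	case True
	show ?thesis
	proof (cases "ps x = 0")
		case False
		then have xQ: "x : Q i" using True by simp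
		have "norm (x - p) < r / 4" using xQ by (simp add: Q_def dist_norm nmc)
		then have "abs (sc x) <= r" using abs_coords_le(1)[of x] r by linarith
		have "norm (ht' x) <= norm (n1, n2) + norm (ga' (sc x) *R (n2, - n1))"
			unfolding ht'_def by (rule norm_triangle_ineq4)
		also have "... <= 1 + L" unfolding norm_scaleR norm_units using L(2)[OF `abs (sc x) <= r`] by simp
		finally have "norm (ht' x) <= 1 + L" .
		have "norm (dze i x) = abs (stp' (e i x)) * (real (Suc i) * norm (ht' x))"
			by (simp add: dze_def de_def abs_mult del: of_nat_Suc)
		also have "... <= 2 * (real (Suc i) * (1 + L))"
			using stp'_bounds[of "e i x"] `norm (ht' x) <= 1 + L` by (intro mult_mono) auto
		finally have "norm (dze i x) <= 2 * (real (Suc i) * (1 + L))" .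
		then have "norm (dze i x) * norm h <= 2 * (real (Suc i) * (1 + L)) * norm h" by (intro mrm) auto
		then have "abs (dze i x *. h) <= 2 * (real (Suc i) * (1 + L)) * norm h" using CS2[of "dze i x" h] by linarith
		then have "abs (ps x) * abs (dze i x *. h) <= B * (2 * (real (Suc i) * (1 + L)) * norm h)" using B(1,2) by (intro mult_mono) auto
		then have "abs (u x) * (abs (ps x) * abs (dze i x *. h)) <= abs (u x) * (B * (2 * (real (Suc i) * (1 + L)) * norm h))" by (intro mlm) auto
		also have "... = ?c * (1 * abs (u x) * real (Suc i))" by (simp only: mult_ac mult_1_left)
		finally show ?thesis by (simp only: abs_mult indicator_simps(1)[OF xQ])
	qed (use B(1) L(1) in auto)
next
	case False
	then have xb: "x : ball p (r/4)" using K(2,3) by blast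
	then have "ht x < 1 / real (Suc i) \<or> ht x > 2 / real (Suc i)" using False by (auto simp: Q_def)
	then have "e i x <= 0 \<or> e i x >= 1" unfolding e_def by (auto simp: field_simps simp del: of_nat_Suc)
	then have "stp' (e i x) = 0" by (rule stp'_eq_0)
	then have "dze i x = 0" by (simp add: dze_def)
	then show ?thesis using B(1) L(1) by simp
qed
have iQ: "Li (%x. ind (Q i) x * abs (u x))" for i
proof -
	have "sqi (%x. ind (Q i) x *R (1::real))"
		by (rule sqi_bounded_compact[OF _ compact_cball[of p "r/4"], of _ 1]) (auto simp: ind_def Q_def)
	from integrable_abs[OF i_mult[OF this u(1)]] show ?thesis by (simp add: abs_mult)
qed
have i2: "Li (%x. u x * (ps x * (dze i x *. h)))" for i
proof (rule ibound)
	show "Li (%x. ?c * (ind (Q i) x * abs (u x) * real (Suc i)))" using iQ by simp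
	show "AE x in lborel. norm (u x * (ps x * (dze i x *. h))) <= norm (?c * (ind (Q i) x * abs (u x) * real (Suc i)))"
		using pt by (intro AE_I2) (simp only: real_norm_def, rule order_trans[OF _ abs_ge_self])
qed measurable
have l2: "(%i. LI x. u x * (ps x * (dze i x *. h))) ----> 0"
proof (rule Lim_null_comparison)
	show "\<forall>\<^sub>F i in sequentially. norm (LI x. u x * (ps x * (dze i x *. h))) <= ?c * ((LI x. ind (Q i) x * abs (u x)) * real (Suc i))"
	proof (rule always_eventually, rule allI)
		fix i
		have "norm (LI x. u x * (ps x * (dze i x *. h))) <= (LI x. ?c * (ind (Q i) x * abs (u x) * real (Suc i)))"
			by (rule LI_le[OF i2]) (use iQ pt in \<open>auto simp del: of_nat_Suc\<close>)
		then show "norm (LI x. u x * (ps x * (dze i x *. h))) <= ?c * ((LI x. ind (Q i) x * abs (u x)) * real (Suc i))" by simp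
	qed
	have "(%i. ?c * ((LI x. ind (Q i) x * abs (u x)) * real (Suc i))) ----> ?c * 0"
		using strip_mean_tendsto[OF u w oP tr] unfolding Q_def by (intro tendsto_mult tendsto_const)
	then show "(%i. ?c * ((LI x. ind (Q i) x * abs (u x)) * real (Suc i))) ----> 0" by simp
qed
have i1: "Li (%x. u x * (ze i x * (D x *. h)))" for i
	by (rule ibound[OF iuD])
		(use ze01 in \<open>auto simp: abs_mult intro!: AE_I2 mlm mult_left_le_one_le\<close>)
have "(LI x. u x * ((ps x *R dze i x + ze i x *R D x) *. h)) =
	(LI x. u x * (ps x * (dze i x *. h))) + (LI x. u x * (ze i x * (D x *. h)))" for i
	using i1 i2 by (simp add: ial distrib_left)
then have E': "(LI x. u x * (ps x * (dze i x *. h))) + (LI x. u x * (ze i x * (D x *. h))) = - (LI x. (G x *. h) * (ps x * ze i x))" for i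
	using E[of i] by (simp only: )
have "(%i. (LI x. u x * (ps x * (dze i x *. h))) + (LI x. u x * (ze i x * (D x *. h)))) ----> 0 + (LI x. u x * (D x *. h))"
	by (rule tendsto_add[OF l2 l1])
moreover have "(%i. (LI x. u x * (ps x * (dze i x *. h))) + (LI x. u x * (ze i x * (D x *. h)))) ----> - (LI x. (G x *. h) * ps x)"
	unfolding E' by (rule tendsto_minus[OF l3])
ultimately show "(LI x. u x * (D x *. h)) = - (LI x. (G x *. h) * ps x)"
	using LIMSEQ_unique by fastforce
qed

end

section \<open>Functions vanishing on one side of a slit\<close>

lemma interval_cutoff:
fixes de c :: real
assumes de: "de > 0"
obtains a Da where "c1 a Da" "!!x. Da x *. n = stp' ((1 / de^2) * ((x - q) *. e - c)^2 - 1) * ((1 / de^2) * (2 * ((x - q) *. e - c) * (e *. n)))"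
	"!!x. 0 <= a x" "!!x. a x <= 1" "!!x. abs ((x - q) *. e - c) <= de ==> a x = 1"
	"!!x. a x ~= 0 ==> (abs ((x - q) *. e - c)) < 3/2 * de"
proof -
let ?s = "%x. (x - q) *. e - c"
let ?f = "%x. (1 / de^2) * (?s x * ?s x) - 1"
have "c1 ?f (%x. (1 / de^2) *R (?s x *R (e - 0) + ?s x *R (e - 0)) - 0)"
	by (intro c1_diff c1_scale c1_mult c1_inner c1_const)
note c = c1_stp[OF this]
have f1: "?f x <= 0" if "abs (?s x) <= de" for x
proof -
	have "abs (?s x)^2 <= de^2" by (rule power_mono[OF that]) simp
	then have "(?s x)^2 / de^2 <= 1" using de by (simp add: divide_le_eq_1)
	then show ?thesis by (simp add: p2eq)
qed
have f2: "?f x >= 1" if "\<not> (abs (?s x)) < 3/2 * de" for x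
proof -
	have "(3/2 * de)^2 <= abs (?s x)^2" using that de by (intro power_mono) auto
	then have "9/4 * de^2 <= (?s x)^2" by (simp add: pmd power_divide)
	moreover have d2: "de^2 > 0" using de by simp
	ultimately have "2 * de^2 <= (?s x)^2" by linarith
	then have "2 <= (?s x)^2 / de^2" using d2 by (simp add: le_divide_eq)
	then show ?thesis by (simp add: p2eq)
qed
show thesis
proof (rule that[OF c])
	show "(stp' (?f x) *R ((1 / de^2) *R (?s x *R (e - 0) + ?s x *R (e - 0)) - 0)) *. n =
		stp' ((1 / de^2) * (?s x)^2 - 1) * ((1 / de^2) * (2 * ?s x * (e *. n)))" for x
		by (simp add: p2eq ial idl)
	show "0 <= stp (?f x)" "stp (?f x) <= 1" for x by (rule stp_bounds)+
	show "stp (?f x) = 1" if "abs (?s x) <= de" for x by (rule stp_eq_1[OF f1[OF that]])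
	show "abs (?s x) < 3/2 * de" if "stp (?f x) ~= 0" for x using that stp_eq_0[OF f2] by blast
qed
qed

text \<open>\<open>h\<close> vanishes on the side \<open>y <= 0\<close> of the wall, but it is
  weakly differentiable only off the window \<open>|s| <= ep\<close> of the wall, so
  \<open>transport\<close> straight across the window is impossible. The way leads around it: across
  the wall at heights between \<open>3 * ep\<close> and \<open>9 * ep\<close>, starting where
  \<open>h\<close> is zero, and then parallel to the wall down to the window, on the side
  \<open>y > 0\<close> only.\<close>

lemma window_poincare:
fixes h :: "R2 => real" and q :: "R2" and sg :: real
defines "y \<equiv> %x. (x - q) *. (sg, 0)" and "s \<equiv> %x. (x - q) *. (0, 1)"
assumes w: "wgrad W h G" and W: "open W" and u: "sqi h" "sqi G" and sg: "sg = 1 \<or> sg = - 1"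
	and hz: "!!x. x : ball q R ==> y x <= 0 ==> h x = 0"
	and Wb: "!!x. x : ball q R ==> y x ~= 0 \<or> (abs (s x)) > ep ==> x : W"
	and ep: "ep > 0" "30 * ep < R"
shows "(LI x. ind {x. abs (y x) <= 3 * ep & abs (s x) <= 3 * ep} x * (h x)^2) <=
	25000 * ep^2 * (LI x. ind (cball q (30 * ep)) x * (norm (G x))^2)"
proof -
let ?e1 = "(sg, 0) :: R2" and ?e2 = "(0, 1) :: R2"
let ?g = "LI x. ind (cball q (30 * ep)) x * (norm (G x))^2"
have sg2: "sg * sg = 1" using sg by auto
have ne: "norm ?e1 = 1" "norm (- ?e2) = 1" using sg by (auto simp: norm_Pair)
have [measurable]: "h : BB" "G : BB" using u by (auto intro: sqi_m)
have [measurable]: "y : BB" "s : BB"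
	unfolding y_def s_def by (auto intro!: bmc continuous_intros)
have nle: "norm (x - q) <= abs (y x) + abs (s x)" for x
proof -
	obtain a b where ab: "x - q = (a, b)" by (cases "x - q")
	have "norm (a, b) <= norm a + norm b" by (simp add: norm_Pair sqrt_sum_squares_le_sum_abs)
	then show ?thesis using sg by (auto simp: y_def s_def ab)
qed
have near: "x : cball q (30 * ep)" if "abs (y x) <= 16 * ep" "abs (s x) <= 10 * ep" for x
	using nle[of x] that ep(1) by (simp add: dist_norm nmc)
have inball: "x : cball q (30 * ep) ==> x : ball q R" for x using ep(2) by simp
have ih: "Li (%x. (h x)^2)" using sqi_i[OF u(1)] by simp
have ihf: "Li (%x. (h x)^2 * f x)" if [measurable]: "f : BB" and "!!x. 0 <= f x" "!!x. f x <= 1" for f :: "_ => real"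
	by (rule ibound[OF ih]) (use that in \<open>auto simp: abs_mult intro!: AE_I2 mult_left_le\<close>)
have d1: "2 * ep > 0" using ep by simp
\<comment> \<open>The profile of the crossing equals 1 for \<open>4 * ep <= s <= 8 * ep\<close>, the
  initial layer of the second motion, and its support stays above the window.\<close>
obtain a Da where a: "c1 a Da" "!!x. Da x *. ?e1 = stp' ((1 / (2 * ep)^2) * ((x - q) *. ?e2 - 6 * ep)^2 - 1) * ((1 / (2 * ep)^2) * (2 * ((x - q) *. ?e2 - 6 * ep) * (?e2 *. ?e1)))"
	"!!x. 0 <= a x" "!!x. a x <= 1" "!!x. abs ((x - q) *. ?e2 - 6 * ep) <= 2 * ep ==> a x = 1"
	"!!x. a x ~= 0 ==> (abs ((x - q) *. ?e2 - 6 * ep)) < 3/2 * (2 * ep)"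
	by (rule interval_cutoff[OF d1, of ?e1 q ?e2 "6 * ep"]) blast
have as: "3 * ep < s x & s x < 9 * ep" if "a x ~= 0" for x using a(6)[OF that] ep(1) unfolding s_def abs_less_iff by linarith
let ?K1 = "cball q (30 * ep) Int {x. 3 * ep <= s x}"
have scont: "continuous_on UNIV s" "continuous_on UNIV y" unfolding s_def y_def by (intro continuous_intros)+
have [measurable]: "a : BB" by (rule bmc[OF c1_cont[OF a(1)]])
have p1: "8 * ep > 0" "ep > 0" using ep by auto
have t1: "(LI x. (h x)^2 * (a x * ind {x. - ep <= y x & y x <= 8 * ep} x)) <=
		(2 * (8 * ep) + 2 * ep) ^ 3 / (8 * ep) * (LI x. ind ?K1 x * (norm (G x))^2) +
		2 * (2 * (8 * ep) + 2 * ep)^2 / ((8 * ep) * ep) * (LI x. (h x)^2 * (a x * ind {x. - 2 * ep <= y x & y x <= - ep} x))"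
	unfolding y_def
proof (rule transport[OF w W u ne(1) a(1) _ a(3) a(4) p1])
	show "Da x *. ?e1 = 0" for x unfolding a(2) by simp
	show "compact ?K1" by (intro compact_Int_closed compact_cball closed_Collect_le scont continuous_intros)
	show "?K1 <= W" using Wb inball ep(1) by fastforce
	fix x assume x: "a x ~= 0" "- 2 * ep <= (x - q) *. ?e1" "(x - q) *. ?e1 <= 2 * (8 * ep)"
	have "abs (y x) <= 16 * ep" using x(2,3) ep(1) unfolding y_def by linarith
	moreover have "abs (s x) <= 10 * ep" using as[OF x(1)] ep(1) by linarith
	ultimately show "x : ?K1" using near[of x] as[OF x(1)] by simp
qed
have z1: "(LI x. (h x)^2 * (a x * ind {x. - 2 * ep <= y x & y x <= - ep} x)) = 0"
proof (rule LINT_eq_0)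
	fix x
	show "(h x)^2 * (a x * ind {x. - 2 * ep <= y x & y x <= - ep} x) = 0"
	proof (cases "a x ~= 0 & - 2 * ep <= y x & y x <= - ep")
		case True
		have "abs (y x) <= 16 * ep" "abs (s x) <= 10 * ep" "y x <= 0" using as[of x] True ep(1) by linarith+
		then have "h x = 0" using hz[OF inball[OF near]] by blast
		then show ?thesis by simp
	qed auto
qed
have iG: "Li (%x. ind A x * (norm (G x))^2)" if "A : sets borel" for A
	using imi[OF _ sqi_i[OF u(2)], of A] that by simp
have gmono: "(LI x. ind A x * (norm (G x))^2) <= ?g" if "A <= cball q (30 * ep)" "A : sets borel" for A
	using that by (intro integral_mono iG) (auto simp: ind_def)
have g0: "?g >= 0" by (intro i_nn) auto
have mK1: "?K1 : sets borel" by measurable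
have e1: "(LI x. (h x)^2 * (a x * ind {x. - ep <= y x & y x <= 8 * ep} x)) <= 729 * ep^2 * ?g"
proof -
	have cc: "(2 * (8 * ep) + 2 * ep) ^ 3 / (8 * ep) = 729 * ep^2" using ep(1) by (simp add: power3_eq_cube p2eq)
	have le: "729 * ep^2 * (LI x. ind ?K1 x * (norm (G x))^2) <= 729 * ep^2 * ?g"
		using gmono[OF Int_lower1 mK1] by (intro mlm) auto
	show ?thesis using order_trans[OF t1[unfolded z1 cc mult_zero_right add_0_right] le] .
qed
\<comment> \<open>The profile of the second motion depends on \<open>y\<close> alone. It vanishes
  for \<open>y <= 1 / Suc i\<close>, to keep off the wall, and beyond \<open>4 * ep\<close>; the
  limit in \<open>i\<close> recovers all of \<open>y > 0\<close>.\<close>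
define b where "b i x = (1 - stp (real (Suc i) * y x - 1)) * stp ((1 / ep) * y x - 3)" for i x
have b01: "0 <= b i x" "b i x <= 1" for i x
	using stp_bounds[of "real (Suc i) * y x - 1"] stp_bounds[of "(1 / ep) * y x - 3"]
	unfolding b_def by (auto intro!: mult_le_one)
have cy: "c1 y (%x. ?e1)" unfolding y_def by (rule c1_inner)
have bsupp: "1 / real (Suc i) <= y x & y x <= 4 * ep" if "b i x ~= 0" for i x
proof (rule ccontr)
	assume "\<not> ?thesis"
	then consider "y x < 1 / real (Suc i)" | "y x > 4 * ep" by linarith
	then show False
	proof cases
		case 1
		then have "real (Suc i) * y x - 1 <= 0" by (simp add: field_simps del: of_nat_Suc)
		then show False using that by (simp add: b_def stp_eq_1 del: of_nat_Suc)
	next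
		case 2
		then have "(1 / ep) * y x - 3 >= 1" using ep(1) by (simp add: field_simps)
		then show False using that by (simp add: b_def stp_eq_0)
	qed
qed
have p2: "3 * ep > 0" "4 * ep > 0" using ep by auto
have step: "(LI x. (h x)^2 * (b i x * ind {x. - (3 * ep) <= s x & s x <= 4 * ep} x)) <= 25000 * ep^2 * ?g" for i
proof -
	let ?K2 = "cball q (30 * ep) Int {x. 1 / real (Suc i) <= y x}"
	have mK2: "?K2 : sets borel" by measurable
	have "c1 (%x. (1 - stp (real (Suc i) * y x - 1)) * stp ((1 / ep) * y x - 3))
		(%x. (1 - stp (real (Suc i) * y x - 1)) *R (stp' ((1 / ep) * y x - 3) *R ((1 / ep) *R ?e1 - 0)) +
			stp ((1 / ep) * y x - 3) *R (0 - stp' (real (Suc i) * y x - 1) *R (real (Suc i) *R ?e1 - 0)))"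
		by (intro c1_mult c1_diff c1_const c1_stp c1_scale cy)
	then obtain Db where b: "c1 (b i) Db" and Db: "!!x. Db x = (1 - stp (real (Suc i) * y x - 1)) *R (stp' ((1 / ep) * y x - 3) *R ((1 / ep) *R ?e1 - 0)) +
			stp ((1 / ep) * y x - 3) *R (0 - stp' (real (Suc i) * y x - 1) *R (real (Suc i) *R ?e1 - 0))"
		unfolding b_def[abs_def] by blast
	have [measurable]: "b i : BB" by (rule bmc[OF c1_cont[OF b]])
	have yn: "(x - q) *. (- ?e2) = - s x" for x unfolding s_def inner_minus_right ..
	have t2: "(LI x. (h x)^2 * (b i x * ind {x. - (4 * ep) <= - s x & - s x <= 3 * ep} x)) <=
		(2 * (3 * ep) + 2 * (4 * ep)) ^ 3 / (3 * ep) * (LI x. ind ?K2 x * (norm (G x))^2) +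
		2 * (2 * (3 * ep) + 2 * (4 * ep))^2 / ((3 * ep) * (4 * ep)) * (LI x. (h x)^2 * (b i x * ind {x. - 2 * (4 * ep) <= - s x & - s x <= - (4 * ep)} x))"
		unfolding yn[symmetric]
	proof (rule transport[OF w W u ne(2) b _ b01 p2])
		show "Db x *. (- ?e2) = 0" for x unfolding Db by (simp add: ial idl)
		show "compact ?K2" by (intro compact_Int_closed compact_cball closed_Collect_le scont continuous_intros)
		show "?K2 <= W"
		proof
			fix x assume x: "x : ?K2"
			have "0 < 1 / real (Suc i)" by simp
			also have "... <= y x" using x by blast
			finally have "y x ~= 0" by simp
			moreover have "x : ball q R" by (rule inball) (use x in blast)
			ultimately show "x : W" by (intro Wb disjI1)
		qed
		fix x assume x: "b i x ~= 0" "- 2 * (4 * ep) <= (x - q) *. (- ?e2)" "(x - q) *. (- ?e2) <= 2 * (3 * ep)"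
		have "0 < 1 / real (Suc i)" by simp
		then have "abs (y x) <= 16 * ep" using bsupp[OF x(1)] ep(1) by linarith
		moreover have "abs (s x) <= 10 * ep" using x(2,3) ep(1) unfolding yn by linarith
		ultimately show "x : ?K2" using near[of x] bsupp[OF x(1)] by blast
	qed
	\<comment> \<open>The constants of the two motions combine to
	  \<open>915 + 33 * 729 = 24972\<close>, rounded up to 25000.\<close>
	have c: "(2 * (3 * ep) + 2 * (4 * ep)) ^ 3 / (3 * ep) <= 915 * ep^2" "2 * (2 * (3 * ep) + 2 * (4 * ep))^2 / ((3 * ep) * (4 * ep)) <= 33"
		using ep(1) by (simp_all add: power3_eq_cube p2eq)
	have "(LI x. (h x)^2 * (b i x * ind {x. - 2 * (4 * ep) <= - s x & - s x <= - (4 * ep)} x)) <=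
		(LI x. (h x)^2 * (a x * ind {x. - ep <= y x & y x <= 8 * ep} x))"
	proof (rule integral_mono)
		show "Li (%x. (h x)^2 * (b i x * ind {x. - 2 * (4 * ep) <= - s x & - s x <= - (4 * ep)} x))"
			by (rule ihf) (use b01 in \<open>auto simp: ind_def\<close>)
		show "Li (%x. (h x)^2 * (a x * ind {x. - ep <= y x & y x <= 8 * ep} x))"
			by (rule ihf) (use a(3,4) in \<open>auto simp: ind_def\<close>)
		fix x
		have "b i x * ind {x. - 2 * (4 * ep) <= - s x & - s x <= - (4 * ep)} x <= a x * ind {x. - ep <= y x & y x <= 8 * ep} x"
		proof (cases "b i x ~= 0 & - 2 * (4 * ep) <= - s x & - s x <= - (4 * ep)")
			case True
			have "0 < 1 / real (Suc i)" by simp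
			then have "- ep <= y x" "y x <= 8 * ep" using bsupp[of i x] True ep(1) by linarith+
			moreover have "a x = 1" using True by (intro a(5)) (simp add: s_def abs_le_iff)
			ultimately show ?thesis using b01[of i x] by (simp add: ind_def)
		next
			case False
			then have "b i x * ind {x. - 2 * (4 * ep) <= - s x & - s x <= - (4 * ep)} x = 0" by (cases "b i x = 0") (simp_all add: ind_def)
			moreover have "0 <= a x * ind {x. - ep <= y x & y x <= 8 * ep} x" using a(3)[of x] by simp
			ultimately show ?thesis by (simp only: )
		qed
		then show "(h x)^2 * (b i x * ind {x. - 2 * (4 * ep) <= - s x & - s x <= - (4 * ep)} x) <= (h x)^2 * (a x * ind {x. - ep <= y x & y x <= 8 * ep} x)"
			by (intro mlm) auto
	qed
	also note e1
	finally have c2: "(LI x. (h x)^2 * (b i x * ind {x. - 2 * (4 * ep) <= - s x & - s x <= - (4 * ep)} x)) <= 729 * ep^2 * ?g" .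
	have c20: "0 <= (LI x. (h x)^2 * (b i x * ind {x. - 2 * (4 * ep) <= - s x & - s x <= - (4 * ep)} x))"
		using b01 by (intro i_nn AE_I2 mult_nonneg_nonneg) auto
	have c30: "0 <= (LI x. ind ?K2 x * (norm (G x))^2)" by (intro i_nn) auto
	have m1: "(2 * (3 * ep) + 2 * (4 * ep)) ^ 3 / (3 * ep) * (LI x. ind ?K2 x * (norm (G x))^2) <= 915 * ep^2 * ?g"
		by (rule mult_mono[OF c(1) gmono[OF Int_lower1 mK2] _ c30]) simp
	have m2: "2 * (2 * (3 * ep) + 2 * (4 * ep))^2 / ((3 * ep) * (4 * ep)) * (LI x. (h x)^2 * (b i x * ind {x. - 2 * (4 * ep) <= - s x & - s x <= - (4 * ep)} x)) <= 33 * (729 * ep^2 * ?g)"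
		by (rule mult_mono[OF c(2) c2 _ c20]) simp
	have eq: "{x. - (4 * ep) <= - s x & - s x <= 3 * ep} = {x. - (3 * ep) <= s x & s x <= 4 * ep}" by auto
	have "0 <= ep^2 * ?g" using g0 by simp
	then have "915 * ep^2 * ?g + 33 * (729 * ep^2 * ?g) <= 25000 * ep^2 * ?g" by simp
	from order_trans[OF order_trans[OF t2[unfolded eq] add_mono[OF m1 m2]] this] show ?thesis .
qed
have "(%i. LI x. (h x)^2 * (b i x * ind {x. - (3 * ep) <= s x & s x <= 4 * ep} x)) ---->
	(LI x. (h x)^2 * (stp ((1 / ep) * y x - 3) * ind {x. - (3 * ep) <= s x & s x <= 4 * ep & 0 < y x} x))"
proof (rule integral_dominated_convergence[OF _ _ ih])
	have stpm: "stp : BB"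
		using DERIV_isCont[OF stp_deriv] by (intro bmc continuous_at_imp_continuous_on) auto
	note [measurable] = stpm
	show "(%x. (h x)^2 * (stp ((1 / ep) * y x - 3) * ind {x. - (3 * ep) <= s x & s x <= 4 * ep & 0 < y x} x)) : borel_measurable lborel"
		by measurable
	show "(%x. (h x)^2 * (b i x * ind {x. - (3 * ep) <= s x & s x <= 4 * ep} x)) : borel_measurable lborel" for i
		unfolding b_def by measurable
	show "AE x in lborel. norm ((h x)^2 * (b i x * ind {x. - (3 * ep) <= s x & s x <= 4 * ep} x)) <= (h x)^2" for i
		using b01 by (intro AE_I2) (auto simp: ind_def abs_mult intro!: mult_left_le)
	show "AE x in lborel. (%i. (h x)^2 * (b i x * ind {x. - (3 * ep) <= s x & s x <= 4 * ep} x)) ---->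
		(h x)^2 * (stp ((1 / ep) * y x - 3) * ind {x. - (3 * ep) <= s x & s x <= 4 * ep & 0 < y x} x)"
	proof (rule AE_I2)
		fix x
		show "(%i. (h x)^2 * (b i x * ind {x. - (3 * ep) <= s x & s x <= 4 * ep} x)) ---->
		(h x)^2 * (stp ((1 / ep) * y x - 3) * ind {x. - (3 * ep) <= s x & s x <= 4 * ep & 0 < y x} x)"
		proof (cases "0 < y x")
			case True
			obtain m where m: "2 / y x <= real m" using real_arch_simple by blast
			have "b i x = stp ((1 / ep) * y x - 3)" if "m <= i" for i
			proof -
				have "2 / y x <= real (Suc i)" using m that by simp
				then have "real (Suc i) * y x - 1 >= 1" using True by (simp add: field_simps del: of_nat_Suc)
				then show ?thesis by (simp add: b_def stp_eq_0 del: of_nat_Suc)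
			qed
			then show ?thesis using True by (intro tendsto_eventually) (auto simp: eventually_sequentially ind_def intro!: exI[of _ m])
		next
			case False
			have "b i x = 0" for i
			proof -
				have "real (Suc i) * y x <= 0" using False by (simp add: mult_le_0_iff del: of_nat_Suc)
				then show ?thesis by (simp add: b_def stp_eq_1 del: of_nat_Suc)
			qed
			then show ?thesis using False by simp
		qed
	qed
qed
then have lim: "(LI x. (h x)^2 * (stp ((1 / ep) * y x - 3) * ind {x. - (3 * ep) <= s x & s x <= 4 * ep & 0 < y x} x)) <= 25000 * ep^2 * ?g"
	by (rule LIMSEQ_le_const2) (use step in blast)
have stpm: "stp : BB"
	using DERIV_isCont[OF stp_deriv] by (intro bmc continuous_at_imp_continuous_on) auto
note [measurable] = stpm
have "(LI x. ind {x. abs (y x) <= 3 * ep & abs (s x) <= 3 * ep} x * (h x)^2) <=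
	(LI x. (h x)^2 * (stp ((1 / ep) * y x - 3) * ind {x. - (3 * ep) <= s x & s x <= 4 * ep & 0 < y x} x))"
proof (rule integral_mono)
	show "Li (%x. ind {x. abs (y x) <= 3 * ep & abs (s x) <= 3 * ep} x * (h x)^2)"
		using ihf[of "ind {x. abs (y x) <= 3 * ep & abs (s x) <= 3 * ep}"] by (simp add: mult.commute)
	show "Li (%x. (h x)^2 * (stp ((1 / ep) * y x - 3) * ind {x. - (3 * ep) <= s x & s x <= 4 * ep & 0 < y x} x))"
		by (rule ihf) (auto simp: ind_def stp_bounds)
	fix x
	show "ind {x. abs (y x) <= 3 * ep & abs (s x) <= 3 * ep} x * (h x)^2 <= (h x)^2 * (stp ((1 / ep) * y x - 3) * ind {x. - (3 * ep) <= s x & s x <= 4 * ep & 0 < y x} x)"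
	proof (cases "abs (y x) <= 3 * ep & abs (s x) <= 3 * ep")
		case True
		then have xb: "x : ball q R" using ep(1) by (intro inball near) linarith+
		show ?thesis
		proof (cases "0 < y x")
			case True': True
			have "(1 / ep) * y x - 3 <= 0" using True ep(1) by (simp add: field_simps abs_le_iff)
			then have "stp ((1 / ep) * y x - 3) = 1" by (rule stp_eq_1)
			moreover have "- (3 * ep) <= s x & s x <= 4 * ep & 0 < y x" using True True' ep(1) by (simp add: abs_le_iff)
			ultimately show ?thesis by (simp add: ind_def)
		next
			case False
			then have "h x = 0" using hz[OF xb] by simp
			then show ?thesis by simp
		qed
	next
		case False
		then have "ind {x. abs (y x) <= 3 * ep & abs (s x) <= 3 * ep} x = (0::real)" by (simp add: ind_def)
		moreover have "0 <= (h x)^2 * (stp ((1 / ep) * y x - 3) * ind {x. - (3 * ep) <= s x & s x <= 4 * ep & 0 < y x} x)"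
			by (intro mult_nonneg_nonneg stp_bounds(1)) auto
		ultimately show ?thesis by (simp only: mult_zero_left)
	qed
qed
with lim show ?thesis by linarith
qed

section \<open>A logarithmic Hardy inequality\<close>

text \<open>The convolution of \<open>ps\<close> with the indicator of a large ball is constant near
  the origin. Its gradient at the origin is zero there, and \<open>c1_conv\<close> evaluates it as
  the integral of \<open>D\<close>.\<close>

lemma ctest_integral_zero:
fixes ps :: "'a::euclidean_space => real"
assumes t: "ctest UNIV ps D"
shows "(LI x. D x *. h) = 0"
proof -
obtain K where K: "compact K" "!!x. x ~: K ==> ps x = 0" "!!x. x ~: K ==> D x = 0" using ctestE[OF t] by metis
obtain R where R: "ALL x:K. norm x <= R" using compact_imp_bounded[OF K(1)] unfolding bounded_iff by blast
define u where "u = (%x::'a. ind (cball 0 (R + 1)) x *R (1::real))"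
have u: "sqi u" unfolding u_def by (rule sqi_cind) simp
have mD: "D : BB" "ps : BB" using ctest_sqi[OF t] by (auto intro: sqi_m)
have near: "u y = 1 \<or> x - y ~: K" if "norm x < 1" for x y
proof (rule disjCI)
	assume "\<not> x - y ~: K"
	then have "norm (x - y) <= R" using R by blast
	then have "norm y <= R + 1" using that norm_triangle_ineq4[of x "x - y"] by simp
	then show "u y = 1" by (simp add: u_def)
qed
have "conv ps u x = (LI y. ps y)" if "x : ball 0 1" for x
proof -
	have "conv ps u x = (LI y. ps (x - y))"
		unfolding conv_def
	proof (intro icong refl)
		fix y show "ps (x - y) *R u y = ps (x - y)" using near[of x y] K(2)[of "x - y"] that by auto
	qed
	also have "... = (LI y. ps y)" by (rule mp_int[OF mp_minus mD(2)])
	finally show ?thesis .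
qed
note const = this
have "(conv ps u has_derivative (%h. 0)) (at 0)"
proof (rule has_derivative_transform_within_open[OF has_derivative_const open_ball])
	show "0 : ball (0::'a) 1" by simp
	show "(LI y. ps y) = conv ps u x" if "x : ball 0 1" for x using const[OF that] by (rule sym)
qed
moreover have "(conv ps u has_derivative (%h. (LI y. u y *R D (0 - y)) *. h)) (at 0)"
	by (rule c1_der[OF c1_conv[OF t u]])
ultimately have "(%h. 0) = (%h. (LI y. u y *R D (0 - y)) *. h)" by (rule hdu)
from fun_cong[OF this, of h] have "0 = (LI y. u y *R D (0 - y)) *. h" .
also have "(LI y. u y *R D (0 - y)) = (LI y. D (0 - y))"
proof (intro icong refl)
	fix y show "u y *R D (0 - y) = D (0 - y)" using near[of 0 y] K(3)[of "0 - y"] by auto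
qed
also have "... = (LI y. D y)" by (rule mp_int[OF mp_minus mD(1)])
also have "(LI y. D y) *. h = (LI y. D y *. h)"
proof (rule integral_inner_left[symmetric])
	have "Li (%x. (ind K x *R (1::real)) *R D x)"
		by (rule i_scaleR[OF sqi_cind[OF K(1)] ctest_sqi(2)[OF t]])
	moreover have "(%x. (ind K x *R (1::real)) *R D x) = D" using K(3) by (auto simp: ind_def)
	ultimately show "Li D" by simp
qed
finally show ?thesis by simp
qed

lemma c1_compose_nonneg:
assumes f: "c1 f F" "!!x. 0 <= f x" and k: "!!t. 0 <= t ==> (k has_real_derivative k' t) (at t)" "continuous_on {0..} k'"
shows "c1 (%x. k (f x)) (%x. k' (f x) *R F x)"
proof -
have "((%x. k (f x)) has_derivative (%h. k' (f x) * (F x *. h))) (at x)" for x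
	using has_derivative_compose[OF c1_der[OF f(1)] k(1)[OF f(2), unfolded has_field_derivative_def]] .
moreover have "continuous_on UNIV (%x. k' (f x) *R F x)"
	using f(2) c1_cont[OF f(1)] c1_contD[OF f(1)]
	by (intro continuous_intros continuous_on_compose2[OF k(2)]) auto
ultimately show ?thesis by (simp add: c1_def)
qed

text \<open>For fixed \<open>R\<close> this grows like \<open>2 |ln r|\<close> as \<open>r\<close>
  tends to 0: the price in the plane for bounding the mass of a function in a disc of radius
  \<open>r\<close> by \<open>r^2\<close> times its Dirichlet integral. The factor 2 inside the
  logarithm is used in the sign condition of the Hardy inequality.\<close>

definition log_factor :: "real => real => real" where
"log_factor R r = 1 + ln (1 + 2 * R^2 / r^2)"

text \<open>The weight is the divergence of the vector field \<open>z(|x - q|\<^sup>2) (x - q)\<close>; the function \<open>z\<close>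
  solves, up to an error of the right sign, the Riccati equation for which completing the square
  costs exactly the available gradient.\<close>

lemma log_hardy:
fixes g :: "R2 => real"
assumes g: "c1 g Dg" "!!x. x ~: cball q R ==> g x = 0" and r: "0 < r" "r <= R"
shows "(LI x. ind (cball q r) x * (g x)^2) <= 2 * (r^2 * log_factor R r) * N2 Dg"
proof -
define A where "A = r^2 * log_factor R r"
define l where "l t = 1 + ln (1 + 2 * R^2 / (t + r^2))" for t
define z where "z t = A / ((t + r^2) * l t)" for t
define z' where "z' t = - (A * (l t - 2 * R^2 / (t + r^2 + 2 * R^2)) / ((t + r^2) * l t)^2)" for t
have R: "R > 0" using r by simp
have r2: "r^2 > 0" and R2: "R^2 > 0" using r R by auto
have lpos: "l t >= 1" if "t >= 0" for t using that r2 R2 by (simp add: l_def)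
have A: "A > 0" using r2 R2 by (auto simp: A_def log_factor_def intro!: mult_pos_pos add_pos_nonneg)
have lA: "r^2 * l t <= A" if "t >= 0" for t
proof -
	have "1 + 2 * R^2 / (t + r^2) <= 1 + 2 * R^2 / r^2" using that r2 R2 by (intro add_left_mono divide_left_mono) (auto intro!: mult_pos_pos add_nonneg_pos)
	then have "ln (1 + 2 * R^2 / (t + r^2)) <= ln (1 + 2 * R^2 / r^2)"
		using that r2 R2 by (intro ln_mono) (auto intro: add_pos_nonneg)
	then show ?thesis using r2 by (simp add: A_def l_def log_factor_def)
qed
have dl: "(l has_real_derivative - (2 * R^2 / ((t + r^2) * (t + r^2 + 2 * R^2)))) (at t)" if "t >= 0" for t
proof -
	have T: "t + r^2 > 0" by (rule add_nonneg_pos[OF that r2])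
	have p: "1 + 2 * R^2 / (t + r^2) > 0" using T R2 by (auto intro: add_pos_nonneg)
	have h1: "(l has_real_derivative (- (2 * R^2) / (t + r^2)^2) / (1 + 2 * R^2 / (t + r^2))) (at t)"
		unfolding l_def[abs_def] using T p by (auto intro!: derivative_eq_intros simp: p2eq)
	have h2: "(- (2 * R^2) / (t + r^2)^2) / (1 + 2 * R^2 / (t + r^2)) = - (2 * R^2 / ((t + r^2) * (t + r^2 + 2 * R^2)))"
	proof -
		define T' where "T' = t + r^2"
		define S where "S = 2 * R^2"
		have "T' > 0" "S > 0" using T R2 by (auto simp: T'_def S_def)
		then have "(- S / T'^2) / (1 + S / T') = - (S / (T' * (T' + S)))"
			by (simp add: field_simps p2eq)
		then show ?thesis unfolding T'_def S_def .
	qed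
	show ?thesis using h1 unfolding h2 .
qed
have dz: "(z has_real_derivative z' t) (at t)" if t: "t >= 0" for t
proof -
	have T: "t + r^2 > 0" by (rule add_nonneg_pos[OF t r2])
	have l1: "l t > 0" using lpos[OF t] by simp
	have "(z has_real_derivative - (A * (l t + (t + r^2) * - (2 * R^2 / ((t + r^2) * (t + r^2 + 2 * R^2)))) / ((t + r^2) * l t)^2)) (at t)"
		unfolding z_def[abs_def] using T l1 by (auto intro!: derivative_eq_intros dl[OF t] simp: p2eq)
	moreover have "(t + r^2) * - (2 * R^2 / ((t + r^2) * (t + r^2 + 2 * R^2))) = - (2 * R^2 / (t + r^2 + 2 * R^2))"
		using T by simp
	ultimately show ?thesis by (simp add: z'_def)
qed
have cl: "continuous_on {0..} l" using dl by (meson DERIV_isCont atLeast_iff continuous_at_imp_continuous_on)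
have cz': "continuous_on {0..} z'"
proof -
	have n: "t + r^2 + 2 * R^2 ~= 0" "((t + r^2) * l t)^2 ~= 0" if "t : {0..}" for t
	proof -
		have t: "0 <= t" using that by simp
		have T: "t + r^2 > 0" by (rule add_nonneg_pos[OF t r2])
		show "t + r^2 + 2 * R^2 ~= 0" using T R2 by linarith
		show "((t + r^2) * l t)^2 ~= 0" using T lpos[OF t] by simp
	qed
	show ?thesis unfolding z'_def[abs_def] by (intro continuous_intros cl ballI n)
qed
let ?N = "%x. (x - q) *. (x - q)"
have N0: "?N x >= 0" for x by simp
note cz = c1_compose_nonneg[OF c1_norm2 N0 dz cz']
define Dt where "Dt e x = (g x * g x) *R (z (?N x) *R e + ((x - q) *. e) *R (z' (?N x) *R (2 *R (x - q)))) + (z (?N x) * ((x - q) *. e)) *R (g x *R Dg x + g x *R Dg x)" for e x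
have ct: "ctest UNIV (%x. (g x * g x) * (z (?N x) * ((x - q) *. e))) (Dt e)" for e
	unfolding ctest_def
proof (intro conjI exI[of _ "cball q R"] allI impI)
	show "c1 (%x. (g x * g x) * (z (?N x) * ((x - q) *. e))) (Dt e)"
		unfolding Dt_def[abs_def] by (intro c1_mult g(1) cz c1_inner)
qed (use g(2) in auto)
let ?e1 = "(1, 0) :: R2" and ?e2 = "(0, 1) :: R2"
\<comment> \<open>The divergence of \<open>g^2\<close> times the radial field, in both coordinate
  directions; its integral is zero.\<close>
define S where "S x = Dt ?e1 x *. ?e1 + Dt ?e2 x *. ?e2" for x
have iDt: "Li (%x. Dt e x *. e)" for e
proof -
	have "Li (%x. (ind (cball q R) x *R e) *. Dt e x)"
		by (rule i_inner[OF sqi_cind ctest_sqi(2)[OF ct]]) simp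
	moreover have "(%x. (ind (cball q R) x *R e) *. Dt e x) = (%x. Dt e x *. e)"
	proof
		fix x show "(ind (cball q R) x *R e) *. Dt e x = Dt e x *. e"
			using g(2)[of x] by (cases "x : cball q R") (simp_all add: inner_commute Dt_def)
	qed
	ultimately show ?thesis by simp
qed
have S0: "(LI x. S x) = 0" and iS: "Li S"
	unfolding S_def[abs_def] using ctest_integral_zero[OF ct] iDt by simp_all
have Sx: "S x = (g x)^2 * (2 * z (?N x) + 2 * z' (?N x) * ?N x) + 2 * (g x * z (?N x) * (Dg x *. (x - q)))" for x
proof -
	obtain a b where ab: "x - q = (a, b)" by (cases "x - q")
	obtain c d where cd: "Dg x = (c, d)" by (cases "Dg x")
	show ?thesis unfolding S_def Dt_def ab cd by (simp add: p2eq algebra_simps)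
qed
have alg: "(if t <= r^2 then 1/2 else 0) <= 2 * z t + 2 * z' t * t - (z t)^2 * t / A" if t: "0 <= t" "t <= R^2" for t
proof -
	define T where "T = t + r^2"
	have "r^2 <= R^2" using r by (intro power_mono) auto
	then have T: "T > 0" "T <= 2 * R^2" using t r2 unfolding T_def by linarith+
	define L where "L = l t"
	have L: "L >= 1" "r^2 * L <= A" using lpos[OF t(1)] lA[OF t(1)] by (auto simp: L_def)
	define W where "W = 2 * R^2 / (T + 2 * R^2)"
	\<comment> \<open>This is the sign of the error in the Riccati equation:
	  \<open>T <= 2 * R^2\<close> for all points of the disc of radius \<open>R\<close>, so the term
	  \<open>(2 * W - 1) * t\<close> helps.\<close>
	have W: "2 * W >= 1" using T R2 by (simp add: W_def field_simps)
	have zt: "z t = A / (T * L)" by (simp add: z_def T_def L_def)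
	have z't: "z' t = - (A * (L - W) / (T * L)^2)" by (simp add: z'_def T_def L_def W_def)
	have "2 * z t + 2 * z' t * t - (z t)^2 * t / A = (A / (T * L)^2) * (2 * T * L - 2 * (L - W) * t - t)"
		unfolding zt z't using T(1) L(1) A by (simp add: field_simps p2eq)
	also have "2 * T * L - 2 * (L - W) * t - t = 2 * r^2 * L + (2 * W - 1) * t" by (simp add: T_def algebra_simps)
	finally have eq: "2 * z t + 2 * z' t * t - (z t)^2 * t / A = (A / (T * L)^2) * (2 * r^2 * L + (2 * W - 1) * t)" .
	have nn: "(2 * W - 1) * t >= 0" using W t by simp
	have AT: "A / (T * L)^2 >= 0" using A by simp
	show ?thesis
	proof (cases "t <= r^2")
		case True
		then have T2: "T <= 2 * r^2" by (simp add: T_def)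
		have "(T * L)^2 <= (2 * r^2 * L)^2" using T T2 L by (intro power_mono mrm) auto
		also have "... = 4 * r^2 * L * (r^2 * L)" by (simp add: p2eq)
		also have "... <= 4 * r^2 * L * A" using L r2 by (intro mlm) auto
		finally have "(T * L)^2 <= 2 * (A * (2 * r^2 * L))" by (simp add: mult_ac)
		then have "1 / 2 <= (A * (2 * r^2 * L)) / (T * L)^2" using T L by (simp add: field_simps)
		also have "... = (A / (T * L)^2) * (2 * r^2 * L)" by simp
		also have "... <= (A / (T * L)^2) * (2 * r^2 * L + (2 * W - 1) * t)" using AT nn by (intro mlm) auto
		finally show ?thesis unfolding eq using True by simp
	next
		case False
		have "0 <= (A / (T * L)^2) * (2 * r^2 * L + (2 * W - 1) * t)" 
		proof (rule mult_nonneg_nonneg[OF AT add_nonneg_nonneg[OF _ nn]])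
			show "0 <= 2 * r^2 * L" using L(1) by simp
		qed
		then show ?thesis unfolding eq using False by simp
	qed
qed
have zero_D: "Dg x = 0" if "x ~: cball q R" for x
proof -
	have "ctest UNIV g Dg" unfolding ctest_def using g by (intro conjI exI[of _ "cball q R"]) auto
	have "(g has_derivative (%h. 0)) (at x)"
		by (rule has_derivative_transform_within_open[of "%_. 0" _ _ _ "- cball q R"]) (use that g(2) in auto)
	from hdu[OF c1_der[OF g(1)] this] have "Dg x *. Dg x = 0" by (rule fun_cong)
	then show ?thesis by simp
qed
have sqD: "sqi Dg" by (rule sqi_continuous[OF c1_contD[OF g(1)] compact_cball zero_D])
have sqg: "sqi g" by (rule sqi_continuous[OF c1_cont[OF g(1)] compact_cball g(2)])
have pt: "ind (cball q r) x * (g x)^2 <= 2 * S x + 2 * A * (norm (Dg x))^2" for x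
proof (cases "x : cball q R")
	case True
	define t where "t = ?N x"
	have nt: "(norm (x - q))^2 = t" by (simp add: t_def power2_norm_eq_inner)
	have t: "0 <= t" "t <= R^2"
		using True R power_mono[of "norm (x - q)" R 2] by (auto simp: nt[symmetric] dist_norm nmc)
	have ind: "ind (cball q r) x <= (if t <= r^2 then 1 else 0 :: real)"
	proof (cases "x : cball q r")
		case True
		then have "t <= r^2" using power_mono[of "norm (x - q)" r 2] by (simp add: nt[symmetric] dist_norm nmc)
		then show ?thesis by simp
	qed simp
	\<comment> \<open>Completing the square, with \<open>A\<close> the weight of the gradient: the loss
	  is exactly the term \<open>z^2 t / A\<close> kept in \<open>alg\<close>.\<close>
	have yng: "- (2 * (g x * z t * (Dg x *. (x - q)))) <= (g x)^2 * ((z t)^2 * t / A) + A * (norm (Dg x))^2"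
	proof -
		have "abs (Dg x *. (x - q)) <= norm (Dg x) * sqrt t" using CS2[of "Dg x" "x - q"] by (simp add: nt[symmetric])
		then have "abs (g x * z t) * abs (Dg x *. (x - q)) <= abs (g x * z t) * (norm (Dg x) * sqrt t)" by (intro mlm) auto
		moreover have "- (g x * z t * (Dg x *. (x - q))) <= abs (g x * z t) * abs (Dg x *. (x - q))"
			using abs_ge_minus_self[of "g x * z t * (Dg x *. (x - q))"] by (simp only: abs_mult)
		ultimately have "- (2 * (g x * z t * (Dg x *. (x - q)))) <= 2 * (abs (g x * z t) * (norm (Dg x) * sqrt t))" by linarith
		also have "... = 2 * (abs (g x * z t) * sqrt t / sqrt A) * (sqrt A * norm (Dg x))" using A by simp
		also have "... <= (abs (g x * z t) * sqrt t / sqrt A)^2 + (sqrt A * norm (Dg x))^2" by (rule sum_squares_bound)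
		also have "... = (g x)^2 * ((z t)^2 * t / A) + A * (norm (Dg x))^2"
			using A t by (simp add: pmd power_divide)
		finally show ?thesis .
	qed
	have "ind (cball q r) x * (g x)^2 <= (2 * (2 * z t + 2 * z' t * t - (z t)^2 * t / A)) * (g x)^2"
	proof (rule mrm)
		define E where "E = 2 * z t + 2 * z' t * t - (z t)^2 * t / A"
		have "(if t <= r^2 then 1/2 else 0) <= E" using alg[OF t] by (simp only: E_def)
		then have "(if t <= r^2 then 1 else 0) <= 2 * E" by (simp split: if_splits)
		then show "ind (cball q r) x <= 2 * (2 * z t + 2 * z' t * t - (z t)^2 * t / A)" using ind unfolding E_def[symmetric] by linarith
	qed simp
	also have "... = 2 * ((g x)^2 * (2 * z t + 2 * z' t * t)) - 2 * ((g x)^2 * ((z t)^2 * t / A))"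
		by (simp add: algebra_simps)
	also have "... <= 2 * S x + 2 * A * (norm (Dg x))^2"
		using yng unfolding Sx t_def[symmetric] by simp
	finally show ?thesis .
next
	case False
	then have "x ~: cball q r" using r by auto
	moreover have "S x = 0" unfolding Sx using g(2)[OF False] by simp
	ultimately show ?thesis using A by simp
qed
have "(LI x. ind (cball q r) x * (g x)^2) <= (LI x. 2 * S x + 2 * A * (norm (Dg x))^2)"
proof (rule integral_mono)
	show "Li (%x. ind (cball q r) x * (g x)^2)"
		using imi[OF _ sqi_i[OF sqg], of "cball q r"] by simp
	show "Li (%x. 2 * S x + 2 * A * (norm (Dg x))^2)" using iS sqi_i[OF sqD] by simp
qed (rule pt)
also have "... = 2 * A * N2 Dg" using iS sqi_i[OF sqD] S0 by (simp add: N2_def)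
finally show ?thesis by (simp add: A_def)
qed

section \<open>Interior regularity\<close>

lemma integrable_convolution_kernel:
fixes w :: "'a::euclidean_space => real"
assumes k: "Li k" "!!x. 0 <= k x" and w: "Li w" "!!x. 0 <= w x"
shows "integrable (lborel \<Otimes>\<^sub>M lborel) (%(x, y). k (x - y) * w y)"
proof (rule integrableI_bounded)
have [measurable]: "k : BB" "w : BB" using k(1) w(1) by auto
show m: "(%(x, y). k (x - y) * w y) : borel_measurable (lborel \<Otimes>\<^sub>M lborel)" by measurable
have one: "(\<integral>\<^sup>+x. ennreal (k (x - y)) \<partial>lborel) = ennreal (LI x. k x)" for y
proof -
	have "(\<integral>\<^sup>+x. ennreal (k (- y + x)) \<partial>lborel) = ennreal (LI x. k (- y + x))"
		using k by (intro nn_integral_eq_integral measure_pres_integrable[OF mp_plus]) auto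
	also have "(LI x. k (- y + x)) = (LI x. k x)" by (rule mp_int[OF mp_plus]) measurable
	finally show ?thesis by simp
qed
have "(\<integral>\<^sup>+z. ennreal (norm (case z of (x, y) => k (x - y) * w y)) \<partial>(lborel \<Otimes>\<^sub>M lborel)) =
	(\<integral>\<^sup>+y. (\<integral>\<^sup>+x. ennreal (k (x - y) * w y) \<partial>lborel) \<partial>lborel)"
	using k(2) w(2) by (subst lborel_pair.nn_integral_snd[symmetric]) (auto simp: abs_mult)
also have "... = (\<integral>\<^sup>+y. ennreal (LI x. k x) * ennreal (w y) \<partial>lborel)"
proof (rule nn_integral_cong)
	fix y
	have "(\<integral>\<^sup>+x. ennreal (k (x - y) * w y) \<partial>lborel) = (\<integral>\<^sup>+x. ennreal (k (x - y)) * ennreal (w y) \<partial>lborel)"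
		using k(2) w(2) by (intro nn_integral_cong) (simp add: ennreal_mult)
	also have "... = ennreal (LI x. k x) * ennreal (w y)" by (subst nn_integral_multc) (auto simp: one)
	finally show "(\<integral>\<^sup>+x. ennreal (k (x - y) * w y) \<partial>lborel) = ennreal (LI x. k x) * ennreal (w y)" .
qed
also have "... = ennreal (LI x. k x) * ennreal (LI y. w y)"
	using w by (subst nn_integral_cmult) (auto simp: nn_integral_eq_integral)
also have "... < \<infinity>" by (simp add: ennreal_mult_less_top)
finally show "(\<integral>\<^sup>+z. ennreal (norm (case z of (x, y) => k (x - y) * w y)) \<partial>(lborel \<Otimes>\<^sub>M lborel)) < \<infinity>" .
qed

text \<open>Fubini's theorem; the integrand is dominated by the sum of two integrable convolution
  kernels, one for each squared norm.\<close>

lemma conv_adjoint: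
fixes f g :: "'a::euclidean_space => 'b::euclidean_space"
assumes k: "test_function UNIV k" and f: "sqi f" and g: "sqi g"
shows "(LI x. conv k f x *. g x) = (LI y. f y *. conv (%z. k (- z)) g y)"
proof -
note t = tf_ctest[OF k]
have [measurable]: "k : BB" "f : BB" "g : BB"
	using ctest_sqi(1)[OF t] f g by (auto intro: sqi_m)
obtain K where K: "compact K" "!!x. x ~: K ==> k x = 0" using ctestE[OF t] by metis
have ik: "Li (%x. abs (k x))"
proof -
	have "Li (%x. (ind K x *R (1::real)) * abs (k x))"
		using integrable_abs[OF i_mult[OF sqi_cind[OF K(1), of "1::real"] ctest_sqi(1)[OF t]]] by (simp add: abs_mult)
	moreover have "(%x. (ind K x *R (1::real)) * abs (k x)) = (%x. abs (k x))"
	proof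
		fix x show "(ind K x *R (1::real)) * abs (k x) = abs (k x)" using K(2)[of x] by (cases "x : K") simp_all
	qed
	ultimately show ?thesis by simp
qed
have ik': "Li (%x. abs (k (- x)))"
	using measure_pres_integrable[OF mp_minus[of 0] ik] by simp
have kb: "abs (a *. b) <= (norm a)^2 + (norm b)^2" for a b :: 'b
	using CS2[of a b] sum_squares_bound[of "norm a" "norm b"]
	mult_nonneg_nonneg[OF norm_ge_zero[of a] norm_ge_zero[of b]] by linarith
have i1: "integrable (lborel \<Otimes>\<^sub>M lborel) (%(x, y). abs (k (x - y)) * (norm (f y))^2)"
	by (rule integrable_convolution_kernel[OF ik _ sqi_i[OF f]]) auto
have "integrable (lborel \<Otimes>\<^sub>M lborel) (%(x, y). abs (k (- (x - y))) * (norm (g y))^2)"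
	by (rule integrable_convolution_kernel[OF ik' _ sqi_i[OF g]]) auto
from lborel_pair.integrable_product_swap[OF this]
have i2: "integrable (lborel \<Otimes>\<^sub>M lborel) (%(x, y). abs (k (x - y)) * (norm (g x))^2)" by (simp add: split_beta')
have int: "integrable (lborel \<Otimes>\<^sub>M lborel) (%(x, y). k (x - y) * (f y *. g x))"
proof (rule ibound[OF Bochner_Integration.integrable_add[OF i1 i2]])
	show "AE z in lborel \<Otimes>\<^sub>M lborel. norm (case z of (x, y) => k (x - y) * (f y *. g x)) <=
		norm ((case z of (x, y) => (abs (k (x - y))) * (norm (f y))^2) + (case z of (x, y) => (abs (k (x - y))) * (norm (g x))^2))"
	proof (rule AE_I2)
		fix z :: "'a \<times> 'a"
		obtain x y where z: "z = (x, y)" by (cases z)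
		have "abs (k (x - y)) * abs (f y *. g x) <= abs (k (x - y)) * ((norm (f y))^2 + (norm (g x))^2)" by (intro mlm kb) auto
		then show "norm (case z of (x, y) => k (x - y) * (f y *. g x)) <=
			norm ((case z of (x, y) => (abs (k (x - y))) * (norm (f y))^2) + (case z of (x, y) => (abs (k (x - y))) * (norm (g x))^2))"
			unfolding z by (simp add: abs_mult distrib_left)
	qed
qed measurable
have "(LI x. conv k f x *. g x) = (LI x. (LI y. k (x - y) * (f y *. g x)))"
proof (intro icong refl)
	fix x
	have "Li (%y. k (x - y) *R f y)" by (intro i_scaleR f mp_sqi[OF mp_minus] ctest_sqi(1)[OF t])
	then have "conv k f x *. g x = (LI y. (k (x - y) *R f y) *. g x)" unfolding conv_def by (intro integral_inner_left[symmetric])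
	then show "conv k f x *. g x = (LI y. k (x - y) * (f y *. g x))" by simp
qed
also have "... = (LI y. (LI x. k (x - y) * (f y *. g x)))"
	using lborel_pair.Fubini_integral[OF int] by simp
also have "... = (LI y. f y *. conv (%z. k (- z)) g y)"
proof (intro icong refl)
	fix y
	have "Li (%x. k (- y + x) *R g x)" by (intro i_scaleR g mp_sqi[OF mp_plus] ctest_sqi(1)[OF t])
	then have "f y *. conv (%z. k (- z)) g y = (LI x. f y *. (k (- (y - x)) *R g x))" unfolding conv_def by (intro integral_inner_right[symmetric]) simp
	then show "(LI x. k (x - y) * (f y *. g x)) = f y *. conv (%z. k (- z)) g y" by simp
qed
finally show ?thesis .
qed

lemma conv_gradient_component:
assumes k: "test_function UNIV k" and u: "sqi u" and c: "c1 (conv k u) V" and e: "e : Basis"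
shows "V x *. e = conv (%z. fd k z e) u x"
proof -
define D where "D = (%x. \<Sum>e\<in>Basis. fd k x e *R e)"
have t: "ctest UNIV k D" unfolding D_def by (rule tf_ctest[OF k])
have De: "D z *. e = fd k z e" for z
	using e unfolding D_def by (simp add: inner_sum_left inner_Basis if_distrib cong: if_cong)
have "V x *. e = (LI y. u y *R D (x - y)) *. e"
	using fun_cong[OF hdu[OF c1_der[OF c] c1_der[OF c1_conv[OF t u]]]] .
also have "... = (LI y. (u y *R D (x - y)) *. e)"
	by (rule integral_inner_left[symmetric])
		(use i_scaleR[OF u mp_sqi[OF mp_minus ctest_sqi(2)[OF t]], of x] in simp)
also have "... = conv (%z. fd k z e) u x" unfolding conv_def by (simp add: De mult.commute)
finally show ?thesis .
qed

text \<open>For a weak solution of \<open>- Laplace U = F\<close> each derivative of the mollified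
  solution solves such an equation with a differentiated right-hand side. A Caccioppoli estimate
  bounds its gradient independently of the mollifier, the Hardy inequality turns this into the gain
  \<open>r^2 * log_factor R r\<close>, and the mollification is removed at the end.\<close>

lemma gradient_log_bound:
fixes U F :: "R2 => real"
assumes w: "wgrad (ball q R) U G" and sq: "sqi U" "sqi G" "sqi F"
	and weak: "!!ph D. ctest (ball q R) ph D ==> (LI x. G x *. D x) = (LI x. F x * ph x)"
	and r: "0 < r" "r < R / 4"
shows "(LI x. ind (cball q r) x * (norm (G x))^2) <= 8 * (r^2 * log_factor R r) * (8 * N2 F + 22 * ((24 / R)^2 * N2 G))"
proof -
have R: "R > 0" using r by simp
let ?A = "r^2 * log_factor R r"
let ?B = "8 * N2 F + 22 * ((24 / R)^2 * N2 G)"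
have A0: "?A >= 0" using R r by (auto simp: log_factor_def intro!: mult_nonneg_nonneg add_nonneg_nonneg)
have R2: "R / 2 > 0" using R by simp
obtain c C where c: "c1 c C" "!!y. y : ball q (R/2/2) ==> c y = 1" "!!y. y ~: cball q (3*(R/2)/4) ==> c y = 0"
	"!!y. 0 <= c y" "!!y. c y <= 1" "!!y. norm (C y) <= 12 / (R/2)" "!!y. y : ball q (R/2/2) ==> C y = 0"
	"!!y. y ~: cball q (3*(R/2)/4) ==> C y = 0"
	by (rule ball_cutoff[OF R2, of q]) (rule that)
let ?K = "cball q (3*(R/2)/4)"
have comp: "(LI x. ind (cball q r) x * (G x *. e)^2) <= 4 * ?A * ?B" if e: "e : Basis" for e
proof (rule field_le_epsilon)
	\<comment> \<open>\<open>d\<close> measures the mollification error, which is estimated last; all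
	  other constants do not depend on the kernel.\<close>
	fix d :: real assume d: "d > 0"
	obtain s0 where s0: "s0 > 0" "!!s k. s < s0 ==> kern s k ==> N2 (%x. conv k G x - G x) < d / 2"
		by (rule mollifier_L2[OF sq(2), of "d / 2"]) (use d in auto)
	define s where "s = min (s0 / 2) (R / 4)"
	have s: "s > 0" "s < s0" "s <= R / 4" using s0(1) R by (auto simp: s_def)
	obtain k :: "R2 => real" where k: "kern s k" using ex_kern[OF s(1)] by blast
	have ne: "norm e = 1" using e by simp
	note kt = kern_test[OF k]
	define ka where "ka z = fd k z e" for z
	have kat: "test_function UNIV ka" unfolding ka_def[abs_def] by (rule test_function_frechet[OF kt e])
	have kdiff: "(k has_derivative fd k z) (at z)" for z
	proof -
		from c1_der[OF ctest_c1[OF tf_ctest[OF kt]], of z]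
		have "k differentiable (at z)" unfolding differentiable_def by blast
		then show ?thesis by (rule frechet_derivative_works[THEN iffD1])
	qed
	have kaz: "ka z = 0" if "z ~: cball 0 s" for z
	proof -
		have "(k has_derivative (%h. 0)) (at z)"
			by (rule has_derivative_transform_within_open[of "%_. 0" _ _ _ "- cball 0 s"]) (use that kern_zero[OF k] in auto)
		from fun_cong[OF hdu[OF kdiff this], of e] show ?thesis by (simp add: ka_def)
	qed
	have keven: "k (- z) = k z" for z using k unfolding kern_def by blast
	\<comment> \<open>The derivative of an even kernel is odd; this provides the sign when the
	  convolution is moved to the test function.\<close>
	have kaodd: "ka (- z) = - ka z" for z
	proof -
		have "((%z. k (- z)) has_derivative (%h. frechet_derivative k (at (- z)) (- h))) (at z)"
			by (rule has_derivative_compose[OF _ kdiff]) (auto intro!: derivative_eq_intros)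
		then have "(k has_derivative (%h. frechet_derivative k (at (- z)) (- h))) (at z)" by (simp add: keven)
		from fun_cong[OF hdu[OF kdiff this], of e]
		have "ka z = frechet_derivative k (at (- z)) (- e)" by (simp add: ka_def)
		also have "... = - ka (- z)" unfolding ka_def by (rule linear_neg[OF has_derivative_linear[OF kdiff]])
		finally show ?thesis by simp
	qed
	\<comment> \<open>The derivative of the mollified solution in direction \<open>e\<close>. Within
	  distance \<open>R / 2\<close> of the centre it equals the mollified component of
	  \<open>G\<close>, because \<open>s <= R / 4\<close>.\<close>
	define w where "w = conv ka U"
	obtain V where V: "c1 w V" unfolding w_def using c1_conv[OF tf_ctest[OF kat] sq(1)] by blast
	obtain V' where V': "c1 (conv k U) V'" using c1_conv[OF tf_ctest[OF kt] sq(1)] by blast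
	have sub: "cball x s <= ball q R" if "x : ball q (R/2)" for x
	proof
		fix y assume "y : cball x s"
		then have "dist q y < R / 2 + s" using that dist_triangle[of q y x] by simp
		then show "y : ball q R" using s(3) R by simp
	qed
	have VG: "V x = conv ka G x" if "x : ball q (R/2)" for x
		by (rule wgrad_conv_test[OF assms(1) sq(1,2) kat kaz sub[OF that] V[unfolded w_def]])
	have wG: "w x = conv k G x *. e" if "x : ball q (R/2)" for x
		using conv_gradient_component[OF kt sq(1) V' e, of x] wgrad_conv_test[OF assms(1) sq(1,2) kt kern_zero[OF k] sub[OF that] V']
		by (simp add: w_def ka_def[abs_def])
	\<comment> \<open>The weak equation for \<open>w\<close>: minus its Laplacian is the derivative in
	  direction \<open>e\<close> of the mollified \<open>F\<close>. The convolution is moved to the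
	  test function, whose support thereby grows by \<open>s\<close> and remains in the ball of radius
	  \<open>R\<close>.\<close>
	have key: "(LI x. V x *. D x) = - (LI x. conv k F x * (D x *. e))" if t: "ctest (ball q (R/2)) ph D" for ph D
	proof -
		obtain K where K: "compact K" "K <= ball q (R/2)" "!!x. x ~: K ==> ph x = 0" "!!x. x ~: K ==> D x = 0" using ctestE[OF t] by metis
		note sD = ctest_sqi[OF t]
		have m: "conv (%z. ka (- z)) D y = - conv ka D y" for y unfolding conv_def kaodd by simp
		have cph: "c1 (conv ka ph) (conv ka D)" by (rule c1_conv_right[OF ctest_sqi(1)[OF tf_ctest[OF kat]] t])
		have tph: "ctest (ball q R) (conv ka ph) (conv ka D)"
			unfolding ctest_def
		proof (intro conjI exI[of _ "{x + y |x y. x : K & y : cball 0 s}"] allI impI cph)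
			show "compact {x + y |x y. x : K & y : cball 0 s}" by (rule compact_sums[OF K(1) compact_cball])
			show "{x + y |x y. x : K & y : cball 0 s} <= ball q R"
			proof
				fix v assume "v : {x + y |x y. x : K & y : cball 0 s}"
				then obtain x y where xy: "v = x + y" "x : K" "y : cball 0 s" by blast
				then have "v : cball x s" by (simp add: dist_norm)
				moreover have "x : ball q (R/2)" using xy(2) K(2) by blast
				ultimately show "v : ball q R" using sub by blast
			qed
			fix x assume x: "x ~: {x + y |x y. x : K & y : cball 0 s}"
			show "conv ka ph x = 0"
			proof (rule conv_eq_0[OF kaz])
				fix y assume y: "dist x y <= s"
				show "ph y = 0"
				proof (rule K(3), rule notI)
					assume "y : K"
					moreover have "x - y : cball 0 s" using y unfolding dist_norm by (simp only: mem_cball_0)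
					moreover have "x = y + (x - y)" by simp
					ultimately show False using x by blast
				qed
			qed
		qed
		have "(LI x. V x *. D x) = (LI x. conv ka G x *. D x)"
		proof (intro icong refl)
			fix x show "V x *. D x = conv ka G x *. D x" using VG[of x] K(2,4) by (cases "x : K") auto
		qed
		also have "... = (LI y. G y *. conv (%z. ka (- z)) D y)" by (rule conv_adjoint[OF kat sq(2) sD(2)])
		also have "... = - (LI y. G y *. conv ka D y)" unfolding m by simp
		also have "(LI y. G y *. conv ka D y) = (LI y. F y * conv ka ph y)" by (rule weak[OF tph])
		also have "conv ka ph = (%y. conv k (%x. D x *. e) y)"
		proof
			fix y
			have "conv ka ph y = conv k D y *. e"
				using conv_gradient_component[OF kt sD(1) c1_conv_right[OF kern_sqi[OF k] t] e, of y] by (simp add: ka_def[abs_def])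
			also have "... = (LI x. (k (y - x) *R D x) *. e)" unfolding conv_def
				by (rule integral_inner_left[symmetric]) (use i_scaleR[OF mp_sqi[OF mp_minus kern_sqi[OF k]] sD(2), of y] in simp)
			finally show "conv ka ph y = conv k (%x. D x *. e) y" by (simp add: conv_def)
		qed
		also have "(LI y. F y * conv k (%x. D x *. e) y) = (LI x. conv k F x * (D x *. e))"
			using conv_adjoint[OF kt sq(3) sqi_ic[OF sD(2), of e]] by (simp add: keven)
		finally show ?thesis .
	qed
	\<comment> \<open>The Caccioppoli test function \<open>c^2 w\<close>. With \<open>a = c V\<close>
	  and \<open>b = w C\<close> the gradient of \<open>c w\<close> is \<open>a + b\<close>.\<close>
	have t: "ctest (ball q (R/2)) (%x. (c x * c x) * w x) (%x. (c x * c x) *R V x + w x *R (c x *R C x + c x *R C x))"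
		unfolding ctest_def
	proof (intro conjI exI[of _ ?K] allI impI)
		show "c1 (%x. (c x * c x) * w x) (%x. (c x * c x) *R V x + w x *R (c x *R C x + c x *R C x))" by (intro c1_mult c V)
		show "?K <= ball q (R/2)" using R by auto
	qed (use c(3) in auto)
	define a where "a x = c x *R V x" for x
	define b where "b x = w x *R C x" for x
	define f where "f x = c x * conv k F x" for x
	note conts = c1_cont[OF c(1)] c1_contD[OF c(1)] c1_cont[OF V] c1_contD[OF V]
	have sa: "sqi a" unfolding a_def[abs_def]
		by (rule sqi_continuous[OF _ compact_cball[of q "3*(R/2)/4"]]) (use c(3) conts in \<open>auto intro!: continuous_intros\<close>)
	have sb: "sqi b" unfolding b_def[abs_def]
		by (rule sqi_continuous[OF _ compact_cball[of q "3*(R/2)/4"]]) (use c(8) conts in \<open>auto intro!: continuous_intros\<close>)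
	have sf: "sqi f"
	proof -
		have "sqi (%x. c x *R conv k F x)"
			by (rule sqi_bm[OF sqi_conv[OF k sq(3)] bmc[OF conts(1)], of 1]) (use c(4,5) in \<open>simp add: abs_le_iff order_trans[OF _ c(4)]\<close>)
		then show ?thesis unfolding f_def[abs_def] by simp
	qed
	have ident: "N2 a + 2 * (LI x. a x *. b x) = - (LI x. f x * (a x *. e)) - 2 * (LI x. f x * (b x *. e))"
	proof -
		have "(LI x. V x *. ((c x * c x) *R V x + w x *R (c x *R C x + c x *R C x))) = (LI x. (norm (a x))^2 + 2 * (a x *. b x))"
		proof (intro icong refl)
			fix x
			have "(norm (a x))^2 + 2 * (a x *. b x) = a x *. a x + 2 * (a x *. b x)" by (simp only: power2_norm_eq_inner)
			also have "... = V x *. ((c x * c x) *R V x + w x *R (c x *R C x + c x *R C x))"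
				unfolding a_def b_def by (simp add: inner_add_right algebra_simps)
			finally show "V x *. ((c x * c x) *R V x + w x *R (c x *R C x + c x *R C x)) = (norm (a x))^2 + 2 * (a x *. b x)" by simp
		qed
		also have "... = N2 a + 2 * (LI x. a x *. b x)"
			using sqi_i[OF sa] i_inner[OF sa sb] by (simp add: N2_def)
		finally have 1: "(LI x. V x *. ((c x * c x) *R V x + w x *R (c x *R C x + c x *R C x))) = N2 a + 2 * (LI x. a x *. b x)" .
		have "(LI x. conv k F x * (((c x * c x) *R V x + w x *R (c x *R C x + c x *R C x)) *. e)) = (LI x. f x * (a x *. e) + 2 * (f x * (b x *. e)))"
			by (intro icong refl) (simp add: a_def b_def f_def ial algebra_simps)
		also have "... = (LI x. f x * (a x *. e)) + 2 * (LI x. f x * (b x *. e))"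
			using i_mult[OF sf sqi_ic[OF sa, of e]] i_mult[OF sf sqi_ic[OF sb, of e]] by simp
		finally show ?thesis using key[OF t] 1 by linarith
	qed
	have N2e: "N2 (%x. v x *. e) <= N2 v" if "sqi v" for v :: "R2 => R2"
	proof (rule N2_mono[OF that])
		show "(%x. v x *. e) : BB" using sqi_ic[OF that] by (rule sqi_m)
		show "norm (v x *. e) <= norm (v x)" for x using CS2[of "v x" e] ne by simp
	qed
	have fv: "abs (LI x. f x * (v x *. e)) <= sqrt (N2 f) * sqrt (N2 v)" if "sqi v" for v :: "R2 => R2"
	proof -
		have "abs (LI x. f x *. (v x *. e)) <= sqrt (N2 f) * sqrt (N2 (%x. v x *. e))" by (rule abs_int_le[OF sf sqi_ic[OF that]])
		also have "... <= sqrt (N2 f) * sqrt (N2 v)" by (intro mlm real_sqrt_le_mono N2e that) (simp add: N2_nonneg)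
		finally show ?thesis by simp
	qed
	have yng: "x * y <= x^2 / 4 + y^2" "x * y <= (x^2 + y^2) / 2" for x y :: real
		using sum_squares_bound[of "x / 2" y] sum_squares_bound[of x y] by (auto simp: p2eq field_simps)
	have sqs: "(sqrt (N2 v))^2 = N2 v" for v :: "R2 => 'c::euclidean_space" by (simp add: N2_nonneg)
	\<comment> \<open>Both mixed terms with \<open>a\<close> are absorbed at the cost of a quarter of
	  \<open>N2 a\<close> each. Then \<open>2 * N2 a + 2 * N2 b <= 22 * N2 b + 8 * N2 f\<close>, which
	  explains the numbers in \<open>?B\<close>.\<close>
	have est: "N2 a <= 10 * N2 b + 4 * N2 f"
	proof -
		have 1: "sqrt (N2 a) * (2 * sqrt (N2 b)) <= N2 a / 4 + 4 * N2 b"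
			using yng(1)[of "sqrt (N2 a)" "2 * sqrt (N2 b)"] by (simp add: pmd N2_nonneg)
		have 2: "sqrt (N2 a) * sqrt (N2 f) <= N2 a / 4 + N2 f"
			using yng(1)[of "sqrt (N2 a)" "sqrt (N2 f)"] by (simp add: N2_nonneg)
		have 3: "sqrt (N2 f) * sqrt (N2 b) <= (N2 f + N2 b) / 2"
			using yng(2)[of "sqrt (N2 f)" "sqrt (N2 b)"] by (simp add: N2_nonneg)
		have 4: "abs (LI x. f x * (a x *. e)) <= sqrt (N2 a) * sqrt (N2 f)" using fv[OF sa] by (simp add: mult.commute)
		have 5: "2 * abs (LI x. a x *. b x) <= sqrt (N2 a) * (2 * sqrt (N2 b))" using abs_int_le[OF sa sb] by simp
		have "- (LI x. f x * (a x *. e)) <= sqrt (N2 a) * sqrt (N2 f)" using 4 by linarith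
		moreover have "- (LI x. f x * (b x *. e)) <= sqrt (N2 f) * sqrt (N2 b)" using fv[OF sb] by linarith
		moreover have "- (2 * (LI x. a x *. b x)) <= sqrt (N2 a) * (2 * sqrt (N2 b))" using 5 by linarith
		ultimately show ?thesis using ident 1 2 3 by argo
	qed
	have cg: "c1 (%x. c x * w x) (%x. c x *R V x + w x *R C x)" by (rule c1_mult[OF c(1) V])
	have "(LI x. ind (cball q r) x * (c x * w x)^2) <= 2 * ?A * N2 (%x. c x *R V x + w x *R C x)"
	proof (rule log_hardy[OF cg])
		show "c x * w x = 0" if "x ~: cball q R" for x using c(3)[of x] that R by simp
	qed (use r in auto)
	also have "... <= 2 * ?A * ?B"
	proof (rule mlm)
		have "N2 (%x. c x *R V x + w x *R C x) <= 2 * N2 a + 2 * N2 b"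
			using N2_add_le[OF sa sb] by (simp add: a_def b_def)
		moreover have "N2 f <= N2 F"
		proof -
			have "N2 f <= N2 (conv k F)"
			proof (rule N2_mono[OF sqi_conv[OF k sq(3)] sqi_m[OF sf]])
				show "norm (f x) <= norm (conv k F x)" for x using c(4,5)[of x] by (simp add: f_def abs_mult mult_left_le_one_le)
			qed
			then show ?thesis using N2_conv_le[OF k sq(3)] by simp
		qed
		moreover have "N2 b <= (24 / R)^2 * N2 G"
		proof -
			have "N2 b <= N2 (%x. (24 / R) *R conv k G x)"
			proof (rule N2_mono[OF sqi_scaleR[OF sqi_conv[OF k sq(2)]] sqi_m[OF sb]])
				fix x
				show "norm (b x) <= norm ((24 / R) *R conv k G x)"
				proof (cases "x : ?K")
					case True
					then have "x : ball q (R/2)" using R by simp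
					then have "abs (w x) <= norm (conv k G x)" using wG CS2[of "conv k G x" e] ne by simp
					then have "abs (w x) * norm (C x) <= norm (conv k G x) * (24 / R)" using c(6)[of x] by (intro mult_mono) auto
					then show ?thesis using R by (simp add: b_def mult.commute)
				next
					case False
					then show ?thesis using c(8)[OF False] by (simp add: b_def)
				qed
			qed
			also have "... = (24 / R)^2 * N2 (conv k G)" by (simp add: N2_def pmd power_divide)
			also have "... <= (24 / R)^2 * N2 G" by (intro mlm N2_conv_le[OF k sq(2)]) simp
			finally show ?thesis .
		qed
		ultimately show "N2 (%x. c x *R V x + w x *R C x) <= ?B" using est by linarith
	qed (use A0 in simp)
	finally have h: "(LI x. ind (cball q r) x * (c x * w x)^2) <= 2 * ?A * ?B" .
	define p where "p x = ind (cball q r) x *R (c x * w x)" for x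
	define m where "m x = ind (cball q r) x *R ((G x - conv k G x) *. e)" for x
	have sp: "sqi p" unfolding p_def[abs_def]
		by (intro sqi_ind sqi_continuous[OF c1_cont[OF cg] compact_cball[of q "3*(R/2)/4"]]) (use c(3) in auto)
	have sm0: "sqi (%x. (G x - conv k G x) *. e)" by (intro sqi_ic sqi_diff sq sqi_conv[OF k])
	have sm: "sqi m" unfolding m_def[abs_def] by (intro sqi_ind sm0) simp
	have pm: "p x + m x = ind (cball q r) x *R (G x *. e)" for x
	proof (cases "x : cball q r")
		case True
		then have "x : ball q (R/2/2)" "x : ball q (R/2)" using r R by auto
		then show ?thesis using True c(2)[of x] wG[of x] by (simp add: p_def m_def idl)
	qed (simp add: p_def m_def)
	\<comment> \<open>\<open>p\<close> is the mollified component and \<open>m\<close> the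
	  mollification error. The splitting doubles \<open>2 * ?A * ?B\<close>, and the two components of
	  the gradient double it once more.\<close>
	have "(LI x. ind (cball q r) x * (G x *. e)^2) = N2 (%x. p x + m x)"
		unfolding pm N2_def by (intro icong refl) (simp add: ind_def)
	also have "... <= 2 * N2 p + 2 * N2 m" by (rule N2_add_le[OF sp sm])
	also have "N2 p = (LI x. ind (cball q r) x * (c x * w x)^2)"
		unfolding p_def N2_def by (intro icong refl) (simp add: ind_def)
	also note h
	also have "N2 m <= N2 (%x. conv k G x - G x)"
	proof (rule N2_mono[OF sqi_diff[OF sqi_conv[OF k sq(2)] sq(2)] sqi_m[OF sm]])
		fix x
		have "abs ((G x - conv k G x) *. e) <= norm (conv k G x - G x)"
			using CS2[of "G x - conv k G x" e] ne by (simp add: nmc)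
		then show "norm (m x) <= norm (conv k G x - G x)" by (simp add: m_def ind_def)
	qed
	also have "N2 (%x. conv k G x - G x) <= d / 2" using s0(2)[OF s(2) k] by simp
	finally show "(LI x. ind (cball q r) x * (G x *. e)^2) <= 4 * ?A * ?B + d" by simp
qed
have i: "Li (%x. ind (cball q r) x * (G x *. e)^2)" for e
	using imi[OF _ sqi_i[OF sqi_ic[OF sq(2), of e]], of "cball q r"] by simp
have b: "(1, 0) : (Basis :: (R2) set)" "(0, 1) : (Basis :: (R2) set)" by (auto simp: Basis_prod_def)
have "(LI x. ind (cball q r) x * (norm (G x))^2) = (LI x. ind (cball q r) x * (G x *. (1, 0))^2 + ind (cball q r) x * (G x *. (0, 1))^2)"
proof (intro icong refl)
	fix x
	obtain a b where ab: "G x = (a, b)" by (cases "G x")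
	show "ind (cball q r) x * (norm (G x))^2 = ind (cball q r) x * (G x *. (1, 0))^2 + ind (cball q r) x * (G x *. (0, 1))^2"
		unfolding ab by (simp add: norm_Pair distrib_left)
qed
also have "... = (LI x. ind (cball q r) x * (G x *. (1, 0))^2) + (LI x. ind (cball q r) x * (G x *. (0, 1))^2)"
	by (rule iadd[OF i i])
also have "... <= 4 * ?A * ?B + 4 * ?A * ?B" by (intro add_mono comp b)
also have "4 * ?A * ?B + 4 * ?A * ?B = 8 * ?A * ?B" by (simp add: mult.assoc)
finally show ?thesis .
qed

section \<open>Hilbert space methods for square integrable functions\<close>

lemma tendsto_zero_squeeze:
fixes f g :: "nat => real"
assumes "g ----> 0" "!!n. 0 <= f n" "!!n. f n <= g n"
shows "f ----> 0"
by (rule tendsto_sandwich[OF _ _ tendsto_const assms(1)]) (simp_all add: assms(2,3))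

lemma N2_minus_commute: "N2 (%x. u x - v x) = N2 (%x. v x - u x)"
unfolding N2_def by (simp add: nmc)

lemma N2_add:
assumes "sqi u" "sqi v"
shows "N2 (%x. u x + v x) = N2 u + 2 * (LI x. u x *. v x) + N2 v"
proof -
have "N2 (%x. u x + v x) = (LI x. (norm (u x))^2 + 2 * (u x *. v x) + (norm (v x))^2)"
	unfolding N2_def by (intro icong refl) (simp add: power2_norm_eq_inner inner_left_distrib inner_right_distrib inner_commute)
also have "... = N2 u + 2 * (LI x. u x *. v x) + N2 v"
	unfolding N2_def using sqi_i[OF assms(1)] sqi_i[OF assms(2)] i_inner[OF assms] by simp
finally show ?thesis .
qed

lemma N2_scaleR: "N2 (%x. c *R u x) = c^2 * N2 u"
unfolding N2_def by (simp add: pmd)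

lemma N2_diff:
assumes "sqi u" "sqi v"
shows "N2 (%x. u x - v x) = N2 u - 2 * (LI x. u x *. v x) + N2 v"
using N2_add[OF assms(1) sqi_uminus[OF assms(2)]] by (simp add: N2_def)

lemma LINT_inner_diff_left:
assumes "sqi u" "sqi v" "sqi w"
shows "(LI x. (u x - v x) *. w x) = (LI x. u x *. w x) - (LI x. v x *. w x)"
using i_inner[OF assms(1,3)] i_inner[OF assms(2,3)] by (simp add: idl)

text \<open>Riesz-Fischer for sequences with geometrically decreasing increments. Half of the decay,
  the factor \<open>r ^ n\<close> with \<open>r = sqrt q\<close>, is spent on a pointwise dominating
  function, the other half on its integrability.\<close>

lemma sqi_complete:
fixes u :: "nat => 'a::euclidean_space => 'b::euclidean_space"
assumes u: "!!n. sqi (u n)" and c: "!!n. N2 (%x. u (Suc n) x - u n x) <= C * q ^ n" and q: "0 < q" "q < 1"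
obtains v where "sqi v" "(%n. N2 (%x. u n x - v x)) ----> 0"
proof -
define r where "r = sqrt q"
define t where "t = sqrt r"
have r: "0 < r" "r < 1" using q by (simp_all add: r_def)
have t: "0 < t" "t^2 = r" using r by (simp_all add: t_def)
have qr: "q = r * r" using q by (simp add: r_def)
have [measurable]: "!!n. u n : BB" using u by (rule sqi_m)
\<comment> \<open>The sum \<open>w\<close> of these weighted increments is integrable; by
  Cauchy-Schwarz with the weights \<open>t ^ k\<close> it bounds all tails of the sequence pointwise
  almost everywhere.\<close>
define f where "f n x = (norm (u (Suc n) x - u n x))^2 / r ^ n" for n x
have f0: "0 <= f n x" for n x using r by (simp add: f_def)
have fi: "Li (f n)" for n
	unfolding f_def using sqi_i[OF sqi_diff[OF u u]] by (intro integrable_divide) 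
have fI: "(LI x. f n x) <= C * r ^ n" for n
proof -
	have "(LI x. f n x) = N2 (%x. u (Suc n) x - u n x) / r ^ n" by (simp add: f_def N2_def)
	also have "... <= C * q ^ n / r ^ n" using c r by (intro divide_right_mono) auto
	also have "... = C * r ^ n" using r by (simp add: qr pmd)
	finally show ?thesis .
qed
have sumI: "summable (%n. LI x. f n x)"
	by (rule summable_comparison_test[of _ "%n. C * r ^ n"])
		(use fI f0 r in \<open>auto intro!: summable_mult summable_geometric simp: abs_of_nonneg i_nn\<close>)
have [measurable]: "f n : BB" for n unfolding f_def by measurable
have "(\<integral>\<^sup>+x. (\<Sum>n. ennreal (f n x)) \<partial>lborel) = (\<Sum>n. \<integral>\<^sup>+x. ennreal (f n x) \<partial>lborel)"
	by (rule nn_integral_suminf) measurable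
also have "... = (\<Sum>n. ennreal (LI x. f n x))"
	using nn_integral_eq_integral[OF fi] f0 by simp
also have "... = ennreal (\<Sum>n. LI x. f n x)"
	by (rule suminf_ennreal2) (use f0 sumI in \<open>auto intro: i_nn\<close>)
finally have "(\<integral>\<^sup>+x. (\<Sum>n. ennreal (f n x)) \<partial>lborel) ~= \<infinity>" by simp
then have "AE x in lborel. (\<Sum>n. ennreal (f n x)) ~= \<infinity>"
	by (intro nn_integral_noteq_infinite) auto
then have AEs: "AE x in lborel. summable (%n. f n x)"
	by (rule AE_mp) (use f0 in \<open>auto intro!: AE_I2 summable_suminf_not_top\<close>)
define w where "w x = (\<Sum>n. f n x)" for x
have wi: "Li w" unfolding w_def
	by (rule integrable_suminf[OF fi]) (use AEs f0 sumI in \<open>auto simp: abs_of_nonneg\<close>)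
define v where "v x = lim (%n. u n x)" for x
have [measurable]: "v : BB" unfolding v_def by measurable
have key: "(norm (u m x - u n x))^2 <= r ^ n / (1 - r) * w x" if s: "summable (%n. f n x)" and "n <= m" for m n x
proof -
	have "u m x - u n x = (\<Sum>k\<in>{n..<m}. u (Suc k) x - u k x)" using sum_Suc_diff'[OF `n <= m`, of "%k. u k x"] by simp
	then have "norm (u m x - u n x) <= (\<Sum>k\<in>{n..<m}. norm (u (Suc k) x - u k x))" by (simp add: norm_sum)
	also have "... = (\<Sum>k\<in>{n..<m}. t ^ k * (norm (u (Suc k) x - u k x) / t ^ k))" using t by simp
	finally have "(norm (u m x - u n x))^2 <= (\<Sum>k\<in>{n..<m}. t ^ k * (norm (u (Suc k) x - u k x) / t ^ k))^2" by (rule power_mono) simp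
	also have "... <= (\<Sum>k\<in>{n..<m}. (t ^ k)^2) * (\<Sum>k\<in>{n..<m}. (norm (u (Suc k) x - u k x) / t ^ k)^2)" by (rule Cauchy_Schwarz_ineq_sum)
	also have "(\<Sum>k\<in>{n..<m}. (norm (u (Suc k) x - u k x) / t ^ k)^2) = (\<Sum>k\<in>{n..<m}. f k x)"
		by (simp add: f_def power_divide t(2)[symmetric] power_mult[symmetric] mult.commute)
	also have "(\<Sum>k\<in>{n..<m}. (t ^ k)^2) = (\<Sum>k\<in>{n..<m}. r ^ k)" by (simp add: t(2)[symmetric] power_mult[symmetric] mult.commute)
	also have "(\<Sum>k\<in>{n..<m}. r ^ k) * (\<Sum>k\<in>{n..<m}. f k x) <= r ^ n / (1 - r) * w x"
	proof (rule mult_mono)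
		have "(\<Sum>k\<in>{n..<m}. r ^ k) = (r ^ n - r ^ m) / (1 - r)"
			using sum_gp[of r n "m - 1"] `n <= m` r by (cases "n = m") (auto simp: atLeastLessThanSuc_atLeastAtMost[symmetric])
		also have "... <= r ^ n / (1 - r)" using r by (intro divide_right_mono) auto
		finally show "(\<Sum>k\<in>{n..<m}. r ^ k) <= r ^ n / (1 - r)" .
		show "(\<Sum>k\<in>{n..<m}. f k x) <= w x" unfolding w_def by (rule sum_le_suminf[OF s]) (use f0 in auto)
	qed (use r f0 in \<open>auto intro: sum_nonneg\<close>)
	finally show ?thesis .
qed
have lim0: "(%n. r ^ n / (1 - r) * c) ----> 0" for c
	using tendsto_mult_left_zero[OF LIMSEQ_power_zero, of r "c / (1 - r)"] r by (simp add: mult.commute divide_simps)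
have bd: "(norm (u n x - v x))^2 <= r ^ n / (1 - r) * w x" if s: "summable (%n. f n x)" for n x
proof -
	have "Cauchy (%n. u n x)"
	proof (rule metric_CauchyI)
		fix e :: real assume "e > 0"
		then have "\<forall>\<^sub>F n in sequentially. r ^ n / (1 - r) * w x < (e / 2)^2" by (intro order_tendstoD(2)[OF lim0]) simp
		then obtain N where N: "r ^ N / (1 - r) * w x < (e / 2)^2" by (auto simp: eventually_sequentially)
		have "dist (u m x) (u N x) < e / 2" if "m >= N" for m
			using key[OF s that] N `e > 0` by (intro power2_less_imp_less[of _ "e / 2"]) (auto simp: dist_norm)
		then have "ALL m>=N. ALL n>=N. dist (u m x) (u n x) < e" by (meson dist_triangle_half_l)
		then show "EX M. ALL m>=M. ALL n>=M. dist (u m x) (u n x) < e" by blast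
	qed
	then have L: "(%n. u n x) ----> v x" unfolding v_def by (simp add: Cauchy_convergent convergent_LIMSEQ_iff[symmetric])
	have "(%m. (norm (u m x - u n x))^2) ----> (norm (v x - u n x))^2" by (intro tendsto_intros L)
	then have "(norm (v x - u n x))^2 <= r ^ n / (1 - r) * w x"
		by (rule LIMSEQ_le_const2) (use key[OF s] in blast)
	then show ?thesis by (simp add: nmc)
qed
have AEb: "AE x in lborel. (norm (u n x - v x))^2 <= r ^ n / (1 - r) * w x" for n
	using AEs by (rule AE_mp) (use bd in auto)
have sq: "sqi (%x. u n x - v x)" for n
	unfolding sqi_def
proof
	have "AE x in lborel. norm ((norm (u n x - v x))^2) <= norm (r ^ n / (1 - r) * w x)"
		using AEb[of n] by (rule ev_mono) (rule norm_le_norm_nonneg[OF zero_le_power2])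
	then show "Li (%x. (norm (u n x - v x))^2)"
		by (intro ibound[OF integrable_mult_right[OF wi, of "r ^ n / (1 - r)"]]) auto
qed measurable
have le: "N2 (%x. u n x - v x) <= r ^ n / (1 - r) * (LI x. w x)" for n
proof -
	have "N2 (%x. u n x - v x) <= (LI x. r ^ n / (1 - r) * w x)" unfolding N2_def
		by (rule integral_mono_AE[OF sqi_i[OF sq] integrable_mult_right[OF wi] AEb])
	then show ?thesis by simp
qed
show thesis
proof
	show "sqi v" using sqi_diff[OF u[of 0] sq[of 0]] by simp
	show "(%n. N2 (%x. u n x - v x)) ----> 0"
		by (rule tendsto_zero_squeeze[OF lim0 N2_nonneg le])
qed
qed

text \<open>The members are functions, not classes, and may satisfy pointwise conditions; hence an
  L2 limit is only required to agree with a member up to a function of norm zero.\<close>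

locale closed_subspace =
fixes S :: "('a::euclidean_space => 'b::euclidean_space) set"
assumes S_sqi: "!!U. U : S ==> sqi U"
	and S_zero: "(%x. 0) : S"
	and S_add: "!!U V. U : S ==> V : S ==> (%x. U x + V x) : S"
	and S_scaleR: "!!U c. U : S ==> (%x. c *R U x) : S"
	and S_closed: "!!U V. (!!n::nat. U n : S) ==> sqi V ==> (%n. N2 (%x. U n x - V x)) ----> 0 ==>
		EX V':S. N2 (%x. V x - V' x) = 0"
begin

lemma S_diff: "U : S ==> V : S ==> (%x. U x - V x) : S"
using S_add[OF _ S_scaleR[of V "- 1"]] by simp

lemma complete:
fixes U :: "nat => 'a => 'b"
assumes U: "!!n. U n : S" and c: "!!n. N2 (%x. U (Suc n) x - U n x) <= C * q ^ n" and q: "0 < q" "q < 1"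
obtains V where "V : S" "(%n. N2 (%x. U n x - V x)) ----> 0"
proof -
obtain V where V: "sqi V" "(%n. N2 (%x. U n x - V x)) ----> 0"
	by (rule sqi_complete[OF S_sqi[OF U] c q])
obtain V' where V': "V' : S" "N2 (%x. V x - V' x) = 0" using S_closed[OF U V] by blast
have le: "N2 (%x. U n x - V' x) <= 2 * N2 (%x. U n x - V x)" for n
	using N2_add_le[OF sqi_diff[OF S_sqi[OF U[of n]] V(1)] sqi_diff[OF V(1) S_sqi[OF V'(1)]]] V'(2) by simp
have "(%n. 2 * N2 (%x. U n x - V x)) ----> 0" using tendsto_mult_left[OF V(2), of 2] by simp
then have "(%n. N2 (%x. U n x - V' x)) ----> 0"
	by (rule tendsto_zero_squeeze[OF _ N2_nonneg le])
with V'(1) show thesis by (rule that)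
qed

text \<open>The minimising sequence is chosen with excess \<open>(1/2) ^ n\<close>, so that the
  parallelogram law makes its increments decrease geometrically.\<close>

lemma projection:
assumes F: "sqi F"
shows "EX U:S. ALL Ph:S. (LI x. (F x - U x) *. Ph x) = 0"
proof -
define I where "I = Inf ((%U. N2 (%x. F x - U x)) ` S)"
have bdd: "bdd_below ((%U. N2 (%x. F x - U x)) ` S)" by (intro bdd_belowI[of _ 0]) (auto simp: N2_nonneg)
have Ile: "I <= N2 (%x. F x - U x)" if "U : S" for U unfolding I_def using that bdd by (intro cInf_lower) auto
have ne: "(%U. N2 (%x. F x - U x)) ` S ~= {}" using S_zero by blast
have "ALL n::nat. EX U. U : S & N2 (%x. F x - U x) < I + (1 / 2) ^ n"
proof
	fix n :: nat
	have "Inf ((%U. N2 (%x. F x - U x)) ` S) < I + (1 / 2) ^ n" by (simp add: I_def)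
	then obtain a where "a : (%U. N2 (%x. F x - U x)) ` S" "a < I + (1 / 2) ^ n" using cInf_less_iff[OF ne bdd] by blast
	then show "EX U. U : S & N2 (%x. F x - U x) < I + (1 / 2) ^ n" by blast
qed
from choice[OF this] obtain U where UU: "ALL n::nat. U n : S & N2 (%x. F x - U n x) < I + (1 / 2) ^ n" ..
have U: "U n : S" "N2 (%x. F x - U n x) < I + (1 / 2) ^ n" for n using UU by simp_all
have sq: "sqi (%x. F x - U n x)" for n by (rule sqi_diff[OF F S_sqi[OF U(1)]])
have c: "N2 (%x. U (Suc n) x - U n x) <= 4 * (1 / 2) ^ n" for n
proof -
	have e: "(%x. F x - (1 / 2) *R (U n x + U (Suc n) x)) = (%x. (1 / 2) *R ((F x - U n x) + (F x - U (Suc n) x)))"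
		using scaleR_half_double by (auto simp: algebra_simps fun_eq_iff simp flip: scaleR_add_left)
	have "I <= N2 (%x. F x - (1 / 2) *R (U n x + U (Suc n) x))" by (intro Ile S_scaleR S_add U)
	also have "... = 1/4 * N2 (%x. (F x - U n x) + (F x - U (Suc n) x))"
		unfolding e using N2_scaleR[of "1/2" "%x. (F x - U n x) + (F x - U (Suc n) x)"] by (simp add: p2eq)
	finally have "4 * I <= N2 (%x. (F x - U n x) + (F x - U (Suc n) x))" by simp
	moreover have "(%x. U (Suc n) x - U n x) = (%x. (F x - U n x) - (F x - U (Suc n) x))" by simp
	then have "N2 (%x. U (Suc n) x - U n x) = 2 * N2 (%x. F x - U n x) + 2 * N2 (%x. F x - U (Suc n) x) - N2 (%x. (F x - U n x) + (F x - U (Suc n) x))"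
		using N2_diff[OF sq[of n] sq[of "Suc n"]] N2_add[OF sq[of n] sq[of "Suc n"]] by simp
	ultimately have "N2 (%x. U (Suc n) x - U n x) <= 2 * (1 / 2) ^ n + 2 * (1 / 2) ^ Suc n"
		using U(2)[of n] U(2)[of "Suc n"] by linarith
	also have "... <= 4 * (1 / 2) ^ n" by simp
	finally show ?thesis .
qed
obtain V where V: "V : S" "(%n. N2 (%x. U n x - V x)) ----> 0" by (rule complete[OF U(1) c]) auto
have "(LI x. (F x - V x) *. Ph x) = 0" if Ph: "Ph : S" for Ph
proof -
	note sPh = S_sqi[OF Ph]
	let ?I = "%n. LI x. Ph x *. (F x - U n x)"
	\<comment> \<open>Moving \<open>U n\<close> in direction \<open>Ph\<close> cannot lower the
	  distance by more than the excess; the discriminant of this quadratic in the step length is the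
	  bound.\<close>
	have "(?I n)^2 <= (1 / 2) ^ n * N2 Ph" for n
	proof (rule square_le_from_quadratic)
		fix t
		have "I <= N2 (%x. F x - (U n x + t *R Ph x))" by (intro Ile S_scaleR S_add U Ph)
		also have "(%x. F x - (U n x + t *R Ph x)) = (%x. (F x - U n x) - t *R Ph x)" by (simp add: diff_diff_eq)
		also have "N2 ... = N2 (%x. F x - U n x) - 2 * t * ?I n + t^2 * N2 Ph"
			using N2_diff[OF sq[of n] sqi_scaleR[OF sPh, of t]] by (simp add: N2_scaleR inner_commute)
		finally show "0 <= (1 / 2) ^ n - 2 * t * ?I n + t^2 * N2 Ph" using U(2)[of n] by linarith
	qed (rule N2_nonneg)
	moreover have "(%n. (1 / 2 :: real) ^ n * N2 Ph) ----> 0" using tendsto_mult_left_zero[OF LIMSEQ_power_zero, of "1/2 :: real" "N2 Ph"] by simp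
	ultimately have "(%n. (?I n)^2) ----> 0" by (intro tendsto_zero_squeeze[where f = "%n. (?I n)^2"]) auto
	then have "?I ----> 0" using tendsto_real_sqrt[of "%n. (?I n)^2" 0] by (simp add: tendsto_rabs_zero_iff)
	moreover have "(%n. N2 (%x. (F x - U n x) - (F x - V x))) ----> 0" using V(2) by (simp add: N2_minus_commute[of V])
	then have "?I ----> (LI x. Ph x *. (F x - V x))"
		by (intro int_inner_lim[OF sPh sq sqi_diff[OF F S_sqi[OF V(1)]]])
	ultimately show ?thesis by (simp add: LIMSEQ_unique inner_commute)
qed
with V(1) show ?thesis by blast
qed

text \<open>The form is an L2 product with a linear map \<open>A x\<close> at every point, so
  coercivity and boundedness are pointwise facts. The solution is the limit of the projected
  iteration with step \<open>ta = 1 / M^2\<close>, which contracts squared norms by the factor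
  \<open>1 - ta\<close>.\<close>

lemma lax_milgram:
assumes sqA: "!!U. sqi U ==> sqi (%x. A x (U x))" and lin: "!!x. linear (A x)"
	and bd: "!!x y. norm (A x y) <= M * norm y" and co: "!!x y. (norm y)^2 <= A x y *. y" and M: "M > 1" and F: "sqi F"
shows "EX U:S. ALL Ph:S. (LI x. A x (U x) *. Ph x) = (LI x. F x *. Ph x)"
proof -
define ta where "ta = 1 / M^2"
define pr where "pr G = (SOME U. U : S & (ALL Ph:S. (LI x. (G x - U x) *. Ph x) = 0))" for G
have pr: "pr G : S & (ALL Ph:S. (LI x. (G x - pr G x) *. Ph x) = 0)" if "sqi G" for G
proof -
	have "EX U. U : S & (ALL Ph:S. (LI x. (G x - U x) *. Ph x) = 0)" using projection[OF that] by blast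
	from someI_ex[OF this] show ?thesis unfolding pr_def .
qed
define N where "N U = (%x. U x - ta *R (A x (U x) - F x))" for U
have sN: "sqi (N U)" if "sqi U" for U unfolding N_def by (intro sqi_diff sqi_scaleR sqA that F)
define U where "U n = rec_nat (%x. 0) (%_ u. pr (N u)) n" for n :: nat
have U_Suc: "U (Suc n) = pr (N (U n))" for n by (simp add: U_def)
have US: "U n : S" for n
proof (induction n)
	case (Suc n) show ?case unfolding U_Suc using pr[OF sN[OF S_sqi[OF Suc]]] by blast
qed (simp add: U_def S_zero)
note sU = S_sqi[OF US]
have orth: "(LI x. (N (U n) x - U (Suc n) x) *. Ph x) = 0" if "Ph : S" for n Ph
	using pr[OF sN[OF sU]] that by (simp add: U_Suc)
have M0: "M^2 > 1" using M by (simp add: p2eq less_1_mult)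
let ?q = "1 - ta"
have q: "0 < ?q" "?q < 1" using M0 by (auto simp: ta_def divide_simps)
have point: "(norm (z - ta *R A x z))^2 <= ?q * (norm z)^2" for x z
proof -
	have "(norm (z - ta *R A x z))^2 = (norm z)^2 - 2 * ta * (A x z *. z) + ta^2 * (norm (A x z))^2"
		unfolding power2_norm_eq_inner by (simp add: idl inner_diff_right inner_commute p2eq algebra_simps)
	moreover have "ta * (norm z)^2 <= ta * (A x z *. z)" using co[of z x] by (intro mlm) (auto simp: ta_def)
	moreover have "ta^2 * (norm (A x z))^2 <= ta^2 * (M * norm z)^2" using bd[of x z] by (intro mlm power_mono) auto
	moreover have "ta^2 * (M * norm z)^2 = ta * (norm z)^2" using M0 by (simp add: ta_def p2eq field_simps)
	ultimately show ?thesis by (simp add: left_diff_distrib)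
qed
have step: "N2 (%x. U (Suc (Suc n)) x - U (Suc n) x) <= ?q * N2 (%x. U (Suc n) x - U n x)" for n
proof -
	let ?d = "%x. U (Suc (Suc n)) x - U (Suc n) x" and ?e = "%x. N (U (Suc n)) x - N (U n) x"
	have dS: "?d : S" by (intro S_diff US)
	have sd: "sqi ?d" "sqi ?e" by (intro sqi_diff sN sU)+
	have i: "(LI x. ?e x *. ?d x) = N2 ?d"
	proof -
		have "(LI x. (?e x - ?d x) *. ?d x) = (LI x. ((N (U (Suc n)) x - U (Suc (Suc n)) x) - (N (U n) x - U (Suc n) x)) *. ?d x)"
			by (intro icong refl) (simp add: idl)
		also have "... = 0"
			using LINT_inner_diff_left[OF sqi_diff[OF sN[OF sU[of "Suc n"]] sU[of "Suc (Suc n)"]] sqi_diff[OF sN[OF sU[of n]] sU[of "Suc n"]] sd(1)]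
				orth[OF dS, of n] orth[OF dS, of "Suc n"] by simp
		finally show ?thesis using LINT_inner_diff_left[OF sd(2) sd(1) sd(1)] by (simp add: N2_def power2_norm_eq_inner)
	qed
	have "N2 ?d <= N2 ?e" using N2_diff[OF sd(2) sd(1)] N2_nonneg[of "%x. ?e x - ?d x"] i by simp
	also have "N2 ?e <= (LI x. ?q * (norm (U (Suc n) x - U n x))^2)" unfolding N2_def
	proof (rule integral_mono[OF sqi_i[OF sd(2)] integrable_mult_right[OF sqi_i[OF sqi_diff[OF sU sU]]]])
		fix x
		have "?e x = (U (Suc n) x - U n x) - ta *R A x (U (Suc n) x - U n x)"
			by (simp add: N_def linear_diff[OF lin] algebra_simps)
		then show "(norm (?e x))^2 <= ?q * (norm (U (Suc n) x - U n x))^2" using point[of "U (Suc n) x - U n x" x] by simp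
	qed
	finally show ?thesis by (simp add: N2_def)
qed
have "N2 (%x. U (Suc n) x - U n x) <= N2 (%x. U (Suc 0) x - U 0 x) * ?q ^ n" for n
proof (induction n)
	case (Suc n)
	have "?q * N2 (%x. U (Suc n) x - U n x) <= ?q * (N2 (%x. U (Suc 0) x - U 0 x) * ?q ^ n)" using Suc q by (intro mlm) auto
	then show ?case using step[of n] by (simp add: algebra_simps)
qed simp
from complete[OF US this q] obtain V where V: "V : S" "(%n. N2 (%x. U n x - V x)) ----> 0" .
note sV = S_sqi[OF V(1)]
have AV: "(%n. N2 (%x. A x (U n x) - A x (V x))) ----> 0"
proof -
	have "N2 (%x. A x (U n x) - A x (V x)) <= M^2 * N2 (%x. U n x - V x)" for n
		unfolding N2_scaleR[symmetric]
	proof (rule N2_mono)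
		show "sqi (%x. M *R (U n x - V x))" by (intro sqi_scaleR sqi_diff sU sV)
		show "(%x. A x (U n x) - A x (V x)) : BB" by (intro sqi_m sqi_diff sqA sU sV)
		show "norm (A x (U n x) - A x (V x)) <= norm (M *R (U n x - V x))" for x
			using bd[of x "U n x - V x"] M by (simp add: linear_diff[OF lin])
	qed
	moreover have "(%n. M^2 * N2 (%x. U n x - V x)) ----> 0" using tendsto_mult_left[OF V(2), of "M^2"] by simp
	ultimately show ?thesis by (intro tendsto_zero_squeeze[OF _ N2_nonneg]) 
qed
have "(LI x. A x (V x) *. Ph x) = (LI x. F x *. Ph x)" if Ph: "Ph : S" for Ph
proof -
	note sPh = S_sqi[OF Ph]
	let ?J = "%W. LI x. Ph x *. W x"
	have eq: "?J (U n) - ta * (?J (%x. A x (U n x)) - ?J F) - ?J (U (Suc n)) = 0" for n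
	proof -
		have "0 = (LI x. Ph x *. (N (U n) x - U (Suc n) x))" using orth[OF Ph, of n] by (simp add: inner_commute)
		also have "... = (LI x. Ph x *. U n x - ta * (Ph x *. A x (U n x) - Ph x *. F x) - Ph x *. U (Suc n) x)"
			unfolding N_def by (simp add: inner_diff_right)
		also have "... = ?J (U n) - ta * (?J (%x. A x (U n x)) - ?J F) - ?J (U (Suc n))"
			using i_inner[OF sPh sU[of n]] i_inner[OF sPh sU[of "Suc n"]] i_inner[OF sPh sqA[OF sU[of n]]] i_inner[OF sPh F]
			by simp
		finally show ?thesis by simp
	qed
	have l1: "(%n. ?J (U n)) ----> ?J V" by (rule int_inner_lim[OF sPh sU sV V(2)])
	have l2: "(%n. ?J (%x. A x (U n x))) ----> ?J (%x. A x (V x))" by (rule int_inner_lim[OF sPh sqA[OF sU] sqA[OF sV] AV])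
	have "(%n. ?J (U n) - ta * (?J (%x. A x (U n x)) - ?J F) - ?J (U (Suc n))) ----> ?J V - ta * (?J (%x. A x (V x)) - ?J F) - ?J V"
		by (intro tendsto_intros l1 l2 LIMSEQ_Suc[OF l1])
	then have "?J V - ta * (?J (%x. A x (V x)) - ?J F) - ?J V = 0" unfolding eq by (simp add: LIMSEQ_const_iff)
	moreover have "ta ~= 0" using M by (simp add: ta_def)
	ultimately show ?thesis by (simp add: inner_commute)
qed
with V(1) show ?thesis by blast
qed

end


section \<open>Representation of functions of class L2 and W12\<close>

text \<open>The bridge from functions that are meaningful only on \<open>Q\<close> and up to
  Lebesgue null sets to Borel functions on the whole space.\<close>

definition rep :: "'a::euclidean_space set => ('a => 'b::euclidean_space) => ('a => 'b) => bool" where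
"rep Q f F \<longleftrightarrow> F : BB & (ALL x. x ~: Q --> F x = 0) & (AE x in lborel. x : Q --> F x = f x)"

lemma rep_map:
assumes r: "rep Q f F" and T: "T : BB" "T 0 = 0"
shows "rep Q (%x. T (f x)) (%x. T (F x))"
proof -
have "F : BB" using r by (simp add: rep_def)
then have "(%x. T (F x)) : BB" using T(1) by (rule measurable_compose)
moreover have "AE x in lborel. x : Q --> F x = f x" using r by (simp add: rep_def)
then have "AE x in lborel. x : Q --> T (F x) = T (f x)" by (rule ev_mono) simp
ultimately show ?thesis using r T(2) by (simp add: rep_def)
qed

lemma rep_lebesgue_on:
fixes h H :: "'a::euclidean_space => 'b::euclidean_space"
assumes r: "rep Q h H" and Q: "Q : sets borel"
shows "h : borel_measurable (lebesgue_on Q)" "integrable (lebesgue_on Q) h \<longleftrightarrow> Li H"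
	"(LINT x|lebesgue_on Q. h x) = (LI x. H x)"
proof -
have H: "H : BB" "!!x. x ~: Q ==> H x = 0" "AE x in lborel. x : Q --> H x = h x"
	using r by (auto simp: rep_def)
have Ql: "Q : sets lebesgue" using Q by simp
let ?h = "%x. if x : Q then h x else 0"
have "AE x in lborel. H x = ?h x" using H(3) by (rule ev_mono) (use H(2) in simp)
then have ae: "AE x in lebesgue. H x = ?h x" by (rule AE_completion)
then have ae': "AE x in lebesgue. ?h x = H x" by (rule ev_mono) (rule sym)
have Hl: "H : borel_measurable lebesgue" using H(1) by (simp add: measurable_completion)
have hl: "?h : borel_measurable lebesgue" by (rule borel_measurable_AE[OF Hl ae])
then show "h : borel_measurable (lebesgue_on Q)" using borel_measurable_if[OF Ql] by blast
have e: "(%x. ind Q x *R h x) = ?h" by (auto simp: ind_def)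
have Qs: "Q Int space lebesgue : sets lebesgue" using Ql by simp
have Hm: "H : borel_measurable lborel" using H(1) by simp
show "integrable (lebesgue_on Q) h \<longleftrightarrow> Li H"
	unfolding integrable_restrict_space[OF Qs] e integrable_completion[OF Hm, symmetric]
	by (rule integrable_cong_AE[OF hl Hl ae'])
show "(LINT x|lebesgue_on Q. h x) = (LI x. H x)"
	unfolding integral_restrict_space[OF Qs] e integral_completion[OF Hm, symmetric]
	by (rule integral_cong_AE[OF hl Hl ae'])
qed

lemma ex_rep:
fixes f :: "'a::euclidean_space => complex"
assumes f: "f : borel_measurable (lebesgue_on Q)" and Q: "Q : sets borel"
shows "EX F. rep Q f F"
proof -
have Ql: "Q : sets lebesgue" using Q by simp
have m: "(%x. if x : Q then f x else 0) : borel_measurable lebesgue" by (rule borel_measurable_if_I[OF f Ql])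
have "(%x. Re (if x : Q then f x else 0)) : borel_measurable lebesgue" using m by measurable
from completion_ex_borel_measurable_real[OF this] obtain a where
	a: "a : borel_measurable lborel" "AE x in lborel. Re (if x : Q then f x else 0) = a x" by blast
have "(%x. Im (if x : Q then f x else 0)) : borel_measurable lebesgue" using m by measurable
from completion_ex_borel_measurable_real[OF this] obtain b where
	b: "b : borel_measurable lborel" "AE x in lborel. Im (if x : Q then f x else 0) = b x" by blast
define F where "F x = ind Q x *R (cr (a x) + \<i> * cr (b x))" for x
have [measurable]: "a : BB" "b : BB" "Q : sets borel" using a(1) b(1) Q by simp_all
have "F : BB" unfolding F_def by measurable
moreover have "AE x in lborel. x : Q --> F x = f x" using a(2) b(2)
	by (rule ev2) (auto simp: F_def complex_eq_iff)
ultimately have "rep Q f F" by (simp add: rep_def F_def)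
then show ?thesis by blast
qed

lemma rep_L2:
fixes f :: "'a::euclidean_space => complex"
assumes r: "rep Q f F" and Q: "Q : sets borel"
shows "f : L2 Q \<longleftrightarrow> sqi F" "L2_norm Q f = sqrt (N2 F)"
proof -
have r2: "rep Q (%x. (cmod (f x))^2) (%x. (cmod (F x))^2)" by (rule rep_map[OF r]) auto
show "f : L2 Q \<longleftrightarrow> sqi F" unfolding L2_def sqi_def
	using rep_lebesgue_on(1)[OF r Q] rep_lebesgue_on(2)[OF r2 Q] r by (simp add: rep_def)
show "L2_norm Q f = sqrt (N2 F)" unfolding L2_norm_def N2_def rep_lebesgue_on(3)[OF r2 Q] ..
qed

text \<open>The real part of \<open>a * cnj b\<close> is \<open>a *. b\<close> and the imaginary
  part is \<open>a *. (\<i> * b)\<close>. Hence a complex identity tested with a complex subspace is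
  a real identity tested with the same subspace.\<close>

lemma L2_inner_rep:
fixes f g :: "'a::euclidean_space => complex"
assumes r: "rep Q f F" "rep Q g G" and Q: "Q : sets borel" and sq: "sqi F" "sqi G"
shows "L2_inner Q f g = Complex (LI x. F x *. G x) (LI x. F x *. (\<i> * G x))"
proof -
have [measurable]: "F : BB" "G : BB" using r by (simp_all add: rep_def)
have "AE x in lborel. x : Q --> F x * cnj (G x) = f x * cnj (g x)"
	using r[unfolded rep_def, THEN conjunct2, THEN conjunct2] by (rule ev2) simp
moreover have [measurable]: "(%x. cnj (G x)) : BB"
	by (rule borel_measurable_continuous_on[of cnj, OF _ `G : BB`]) (intro continuous_intros)
have "(%x. F x * cnj (G x)) : BB" by measurable
ultimately have rr: "rep Q (%x. f x * cnj (g x)) (%x. F x * cnj (G x))" using r by (auto simp: rep_def)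
have sG: "sqi (%x. \<i> * G x)" by (rule sqi_bound[OF _ sq(2), of _ 1]) (auto simp: norm_mult)
have e: "F x * cnj (G x) = cr (F x *. G x) + \<i> * cr (F x *. (\<i> * G x))" for x
	by (simp add: complex_eq_iff inner_complex_def)
have i: "Li (%x. cr (F x *. G x))" "Li (%x. \<i> * cr (F x *. (\<i> * G x)))"
	using i_inner[OF sq] i_inner[OF sq(1) sG] by (auto intro!: integrable_of_real)
show ?thesis unfolding L2_inner_def rep_lebesgue_on(3)[OF rr Q] e iadd[OF i]
	by (simp add: complex_eq_iff)
qed

text \<open>By the Lindelof property countably many of the balls cover \<open>W\<close>, so the
  exceptional null sets add up to a null set.\<close>

lemma ae_on_cover:
fixes W :: "'a::euclidean_space set"
assumes loc: "!!x. x : W ==> EX r>0. AE y in lborel. y : ball x r --> R y"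
shows "AE y in lborel. y : W --> R y"
proof -
define \<F> where "\<F> = {ball x r | x r. AE y in lborel. y : ball x r --> R y}"
obtain \<G> where G: "\<G> <= \<F>" "countable \<G>" "\<Union>\<G> = \<Union>\<F>" by (rule Lindelof[of \<F>]) (auto simp: \<F>_def)
have "AE y in lborel. ALL B:\<G>. y : B --> R y"
	using G(1) unfolding AE_ball_countable[OF G(2)] by (auto simp: \<F>_def)
moreover have "W <= \<Union>\<F>"
proof
	fix x assume "x : W"
	then obtain r where r: "r > 0" "AE y in lborel. y : ball x r --> R y" using loc by blast
	then have "ball x r : \<F>" unfolding \<F>_def by blast
	then show "x : \<Union>\<F>" using r(1) by (intro UnionI[of "ball x r"]) auto
qed
ultimately show ?thesis unfolding G(3)[symmetric] by (elim ev_mono) blast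
qed

lemma N2_eq_0_AE: assumes "sqi u" "N2 u = 0" shows "AE x in lborel. u x = 0"
proof -
have "AE x in lborel. (norm (u x))^2 = 0"
	using assms(2) integral_nonneg_eq_0_iff_AE[OF sqi_i[OF assms(1)]] by (simp add: N2_def)
then show ?thesis by (rule ev_mono) simp
qed

text \<open>The fundamental lemma, hence uniqueness of weak gradients: after localisation by a
  cutoff all mollifications of a component of \<open>G\<close> vanish, and they converge to it in
  L2.\<close>

lemma wgrad_zero_AE:
assumes w: "wgrad W (%x. 0) G" and W: "open W" and G: "sqi G"
shows "AE x in lborel. x : W --> G x = 0"
proof (rule ae_on_cover)
fix x assume "x : W"
then obtain r where r: "r > 0" "ball x r <= W" using W by (meson openE)
obtain c C where c: "c1 c C" "!!y. y : ball x (r/2) ==> c y = 1" "!!y. y ~: cball x (3*r/4) ==> c y = 0"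
	"!!y. 0 <= c y" "!!y. c y <= 1" by (rule ball_cutoff[OF r(1), of x]) (rule that)
have tc: "ctest W c C" unfolding ctest_def using c(1,3) r by (intro conjI exI[of _ "cball x (3*r/4)"]) auto
have cm: "c : BB" by (rule bmc[OF c1_cont[OF c(1)]])
have z: "AE y in lborel. c y *R (G y *. h) = 0" for h
proof (rule N2_eq_0_AE)
	let ?g = "%y. c y *R (G y *. h)"
	show s: "sqi ?g" by (rule sqi_bm[OF sqi_ic[OF G] cm, of 1]) (use c(4,5) in auto)
	have "EX k :: 'a => real. kern (1 / Suc n) k" for n by (rule ex_kern) simp
	then obtain k :: "nat => 'a => real" where k: "!!n. kern (1 / Suc n) (k n)" using choice[of "%n k. kern (1 / Suc n) k"] by auto
	have l: "(%n. 1 / real (Suc n)) ----> 0" by (rule LIMSEQ_Suc[OF lim_1_over_n])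
	have "conv (k n) ?g y = 0" for n y
	proof -
		define D where "D z = (\<Sum>e\<in>Basis. frechet_derivative (k n) (at z) e *R e)" for z
		have tk: "ctest UNIV (k n) D" unfolding D_def by (rule tf_ctest[OF kern_test[OF k]])
		obtain K where K: "compact K" "!!z. z ~: K ==> k n z = 0" by (rule ctestE[OF tk]) blast
		have "ctest UNIV (%z. k n (y - z)) (%z. - D (y - z))" by (rule ctest_reflect[OF tk K(1,2)]) auto
		then have "ctest W (%z. c z * k n (y - z)) (%z. c z *R (- D (y - z)) + k n (y - z) *R C z)"
			by (intro ctest_mult_left[OF tc] ctest_c1)
		from wgradD[OF w this, of h] have "(LI z. (G z *. h) * (c z * k n (y - z))) = 0" by simp
		then show ?thesis by (simp add: conv_def mult_ac)
	qed
	then have "(%n. N2 ?g) ----> 0" using mollifier_seq[OF s k l] by (simp add: N2_def)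
	then show "N2 ?g = 0" by (simp add: LIMSEQ_const_iff)
qed
have "AE y in lborel. ALL h:Basis. c y *R (G y *. h) = 0" unfolding AE_ball_countable[OF countable_finite[OF finite_Basis]] using z by blast
then have "AE y in lborel. y : ball x (r/2) --> G y = 0"
proof (rule ev_mono)
	fix y assume a: "ALL h:Basis. c y *R (G y *. h) = 0"
	show "y : ball x (r/2) --> G y = 0"
	proof
		assume "y : ball x (r/2)"
		then have "c y = 1" by (rule c(2))
		then show "G y = 0" using a by (simp add: euclidean_all_zero_iff)
	qed
qed
then show "EX r>0. AE y in lborel. y : ball x r --> G y = 0" using r(1) by (intro exI[of _ "r/2"]) simp
qed

lemma wgrad_add:
assumes "wgrad W u G" "wgrad W v H" "sqi u" "sqi G" "sqi v" "sqi H"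
shows "wgrad W (%x. u x + v x) (%x. G x + H x)"
unfolding wgrad_def
proof (intro allI impI)
fix ps D h assume t: "ctest W ps D"
note s = ctest_sqi[OF t]
have i: "Li (%x. u x * (D x *. h))" "Li (%x. v x * (D x *. h))"
	"Li (%x. (G x *. h) * ps x)" "Li (%x. (H x *. h) * ps x)"
	by (intro i_mult sqi_ic assms s)+
show "(LI x. (u x + v x) * (D x *. h)) = - (LI x. ((G x + H x) *. h) * ps x)"
	using wgradD[OF assms(1) t, of h] wgradD[OF assms(2) t, of h] i by (simp add: distrib_right ial)
qed

lemma wgrad_uminus: "wgrad W u G ==> wgrad W (%x. - u x) (%x. - G x)"
unfolding wgrad_def by simp

lemma wgrad_scale: "wgrad W u G ==> wgrad W (%x. c * u x) (%x. c *R G x)"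
unfolding wgrad_def by (simp add: mult.assoc)

lemma wgrad_diff:
assumes "wgrad W u G" "wgrad W v H" "sqi u" "sqi G" "sqi v" "sqi H"
shows "wgrad W (%x. u x - v x) (%x. G x - H x)"
using wgrad_add[OF assms(1) wgrad_uminus[OF assms(2)] assms(3,4) sqi_uminus[OF assms(5)] sqi_uminus[OF assms(6)]] by simp

lemma wgrad_closed:
assumes w: "!!n::nat. wgrad W (u n) (G n)" and s: "!!n. sqi (u n)" "!!n. sqi (G n)" "sqi v" "sqi H"
	and l: "(%n. N2 (%x. u n x - v x)) ----> 0" "(%n. N2 (%x. G n x - H x)) ----> 0"
shows "wgrad W v H"
unfolding wgrad_def
proof (intro allI impI)
fix ps D h assume t: "ctest W ps D"
note st = ctest_sqi[OF t]
have a: "(%n. LI x. (D x *. h) *. u n x) ----> (LI x. (D x *. h) *. v x)"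
	by (rule int_inner_lim[OF sqi_ic[OF st(2)] s(1,3) l(1)])
have "(%n. LI x. (ps x *R h) *. G n x) ----> (LI x. (ps x *R h) *. H x)"
	by (rule int_inner_lim[OF _ s(2,4) l(2)], rule sqi_bound[OF _ st(1), of _ "norm h"]) (use sqi_m[OF st(1)] in auto)
then have "(%n. - (LI x. (G n x *. h) * ps x)) ----> - (LI x. (H x *. h) * ps x)"
	by (intro tendsto_minus) (simp add: inner_commute mult.commute)
moreover have "(%n. - (LI x. (G n x *. h) * ps x)) ----> (LI x. v x * (D x *. h))"
	using a unfolding wgradD[OF w t, where h = h, symmetric] by (simp add: mult.commute)
ultimately show "(LI x. v x * (D x *. h)) = - (LI x. (H x *. h) * ps x)" by (rule LIMSEQ_unique[rotated])
qed

text \<open>A function of \<open>W\<^sub>2\<^sup>1\<close> is represented by the triple of its values and its two partial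
  derivatives, and tested against a direction \<open>c\<close> of the complex plane.\<close>

definition pr :: "complex => (R2 => C3) => R2 => real" where
"pr c U x = c *. fst (U x)"

definition gr :: "complex => (R2 => C3) => R2 => R2" where
"gr c U x = (c *. fst (snd (U x)), c *. snd (snd (U x)))"

text \<open>Real weak gradients in all complex directions at once, so that the real theory applies
  and invariance under complex multiples is a change of \<open>c\<close>.\<close>

definition cgrad :: "(R2) set => (R2 => C3) => bool" where
"cgrad W U \<longleftrightarrow> (ALL c. wgrad W (pr c U) (gr c U))"

lemma norm_triple_sq: "(norm (y :: C3))^2 = (norm (fst y))^2 + (norm (fst (snd y)))^2 + (norm (snd (snd y)))^2"
by (cases y) (simp add: norm_Pair)

lemma triple_norm_le: "norm (fst y) <= norm y" "norm (fst (snd y)) <= norm y" "norm (snd (snd y)) <= norm (y :: C3)"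
by (rule power2_le_imp_le, simp_all add: norm_triple_sq)+

lemma triple_measurable:
assumes "U : BB"
shows "(%x. fst (U x)) : BB" "(%x. fst (snd (U x))) : BB"
	"(%x. snd (snd (U x) :: 'a::euclidean_space \<times> 'b::euclidean_space)) : BB"
by (rule borel_measurable_continuous_on[OF _ assms, of "%y. fst y"] borel_measurable_continuous_on[OF _ assms, of "%y. fst (snd y)"]
	borel_measurable_continuous_on[OF _ assms, of "%y. snd (snd y)"], intro continuous_intros)+

lemma sqi_3:
assumes "sqi (U :: R2 => C3)"
shows "sqi (%x. fst (U x))" "sqi (%x. fst (snd (U x)))" "sqi (%x. snd (snd (U x)))"
by (rule sqi_bound[OF _ assms, of _ 1], use triple_measurable[OF sqi_m[OF assms]] triple_norm_le in auto)+

lemma gr_norm_le: "norm (gr c U x) <= cmod c * norm (U x)"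
proof (rule power2_le_imp_le)
have "(c *. a)^2 <= (cmod c)^2 * (cmod a)^2" for a
	using power_mono[OF CS2[of c a], of 2] by (simp add: pmd)
note cs = add_mono[OF this[of "fst (snd (U x))"] this[of "snd (snd (U x))"]]
have "(norm (gr c U x))^2 <= (cmod c)^2 * (cmod (fst (snd (U x))))^2 + (cmod c)^2 * (cmod (snd (snd (U x))))^2" using cs by (simp add: gr_def norm_Pair)
moreover have "(cmod c * norm (U x))^2 = (cmod c)^2 * (cmod (fst (U x)))^2 + (cmod c)^2 * (cmod (fst (snd (U x))))^2 + (cmod c)^2 * (cmod (snd (snd (U x))))^2"
	by (simp add: norm_triple_sq pmd distrib_left)
ultimately show "(norm (gr c U x))^2 <= (cmod c * norm (U x))^2"
	using mult_nonneg_nonneg[of "(cmod c)^2" "(cmod (fst (U x)))^2", OF zero_le_power2 zero_le_power2] by linarith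
qed simp

lemma sqi_pr_gr:
assumes "sqi U" shows "sqi (pr c U)" "sqi (gr c U)"
proof -
note t = sqi_3[OF assms]
have [measurable]: "pr c U : BB"
	unfolding pr_def[abs_def] using sqi_m[OF t(1)] by measurable
have m2: "gr c U : BB"
	unfolding gr_def[abs_def] by (intro borel_measurable_Pair borel_measurable_inner borel_measurable_const sqi_m t)
show "sqi (pr c U)"
proof (rule sqi_bound[OF _ assms, of _ "cmod c"])
	fix x show "norm (pr c U x) <= cmod c * norm (U x)"
		using order_trans[OF CS2[of c "fst (U x)"] mlm[OF triple_norm_le(1)[of "U x"], of "cmod c"]] by (simp add: pr_def)
qed measurable
show "sqi (gr c U)" by (rule sqi_bound[OF m2 assms, of "cmod c"]) (rule gr_norm_le)
qed

lemma frechet_component: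
assumes "test_function Q ph"
obtains D where "ctest Q ph D" "ALL e:Basis. ALL x. D x *. e = fd ph x e"
using tf_ctest[OF assms] by (rule that) (simp add: inner_sum_left_Basis)

lemma cgrad_iff:
assumes Q: "open Q" and U: "sqi U"
shows "cgrad Q U \<longleftrightarrow> (ALL ph. test_function Q ph -->
	(LI x. fd ph x (1, 0) *R fst (U x)) = - (LI x. ph x *R fst (snd (U x))) &
	(LI x. fd ph x (0, 1) *R fst (U x)) = - (LI x. ph x *R snd (snd (U x))))"
proof -
note t = sqi_3[OF U]
have B: "(1, 0) : (Basis :: (R2) set)" "(0, 1) : (Basis :: (R2) set)" by (auto simp: Basis_prod_def)
have B': "e = (1, 0) \<or> e = (0, 1)" if "e : (Basis :: (R2) set)" for e using that by (auto simp: Basis_prod_def)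
have c1: "c *. (LI x. fd ph x e *R fst (U x)) = (LI x. pr c U x * fd ph x e)"
	if tf: "test_function Q ph" and "e : Basis" for ph e c
proof -
	obtain D where D: "ctest Q ph D" "ALL e:Basis. ALL x. D x *. e = fd ph x e" by (rule frechet_component[OF tf])
	have "Li (%x. (D x *. e) *R fst (U x))" by (intro i_scaleR sqi_ic ctest_sqi(2)[OF D(1)] t)
	then have "c *. (LI x. (D x *. e) *R fst (U x)) = (LI x. pr c U x * (D x *. e))"
		by (subst integral_inner_right[symmetric]) (simp_all add: pr_def mult.commute)
	then show ?thesis unfolding D(2)[rule_format, OF `e : Basis`] .
qed
have c2: "c *. (LI x. ph x *R H x) = (LI x. (c *. H x) * ph x)"
	if tf: "test_function Q ph" and "sqi H" for ph c and H :: "R2 => complex"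
proof -
	obtain D where D: "ctest Q ph D" by (rule frechet_component[OF tf])
	have "Li (%x. ph x *R H x)" by (intro i_scaleR ctest_sqi(1)[OF D(1)] that)
	then show ?thesis by (subst integral_inner_right[symmetric]) (simp_all add: mult.commute)
qed
show ?thesis
proof (intro iffI allI impI)
	fix ph assume cg: "cgrad Q U" and tf: "test_function Q ph"
	obtain D where D: "ctest Q ph D" "ALL e:Basis. ALL x. D x *. e = fd ph x e" by (rule frechet_component[OF tf])
	have w: "(LI x. pr c U x * fd ph x e) = - (LI x. (gr c U x *. e) * ph x)" if "e : Basis" for c e
		using wgradD[OF cg[unfolded cgrad_def, rule_format, of c] D(1), of e] unfolding D(2)[rule_format, OF that] .
	have "c *. (LI x. fd ph x (1, 0) *R fst (U x)) = c *. - (LI x. ph x *R fst (snd (U x)))" for c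
		using w[OF B(1), of c] unfolding c1[OF tf B(1)] inner_minus_right c2[OF tf t(2)] by (simp add: gr_def)
	moreover have "c *. (LI x. fd ph x (0, 1) *R fst (U x)) = c *. - (LI x. ph x *R snd (snd (U x)))" for c
		using w[OF B(2), of c] unfolding c1[OF tf B(2)] inner_minus_right c2[OF tf t(3)] by (simp add: gr_def)
	ultimately show "(LI x. fd ph x (1, 0) *R fst (U x)) = - (LI x. ph x *R fst (snd (U x))) &
		(LI x. fd ph x (0, 1) *R fst (U x)) = - (LI x. ph x *R snd (snd (U x)))"
		using vector_eq_ldot by blast
next
	assume *: "ALL ph. test_function Q ph -->
		(LI x. fd ph x (1, 0) *R fst (U x)) = - (LI x. ph x *R fst (snd (U x))) &
		(LI x. fd ph x (0, 1) *R fst (U x)) = - (LI x. ph x *R snd (snd (U x)))"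
	show "cgrad Q U" unfolding cgrad_def
	proof (intro allI wgrad_of_test[OF Q sqi_pr_gr[OF U]])
		fix c ph and e :: "R2" assume tf: "test_function Q ph" and e: "e : Basis"
		note * = *[rule_format, OF tf]
		show "(LI x. pr c U x * fd ph x e) = - (LI x. (gr c U x *. e) * ph x)"
			using B'[OF e]
		proof
			assume e: "e = (1, 0)"
			show ?thesis unfolding c1[OF tf B(1), symmetric] e conjunct1[OF *] inner_minus_right c2[OF tf t(2)] by (simp add: gr_def)
		next
			assume e: "e = (0, 1)"
			show ?thesis unfolding c1[OF tf B(2), symmetric] e conjunct2[OF *] inner_minus_right c2[OF tf t(3)] by (simp add: gr_def)
		qed
	qed
qed
qed


section \<open>Complex scalars, the potential and the form in terms of triples\<close>

definition smul :: "complex => C3 => C3" where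
"smul z y = (z * fst y, z * fst (snd y), z * snd (snd y))"

text \<open>The coefficient matrix of the form: the value is multiplied and the two derivatives are
  left alone. The L2 product of \<open>pot z (U x)\<close> with \<open>Ph x\<close> is the real part
  of the gradient form plus the zero-order term.\<close>

definition pot :: "complex => C3 => C3" where
"pot z y = (z * fst y, fst (snd y), snd (snd y))"

lemma inner_triple: "y *. y' = fst y *. fst y' + fst (snd y) *. fst (snd y') + snd (snd y) *. snd (snd y')"
for y y' :: "C3"
by (simp add: inner_prod_def)

lemma inner_mult_cnj: "(z * a) *. b = a *. (cnj z * b)" for a b z :: complex
by (simp add: inner_complex_def algebra_simps)

lemma smul_adjoint: "smul z y *. y' = y *. smul (cnj z) y'"
by (simp add: smul_def inner_triple inner_mult_cnj)

lemma norm_smul: "norm (smul z y) = cmod z * norm y"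
proof (rule power2_eq_imp_eq)
show "(norm (smul z y))^2 = (cmod z * norm y)^2"
	by (simp add: norm_triple_sq smul_def norm_mult pmd distrib_left)
qed simp_all

lemma linear_pot: "linear (pot z)" by (rule linearI) (simp_all add: pot_def algebra_simps prod_eq_iff)

lemma linear_smul: "linear (smul z)" by (rule linearI) (simp_all add: smul_def algebra_simps)

lemma smul_smul: "smul z (smul w y) = smul (z * w) y" by (simp add: smul_def mult.assoc)

lemma smul_one: "smul 1 y = y" by (simp add: smul_def)

lemma norm_pot_le: "norm (pot z y) <= (cmod z + 1) * norm y"
proof -
have a: "norm (z * fst y, 0::complex, 0::complex) <= cmod z * norm y"
	using mlm[OF triple_norm_le(1)[of y], of "cmod z"] by (simp add: norm_Pair norm_mult)
have b: "norm (0::complex, fst (snd y), snd (snd y)) <= norm y"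
	by (rule power2_le_imp_le) (simp_all add: norm_triple_sq norm_Pair del: prod.collapse)
have "pot z y = (z * fst y, 0, 0) + (0, fst (snd y), snd (snd y))" by (simp add: pot_def prod_eq_iff)
then have "norm (pot z y) <= norm (z * fst y, 0::complex, 0::complex) + norm (0::complex, fst (snd y), snd (snd y))" by (simp only: norm_triangle_ineq)
with a b show ?thesis by (simp add: distrib_right)
qed

lemma borel_smul: assumes "U : BB" shows "(%x. smul z (U x)) : BB"
unfolding smul_def by (intro borel_measurable_Pair borel_measurable_times borel_measurable_const triple_measurable assms)

lemma sqi_smul: assumes "sqi U" shows "sqi (%x. smul z (U x))"
by (rule sqi_bound[OF borel_smul[OF sqi_m[OF assms]] assms, of z "cmod z"]) (simp add: norm_smul)

lemma N2_smul: "N2 (%x. smul z (U x)) = (cmod z)^2 * N2 U"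
unfolding N2_def by (simp add: norm_smul pmd)

lemma sqi_pot:
assumes "sqi U" "v : BB" "!!x. cmod (v x) <= K"
shows "sqi (%x. pot (v x) (U x))"
proof (rule sqi_bound[OF _ assms(1), of _ "K + 1"])
show "(%x. pot (v x) (U x)) : BB"
	unfolding pot_def by (intro borel_measurable_Pair borel_measurable_times assms(2) triple_measurable sqi_m[OF assms(1)])
fix x
show "norm (pot (v x) (U x)) <= (K + 1) * norm (U x)"
	using norm_pot_le[of "v x" "U x"] mrm[OF assms(3)[of x], of "norm (U x)"] by (simp add: distrib_right)
qed

lemma AE_lebesgue_on_iff:
assumes "Q : sets borel" shows "(AE x in lebesgue_on Q. R x) \<longleftrightarrow> (AE x in lborel. x : Q --> R x)"
using AE_restrict_space_iff[of Q lebesgue R] assms by (simp add: AE_completion_iff)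

lemma Basis_plane: "(Basis :: (R2) set) = {(1, 0), (0, 1)}" by (auto simp: Basis_prod_def)

text \<open>\<open>weak_partial\<close> is an arbitrary choice among functions equal almost
  everywhere; the triple provides Borel versions of the chosen ones.\<close>

definition is_rep :: "(R2) set => (R2 => complex) => (R2 => C3) => bool" where
"is_rep Q u U \<longleftrightarrow> sqi U & cgrad Q U & rep Q u (%x. fst (U x)) &
	rep Q (weak_partial Q (1, 0) u) (%x. fst (snd (U x))) & rep Q (weak_partial Q (0, 1) u) (%x. snd (snd (U x)))"

lemma is_weak_partial_rep:
assumes Q: "open Q" and r: "rep Q u F" "rep Q g G" and s: "sqi F" "sqi G" and e: "e : Basis"
shows "is_weak_partial Q e u g \<longleftrightarrow> (ALL ph. test_function Q ph -->
	(LI x. fd ph x e *R F x) = - (LI x. ph x *R G x))"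
proof -
have Qb: "Q : sets borel" using Q by simp
have i: "(LINT x|lebesgue_on Q. u' x * cr (a x)) = (LI x. a x *R F' x)"
	if "rep Q u' F'" "a : BB" for u' F' and a :: "_ => real"
proof (rule rep_lebesgue_on(3)[OF _ Qb])
	have "F' : BB" using that(1) by (simp add: rep_def)
	then have "(%x. a x *R F' x) : BB" using that(2) by measurable
	moreover have "AE x in lborel. x : Q --> F' x = u' x" using that(1) by (simp add: rep_def)
	then have "AE x in lborel. x : Q --> a x *R F' x = u' x * cr (a x)"
		by (rule ev_mono) (simp add: scaleR_conv_of_real)
	ultimately show "rep Q (%x. u' x * cr (a x)) (%x. a x *R F' x)" using that(1) by (simp add: rep_def)
qed
have "(LINT x|lebesgue_on Q. u x * cr (fd ph x e)) = (LI x. fd ph x e *R F x)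
	& (LINT x|lebesgue_on Q. g x * cr (ph x)) = (LI x. ph x *R G x)" if tf: "test_function Q ph" for ph
proof -
	obtain D where D: "ctest Q ph D" "ALL e:Basis. ALL x. D x *. e = fd ph x e" by (rule frechet_component[OF tf])
	have "(%x. fd ph x e) : BB"
		using sqi_m[OF sqi_ic[OF ctest_sqi(2)[OF D(1)], of e]] by (simp add: D(2)[rule_format, OF e])
	with i[OF r(1)] i[OF r(2) sqi_m[OF ctest_sqi(1)[OF D(1)]]] show ?thesis by simp
qed
then show ?thesis unfolding is_weak_partial_def by simp
qed

lemma W12_is_rep:
assumes Q: "open Q" and u: "u : W12 Q"
shows "EX U. is_rep Q u U"
proof -
have Qb: "Q : sets borel" using Q by simp
have uL: "u : L2 Q" using u by (simp add: W12_def)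
have L2m: "f : L2 Q ==> f : borel_measurable (lebesgue_on Q)" for f :: "R2 => complex" by (simp add: L2_def)
have wp: "weak_partial Q e u : L2 Q & is_weak_partial Q e u (weak_partial Q e u)" if "e : Basis" for e
proof -
	have "EX g. g : L2 Q & is_weak_partial Q e u g" using u that unfolding W12_def by blast
	from someI_ex[OF this] show ?thesis unfolding weak_partial_def .
qed
have B: "(1, 0) : (Basis :: (R2) set)" "(0, 1) : (Basis :: (R2) set)" by (simp_all add: Basis_plane)
obtain F where F: "rep Q u F" using ex_rep[OF L2m[OF uL] Qb] by blast
obtain G where G: "rep Q (weak_partial Q (1, 0) u) G" using ex_rep[OF L2m[OF conjunct1[OF wp[OF B(1)]]] Qb] by blast
obtain H where H: "rep Q (weak_partial Q (0, 1) u) H" using ex_rep[OF L2m[OF conjunct1[OF wp[OF B(2)]]] Qb] by blast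
have sF: "sqi F" using rep_L2(1)[OF F Qb] uL by simp
have sG: "sqi G" using rep_L2(1)[OF G Qb] wp[OF B(1)] by simp
have sH: "sqi H" using rep_L2(1)[OF H Qb] wp[OF B(2)] by simp
let ?U = "%x. (F x, G x, H x)"
have sU: "sqi ?U" unfolding sqi_def
	using sqi_i[OF sF] sqi_i[OF sG] sqi_i[OF sH] sqi_m[OF sF] sqi_m[OF sG] sqi_m[OF sH]
	by (simp add: norm_triple_sq borel_measurable_Pair)
have "cgrad Q ?U" unfolding cgrad_iff[OF Q sU]
	using is_weak_partial_rep[OF Q F G sF sG B(1)] is_weak_partial_rep[OF Q F H sF sH B(2)] wp[OF B(1)] wp[OF B(2)] by simp
then have "is_rep Q u ?U" using sU F G H by (simp add: is_rep_def)
then show ?thesis by blast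
qed

text \<open>Any triple of weak derivatives agrees almost everywhere with the chosen
  \<open>weak_partial\<close>, by uniqueness of weak gradients in the directions 1 and
  \<open>\<i>\<close>.\<close>

lemma cgrad_W12:
assumes Q: "open Q" and U: "sqi U" "cgrad Q U" "rep Q u (%x. fst (U x))"
	and off: "!!x. x ~: Q ==> U x = 0"
shows "u : W12 Q" "is_rep Q u U"
proof -
have Qb: "Q : sets borel" using Q by simp
note s = sqi_3[OF U(1)]
have r: "rep Q (%x. fst (snd (U x))) (%x. fst (snd (U x)))" "rep Q (%x. snd (snd (U x))) (%x. snd (snd (U x)))"
	using s[THEN sqi_m] off by (simp_all add: rep_def)
have B: "(1, 0) : (Basis :: (R2) set)" "(0, 1) : (Basis :: (R2) set)" by (simp_all add: Basis_plane)
have "is_weak_partial Q (1, 0) u (%x. fst (snd (U x)))" "is_weak_partial Q (0, 1) u (%x. snd (snd (U x)))"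
	using U(2) unfolding cgrad_iff[OF Q U(1)] is_weak_partial_rep[OF Q U(3) r(1) s(1,2) B(1)] is_weak_partial_rep[OF Q U(3) r(2) s(1,3) B(2)] by simp_all
moreover have "u : L2 Q" "(%x. fst (snd (U x))) : L2 Q" "(%x. snd (snd (U x))) : L2 Q"
	using rep_L2(1)[OF U(3) Qb] rep_L2(1)[OF r(1) Qb] rep_L2(1)[OF r(2) Qb] s by simp_all
ultimately show u: "u : W12 Q" unfolding W12_def Basis_plane by auto
obtain U' where U': "is_rep Q u U'" using W12_is_rep[OF Q u] by blast
have s': "sqi U'" and cg': "cgrad Q U'" and r': "rep Q u (%x. fst (U' x))"
	and g': "rep Q (weak_partial Q (1, 0) u) (%x. fst (snd (U' x)))" "rep Q (weak_partial Q (0, 1) u) (%x. snd (snd (U' x)))"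
	using U' by (simp_all add: is_rep_def)
have ae0: "AE x in lborel. x : Q --> fst (U x) = fst (U' x)"
	using U(3)[unfolded rep_def, THEN conjunct2, THEN conjunct2] r'[unfolded rep_def, THEN conjunct2, THEN conjunct2] by (rule ev2) simp
have d: "AE x in lborel. x : Q --> gr c U x - gr c U' x = 0" for c
proof (rule wgrad_zero_AE[OF _ Q sqi_diff[OF sqi_pr_gr(2)[OF U(1)] sqi_pr_gr(2)[OF s']]])
	have w: "wgrad Q (%x. pr c U x - pr c U' x) (%x. gr c U x - gr c U' x)"
		by (rule wgrad_diff) (use U(2) cg' sqi_pr_gr[OF U(1)] sqi_pr_gr[OF s'] in \<open>simp_all add: cgrad_def\<close>)
	show "wgrad Q (%x. 0) (%x. gr c U x - gr c U' x)"
	proof (rule wgrad_cong_AE[OF w])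
		show "AE x in lborel. x : Q --> 0 = pr c U x - pr c U' x & gr c U x - gr c U' x = gr c U x - gr c U' x"
			using ae0 by (rule ev_mono) (simp add: pr_def)
	qed (intro sqi_m sqi_diff sqi_pr_gr U(1) s' sqi_zero)+
qed
have ae: "AE x in lborel. x : Q --> fst (snd (U x)) = fst (snd (U' x)) & snd (snd (U x)) = snd (snd (U' x))"
	using d[of 1] d[of \<i>] by (rule ev2) (auto simp: gr_def inner_complex_def complex_eq_iff zero_prod_def)
have "rep Q (weak_partial Q (1, 0) u) (%x. fst (snd (U x)))" unfolding rep_def
proof (intro conjI)
	show "AE x in lborel. x : Q --> fst (snd (U x)) = weak_partial Q (1, 0) u x"
		using ae g'(1)[unfolded rep_def, THEN conjunct2, THEN conjunct2] by (rule ev2) simp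
qed (use sqi_m[OF s(2)] off in auto)
moreover have "rep Q (weak_partial Q (0, 1) u) (%x. snd (snd (U x)))" unfolding rep_def
proof (intro conjI)
	show "AE x in lborel. x : Q --> snd (snd (U x)) = weak_partial Q (0, 1) u x"
		using ae g'(2)[unfolded rep_def, THEN conjunct2, THEN conjunct2] by (rule ev2) simp
qed (use sqi_m[OF s(3)] off in auto)
ultimately show "is_rep Q u U" using U by (simp add: is_rep_def)
qed

lemma N2_triple:
assumes "sqi (U :: R2 => C3)"
shows "N2 U = N2 (%x. fst (U x)) + N2 (%x. fst (snd (U x))) + N2 (%x. snd (snd (U x)))"
unfolding N2_def norm_triple_sq[of "U _"] using sqi_3[OF assms, THEN sqi_i] by simp

lemma W12_norm_rep:
assumes Q: "open Q" and r: "is_rep Q u U"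
shows "W12_norm Q u = sqrt (N2 U)"
proof -
have Qb: "Q : sets borel" using Q by simp
have n: "(L2_norm Q f)^2 = N2 F" if "rep Q f F" for f F using rep_L2(2)[OF that Qb] by (simp add: N2_nonneg)
have rr: "sqi U" "rep Q u (%x. fst (U x))" "rep Q (weak_partial Q (1, 0) u) (%x. fst (snd (U x)))" "rep Q (weak_partial Q (0, 1) u) (%x. snd (snd (U x)))"
	using r by (simp_all add: is_rep_def)
show ?thesis unfolding W12_norm_def n[OF rr(2)] Basis_plane using n[OF rr(3)] n[OF rr(4)] N2_triple[OF rr(1)] by (simp add: add.assoc)
qed

lemma inner_triple_integral:
fixes U V :: "R2 => C3"
assumes "sqi U" "sqi V"
shows "(LI x. U x *. V x) = (LI x. fst (U x) *. fst (V x)) + (LI x. fst (snd (U x)) *. fst (snd (V x)))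
	+ (LI x. snd (snd (U x)) *. snd (snd (V x)))"
proof -
note i = i_inner[OF sqi_3(1)[OF assms(1)] sqi_3(1)[OF assms(2)]] i_inner[OF sqi_3(2)[OF assms(1)] sqi_3(2)[OF assms(2)]]
	i_inner[OF sqi_3(3)[OF assms(1)] sqi_3(3)[OF assms(2)]]
show ?thesis unfolding inner_triple[of "U _"] using i by simp
qed

lemma schroedinger_form_rep:
assumes Q: "open Q" and r: "is_rep Q u U" "is_rep Q v Ph"
	and V: "Vh : BB" "!!x. abs (Vh x) <= K" "AE x in lborel. x : Q --> V x = Vh x"
shows "schroedinger_form Q V u v = Complex (LI x. pot (cr (Vh x)) (U x) *. Ph x)
	(LI x. pot (cr (Vh x)) (U x) *. smul \<i> (Ph x))"
proof -
have Qb: "Q : sets borel" using Q by simp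
have ru: "sqi U" "rep Q u (%x. fst (U x))" "rep Q (weak_partial Q (1, 0) u) (%x. fst (snd (U x)))" "rep Q (weak_partial Q (0, 1) u) (%x. snd (snd (U x)))"
	using r(1) by (simp_all add: is_rep_def)
have rv: "sqi Ph" "rep Q v (%x. fst (Ph x))" "rep Q (weak_partial Q (1, 0) v) (%x. fst (snd (Ph x)))" "rep Q (weak_partial Q (0, 1) v) (%x. snd (snd (Ph x)))"
	using r(2) by (simp_all add: is_rep_def)
note sU = sqi_3[OF ru(1)] and sPh = sqi_3[OF rv(1)]
have sVU: "sqi (%x. pot (cr (Vh x)) (U x))"
	by (rule sqi_pot[OF ru(1), of _ K]) (use V(1,2) in auto)
have sV0: "sqi (%x. cr (Vh x) * fst (U x))" using sqi_3(1)[OF sVU] by (simp add: pot_def)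
have rV: "rep Q (%x. cr (V x) * u x) (%x. cr (Vh x) * fst (U x))" unfolding rep_def
proof (intro conjI)
	show "AE x in lborel. x : Q --> cr (Vh x) * fst (U x) = cr (V x) * u x"
		using V(3) ru(2)[unfolded rep_def, THEN conjunct2, THEN conjunct2] by (rule ev2) simp
qed (use sqi_m[OF sV0] ru(2) in \<open>auto simp: rep_def\<close>)
have "schroedinger_form Q V u v = L2_inner Q (weak_partial Q (1, 0) u) (weak_partial Q (1, 0) v) + L2_inner Q (weak_partial Q (0, 1) u) (weak_partial Q (0, 1) v)
		+ L2_inner Q (%x. cr (V x) * u x) v"
	by (simp add: schroedinger_form_def grad_inner_def Basis_plane)
also have "... = Complex (LI x. pot (cr (Vh x)) (U x) *. Ph x)
	(LI x. pot (cr (Vh x)) (U x) *. smul \<i> (Ph x))"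
	unfolding L2_inner_rep[OF ru(3) rv(3) Qb sU(2) sPh(2)] L2_inner_rep[OF ru(4) rv(4) Qb sU(3) sPh(3)] L2_inner_rep[OF rV rv(2) Qb sV0 sPh(1)]
		inner_triple_integral[OF sVU rv(1)] inner_triple_integral[OF sVU sqi_smul[OF rv(1)]]
	by (simp add: complex_eq_iff pot_def smul_def)
finally show ?thesis .
qed


section \<open>The operator and its resolvent for an abstract model of the form domain\<close>

lemma sqi_times_i: "sqi u ==> sqi (%x. \<i> * u x)" for u :: "'a::euclidean_space => complex"
by (rule sqi_bound[of _ u 1]) (auto simp: norm_mult dest: sqi_m)

text \<open>On derivatives the factor \<open>1 + \<i> l\<close> has real part 1; on values
  \<open>(1 + \<i> l) (v - \<i>)\<close> has real part \<open>v + l\<close>.\<close>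

lemma pot_coercive:
"v + l >= 1 ==> (norm y)^2 <= smul (Complex 1 l) (pot (cr v - \<i>) y) *. y"
proof -
assume a: "v + l >= 1"
have p: "(Complex 1 l * b) *. b = (cmod b)^2" for b
	unfolding cmod_power2 by (simp add: inner_complex_def algebra_simps p2eq)
have "(Complex 1 l * ((cr v - \<i>) * b)) *. b = (v + l) * (cmod b)^2" for b
	unfolding cmod_power2 by (simp add: inner_complex_def algebra_simps p2eq)
moreover have "1 * (cmod (fst y))^2 <= (v + l) * (cmod (fst y))^2" by (rule mrm[OF a]) simp
ultimately show ?thesis by (simp add: inner_triple smul_def pot_def p norm_triple_sq)
qed

text \<open>Separates the Hilbert space part from the geometry: \<open>S\<close> models the space
  \<open>W12_0 Q\<close> by triples, \<open>Vh\<close> is a bounded Borel version of the potential.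
  The locale is used both with and without windows.\<close>

locale dirichlet_rep = closed_subspace S
for S :: "(R2 => C3) set" +
fixes Q :: "(R2) set" and V Vh :: "R2 => real" and K :: real
assumes openQ: "open Q" and Vh_borel: "Vh : BB" and Vh_bound: "!!x. abs (Vh x) <= K"
	and Vh_eq: "AE x in lborel. x : Q --> V x = Vh x"
	and S_smul: "!!U z. U : S ==> (%x. smul z (U x)) : S"
	and S_cgrad: "!!U. U : S ==> cgrad Q U" and S_off: "!!U x. U : S ==> x ~: Q ==> U x = 0"
	and W12_0_iff: "!!u. u : W12_0 Q \<longleftrightarrow> (EX U:S. AE x in lborel. x : Q --> fst (U x) = u x)"
begin

abbreviation "sch x \<equiv> pot (cr (Vh x) - \<i>)"

lemma Qb: "Q : sets borel" using openQ by simp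

lemma K: "0 <= K" using Vh_bound[of 0] by linarith

lemma sqi_sch: "sqi U ==> sqi (%x. sch x (U x))"
proof (rule sqi_pot[of _ _ "K + 1"])
show "(%x. cr (Vh x) - \<i>) : BB" using Vh_borel by measurable
show "cmod (cr (Vh x) - \<i>) <= K + 1" for x
	using norm_triangle_ineq4[of "cr (Vh x)" \<i>] Vh_bound[of x] by simp
qed

lemma sqi_potV: "sqi U ==> sqi (%x. pot (cr (Vh x)) (U x))"
by (rule sqi_pot[of _ _ K]) (use Vh_borel Vh_bound in auto)

lemma coercive:
assumes "sqi U"
shows "N2 U <= (LI x. smul (Complex 1 (K + 1)) (sch x (U x)) *. U x)"
unfolding N2_def
proof (rule integral_mono[OF sqi_i[OF assms] i_inner[OF sqi_smul[OF sqi_sch[OF assms]] assms]])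
fix x
show "(norm (U x))^2 <= smul (Complex 1 (K + 1)) (sch x (U x)) *. U x"
	by (rule pot_coercive) (use Vh_bound[of x] in linarith)
qed

lemma S_is_rep:
assumes "U : S" "AE x in lborel. x : Q --> fst (U x) = u x"
shows "u : W12 Q" "is_rep Q u U"
proof -
have "rep Q u (%x. fst (U x))"
	using assms(2) S_off[OF assms(1)] sqi_m[OF sqi_3(1)[OF S_sqi[OF assms(1)]]] by (simp add: rep_def)
note c = cgrad_W12[OF openQ S_sqi[OF assms(1)] S_cgrad[OF assms(1)] this]
show "u : W12 Q" by (rule c(1)) (rule S_off[OF assms(1)])
show "is_rep Q u U" by (rule c(2)) (rule S_off[OF assms(1)])
qed

text \<open>Lax-Milgram is applied to the equation rotated by \<open>z = 1 + \<i> (K + 1)\<close>,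
  where coercivity holds with constant 1.\<close>

lemma weak_solution:
assumes F: "sqi F"
shows "EX U:S. ALL Ph:S. (LI x. sch x (U x) *. Ph x) = (LI x. F x *. fst (Ph x))"
proof -
define z where "z = Complex 1 (K + 1)"
have z0: "z ~= 0" by (simp add: z_def complex_eq_iff)
let ?F = "%x. smul z (F x, 0, 0)"
have sF: "sqi (%x. (F x, 0::complex, 0::complex))"
	by (rule sqi_bound[OF _ F, of _ 1]) (use sqi_m[OF F] in \<open>auto intro!: borel_measurable_Pair simp: norm_Pair\<close>)
have "EX U:S. ALL Ph:S. (LI x. smul z (sch x (U x)) *. Ph x) = (LI x. ?F x *. Ph x)"
proof (rule lax_milgram)
	show "sqi (%x. smul z (sch x (U x)))" if "sqi U" for U by (intro sqi_smul sqi_sch that)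
	show "linear (%y. smul z (sch x y))" for x using linear_compose[OF linear_pot linear_smul] by (simp add: o_def)
	show "(norm y)^2 <= smul z (sch x y) *. y" for x y
		unfolding z_def by (rule pot_coercive) (use Vh_bound[of x] in linarith)
	show "norm (smul z (sch x y)) <= (cmod z * (K + 2)) * norm y" for x y
	proof -
		have "cmod (cr (Vh x) - \<i>) + 1 <= K + 2" using norm_triangle_ineq4[of "cr (Vh x)" \<i>] Vh_bound[of x] by simp
		then have "norm (sch x y) <= (K + 2) * norm y" using norm_pot_le[of "cr (Vh x) - \<i>" y] mrm[OF _ norm_ge_zero[of y]] by (meson order_trans)
		then show ?thesis unfolding norm_smul using mlm[of _ _ "cmod z"] by (simp add: mult.assoc)
	qed
	have "1 <= cmod z" using complex_Re_le_cmod[of z] by (simp add: z_def)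
	then have "1 * (K + 2) <= cmod z * (K + 2)" using K by (intro mrm) auto
	moreover have "1 < 1 * (K + 2)" using K by simp
	ultimately show "1 < cmod z * (K + 2)" by (rule less_le_trans[rotated])
	show "sqi ?F" by (rule sqi_smul[OF sF])
qed
then obtain U where U: "U : S" "ALL Ph:S. (LI x. smul z (sch x (U x)) *. Ph x) = (LI x. ?F x *. Ph x)" by blast
have "(LI x. sch x (U x) *. Ph x) = (LI x. F x *. fst (Ph x))" if "Ph : S" for Ph
proof -
	\<comment> \<open>The rotation is undone by rotating the test function, which is possible because
	  \<open>S\<close> is a complex space.\<close>
	have "(%x. smul (1 / cnj z) (Ph x)) : S" by (rule S_smul[OF that])
	from U(2)[rule_format, OF this] show ?thesis
		unfolding smul_adjoint smul_smul using z0 by (simp add: smul_one inner_triple)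
qed
with U(1) show ?thesis by blast
qed

text \<open>Testing with \<open>Ph\<close> and with \<open>\<i>\<close> times \<open>Ph\<close>
  recovers real and imaginary part, so the real equation for all of \<open>S\<close> is the complex
  one that defines the operator.\<close>

lemma operator_iff:
assumes r: "rep Q w W" and sW: "sqi W"
shows "(u, w) : dirichlet_schroedinger Q V \<longleftrightarrow> (EX U:S. is_rep Q u U &
	(ALL Ph:S. (LI x. pot (cr (Vh x)) (U x) *. Ph x) = (LI x. W x *. fst (Ph x))))"
proof -
have wL: "w : L2 Q" using rep_L2(1)[OF r Qb] sW by simp
have form: "schroedinger_form Q V u v = Complex (LI x. pot (cr (Vh x)) (U x) *. Ph x)
		(LI x. pot (cr (Vh x)) (U x) *. smul \<i> (Ph x))"
	"L2_inner Q w v = Complex (LI x. W x *. fst (Ph x)) (LI x. W x *. fst (smul \<i> (Ph x)))"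
	if "is_rep Q u U" "is_rep Q v Ph" for v U Ph
proof -
	show "schroedinger_form Q V u v = Complex (LI x. pot (cr (Vh x)) (U x) *. Ph x)
		(LI x. pot (cr (Vh x)) (U x) *. smul \<i> (Ph x))"
		by (rule schroedinger_form_rep[OF openQ that Vh_borel Vh_bound Vh_eq])
	have "rep Q v (%x. fst (Ph x))" "sqi Ph" using that(2) by (simp_all add: is_rep_def)
	then show "L2_inner Q w v = Complex (LI x. W x *. fst (Ph x)) (LI x. W x *. fst (smul \<i> (Ph x)))"
		using L2_inner_rep[OF r _ Qb sW sqi_3(1)] by (simp add: smul_def)
qed
show ?thesis
proof
	assume "(u, w) : dirichlet_schroedinger Q V"
	then have u: "u : W12_0 Q" and eq: "!!v. v : W12_0 Q ==> schroedinger_form Q V u v = L2_inner Q w v"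
		by (simp_all add: dirichlet_schroedinger_def form_operator_def)
	obtain U where U: "U : S" "AE x in lborel. x : Q --> fst (U x) = u x" using u unfolding W12_0_iff by blast
	note ru = S_is_rep(2)[OF U]
	have "(LI x. pot (cr (Vh x)) (U x) *. Ph x) = (LI x. W x *. fst (Ph x))" if "Ph : S" for Ph
	proof -
		have a: "AE x in lborel. x : Q --> fst (Ph x) = fst (Ph x)" by simp
		then have "(%x. fst (Ph x)) : W12_0 Q" unfolding W12_0_iff using that by (intro bexI[of _ Ph])
		from eq[OF this] show ?thesis unfolding form[OF ru S_is_rep(2)[OF that a]] by simp
	qed
	with U(1) ru show "EX U:S. is_rep Q u U &
		(ALL Ph:S. (LI x. pot (cr (Vh x)) (U x) *. Ph x) = (LI x. W x *. fst (Ph x)))" by blast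
next
	assume "EX U:S. is_rep Q u U &
		(ALL Ph:S. (LI x. pot (cr (Vh x)) (U x) *. Ph x) = (LI x. W x *. fst (Ph x)))"
	then obtain U where U: "U : S" "is_rep Q u U"
		and eq: "!!Ph. Ph : S ==> (LI x. pot (cr (Vh x)) (U x) *. Ph x) = (LI x. W x *. fst (Ph x))" by blast
	have "u : W12_0 Q" unfolding W12_0_iff
		using U by (intro bexI[of _ U]) (auto simp: is_rep_def rep_def)
	moreover have "schroedinger_form Q V u v = L2_inner Q w v" if "v : W12_0 Q" for v
	proof -
		obtain Ph where P: "Ph : S" "AE x in lborel. x : Q --> fst (Ph x) = v x" using `v : W12_0 Q` unfolding W12_0_iff by blast
		show ?thesis unfolding form[OF U(2) S_is_rep(2)[OF P]] eq[OF P(1)] eq[OF S_smul[OF P(1)]] ..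
	qed
	ultimately show "(u, w) : dirichlet_schroedinger Q V" using wL by (simp add: dirichlet_schroedinger_def form_operator_def)
qed
qed

lemma sch_inner: "sch x y *. y' = pot (cr (Vh x)) y *. y' - (\<i> * fst y) *. fst y'"
by (simp add: pot_def inner_triple left_diff_distrib idl)

lemma sch_integral:
assumes "sqi U" "sqi Ph"
shows "(LI x. sch x (U x) *. Ph x) = (LI x. pot (cr (Vh x)) (U x) *. Ph x) - (LI x. (\<i> * fst (U x)) *. fst (Ph x))"
unfolding sch_inner
using i_inner[OF sqi_potV[OF assms(1)] assms(2)] i_inner[OF sqi_times_i[OF sqi_3(1)[OF assms(1)]] sqi_3(1)[OF assms(2)]] by simp

lemma solution_exists:
assumes f: "f : L2 Q"
shows "EX u w. (u, w) : dirichlet_schroedinger Q V & (AE x in lebesgue_on Q. w x - \<i> * u x = f x)"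
proof -
obtain F where F: "rep Q f F" using ex_rep[OF _ Qb, of f] f by (auto simp: L2_def)
have sF: "sqi F" using rep_L2(1)[OF F Qb] f by simp
obtain U where U: "U : S" "!!Ph. Ph : S ==> (LI x. sch x (U x) *. Ph x) = (LI x. F x *. fst (Ph x))"
	using weak_solution[OF sF] by blast
let ?u = "%x. fst (U x)"
let ?w = "%x. f x + \<i> * ?u x" and ?W = "%x. F x + \<i> * ?u x"
note sU = S_sqi[OF U(1)]
have ru: "is_rep Q ?u U" using S_is_rep(2)[OF U(1), of ?u] by simp
have sW: "sqi ?W" by (intro sqi_add sF sqi_times_i sqi_3 sU)
have "AE x in lborel. x : Q --> F x = f x" using F by (simp add: rep_def)
then have "AE x in lborel. x : Q --> ?W x = ?w x" by (rule ev_mono) simp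
then have rW: "rep Q ?w ?W" using F S_off[OF U(1)] sqi_m[OF sW] by (simp add: rep_def)
have "(LI x. pot (cr (Vh x)) (U x) *. Ph x) = (LI x. ?W x *. fst (Ph x))" if "Ph : S" for Ph
	using U(2)[OF that] sch_integral[OF sU S_sqi[OF that]] i_inner[OF sF sqi_3(1)[OF S_sqi[OF that]]]
		i_inner[OF sqi_times_i[OF sqi_3(1)[OF sU]] sqi_3(1)[OF S_sqi[OF that]]] by (simp add: ial)
then have "(?u, ?w) : dirichlet_schroedinger Q V" unfolding operator_iff[OF rW sW] using U(1) ru by blast
then show ?thesis by (intro exI[of _ ?u] exI[of _ ?w]) simp
qed

text \<open>Surjectivity is \<open>solution_exists\<close>. The bound with constant 1 is the usual
  estimate of a symmetric operator minus \<open>\<i>\<close>: the imaginary part of the equation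
  tested with the solution.\<close>

lemma i_in_resolvent_set: "\<i> : resolvent_set Q (dirichlet_schroedinger Q V)"
proof -
have "L2_norm Q u <= 1 * L2_norm Q (%x. w x - \<i> * u x)" if op: "(u, w) : dirichlet_schroedinger Q V" for u w
proof -
	have wL: "w : L2 Q" using op by (simp add: dirichlet_schroedinger_def form_operator_def)
	obtain W where W: "rep Q w W" using ex_rep[OF _ Qb, of w] wL by (auto simp: L2_def)
	have sW: "sqi W" using rep_L2(1)[OF W Qb] wL by simp
	obtain U where U: "U : S" "is_rep Q u U"
		and eq: "!!Ph. Ph : S ==> (LI x. pot (cr (Vh x)) (U x) *. Ph x) = (LI x. W x *. fst (Ph x))"
		using op unfolding operator_iff[OF W sW] by blast
	let ?u = "%x. fst (U x)"
	let ?G = "%x. W x - \<i> * ?u x"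
	note sU = S_sqi[OF U(1)]
	have su: "sqi ?u" by (intro sqi_3 sU)
	have ru: "rep Q u ?u" using U(2) by (simp add: is_rep_def)
	have sG: "sqi ?G" by (intro sqi_diff sW sqi_times_i su)
	have "AE x in lborel. x : Q --> W x - \<i> * ?u x = w x - \<i> * u x"
		using W[unfolded rep_def, THEN conjunct2, THEN conjunct2] ru[unfolded rep_def, THEN conjunct2, THEN conjunct2] by (rule ev2) simp
	then have rG: "rep Q (%x. w x - \<i> * u x) ?G" using W ru sqi_m[OF sG] by (simp add: rep_def)
	\<comment> \<open>The quadratic form is real, so its imaginary part drops out.\<close>
	have pt: "pot (cr (Vh x)) (U x) *. smul \<i> (U x) = 0" for x
		by (simp add: inner_triple pot_def smul_def inner_complex_def algebra_simps)
	have "(LI x. W x *. fst (smul \<i> (U x))) = 0" using eq[OF S_smul[OF U(1), of \<i>]] unfolding pt by simp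
	then have "(LI x. ?G x *. (\<i> * ?u x)) = - N2 (%x. \<i> * ?u x)"
		using i_inner[OF sW sqi_times_i[OF su]] i_inner[OF sqi_times_i[OF su] sqi_times_i[OF su]]
		by (simp add: idl smul_def N2_def power2_norm_eq_inner)
	then have "abs (N2 (%x. \<i> * ?u x)) <= sqrt (N2 ?G) * sqrt (N2 (%x. \<i> * ?u x))"
		using abs_int_le[OF sG sqi_times_i[OF su]] by simp
	moreover have "N2 (%x. \<i> * ?u x) = N2 ?u" by (simp add: N2_def norm_mult)
	ultimately have le: "sqrt (N2 ?u) * sqrt (N2 ?u) <= sqrt (N2 ?G) * sqrt (N2 ?u)" using N2_nonneg[of ?u] by simp
	have "sqrt (N2 ?u) <= sqrt (N2 ?G)"
	proof (cases "N2 ?u = 0")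
		case False
		then show ?thesis using mult_right_le_imp_le[OF le] N2_nonneg[of ?u] by simp
	qed (simp add: N2_nonneg)
	then show ?thesis unfolding rep_L2(2)[OF ru Qb] rep_L2(2)[OF rG Qb] by simp
qed
then have "EX K. ALL (u, w):dirichlet_schroedinger Q V. L2_norm Q u <= K * L2_norm Q (%x. w x - \<i> * u x)" by blast
moreover have "ALL f:L2 Q. EX (u, w):dirichlet_schroedinger Q V. AE x in lebesgue_on Q. w x - \<i> * u x = f x"
	using solution_exists by blast
ultimately show ?thesis by (simp add: resolvent_set_def)
qed

text \<open>Whatever element the choice in \<open>resolvent\<close> selects, it is represented by a
  triple that solves the weak equation; this is the only information about the resolvent used
  later.\<close>

lemma resolvent_rep:
assumes f: "f : L2 Q" and F: "rep Q f F"
obtains U where "U : S" "is_rep Q (resolvent Q (dirichlet_schroedinger Q V) \<i> f) U"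
	"!!Ph. Ph : S ==> (LI x. sch x (U x) *. Ph x) = (LI x. F x *. fst (Ph x))"
proof -
define u where "u = resolvent Q (dirichlet_schroedinger Q V) \<i> f"
from someI_ex[OF solution_exists[OF f]] obtain w where
	w: "(u, w) : dirichlet_schroedinger Q V" "AE x in lebesgue_on Q. w x - \<i> * u x = f x"
	unfolding u_def resolvent_def by blast
have sF: "sqi F" using rep_L2(1)[OF F Qb] f by simp
have u0: "u : W12_0 Q" using w(1) by (simp add: dirichlet_schroedinger_def form_operator_def)
obtain U0 where U0: "U0 : S" "AE x in lborel. x : Q --> fst (U0 x) = u x" using u0 unfolding W12_0_iff by blast
let ?W = "%x. F x + \<i> * fst (U0 x)"
have sW: "sqi ?W" by (intro sqi_add sF sqi_times_i sqi_3 S_sqi[OF U0(1)])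
have ae: "AE x in lborel. x : Q --> w x - \<i> * u x = f x" using w(2) unfolding AE_lebesgue_on_iff[OF Qb] .
have "AE x in lborel. x : Q --> F x = f x" using F by (simp add: rep_def)
then have "AE x in lborel. x : Q --> F x + \<i> * u x = w x" using ae by (rule ev2) (auto simp: algebra_simps)
then have "AE x in lborel. x : Q --> ?W x = w x" using U0(2) by (rule ev2) simp
then have rW: "rep Q w ?W" using F S_off[OF U0(1)] sqi_m[OF sW] by (simp add: rep_def)
obtain U where U: "U : S" "is_rep Q u U"
	and eq: "!!Ph. Ph : S ==> (LI x. pot (cr (Vh x)) (U x) *. Ph x) = (LI x. ?W x *. fst (Ph x))"
	using w(1) unfolding operator_iff[OF rW sW] by blast
have "rep Q u (%x. fst (U x))" using U(2) by (simp add: is_rep_def)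
then have "AE x in lborel. x : Q --> fst (U x) = u x" by (simp add: rep_def)
then have "AE x in lborel. x : Q --> fst (U0 x) = fst (U x)" using U0(2) by (rule ev2) simp
then have aeU: "AE x in lborel. fst (U0 x) = fst (U x)" by (rule ev_mono) (use S_off[OF U(1)] S_off[OF U0(1)] in auto)
show thesis
proof (rule that[OF U(1) U(2)[unfolded u_def]])
	fix Ph assume P: "Ph : S"
	note sPh = sqi_3(1)[OF S_sqi[OF P]] and s0 = sqi_times_i[OF sqi_3(1)[OF S_sqi[OF U0(1)]]] and s1 = sqi_times_i[OF sqi_3(1)[OF S_sqi[OF U(1)]]]
	have "(LI x. (\<i> * fst (U0 x)) *. fst (Ph x)) = (LI x. (\<i> * fst (U x)) *. fst (Ph x))"
	proof (rule integral_cong_AE)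
		show "AE x in lborel. (\<i> * fst (U0 x)) *. fst (Ph x) = (\<i> * fst (U x)) *. fst (Ph x)"
			using aeU by (rule ev_mono) simp
	qed (use i_inner[OF s0 sPh] i_inner[OF s1 sPh] in \<open>simp_all add: borel_measurable_integrable\<close>)
	then show "(LI x. sch x (U x) *. Ph x) = (LI x. F x *. fst (Ph x))"
		unfolding sch_integral[OF S_sqi[OF U(1)] S_sqi[OF P]] eq[OF P]
		using i_inner[OF sF sPh] i_inner[OF s0 sPh] by (simp add: ial)
qed
qed

end


section \<open>Geometry of the array\<close>

lemma countable_hausdorff1_null:
fixes N :: "'a::metric_space set"
assumes "countable N" shows "hausdorff1_null N"
unfolding hausdorff1_null_def
proof (intro allI impI)
fix de :: real assume "de > 0"
show "EX A :: nat => 'a set. N <= (\<Union>i. A i) & (ALL i. bounded (A i)) & summable (%i. diameter (A i)) & (\<Sum>i. diameter (A i)) < de"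
proof (cases "N = {}")
	case False
	then show ?thesis using range_from_nat_into[OF False assms] `de > 0`
		by (intro exI[of _ "%i. {from_nat_into N i}"]) auto
qed (use `de > 0` in \<open>auto intro!: exI[of _ "%i. {}"]\<close>)
qed

text \<open>A map that does not increase distances sends a set of diameter \<open>t\<close> into an
  interval of length \<open>2 * t\<close>, centred at the image of one of its points. Total diameter
  below \<open>e / 2\<close> therefore gives length below \<open>e\<close>.\<close>

lemma hausdorff1_null_image:
fixes f :: "'a::metric_space => real"
assumes N: "hausdorff1_null N" and f: "!!x y. abs (f x - f y) <= dist x y"
shows "AE s in lborel. s ~: f ` N"
proof -
have "negligible (f ` N)" unfolding negligible_outer
proof (intro allI impI)
	fix e :: real assume "e > 0"
	then have "e / 2 > 0" by simp
	then obtain A :: "nat => 'a set" where A: "N <= (\<Union>i. A i)" "!!i. bounded (A i)" "summable (%i. diameter (A i))" "(\<Sum>i. diameter (A i)) < e / 2"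
		using N[unfolded hausdorff1_null_def] by blast
	define B where "B i = (if A i = {} then {} else cball (f (SOME a. a : A i)) (diameter (A i)))" for i
	have sub: "f ` A i <= B i" for i
	proof
		fix y assume "y : f ` A i"
		then obtain x where x: "x : A i" "y = f x" by blast
		then have a: "(SOME a. a : A i) : A i" by (metis someI_ex)
		have "dist (f (SOME a. a : A i)) y <= diameter (A i)"
			using order_trans[OF f[of "SOME a. a : A i" x] diameter_bounded_bound[OF A(2) a x(1)]] x(2) by (simp add: dist_real_def)
		then show "y : B i" using x(1) by (auto simp: B_def)
	qed
	have d0: "0 <= diameter (A i)" for i by (rule diameter_ge_0[OF A(2)])
	have "emeasure lebesgue (\<Union>i. B i) <= (\<Sum>i. emeasure lebesgue (B i))" by (rule emeasure_subadditive_countably) (auto simp: B_def)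
	also have "... <= (\<Sum>i. ennreal (2 * diameter (A i)))"
		by (intro suminf_le) (auto simp: B_def cball_eq_atLeastAtMost d0)
	also have "... = ennreal (\<Sum>i. 2 * diameter (A i))" by (rule suminf_ennreal2) (use A(3) d0 in auto)
	also have "(\<Sum>i. 2 * diameter (A i)) = 2 * (\<Sum>i. diameter (A i))" by (rule suminf_mult[OF A(3)])
	also have "ennreal ... < ennreal e" using A(4) `e > 0` by (intro ennreal_lessI) auto
	finally have lt: "emeasure lebesgue (\<Union>i. B i) < ennreal e" .
	have m: "(\<Union>i. B i) : lmeasurable"
		by (rule fmeasurableI) (use lt in \<open>auto simp: B_def intro: less_trans\<close>)
	have "measure lebesgue (\<Union>i. B i) < e" using lt `e > 0` by (simp add: emeasure_eq_measure2[OF m] ennreal_less_iff)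
	moreover have "f ` N <= (\<Union>i. B i)" using A(1) sub by blast
	ultimately show "EX T. f ` N <= T & T : lmeasurable & measure lebesgue T < e" using m by blast
qed
then have "AE s in lebesgue. s ~: f ` N" by (simp add: negligible_iff_null_sets AE_not_in)
then show ?thesis by (simp add: AE_completion_iff)
qed

context graph_nbhd
begin

text \<open>The point at height \<open>rh / 2\<close> on the normal through \<open>p\<close> is the
  centre of a ball of radius \<open>rh / (4 * L)\<close> that lies in \<open>P\<close> and in the
  ball about \<open>p\<close>, by the Lipschitz bound of the graph.\<close>

lemma measure_lower_bound:
obtains c where "c > 0" "!!rh. 0 < rh ==> rh < r ==> c * rh^2 <= measure lebesgue (ball p rh Int P)"
proof -
obtain L where L: "L >= 1" "!!s s'. abs (s) <= r ==> (abs (s')) <= r ==> (abs (ga s - ga s')) <= L * abs (s - s')"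
	by (rule lipschitz) (rule that)
define c where "c = unit_ball_vol 2 * (1 / (4 * L))^2"
have "c * rh^2 <= measure lebesgue (ball p rh Int P)" if rh: "0 < rh" "rh < r" for rh
proof -
	define q where "q = p + (rh / 2) *R (n1, n2)"
	define t where "t = rh / (4 * L)"
	have t: "0 < t" "t <= rh / 4" using L(1) rh by (auto simp: t_def divide_simps)
	have "ball q t <= ball p rh Int P"
	proof
		fix x assume x: "x : ball q t"
		have nq: "norm (x - q) < t" using x by (simp add: dist_norm nmc)
		have e: "x - p = (x - q) + (rh / 2) *R (n1, n2)" by (simp add: q_def)
		have "norm ((rh / 2) *R (n1, n2)) = rh / 2" unfolding norm_scaleR norm_units using rh by simp
		then have "norm (x - p) <= norm (x - q) + rh / 2" unfolding e using norm_triangle_ineq[of "x - q" "(rh / 2) *R (n1, n2)"] by linarith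
		then have nb: "norm (x - p) < rh" using nq t(2) rh by linarith
		then have xb: "x : ball p r" using rh by (simp add: dist_norm nmc)
		have sc: "sc x = (x - q) *. (n2, - n1)" and yc: "yc x = (x - q) *. (n1, n2) + rh / 2"
			unfolding sc_def yc_def e ial inner_scaleR_left inner_units by simp_all
		have s: "abs (sc x) < t" unfolding sc using CS2[of "x - q" "(n2, - n1)"] nq norm_units by simp
		have y: "abs ((x - q) *. (n1, n2)) < t" using CS2[of "x - q" "(n1, n2)"] nq norm_units by simp
		have "abs (ga (sc x) - ga 0) <= L * abs (sc x - 0)" by (rule L(2)) (use s t rh in auto)
		also have "... <= L * t" using s L(1) by (intro mlm) auto
		also have "L * t = rh / 4" using L(1) by (simp add: t_def)
		finally have "ga (sc x) <= rh / 4" by (simp add: gamma_0)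
		then have "ht x > 0" unfolding ht_def yc using y t(2) by linarith
		then show "x : ball p rh Int P" using mem_P_iff[OF xb] nb by (simp add: dist_norm nmc)
	qed
	moreover have "ball p rh Int P : lmeasurable"
	proof (rule bounded_set_imp_lmeasurable)
		have "ball p rh Int P = ball p rh Int {x. 0 < ht x}"
			using mem_P_iff rh(2) by auto
		then show "ball p rh Int P : sets lebesgue" using open_Collect_less[OF continuous_on_const ht_continuous, of 0] by simp
	qed (meson bounded_ball bounded_Int)
	ultimately have "measure lebesgue (ball q t) <= measure lebesgue (ball p rh Int P)" by (intro measure_mono_fmeasurable) auto
	moreover have "measure lebesgue (ball q t) = c * rh^2"
		using content_ball[of t q] t(1) by (simp add: c_def t_def power_divide pmd p2eq)
	ultimately show ?thesis by simp
qed
moreover have "c > 0" using L(1) by (simp add: c_def)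
ultimately show thesis using that by blast
qed

end

locale cell_array =
fixes P :: "(R2) set" and d x20 :: real
assumes openP: "open P" and bdP: "Ck_boundary 3 P" and d: "d > 0" and strip: "P <= {x. 0 < fst x & fst x < d}"
	and x20: "x20 > 0" and slits: "frontier P Int {x. abs (snd x) < x20} = {x. fst x = 0 & abs (snd x) < x20} \<union> {x. fst x = d & abs (snd x) < x20}"
begin

definition org :: "int => R2" where "org k = (of_int k * d, 0)"
definition Pk :: "int => (R2) set" where "Pk k = {x. x - org k : P}"
definition Om :: "(R2) set" where "Om = (\<Union>k. Pk k)"
definition Oe :: "real => (R2) set" where "Oe e = array_with_windows P d e"
text \<open>The plane without the closed windows, while \<open>Oe\<close> contains the open ones;
  the end points of the windows belong to neither set. For \<open>e = - 1\<close> this is the whole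
  plane and \<open>Oe\<close> is the array itself, so the problem without windows is an instance of
  the same statements.\<close>

definition We :: "real => (R2) set" where "We e = {x. ALL k. fst x = of_int k * d --> (abs (snd x)) > e}"

lemma sub_org: "x - org k = (fst x - of_int k * d, snd x)" by (simp add: org_def prod_eq_iff)

lemma Om_eq: "Om = periodic_array P d" by (simp add: Om_def Pk_def periodic_array_def sub_org)

lemma Oe_iff: "x : Oe e \<longleftrightarrow> (EX k. x : Pk k) \<or> (EX k. fst x = of_int k * d & abs (snd x) < e)"
unfolding Oe_def array_with_windows_def Om_eq[symmetric] by (auto simp: Om_def)

lemma Pk_strip: "x : Pk k ==> of_int k * d < fst x & fst x < (of_int k + 1) * d"
using strip by (auto simp: Pk_def sub_org distrib_right)

lemma cell_unique:
assumes "of_int j * d < t" "t < (of_int j + 1) * d" "of_int k * d < t" "t < (of_int k + 1) * d" shows "j = (k::int)"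
proof -
have "of_int j * d < (of_int k + 1) * d" "of_int k * d < (of_int j + 1) * d" using assms by linarith+
then have "real_of_int j < real_of_int k + 1" "real_of_int k < real_of_int j + 1" using d by (simp_all add: mult_less_cancel_right)
then show ?thesis by linarith
qed

lemma Pk_unique: "x : Pk j ==> x : Pk k ==> j = k"
using cell_unique[of j "fst x" k] Pk_strip[of x j] Pk_strip[of x k] by blast

lemma open_Pk: "open (Pk k)"
proof -
have "Pk k = (%x. x - org k) -` P" by (auto simp: Pk_def)
then show ?thesis using open_vimage[OF openP, of "%x. x - org k"] by (simp add: continuous_intros)
qed

lemma Pk_borel [measurable]: "Pk k : sets borel" using open_Pk by simp

lemma open_Om: "open Om" unfolding Om_def using open_Pk by blast

text \<open>The open rectangle is connected and misses the frontier of \<open>P\<close>, while the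
  frontier point at the origin forces it to meet \<open>P\<close>. So it lies in \<open>P\<close>:
  next to a window there is a full strip of each adjacent cell.\<close>

lemma rectangle: "{0<..<d} \<times> {-x20<..<x20} <= P"
proof -
let ?R = "{0<..<d} \<times> {-x20<..<x20}"
have "connected ?R" by (intro connected_Times) (simp_all add: connected_Ioo)
moreover have "?R Int frontier P = {}"
proof -
	have "x ~: frontier P" if "x : ?R" for x
	proof
		assume "x : frontier P"
		moreover have "abs (snd x) < x20" "0 < fst x" "fst x < d" using that by auto
		ultimately have "x : frontier P Int {x. abs (snd x) < x20}" by simp
		then show False unfolding slits using `0 < fst x` `fst x < d` by simp
	qed
	then show ?thesis by blast
qed
moreover have "?R Int P ~= {}"
proof -
	have "(0, 0) : frontier P Int {x. abs (snd x) < x20}" unfolding slits using x20 by simp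
	then have "(0, 0) : closure P" by (simp add: frontier_def)
	then obtain y where y: "y : P" "dist y (0, 0) < x20" using x20 unfolding closure_approachable by blast
	have "abs (snd y) < x20" using y(2) dist_snd_le[of y "(0, 0)"] by (simp add: dist_real_def)
	then have "y : ?R" using y(1) strip by (cases y) (auto simp: abs_less_iff)
	then show ?thesis using y(1) by blast
qed
ultimately show ?thesis using connected_Int_frontier[of ?R P] by blast
qed

lemma rectangle_k: "of_int k * d < fst x ==> fst x < (of_int k + 1) * d ==> (abs (snd x)) < x20 ==> x : Pk k"
using rectangle by (auto simp: Pk_def sub_org distrib_right abs_less_iff)

lemma fst_ball: "y : ball x r ==> (abs (fst y - fst x)) < r" "y : ball x r ==> (abs (snd y - snd x)) < r"
using dist_fst_le[of y x] dist_snd_le[of y x] by (simp_all add: dist_real_def dist_commute)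

text \<open>The wall nearest to \<open>x\<close> separates the only two cells that a ball of radius
  \<open>d / 2\<close> can meet.\<close>

lemma near_cells:
obtains j where "!!y k. y : ball x (d / 2) ==> y : Pk k ==> k = j - 1 \<or> k = j"
proof
fix y k assume y: "y : ball x (d / 2)" "y : Pk k"
define j where "j = round (fst x / d)"
have "abs (of_int j - fst x / d) <= 1 / 2" unfolding j_def by (rule of_int_round_abs_le)
then have "abs (of_int j - fst x / d) * d <= 1 / 2 * d" using d by (intro mrm) auto
also have "abs (of_int j - fst x / d) * d = abs ((of_int j - fst x / d) * d)" using d by (simp add: abs_mult)
also have "(of_int j - fst x / d) * d = of_int j * d - fst x" using d by (simp add: field_simps)
finally have "of_int j * d - d < fst y" "fst y < of_int j * d + d" using fst_ball(1)[OF y(1)] by linarith+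
then have "of_int j * d < (of_int k + 2) * d" "of_int k * d < (of_int j + 1) * d"
	using Pk_strip[OF y(2)] by (simp_all add: distrib_right)
then have "real_of_int j < real_of_int k + 2" "real_of_int k < real_of_int j + 1" using d by (simp_all add: mult_less_cancel_right)
then show "k = round (fst x / d) - 1 \<or> k = round (fst x / d)" unfolding j_def[symmetric] by linarith
qed

lemma off_line: "0 < abs (t - of_int k * d) ==> (abs (t - of_int k * d)) < d ==> t ~= of_int j * d"
proof
assume a: "0 < abs (t - of_int k * d)" "abs (t - of_int k * d) < d" "t = of_int j * d"
then have "abs (real_of_int (j - k)) * d < 1 * d" using d by (simp add: abs_mult left_diff_distrib[symmetric])
then have "abs (real_of_int (j - k)) < 1" using d by (simp only: mult_less_cancel_right_pos)
then have "j = k" by linarith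
with a show False by simp
qed

lemma open_We: "open (We e)"
proof (rule openI)
fix x assume x: "x : We e"
obtain k where k: "abs (fst x - of_int k * d) <= d / 2"
proof -
	have "abs (of_int (round (fst x / d)) - fst x / d) * d <= 1 / 2 * d" using d of_int_round_abs_le[of "fst x / d"] by (intro mrm) auto
	then have "abs ((of_int (round (fst x / d)) - fst x / d) * d) <= d / 2" using d by (simp add: abs_mult)
	then show thesis using that[of "round (fst x / d)"] d by (simp add: left_diff_distrib abs_minus_commute)
qed
show "EX r>0. ball x r <= We e"
proof (cases "fst x = of_int k * d")
	case True
	then have s: "abs (snd x) > e" using x by (auto simp: We_def)
	have "ball x (min d (abs (snd x) - e)) <= We e"
	proof
		fix y assume y: "y : ball x (min d (abs (snd x) - e))"
		have "abs (snd y) > e" using fst_ball(2)[OF y] by linarith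
		then show "y : We e" by (simp add: We_def)
	qed
	then show ?thesis using s d by (intro exI[of _ "min d (abs (snd x) - e)"]) simp
next
	case False
	have "ball x (min (d / 2) (abs (fst x - of_int k * d))) <= We e"
	proof
		fix y assume y: "y : ball x (min (d / 2) (abs (fst x - of_int k * d)))"
		have "fst y ~= of_int j * d" for j by (rule off_line[of _ k]) (use fst_ball(1)[OF y] k in linarith)+
		then show "y : We e" by (simp add: We_def)
	qed
	then show ?thesis using False d by (intro exI[of _ "min (d / 2) (abs (fst x - of_int k * d))"]) simp
qed
qed

lemma open_Oe: assumes e: "e < x20" shows "open (Oe e)"
proof (rule openI)
fix x assume "x : Oe e"
then consider k where "x : Pk k" | k where "fst x = of_int k * d" "abs (snd x) < e" unfolding Oe_iff by blast
then show "EX r>0. ball x r <= Oe e"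
proof cases
	case 1
	then obtain r where r: "r > 0" "ball x r <= Pk k" using open_Pk by (meson openE)
	then have "ball x r <= Oe e" unfolding Oe_iff[abs_def] subset_iff by (auto simp: Oe_iff)
	with r(1) show ?thesis by blast
next
	case 2
	note x2 = 2
	have "ball x (min d (e - abs (snd x))) <= Oe e"
	proof
		fix y assume y: "y : ball x (min d (e - abs (snd x)))"
		note f = fst_ball[OF y]
		have s: "abs (snd y) < e" using f(2) by linarith
		consider "fst y = of_int k * d" | "of_int k * d < fst y" | "fst y < of_int k * d" by linarith
		then show "y : Oe e"
		proof cases
			case 1 then show ?thesis using s unfolding Oe_iff by blast
		next
			case 2
			then have "y : Pk k" by (rule rectangle_k) (use f(1) s e x2(1) in \<open>simp_all add: distrib_right abs_less_iff\<close>)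
			then show ?thesis unfolding Oe_iff by blast
		next
			case 3
			then have "y : Pk (k - 1)" by (intro rectangle_k) (use f(1) s e `fst x = of_int k * d` in \<open>simp_all add: left_diff_distrib\<close>)
			then show ?thesis unfolding Oe_iff by blast
		qed
	qed
	then show ?thesis using 2 d by (intro exI[of _ "min d (e - abs (snd x))"]) simp
qed
qed

lemma Om_sub_Oe: "Om <= Oe e" by (auto simp: Om_def Oe_iff)

text \<open>Only two cells matter near \<open>p\<close>, so a point in the closure of the union is
  in the closure of one of them.\<close>

lemma frontier_Oe:
assumes e: "e < x20" and p: "p : frontier (Oe e)"
shows "p ~: Oe e" "EX k. p : frontier (Pk k)"
proof -
show np: "p ~: Oe e" using p open_Oe[OF e] by (simp add: frontier_def interior_open)
have clOe: "p : closure (Oe e)" using p by (simp add: frontier_def)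
obtain j where j: "!!y k. y : ball p (d / 2) ==> y : Pk k ==> k = j - 1 \<or> k = j" using near_cells[of p] by blast
have "p : closure (Pk (j - 1) \<union> Pk j)" unfolding closure_approachable
proof (intro allI impI)
	fix de :: real assume de: "de > 0"
	define t where "t = min (de / 2) (d / 4)"
	have t: "t > 0" using de d by (simp add: t_def)
	obtain y where y: "y : Oe e" "dist y p < t" using clOe t unfolding closure_approachable by blast
	have "EX z k. z : Pk k & dist z y < t"
		using y(1) unfolding Oe_iff
	proof
		assume "EX k. y : Pk k" then show ?thesis using t by (metis dist_self)
	next
		assume "EX k. fst y = of_int k * d & abs (snd y) < e"
		then obtain k where k: "fst y = of_int k * d" "abs (snd y) < e" by blast
		\<comment> \<open>A point of a window is moved slightly to the right into the adjacent cell, so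
		  points of cells alone approach \<open>p\<close>.\<close>
		have "(fst y + t / 2, snd y) : Pk k" by (rule rectangle_k) (use k e t in \<open>auto simp: t_def distrib_right\<close>)
		moreover have "dist (fst y + t / 2, snd y) y < t" using t by (cases y) (simp add: dist_Pair_Pair dist_real_def)
		ultimately show ?thesis by blast
	qed
	then obtain z k where z: "z : Pk k" "dist z y < t" by blast
	have zp: "dist z p < 2 * t" using z(2) y(2) dist_triangle[of z p y] by linarith
	then have "z : ball p (d / 2)" by (simp add: t_def dist_commute)
	with j z(1) have "z : Pk (j - 1) \<union> Pk j" by blast
	moreover have "dist z p < de" using zp by (simp add: t_def)
	ultimately show "EX z:Pk (j - 1) \<union> Pk j. dist z p < de" by blast
qed
then obtain k where k: "p : closure (Pk k)" by auto
have "p ~: Pk k" using np unfolding Oe_iff by blast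
then have "p : frontier (Pk k)" using k open_Pk by (simp add: frontier_def interior_open)
then show "EX k. p : frontier (Pk k)" by blast
qed

text \<open>Off the closed windows a boundary point of one cell cannot be filled in by a window, nor
  by another cell, since cells are open and disjoint.\<close>

lemma frontier_Pk_Oe:
assumes "p : frontier (Pk k)" "p : We e"
shows "p : frontier (Oe e)"
proof -
have cl: "p : closure (Pk k)" and np: "p ~: Pk k" using assms(1) open_Pk by (simp_all add: frontier_def interior_open)
have "p ~: Pk j" for j
proof
	assume pj: "p : Pk j"
	then obtain y where "y : Pk k" "y : Pk j" using cl open_Pk[of j] by (metis IntE disjoint_iff open_Int_closure_eq_empty)
	then show False using Pk_unique np pj by metis
qed
then have "p ~: Oe e" using assms(2) unfolding Oe_iff We_def by force
moreover have "p : closure (Oe e)" using cl closure_mono[of "Pk k" "Oe e"] Oe_iff by blast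
ultimately show ?thesis using interior_subset by (auto simp: frontier_def)
qed

lemma frontier_graph:
assumes p: "p : frontier (Pk k)"
obtains r0 n1 n2 ga ga' where "r0 > 0" "!!r. 0 < r ==> r <= r0 ==> graph_nbhd (Pk k) p r n1 n2 ga ga'"
proof -
have tr: "Pk k = (+) (org k) ` P" 
	unfolding Pk_def by (auto simp: image_iff) (metis add.commute diff_add_cancel)
have "p : (+) (org k) ` frontier P" using p unfolding tr frontier_translation .
then have p': "p - org k : frontier P" by auto
obtain r0 n1 n2 ga where r0: "r0 > 0" and n: "n1^2 + n2^2 = 1" and g: "Ck_on 3 UNIV ga"
	and eq: "P Int ball (p - org k) r0 = {x : ball (p - org k) r0. (x - (p - org k)) *. (n1, n2) > ga ((x - (p - org k)) *. (n2, - n1))}"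
	using bdP[unfolded Ck_boundary_def] p' by blast
define ga' where "ga' t = fd ga t 1" for t
have di: "!!t. ga differentiable (at t)" and "continuous_on UNIV ga'"
	using g unfolding numeral_3_eq_3 ga'_def[abs_def] by simp_all
note `continuous_on UNIV ga'`
moreover have "(ga has_real_derivative ga' t) (at t)" for t
proof -
	have hd: "(ga has_derivative fd ga t) (at t)" using di by (simp add: frechet_derivative_works)
	then obtain c where "(ga has_real_derivative c) (at t)" using di real_differentiableE by blast
	moreover then have "fd ga t = (*) c" using hd hdu by (auto simp: has_field_derivative_def)
	ultimately show ?thesis by (simp add: ga'_def)
qed
moreover have "Pk k Int ball p r = {x : ball p r. (x - p) *. (n1, n2) > ga ((x - p) *. (n2, - n1))}" if r: "r <= r0" for r
proof -
	have "x : Pk k \<longleftrightarrow> (x - p) *. (n1, n2) > ga ((x - p) *. (n2, - n1))" if "x : ball p r" for x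
	proof -
		have b: "x - org k : ball (p - org k) r0" using that r by (simp add: dist_norm algebra_simps)
		have "x : Pk k \<longleftrightarrow> x - org k : P Int ball (p - org k) r0" using b by (simp add: Pk_def)
		also have "... \<longleftrightarrow> (x - org k - (p - org k)) *. (n1, n2) > ga ((x - org k - (p - org k)) *. (n2, - n1))" unfolding eq using b by simp
		finally show ?thesis by simp
	qed
	then show ?thesis by auto
qed
ultimately have "graph_nbhd (Pk k) p r n1 n2 ga ga'" if "0 < r" "r <= r0" for r
	using that n p by unfold_locales
with r0 show thesis by (rule that)
qed

end


section \<open>The form domain and its identification with the functions of zero trace\<close>

lemma pr_gr_indicator:
"pr c (%x. ind A x *R U x) = (%x. ind A x * pr c U x)" "gr c (%x. ind A x *R U x) = (%x. ind A x *R gr c U x)"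
by (auto simp: pr_def gr_def fun_eq_iff)

lemma pr_gr_diff: "pr c (%x. U x - V x) = (%x. pr c U x - pr c V x)" "gr c (%x. U x - V x) = (%x. gr c U x - gr c V x)"
by (auto simp: pr_def gr_def fun_eq_iff inner_diff_right)

lemma cgrad_add:
assumes "cgrad W U" "cgrad W V" "sqi U" "sqi V" shows "cgrad W (%x. U x + V x)"
proof -
have "pr c (%x. U x + V x) = (%x. pr c U x + pr c V x)" "gr c (%x. U x + V x) = (%x. gr c U x + gr c V x)" for c
	by (auto simp: pr_def gr_def fun_eq_iff inner_add_right)
then show ?thesis using assms wgrad_add[of W "pr _ U" "gr _ U" "pr _ V" "gr _ V"] by (simp add: cgrad_def sqi_pr_gr)
qed

lemma pr_gr_smul: "pr c (%x. smul z (U x)) = pr (cnj z * c) U" "gr c (%x. smul z (U x)) = gr (cnj z * c) U"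
proof -
have "c *. (z * b) = (cnj z * c) *. b" for b by (simp add: inner_complex_def algebra_simps)
then show "pr c (%x. smul z (U x)) = pr (cnj z * c) U" "gr c (%x. smul z (U x)) = gr (cnj z * c) U"
	by (simp_all add: pr_def gr_def smul_def fun_eq_iff)
qed

lemma cgrad_smul: "cgrad W U ==> cgrad W (%x. smul z (U x))"
unfolding cgrad_def pr_gr_smul by blast

lemma smul_of_real: "smul (cr c) y = c *R y"
by (simp add: smul_def prod_eq_iff scaleR_conv_of_real)

lemma cgrad_mono: "cgrad W U ==> W' <= W ==> cgrad W' U"
unfolding cgrad_def using wgrad_mono by blast

lemma cgrad_eq_0: "(!!x. x : W ==> U x = 0) ==> cgrad W U"
unfolding cgrad_def by (intro allI wgrad_eq_0) (simp_all add: pr_def gr_def zero_prod_def)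

lemma cgrad_local:
assumes "sqi U" "!!x. x : W ==> EX r>0. cgrad (ball x r) U"
shows "cgrad W U"
unfolding cgrad_def
proof (intro allI wgrad_local sqi_pr_gr assms(1))
fix c x assume "x : W"
from assms(2)[OF this] show "EX r>0. wgrad (ball x r) (pr c U) (gr c U)" unfolding cgrad_def by blast
qed

lemma cgrad_cong_AE:
assumes "cgrad W U" "AE x in lborel. x : W --> U' x = U x" "sqi U" "sqi U'"
shows "cgrad W U'"
unfolding cgrad_def
proof
fix c
have "AE x in lborel. x : W --> pr c U' x = pr c U x & gr c U' x = gr c U x"
	using assms(2) by (rule ev_mono) (simp add: pr_def gr_def)
from wgrad_cong_AE[OF assms(1)[unfolded cgrad_def, rule_format] this] show "wgrad W (pr c U') (gr c U')"
	by (simp add: sqi_m sqi_pr_gr assms(3,4))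
qed

lemma cgrad_cong: "cgrad W U ==> (!!x. x : W ==> U' x = U x) ==> sqi U ==> sqi U' ==> cgrad W U'"
by (rule cgrad_cong_AE) auto

lemma N2_pr_gr_le:
assumes "sqi U" shows "N2 (pr c U) <= (cmod c)^2 * N2 U" "N2 (gr c U) <= (cmod c)^2 * N2 U"
proof -
have s: "sqi (%x. cmod c *R U x)" by (rule sqi_scaleR[OF assms])
have "N2 (pr c U) <= N2 (%x. cmod c *R U x)"
proof (rule N2_mono[OF s sqi_m[OF sqi_pr_gr(1)[OF assms]]])
	fix x show "norm (pr c U x) <= norm (cmod c *R U x)"
		using order_trans[OF CS2[of c "fst (U x)"] mlm[OF triple_norm_le(1)[of "U x"], of "cmod c"]] by (simp add: pr_def)
qed
moreover have "N2 (gr c U) <= N2 (%x. cmod c *R U x)"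
	by (rule N2_mono[OF s sqi_m[OF sqi_pr_gr(2)[OF assms]]]) (use gr_norm_le in simp)
ultimately show "N2 (pr c U) <= (cmod c)^2 * N2 U" "N2 (gr c U) <= (cmod c)^2 * N2 U" by (simp_all add: N2_scaleR)
qed

lemma cgrad_closed:
assumes U: "!!n::nat. cgrad W (U n)" "!!n. sqi (U n)" "sqi V" and l: "(%n. N2 (%x. U n x - V x)) ----> 0"
shows "cgrad W V"
unfolding cgrad_def
proof
fix c
have l': "(%n. (cmod c)^2 * N2 (%x. U n x - V x)) ----> 0" using tendsto_mult_left[OF l, of "(cmod c)^2"] by simp
note b = N2_pr_gr_le[OF sqi_diff[OF U(2,3)], of c, unfolded pr_gr_diff]
show "wgrad W (pr c V) (gr c V)"
proof (rule wgrad_closed[of W "%n. pr c (U n)" "%n. gr c (U n)"])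
	show "wgrad W (pr c (U n)) (gr c (U n))" for n using U(1) by (simp add: cgrad_def)
	show "(%n. N2 (%x. pr c (U n) x - pr c V x)) ----> 0" by (rule tendsto_zero_squeeze[OF l' N2_nonneg b(1)])
	show "(%n. N2 (%x. gr c (U n) x - gr c V x)) ----> 0" by (rule tendsto_zero_squeeze[OF l' N2_nonneg b(2)])
qed (intro sqi_pr_gr U)+
qed

lemma i_ball:
fixes u :: "'a::euclidean_space => 'b::euclidean_space"
assumes "sqi u" shows "Li (%x. ind (ball p r) x * norm (u x))"
proof (rule ibound[OF integrable_cball_norm[OF assms compact_cball[of p r]]])
have "(%x. ind (ball p r) x * norm (u x)) : BB"
	by (intro borel_measurable_times borel_measurable_indicator measurable_compose[OF sqi_m[OF assms] borel_measurable_norm]) simp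
then show "(%x. ind (ball p r) x * norm (u x)) : borel_measurable lborel" by simp
qed (auto simp: ind_def)

lemma trace_integral_rep:
fixes u F :: "'a::euclidean_space => complex"
assumes Q: "open Q" and r: "rep Q u F"
shows "(LINT y|lebesgue_on (ball x rh Int Q). cmod (u y - 0)) = (LI y. ind (ball x rh) y * cmod (F y))"
proof (rule rep_lebesgue_on(3))
have F: "F : BB" using r by (simp add: rep_def)
have "(%y. ind (ball x rh) y * cmod (F y)) : BB"
	by (intro borel_measurable_times borel_measurable_indicator measurable_compose[OF F borel_measurable_norm]) simp
moreover have "AE y in lborel. y : Q --> F y = u y" using r by (simp add: rep_def)
then have "AE y in lborel. y : ball x rh Int Q --> ind (ball x rh) y * cmod (F y) = cmod (u y - 0)" by (rule ev_mono) simp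
ultimately show "rep (ball x rh Int Q) (%y. cmod (u y - 0)) (%y. ind (ball x rh) y * cmod (F y))"
	using r by (auto simp: rep_def)
qed (use Q in simp)

lemma AE_not_on_vertical_line: "AE x in (lborel :: (R2) measure). fst x ~= c"
proof -
have "negligible {x :: R2. x *. (1, 0) = c}" by (rule negligible_standard_hyperplane) (simp add: Basis_plane)
then have "AE x :: R2 in lebesgue. x ~: {x. x *. (1, 0) = c}" unfolding negligible_iff_null_sets by (rule AE_not_in)
then show ?thesis by (simp add: AE_completion_iff inner_prod_def)
qed

context cell_array
begin

definition cut :: "int => (R2 => C3) => R2 => C3" where
"cut k U x = ind (Pk k) x *R U x"

text \<open>The form domain: extended by zero, the part of the function in every single cell is weakly
  differentiable across the walls away from the windows. For \<open>e < 0\<close> there are no windows.\<close>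

definition S :: "real => (R2 => C3) set" where
"S e = {U. sqi U & (ALL x. x ~: Om --> U x = 0) & cgrad (Oe e) U & (ALL k. cgrad (We e) (cut k U))}"

lemma S_D: assumes "U : S e" shows "sqi U" "x ~: Om ==> U x = 0" "cgrad (Oe e) U" "cgrad (We e) (cut k U)"
using assms unfolding S_def by blast+

lemma S_I: "sqi U ==> (!!x. x ~: Om ==> U x = 0) ==> cgrad (Oe e) U ==> (!!k. cgrad (We e) (cut k U)) ==> U : S e"
unfolding S_def by blast

lemma cut_eq: "cut k U = (%x. ind (Pk k) x *R U x)" by (simp add: cut_def fun_eq_iff)

lemma sqi_cut: "sqi U ==> sqi (cut k U)" unfolding cut_eq by (rule sqi_ind) simp_all

lemma pr_gr_cut: "pr c (cut k U) = (%x. ind (Pk k) x * pr c U x)" "gr c (cut k U) = (%x. ind (Pk k) x *R gr c U x)"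
unfolding cut_eq by (rule pr_gr_indicator)+

lemma S_smul: "U : S e ==> (%x. smul z (U x)) : S e"
proof -
assume U: "U : S e"
have "cut k (%x. smul z (U x)) = (%x. smul z (cut k U x))" for k by (simp add: cut_eq fun_eq_iff smul_def prod_eq_iff)
then show ?thesis
	by (intro S_I) (simp_all add: sqi_smul cgrad_smul S_D[OF U], simp add: smul_def zero_prod_def)
qed

lemma AE_Oe_Om: "AE x in lborel. x : Oe e --> x : Om"
proof -
have "AE x in (lborel :: (R2) measure). ALL k::int. fst x ~= of_int k * d" unfolding AE_all_countable using AE_not_on_vertical_line by blast
then show ?thesis by (rule ev_mono) (simp add: Oe_iff Om_def)
qed

lemma csS: "closed_subspace (S e)"
proof
show "U : S e ==> sqi U" for U by (simp add: S_def)
have "cut k (%x. 0) = (%x. 0)" for k by (simp add: cut_eq)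
then show "(%x. 0) : S e" by (simp add: S_def cgrad_eq_0)
show "(%x. U x + V x) : S e" if "U : S e" "V : S e" for U V
proof -
	have "cut k (%x. U x + V x) = (%x. cut k U x + cut k V x)" for k by (simp add: cut_eq scaleR_add_right)
	then show ?thesis using that by (simp add: S_def sqi_add cgrad_add sqi_cut)
qed
show "(%x. c *R U x) : S e" if "U : S e" for U c using S_smul[OF that, of "cr c"] by (simp add: smul_of_real)
show "EX V':S e. N2 (%x. V x - V' x) = 0"
	if U: "!!n::nat. U n : S e" and V: "sqi V" and l: "(%n. N2 (%x. U n x - V x)) ----> 0" for U V
proof -
	\<comment> \<open>The limit is determined only almost everywhere; restricting it to
	  \<open>Om\<close> restores the pointwise condition and moves no mass, since all
	  \<open>U n\<close> vanish off \<open>Om\<close>.\<close>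
	define V' where "V' = (%x. ind Om x *R V x)"
	have Ob: "Om : sets borel" using open_Om by simp
	have sU: "sqi (U n)" and U0: "x ~: Om ==> U n x = 0" for n x using S_D[OF U] by blast+
	have sV: "sqi V'" unfolding V'_def by (rule sqi_ind[OF V Ob])
	have l': "(%n. N2 (%x. U n x - V' x)) ----> 0"
		by (rule tendsto_zero_squeeze[OF l N2_nonneg], rule N2_mono[OF sqi_diff[OF sU V] sqi_m[OF sqi_diff[OF sU sV]]])
			(simp add: V'_def ind_def U0)
	have lc: "(%n. N2 (%x. cut k (U n) x - cut k V' x)) ----> 0" for k
		by (rule tendsto_zero_squeeze[OF l' N2_nonneg], rule N2_mono[OF sqi_diff[OF sU sV] sqi_m[OF sqi_diff[OF sqi_cut[OF sU] sqi_cut[OF sV]]]])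
			(simp add: cut_def ind_def)
	have "cgrad (Oe e) V'" by (rule cgrad_closed[OF _ sU sV l']) (rule S_D(3)[OF U])
	moreover have "cgrad (We e) (cut k V')" for k by (rule cgrad_closed[OF _ sqi_cut[OF sU] sqi_cut[OF sV] lc]) (rule S_D(4)[OF U])
	moreover have "x ~: Om ==> V' x = 0" for x by (simp add: V'_def)
	ultimately have "V' : S e" using sV by (intro S_I)
	moreover have "N2 (%x. V x - V' x) <= N2 (%x. U n x - V x)" for n
		by (rule N2_mono[OF sqi_diff[OF sU V] sqi_m[OF sqi_diff[OF V sV]]]) (simp add: V'_def ind_def U0)
	then have "N2 (%x. V x - V' x) <= 0" using LIMSEQ_le_const[OF l] by blast
	ultimately show ?thesis using N2_nonneg[of "%x. V x - V' x"] by (intro bexI[of _ V']) auto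
qed
qed

text \<open>At a boundary point of the cell this is \<open>trace_of_extension\<close>; at an
  exterior point the cut function vanishes nearby.\<close>

lemma boundary_mean_tendsto:
assumes w: "cgrad (We e) (cut k U)" and U: "sqi U" and p: "p : We e" "p ~: Pk k"
shows "((%rh. (LI x. ind (ball p rh) x * abs (pr c (cut k U) x)) / rh^2) \<longlongrightarrow> 0) (at_right 0)"
proof (cases "p : frontier (Pk k)")
case True
obtain r0 n1 n2 ga ga' where g: "r0 > 0" "!!r. 0 < r ==> r <= r0 ==> graph_nbhd (Pk k) p r n1 n2 ga ga'"
	by (rule frontier_graph[OF True]) (rule that)
obtain r1 where r1: "r1 > 0" "ball p r1 <= We e" using open_We p(1) by (meson openE)
interpret graph_nbhd "Pk k" p r0 n1 n2 ga ga' by (rule g(2)[OF g(1) order_refl])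
show ?thesis
proof (rule trace_of_extension[OF sqi_pr_gr[OF sqi_cut[OF U]] _ r1(1)])
	show "wgrad (ball p r1) (pr c (cut k U)) (gr c (cut k U))" using wgrad_mono[OF _ r1(2)] w by (simp add: cgrad_def)
qed (simp add: pr_gr_cut)
next
case False
then have "p ~: closure (Pk k)" using p(2) open_Pk by (simp add: frontier_def interior_open)
then obtain r where r: "r > 0" "ball p r Int Pk k = {}"
	by (metis closure_approachable disjoint_iff dist_commute mem_ball)
have "\<forall>\<^sub>F rh in at_right 0. 0 = (LI x. ind (ball p rh) x * abs (pr c (cut k U) x)) / rh^2"
proof (rule eventually_at_rightI[OF _ r(1)])
	fix rh assume rh: "rh : {0<..<r}"
	have "ind (ball p rh) x * abs (pr c (cut k U) x) = 0" for x
		using r(2) rh subset_ball[of rh r p] by (auto simp: pr_gr_cut ind_def)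
	then show "0 = (LI x. ind (ball p rh) x * abs (pr c (cut k U) x)) / rh^2" by (subst LINT_eq_0) simp_all
qed
then show ?thesis by (rule Lim_transform_eventually[OF tendsto_const])
qed

text \<open>The averages defining a trace are normalised by the area of the adjacent part of the
  domain. It is comparable to \<open>rh^2\<close>, because at least one cell contributes the part
  above a graph.\<close>

lemma measure_bounds:
assumes e: "e < x20" and p: "p : frontier (Oe e)"
obtains c r where "c > 0" "r > 0" "!!rh. 0 < rh ==> rh < r ==> c * rh^2 <= measure lebesgue (ball p rh Int Oe e)"
proof -
obtain k where k: "p : frontier (Pk k)" using frontier_Oe(2)[OF e p] by blast
obtain r0 n1 n2 ga ga' where g: "r0 > 0" "!!r. 0 < r ==> r <= r0 ==> graph_nbhd (Pk k) p r n1 n2 ga ga'"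
	by (rule frontier_graph[OF k]) (rule that)
interpret graph_nbhd "Pk k" p r0 n1 n2 ga ga' by (rule g(2)[OF g(1) order_refl])
obtain c where c: "c > 0" "!!rh. 0 < rh ==> rh < r0 ==> c * rh^2 <= measure lebesgue (ball p rh Int Pk k)" by (rule measure_lower_bound) (rule that)
have "measure lebesgue (ball p rh Int Pk k) <= measure lebesgue (ball p rh Int Oe e)" for rh
proof (rule measure_mono_fmeasurable)
	show "ball p rh Int Oe e : lmeasurable"
		by (rule bounded_set_imp_lmeasurable[OF bounded_subset[OF bounded_ball[of p rh]]]) (use open_Oe[OF e] in auto)
	show "ball p rh Int Pk k : sets lebesgue" using open_Pk by simp
	show "ball p rh Int Pk k <= ball p rh Int Oe e" using Oe_iff by blast
qed
with c g(1) show thesis by (intro that[of c r0]) (auto intro: order_trans)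
qed

text \<open>At a frontier point off the closed windows the mean of \<open>|u|\<close> is at most a
  sum of four means, over two cells and the real and imaginary directions, and each tends to
  zero.\<close>

lemma S_zero_trace:
assumes e: "e < x20" and U: "U : S e" and u: "rep (Oe e) u (%x. fst (U x))"
shows "zero_trace (Oe e) u"
proof -
\<comment> \<open>The end points of the windows, which are not in \<open>We e\<close>: a countable
  exceptional set.\<close>
define N where "N = range (%k::int. (of_int k * d, e)) \<union> range (%k::int. (of_int k * d, - e))"
have "hausdorff1_null N" by (rule countable_hausdorff1_null) (simp add: N_def)
moreover have "has_trace_at (Oe e) u p 0" if p: "p : frontier (Oe e) - N" for p
proof -
	have pf: "p : frontier (Oe e)" and pN: "p ~: N" using p by auto
	have np: "p ~: Oe e" by (rule frontier_Oe(1)[OF e pf])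
	have "p : We e" unfolding We_def
	proof (intro CollectI allI impI)
		fix k assume k: "fst p = of_int k * d"
		then have "\<not> (abs (snd p)) < e" using np Oe_iff by blast
		moreover have "snd p ~= e" "snd p ~= - e"
		proof -
			have "snd p ~= s" if "s = e \<or> s = - e" for s
			proof
				assume "snd p = s"
				then have "p = (of_int k * d, s)" using k by (simp add: prod_eq_iff)
				then show False using pN that unfolding N_def by blast
			qed
			then show "snd p ~= e" "snd p ~= - e" by blast+
		qed
		ultimately show "e < abs (snd p)" by linarith
	qed
	have sU: "sqi U" and w: "cgrad (We e) (cut k U)" and U0: "x ~: Om ==> U x = 0" for k x using S_D[OF U] by blast+
	let ?T = "%k c rh. (LI x. ind (ball p rh) x * abs (pr c (cut k U) x))"
	have T: "((%rh. ?T k c rh / rh^2) \<longlongrightarrow> 0) (at_right 0)" for k c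
		by (rule boundary_mean_tendsto[OF w sU `p : We e`]) (use np Oe_iff in blast)
	obtain j where j: "!!y k. y : ball p (d / 2) ==> y : Pk k ==> k = j - 1 \<or> k = j" using near_cells[of p] by blast
	obtain c r where c: "c > 0" "r > 0" "!!rh. 0 < rh ==> rh < r ==> c * rh^2 <= measure lebesgue (ball p rh Int Oe e)" by (rule measure_bounds[OF e pf]) (rule that)
	let ?A = "%rh. (LI y. ind (ball p rh) y * cmod (fst (U y)))"
	let ?B = "%rh. ?T (j - 1) 1 rh + ?T (j - 1) \<i> rh + ?T j 1 rh + ?T j \<i> rh"
	have le: "?A rh <= ?B rh" if rh: "rh < d / 2" for rh
	proof -
		have i: "Li (%x. ind (ball p rh) x * abs (pr c (cut k U) x))" for k c
			using i_ball[OF sqi_pr_gr(1)[OF sqi_cut[OF sU]]] by simp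
		have "?A rh <= (LI x. ind (ball p rh) x * abs (pr 1 (cut (j - 1) U) x) + ind (ball p rh) x * abs (pr \<i> (cut (j - 1) U) x)
				+ ind (ball p rh) x * abs (pr 1 (cut j U) x) + ind (ball p rh) x * abs (pr \<i> (cut j U) x))"
		proof (rule integral_mono[OF i_ball[OF sqi_3(1)[OF sU]]])
			fix x
			show "ind (ball p rh) x * cmod (fst (U x)) <= ind (ball p rh) x * abs (pr 1 (cut (j - 1) U) x) + ind (ball p rh) x * abs (pr \<i> (cut (j - 1) U) x)
				+ ind (ball p rh) x * abs (pr 1 (cut j U) x) + ind (ball p rh) x * abs (pr \<i> (cut j U) x)"
			proof (cases "x : ball p rh & x : Om")
				case True
				then obtain k where k: "x : Pk k" unfolding Om_def by blast
				have "x : ball p (d / 2)" using True rh by simp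
				from j[OF this k] have "cut k U x = U x" "k = j - 1 \<or> k = j" using k by (simp_all add: cut_def)
				moreover have "cmod (fst (U x)) <= abs (pr 1 U x) + abs (pr \<i> U x)" using cmod_le[of "fst (U x)"] by (simp add: pr_def inner_complex_def)
				ultimately show ?thesis using True by (auto simp: pr_def)
			next
				case False
				then show ?thesis using U0[of x] by (cases "x : Om") auto
			qed
		qed (intro Bochner_Integration.integrable_add i)
		then show ?thesis using i by simp
	qed
	have "((%rh. (?T (j - 1) 1 rh / rh^2 + ?T (j - 1) \<i> rh / rh^2 + ?T j 1 rh / rh^2 + ?T j \<i> rh / rh^2) / c) \<longlongrightarrow> (0 + 0 + 0 + 0) / c) (at_right 0)"
		using c(1) by (intro tendsto_intros T) simp
	then have lim: "((%rh. ?B rh / (c * rh^2)) \<longlongrightarrow> 0) (at_right 0)" using c(1) by (simp add: add_divide_distrib mult.commute)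
	have ev: "\<forall>\<^sub>F rh in at_right 0. ?A rh / measure lebesgue (ball p rh Int Oe e) <= ?B rh / (c * rh^2)"
	proof (rule eventually_at_rightI[of 0 "min r (d / 2)"])
		fix rh assume "rh : {0<..<min r (d / 2)}"
		then have rh: "0 < rh" "rh < r" "rh < d / 2" by auto
		show "?A rh / measure lebesgue (ball p rh Int Oe e) <= ?B rh / (c * rh^2)"
			by (rule frac_le[OF _ le[OF rh(3)] _ c(3)[OF rh(1,2)]]) (use c(1) rh(1) in \<open>auto intro!: i_nn add_nonneg_nonneg\<close>)
	qed (use c(2) d in simp)
	have "((%rh. ?A rh / measure lebesgue (ball p rh Int Oe e)) \<longlongrightarrow> 0) (at_right 0)"
		by (rule tendsto_sandwich[OF always_eventually ev tendsto_const lim]) (auto intro!: divide_nonneg_nonneg i_nn)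
	then show ?thesis unfolding has_trace_at_def trace_integral_rep[OF open_Oe[OF e] u] .
qed
ultimately show ?thesis unfolding zero_trace_def by blast
qed

lemma trace_zero_component:
assumes e: "e < x20" and q: "q : frontier (Oe e)" and u: "rep (Oe e) u (%x. fst (U x))" and U: "sqi U" and t: "has_trace_at (Oe e) u q 0"
shows "((%rh. (LI x. ind (ball q rh) x * abs (pr c (cut k U) x)) / rh^2) \<longlongrightarrow> 0) (at_right 0)"
proof -
let ?A = "%rh. (LI y. ind (ball q rh) y * cmod (fst (U y)))" and ?m = "%rh. measure lebesgue (ball q rh Int Oe e)"
obtain b r where b: "b > 0" "r > 0" "!!rh. 0 < rh ==> rh < r ==> b * rh^2 <= ?m rh" by (rule measure_bounds[OF e q]) (rule that)
have "((%rh. ?A rh / ?m rh) \<longlongrightarrow> 0) (at_right 0)" using t unfolding has_trace_at_def trace_integral_rep[OF open_Oe[OF e] u] .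
then have lim: "((%rh. (4 * cmod c) * (?A rh / ?m rh)) \<longlongrightarrow> 0) (at_right 0)" using tendsto_mult_right_zero by blast
have i: "Li (%x. ind (ball q rh) x * abs (pr c (cut k U) x))" for rh
	using i_ball[OF sqi_pr_gr(1)[OF sqi_cut[OF U]]] by simp
have ev: "\<forall>\<^sub>F rh in at_right 0. (LI x. ind (ball q rh) x * abs (pr c (cut k U) x)) / rh^2 <= (4 * cmod c) * (?A rh / ?m rh)"
proof (rule eventually_at_rightI[OF _ b(2)])
	fix rh assume "rh : {0<..<r}"
	then have rh: "0 < rh" "rh < r" by auto
	have m0: "0 < ?m rh" using b(3)[OF rh] b(1) rh(1) by (meson less_le_trans mult_pos_pos zero_less_power)
	have "?m rh <= measure lebesgue (ball q rh)"
		by (rule measure_mono_fmeasurable) (use open_Oe[OF e] in auto)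
	also have "... <= 4 * rh^2" using integral_indicator_ball_le[of rh q] rh(1) by simp
	finally have m4: "?m rh <= 4 * rh^2" .
	have "(LI x. ind (ball q rh) x * abs (pr c (cut k U) x)) <= (LI x. cmod c * (ind (ball q rh) x * cmod (fst (U x))))"
	proof (rule integral_mono[OF i integrable_mult_right[OF i_ball[OF sqi_3(1)[OF U]]]])
		fix x show "ind (ball q rh) x * abs (pr c (cut k U) x) <= cmod c * (ind (ball q rh) x * cmod (fst (U x)))"
			using CS2[of c "fst (U x)"] by (auto simp: pr_gr_cut ind_def pr_def)
	qed
	then have "(LI x. ind (ball q rh) x * abs (pr c (cut k U) x)) <= cmod c * ?A rh" by simp
	then have "(LI x. ind (ball q rh) x * abs (pr c (cut k U) x)) / rh^2 <= cmod c * ?A rh / rh^2" by (rule divide_right_mono) simp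
	also have "... <= cmod c * ?A rh / (?m rh / 4)"
		using m0 m4 by (intro divide_left_mono mult_nonneg_nonneg mult_pos_pos i_nn) (use rh(1) in auto)
	also have "... = (4 * cmod c) * (?A rh / ?m rh)" by simp
	finally show "(LI x. ind (ball q rh) x * abs (pr c (cut k U) x)) / rh^2 <= (4 * cmod c) * (?A rh / ?m rh)" .
qed
show ?thesis
	by (rule tendsto_sandwich[OF always_eventually ev tendsto_const lim]) (auto intro!: divide_nonneg_nonneg i_nn)
qed

text \<open>Weak differentiability of the cut function is local. Inside and outside the cell it is
  immediate. At a boundary point the trace vanishes at almost every point of the graph, and
  \<open>extension_of_trace\<close> applies.\<close>

lemma W12_0_in_S:
assumes e: "e < x20" and u: "u : W12_0 (Oe e)"
shows "EX U:S e. AE x in lborel. x : Oe e --> fst (U x) = u x"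
proof -
note oQ = open_Oe[OF e]
have uW: "u : W12 (Oe e)" and zt: "zero_trace (Oe e) u" using u by (simp_all add: W12_0_def)
obtain U0 where U0: "is_rep (Oe e) u U0" using W12_is_rep[OF oQ uW] by blast
have s0: "sqi U0" "cgrad (Oe e) U0" "rep (Oe e) u (%x. fst (U0 x))" using U0 by (simp_all add: is_rep_def)
define U where "U = (%x. ind Om x *R U0 x)"
have sU: "sqi U" unfolding U_def by (rule sqi_ind[OF s0(1)]) (use open_Om in simp)
have aeU: "AE x in lborel. x : Oe e --> U x = U0 x" using AE_Oe_Om[of e] by (rule ev_mono) (simp add: U_def)
have cQ: "cgrad (Oe e) U" by (rule cgrad_cong_AE[OF s0(2) aeU s0(1) sU])
have ae: "AE x in lborel. x : Oe e --> fst (U x) = u x"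
	using aeU s0(3)[unfolded rep_def, THEN conjunct2, THEN conjunct2] by (rule ev2) simp
have off: "x ~: Om ==> U x = 0" for x by (simp add: U_def)
then have "x ~: Oe e ==> U x = 0" for x using Om_sub_Oe by blast
then have rU: "rep (Oe e) u (%x. fst (U x))"
	using ae sqi_m[OF sqi_3(1)[OF sU]] by (simp add: rep_def)
obtain N where N: "hausdorff1_null N" "!!x. x : frontier (Oe e) - N ==> has_trace_at (Oe e) u x 0" using zt unfolding zero_trace_def by blast
have "cgrad (We e) (cut k U)" for k
proof (rule cgrad_local[OF sqi_cut[OF sU]])
	fix p assume pW: "p : We e"
	consider "p : Pk k" | "p ~: closure (Pk k)" | "p : frontier (Pk k)" using open_Pk by (auto simp: frontier_def interior_open)
	then show "EX r>0. cgrad (ball p r) (cut k U)"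
	proof cases
		case 1
		then obtain r where r: "r > 0" "ball p r <= Pk k" using open_Pk by (meson openE)
		have "ball p r <= Oe e" using r(2) Oe_iff by blast
		then have "cgrad (ball p r) (cut k U)"
			by (intro cgrad_cong[OF cgrad_mono[OF cQ] _ sU sqi_cut[OF sU]]) (use r(2) in \<open>auto simp: cut_def ind_def\<close>)
		with r(1) show ?thesis by blast
	next
		case 2
		then obtain r where r: "r > 0" "ball p r Int Pk k = {}" by (metis closure_approachable disjoint_iff dist_commute mem_ball)
		have "cgrad (ball p r) (cut k U)" by (rule cgrad_eq_0) (use r(2) in \<open>auto simp: cut_def ind_def\<close>)
		with r(1) show ?thesis by blast
	next
		case 3
		obtain r0 n1 n2 ga ga' where g: "r0 > 0" "!!r. 0 < r ==> r <= r0 ==> graph_nbhd (Pk k) p r n1 n2 ga ga'"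
			by (rule frontier_graph[OF 3]) (rule that)
		interpret G: graph_nbhd "Pk k" p r0 n1 n2 ga ga' by (rule g(2)[OF g(1) order_refl])
		obtain r1 where r1: "r1 > 0" "ball p r1 <= We e" using open_We pW by (meson openE)
		obtain L where L: "L >= 1" "!!s s'. abs (s) <= r0 ==> (abs (s')) <= r0 ==> (abs (ga s - ga s')) <= L * abs (s - s')"
			by (rule G.lipschitz) (rule that)
		\<comment> \<open>For \<open>|s| < r\<close> the graph point \<open>X s\<close> stays within
		  distance \<open>(1 + L) * r\<close> of \<open>p\<close>, where both the graph description and
		  \<open>We e\<close> are available.\<close>
		define r where "r = min r0 r1 / (1 + L)"
		have r: "0 < r" "(1 + L) * r = min r0 r1" using g(1) r1(1) L(1) by (auto simp: r_def)
		have "0 <= L * r" using r(1) L(1) by simp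
		then have rr: "r <= r0" using r(2) by (simp add: distrib_right)
		interpret H: graph_nbhd "Pk k" p r n1 n2 ga ga' by (rule g(2)[OF r(1) rr])
		have XF: "H.X s : frontier (Oe e)" if s: "abs (s) < r" for s
		proof -
			have "abs (ga s - ga 0) <= L * abs (s - 0)" by (rule L(2)) (use s rr g(1) in auto)
			then have "norm (H.X s - p) <= (1 + L) * abs (s)"
				using H.norm_le_coords[of "H.X s"] unfolding H.X_coords H.gamma_0 by (simp add: distrib_right)
			also have "... < (1 + L) * r" using s L(1) by (intro mult_strict_left_mono) auto
			finally have n: "norm (H.X s - p) < min r0 r1" unfolding r(2) .
			then have Xb: "H.X s : ball p r0" "H.X s : ball p r1" by (simp_all add: dist_norm nmc)
			have "H.X s : closure (Pk k)" unfolding closure_approachable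
			proof (intro allI impI)
				fix de :: real assume de: "de > 0"
				define t where "t = min (de / 2) ((r0 - norm (H.X s - p)) / 2)"
				have t: "t > 0" "t < de" "t < r0 - norm (H.X s - p)" proof -
					have n0: "norm (H.X s - p) < r0" using n by simp
					then show "t > 0" using de by (simp add: t_def)
					have "t <= de / 2" unfolding t_def by (rule min.cobounded1)
					moreover have "t <= (r0 - norm (H.X s - p)) / 2" unfolding t_def by (rule min.cobounded2)
					moreover have "a < b" if "a <= b / 2" "0 < b" for a b :: real using that by linarith
					ultimately show "t < r0 - norm (H.X s - p)" using n0 by simp
					show "t < de" using `t <= de / 2` de by linarith
				qed
				\<comment> \<open>Points slightly above the graph belong to the cell, which shows that
				  \<open>X s\<close> is in its closure.\<close>
				define y where "y = H.X s + t *R (n1, n2)"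
				have "norm (t *R (n1, n2)) = t" unfolding norm_scaleR G.norm_units using t(1) by simp
				then have d1: "dist y (H.X s) = t" by (simp add: y_def dist_norm)
				have e1: "y - p = (H.X s - p) + t *R (n1, n2)" by (simp add: y_def)
				have "norm (y - p) < r0" unfolding e1 using norm_triangle_ineq[of "H.X s - p" "t *R (n1, n2)"] `norm (t *R (n1, n2)) = t` t(3) by linarith
				then have yb: "y : ball p r0" by (simp add: dist_norm nmc)
				have "G.sc y = s" "G.yc y = ga s + t"
					using H.X_coords[of s] unfolding G.sc_def G.yc_def H.sc_def H.yc_def e1 ial inner_scaleR_left G.inner_units by simp_all
				then have "G.ht y > 0" using t(1) by (simp add: G.ht_def)
				then have "y : Pk k" using G.mem_P_iff[OF yb] by simp
				then show "EX y:Pk k. dist y (H.X s) < de" using d1 t(2) by auto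
			qed
			moreover have "H.X s ~: Pk k"
				using G.mem_P_iff[OF Xb(1)] H.X_coords[of s] by (simp add: G.ht_def G.sc_def G.yc_def H.sc_def H.yc_def)
			ultimately have "H.X s : frontier (Pk k)" using open_Pk by (simp add: frontier_def interior_open)
			then show ?thesis by (rule frontier_Pk_Oe) (use Xb(2) r1(2) in blast)
		qed
		\<comment> \<open>The tangential coordinate does not increase distances, so the exceptional set of
		  the trace projects to a null set of parameters.\<close>
		have "AE s in lborel. s ~: H.sc ` N"
		proof (rule hausdorff1_null_image[OF N(1)])
			fix x y
			have "H.sc x - H.sc y = (x - y) *. (n2, - n1)" by (simp add: H.sc_def idl)
			then show "abs (H.sc x - H.sc y) <= dist x y" using CS2[of "x - y" "(n2, - n1)"] H.norm_units by (simp add: dist_norm)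
		qed
		then have "AE s in lborel. abs (s) < r --> H.X s ~: N" by (rule ev_mono) (metis H.X_coords(1) image_eqI)
		then have tr: "AE s in lborel. abs (s) < r -->
			((%rh. (LI x. ind (ball (H.X s) rh) x * abs (pr c (cut k U) x)) / rh^2) \<longlongrightarrow> 0) (at_right 0)" for c
			by (rule ev_mono) (intro impI trace_zero_component[OF e _ rU sU] N(2); use XF in blast)
		have "cgrad (ball p (r / 4)) (cut k U)" unfolding cgrad_def
		proof
			fix c
			have "cgrad (Pk k) (cut k U)"
				by (rule cgrad_cong[OF cgrad_mono[OF cQ] _ sU sqi_cut[OF sU]]) (use Oe_iff in \<open>auto simp: cut_def\<close>)
			then have "cgrad (Pk k Int ball p r) (cut k U)" by (rule cgrad_mono) simp
			then have w: "wgrad (Pk k Int ball p r) (pr c (cut k U)) (gr c (cut k U))" by (simp add: cgrad_def)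
			show "wgrad (ball p (r / 4)) (pr c (cut k U)) (gr c (cut k U))"
				by (rule H.extension_of_trace[OF sqi_pr_gr[OF sqi_cut[OF sU]] w open_Pk _ _ tr]) (simp_all add: pr_gr_cut)
		qed
		then show ?thesis using r(1) by (intro exI[of _ "r / 4"]) simp
	qed
qed
then have "U : S e" using sU cQ off by (intro S_I)
with ae show ?thesis by blast
qed

lemma W12_0_iff_S:
assumes e: "e < x20"
shows "u : W12_0 (Oe e) \<longleftrightarrow> (EX U:S e. AE x in lborel. x : Oe e --> fst (U x) = u x)"
proof
assume "EX U:S e. AE x in lborel. x : Oe e --> fst (U x) = u x"
then obtain U where U: "U : S e" and ae: "AE x in lborel. x : Oe e --> fst (U x) = u x" by blast
have s: "sqi U" "cgrad (Oe e) U" and off: "x ~: Oe e ==> U x = 0" for x using S_D[OF U] Om_sub_Oe by blast+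
have r: "rep (Oe e) u (%x. fst (U x))" using ae off sqi_m[OF sqi_3(1)[OF s(1)]] by (simp add: rep_def)
have "u : W12 (Oe e)" by (rule cgrad_W12(1)[OF open_Oe[OF e] s r]) (rule off)
then show "u : W12_0 (Oe e)" using S_zero_trace[OF e U r] by (simp add: W12_0_def)
qed (rule W12_0_in_S[OF e])

end


section \<open>Reflection across a wall\<close>

lemma wgrad_mult:
assumes w: "wgrad W u G" and s: "sqi u" "sqi G" and c: "c1 et E"
shows "wgrad W (%x. et x * u x) (%x. et x *R G x + u x *R E x)"
unfolding wgrad_def
proof (intro allI impI)
fix ps D h assume t: "ctest W ps D"
obtain K where K: "compact K" "K <= W" "!!x. x ~: K ==> ps x = 0" "!!x. x ~: K ==> D x = 0" using ctestE[OF t] by blast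
have q: "sqi (%x. ps x * (E x *. h))" "sqi (%x. et x * (D x *. h))" "sqi (%x. ps x * et x)"
	by (rule sqi_continuous[OF _ K(1)], (intro continuous_intros c1_cont[OF c] c1_contD[OF c] c1_cont[OF ctest_c1[OF t]] c1_contD[OF ctest_c1[OF t]])[1], simp add: K(3,4))+
have i: "Li (%x. u x * (ps x * (E x *. h)))" "Li (%x. u x * (et x * (D x *. h)))" "Li (%x. (G x *. h) * (ps x * et x))"
	by (intro i_mult s q sqi_ic)+
have "(LI x. u x * (ps x * (E x *. h))) + (LI x. u x * (et x * (D x *. h))) = - (LI x. (G x *. h) * (ps x * et x))"
	using wgradD[OF w ctest_mult_left[OF t c], of h] i by (simp add: ial distrib_left)
moreover have "(LI x. ((et x *R G x + u x *R E x) *. h) * ps x) = (LI x. (G x *. h) * (ps x * et x) + u x * (ps x * (E x *. h)))"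
	by (intro icong refl) (simp add: ial algebra_simps)
moreover have "(LI x. et x * u x * (D x *. h)) = (LI x. u x * (et x * (D x *. h)))"
	by (simp add: mult_ac)
ultimately show "(LI x. et x * u x * (D x *. h)) = - (LI x. ((et x *R G x + u x *R E x) *. h) * ps x)"
	using i by simp
qed

lemma ctest_wgrad: assumes "ctest UNIV f F" shows "wgrad UNIV f F"
unfolding wgrad_def
proof (intro allI impI)
fix ps :: "'a => real" and D h assume t: "ctest UNIV ps D"
have z: "(LI x. (f x *R D x + ps x *R F x) *. h) = 0"
	by (rule ctest_integral_zero[OF ctest_mult_left[OF assms ctest_c1[OF t]]])
have i: "Li (%x. f x * (D x *. h))" "Li (%x. ps x * (F x *. h))"
	by (intro i_mult sqi_ic ctest_sqi[OF assms] ctest_sqi[OF t])+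
show "(LI x. f x * (D x *. h)) = - (LI x. (F x *. h) * ps x)"
	using z i by (simp add: ial mult.commute)
qed

lemma ctest_lipschitz:
assumes "ctest W th D" "!!x. norm (D x) <= B"
shows "abs (th x - th y) <= B * norm (x - y)"
proof -
have "norm (th x - th y) <= B * norm (x - y)"
proof (rule differentiable_bound[of UNIV])
	show "(th has_derivative (%h. D z *. h)) (at z within UNIV)" for z using c1_der[OF ctest_c1[OF assms(1)]] by simp
	show "onorm (%h. D z *. h) <= B" for z
	proof (rule onorm_le)
		show "norm (D z *. h) <= B * norm h" for h
			using order_trans[OF CS2[of "D z" h] mrm[OF assms(2)[of z] norm_ge_zero]] by simp
	qed
qed simp_all
then show ?thesis by simp
qed

lemma half_extension:
fixes th :: "R2 => real" and a sg :: real
defines "H \<equiv> {x. 0 < sg * (fst x - a)}"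
assumes t: "ctest UNIV th D" and z: "!!x. fst x = a ==> th x = 0" and sg: "sg = 1 \<or> sg = - 1"
shows "wgrad UNIV (%x. ind H x * th x) (%x. ind H x *R D x)"
proof -
obtain K where K: "compact K" "!!x. x ~: K ==> th x = 0" "!!x. x ~: K ==> D x = 0" by (rule ctestE[OF t]) (rule that)
obtain B where B: "B > 0" "!!x. abs (th x) <= B" "!!x. norm (D x) <= B" by (rule ctest_bounded[OF t]) (rule that)
define y where "y x = (x - (a, 0)) *. (sg, 0)" for x :: "R2"
have y: "y x = sg * (fst x - a)" for x by (simp add: y_def inner_prod_def mult.commute)
have lip: "abs (th x) <= B * abs (y x)" for x
proof -
	have "x - (a, snd x) = (fst x - a, 0)" by (simp add: prod_eq_iff)
	then have "norm (x - (a, snd x)) = abs (y x)" using sg by (auto simp: y norm_Pair abs_mult)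
	then show ?thesis using ctest_lipschitz[OF t B(3), of x "(a, snd x)"] z by simp
qed
define f where "f n x = real (Suc n) * y x - 1" for n x
define et where "et n x = 1 - stp (f n x)" for n x
define E where "E n x = - stp' (f n x) *R (real (Suc n) *R (sg, 0::real))" for n x
have cy: "c1 y (%x. (sg, 0))" unfolding y_def[abs_def] by (rule c1_inner)
have "c1 (f n) (%x. real (Suc n) *R (sg, 0) - 0)" for n unfolding f_def[abs_def] by (intro c1_diff c1_scale cy c1_const)
then have cet: "c1 (et n) (E n)" for n unfolding et_def[abs_def] E_def[abs_def] using c1_diff[OF c1_const c1_stp] by fastforce
define g where "g n x = th x * et n x" for n x
define G where "G n x = th x *R E n x + et n x *R D x" for n x
have tg: "ctest UNIV (g n) (G n)" for n unfolding g_def[abs_def] G_def[abs_def] by (rule ctest_mult_left[OF t cet])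
have Hm: "H : sets borel"
proof -
	have "H = {x. 0 < y x}" by (simp add: H_def y)
	then show ?thesis using open_Collect_less[OF continuous_on_const c1_cont[OF cy], of 0] by simp
qed
have sh: "sqi (%x. ind H x * th x)" "sqi (%x. ind H x *R D x)"
	using sqi_ind[OF ctest_sqi(1)[OF t] Hm] sqi_ind[OF ctest_sqi(2)[OF t] Hm] by simp_all
have y0: "y x <= 0 ==> et n x = 0 & E n x = 0" for n x
proof -
	assume "y x <= 0"
	then have "f n x <= 0" using mult_nonneg_nonpos[of "real (Suc n)" "y x"] by (simp add: f_def)
	then show ?thesis by (simp add: et_def E_def stp_eq_1 stp'_eq_0 zero_prod_def)
qed
have y1: "2 <= real (Suc n) * y x ==> et n x = 1 & E n x = 0" for n x
	by (simp add: et_def E_def f_def stp_eq_0 stp'_eq_0 zero_prod_def)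
have ev: "\<forall>\<^sub>F n in sequentially. et n x = ind H x & E n x = 0" for x
proof (cases "y x <= 0")
	case True
	then show ?thesis using y0[OF True] by (simp add: H_def y)
next
	case False
	obtain N :: nat where N: "2 / y x < N" using reals_Archimedean2 by blast
	have "et n x = ind H x & E n x = 0" if "n >= N" for n
	proof -
		have "2 / y x <= real (Suc n)" using N that by simp
		then have "2 <= real (Suc n) * y x" using False by (simp add: divide_simps)
		then show ?thesis using y1[of n x] False by (simp add: H_def y)
	qed
	then show ?thesis unfolding eventually_sequentially by blast
qed
have et01: "abs (et n x - ind H x) <= 1" for n x
	using stp_bounds[of "f n x"] by (auto simp: et_def ind_def)
have EB: "norm (th x *R E n x) <= 4 * B" for n x
proof (cases "y x <= 0 \<or> 2 <= real (Suc n) * y x")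
	case True
	then have "E n x = 0" using y0 y1 by blast
	then show ?thesis using B(1) by simp
next
	case False
	have "norm (E n x) <= 2 * real (Suc n)"
	proof -
		have "norm (sg, 0::real) = 1" using sg by (auto simp: norm_Pair)
		then have "norm (E n x) = abs (stp' (f n x)) * real (Suc n)" unfolding E_def norm_scaleR by simp
		also have "... <= 2 * real (Suc n)" by (rule mrm) (use stp'_bounds[of "f n x"] in auto)
		finally show ?thesis .
	qed
	then have "norm (th x *R E n x) <= (B * y x) * (2 * real (Suc n))"
		unfolding norm_scaleR using lip[of x] False by (intro mult_mono) auto
	also have "... = (2 * B) * (real (Suc n) * y x)" by simp
	also have "... <= (2 * B) * 2" using False B(1) by (intro mlm) auto
	finally show ?thesis by simp
qed
have wI: "Li (%x. (norm (ind K x *R (5 * B)))^2)" by (rule sqi_i[OF sqi_cind[OF K(1)]])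
show ?thesis
proof (rule wgrad_closed[of UNIV g G])
	show "(%n. N2 (%x. g n x - ind H x * th x)) ----> 0"
	proof (rule N2_tendsto_zero[OF _ wI])
		show "(%x. g n x - ind H x * th x) : BB" for n by (intro sqi_m sqi_diff ctest_sqi[OF tg] sh)
		show "(norm (g n x - ind H x * th x))^2 <= (norm (ind K x *R (5 * B)))^2" for n x
		proof (cases "x : K")
			case True
			have "abs ((et n x - ind H x) * th x) <= 1 * B" unfolding abs_mult using et01 B(2) by (intro mult_mono) auto
			then have "abs (g n x - ind H x * th x) <= 5 * B" using B(1) by (simp add: g_def algebra_simps)
			then show ?thesis using True B(1) by (intro power_mono) auto
		qed (simp add: g_def K)
		have "(%n. g n x - ind H x * th x) ----> 0" for x
			by (intro tendsto_eventually) (rule ev_mono[OF ev[of x]], simp add: g_def)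
		then show "AE x in lborel. (%n. g n x - ind H x * th x) ----> 0" by simp
	qed
	show "(%n. N2 (%x. G n x - ind H x *R D x)) ----> 0"
	proof (rule N2_tendsto_zero[OF _ wI])
		show "(%x. G n x - ind H x *R D x) : BB" for n by (intro sqi_m sqi_diff ctest_sqi[OF tg] sh)
		show "(norm (G n x - ind H x *R D x))^2 <= (norm (ind K x *R (5 * B)))^2" for n x
		proof (cases "x : K")
			case True
			have "G n x - ind H x *R D x = th x *R E n x + (et n x - ind H x) *R D x" by (simp add: G_def algebra_simps)
			moreover have "norm ((et n x - ind H x) *R D x) <= 1 * B" unfolding norm_scaleR using et01 B(3) by (intro mult_mono) auto
			ultimately have "norm (G n x - ind H x *R D x) <= 4 * B + 1 * B" by (simp only: norm_triangle_mono[OF EB])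
			then show ?thesis using True B(1) by (intro power_mono) auto
		qed (simp add: G_def K)
		have "(%n. G n x - ind H x *R D x) ----> 0" for x
			by (intro tendsto_eventually) (rule ev_mono[OF ev[of x]], simp add: G_def)
		then show "AE x in lborel. (%n. G n x - ind H x *R D x) ----> 0" by simp
	qed
qed (intro ctest_wgrad tg ctest_sqi[OF tg] sh)+
qed

definition mirror :: "real => R2 => R2" where "mirror a x = (2 * a - fst x, snd x)"

lemma mirror_mirror [simp]: "mirror a (mirror a x) = x" by (simp add: mirror_def prod_eq_iff)

lemma mirror_inner: "mirror 0 g *. h = g *. mirror 0 h" by (simp add: mirror_def inner_prod_def)

lemma norm_mirror: "norm (mirror 0 g) = norm g" by (cases g) (simp add: mirror_def norm_Pair)

lemma dist_mirror: "dist (a, 0) (mirror a x) = dist (a, 0) x"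
by (cases x) (simp add: mirror_def dist_Pair_Pair dist_real_def abs_minus_commute)

lemma mirror_continuous: "continuous_on A (mirror a)" unfolding mirror_def[abs_def] by (intro continuous_intros)

lemma measure_pres_mirror: "measure_pres (mirror a)"
proof -
define c where "c j = (if j = (1, 0) then -1 else 1 :: real)" for j :: "R2"
define T where "T x = (2 * a, 0) + (\<Sum>j\<in>Basis. (c j * (x *. j)) *R j)" for x :: "R2"
have T: "T = mirror a" by (simp add: T_def fun_eq_iff mirror_def Basis_plane c_def prod_eq_iff inner_prod_def)
have "lborel = density (distr lborel borel T) (%_. (\<Prod>j\<in>Basis. abs (c j)))"
	unfolding T_def by (rule lborel_affine_euclidean) (simp add: c_def)
moreover have "(\<Prod>j\<in>Basis. abs (c j)) = 1" by (simp add: c_def Basis_plane)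
ultimately have "lborel = distr lborel borel (mirror a)" by (simp add: T density_1)
then show ?thesis by (simp add: measure_pres_def bmc mirror_continuous)
qed

lemma sqi_mirror:
assumes "sqi G" shows "sqi (%x. mirror 0 (G (mirror a x)))" "N2 (%x. mirror 0 (G (mirror a x))) = N2 G"
proof -
note s = mp_sqi[OF measure_pres_mirror[of a] assms]
show "sqi (%x. mirror 0 (G (mirror a x)))"
	by (rule sqi_bound[OF measurable_compose[OF sqi_m[OF s] bmc[OF mirror_continuous]] s, of _ 1]) (simp add: norm_mirror)
show "N2 (%x. mirror 0 (G (mirror a x))) = N2 G" using measure_pres_N2[OF measure_pres_mirror[of a] assms] by (simp add: N2_def norm_mirror)
qed

lemma ctest_mirror:
assumes t: "ctest W ps D" and W: "!!x. x : W ==> mirror a x : W'"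
shows "ctest W' (%x. ps (mirror a x)) (%x. mirror 0 (D (mirror a x)))"
proof -
obtain K where K: "compact K" "K <= W" "!!x. x ~: K ==> ps x = 0" by (rule ctestE[OF t]) (rule that)
have r': "(mirror a has_derivative mirror 0) (at x)" for x
	unfolding mirror_def[abs_def] by (auto intro!: derivative_eq_intros)
have "((%x. ps (mirror a x)) has_derivative (%h. mirror 0 (D (mirror a x)) *. h)) (at x)" for x
	using has_derivative_compose[OF r'[of x] c1_der[OF ctest_c1[OF t], of "mirror a x"]] by (simp add: mirror_inner)
moreover have "continuous_on UNIV (%x. mirror 0 (D (mirror a x)))"
	by (rule continuous_on_compose2[OF mirror_continuous continuous_on_compose2[OF c1_contD[OF ctest_c1[OF t]] mirror_continuous]]) auto
ultimately have "c1 (%x. ps (mirror a x)) (%x. mirror 0 (D (mirror a x)))" by (simp add: c1_def)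
moreover have "ps (mirror a x) = 0" if "x ~: mirror a ` K" for x
	using that K(3)[of "mirror a x"] by (metis image_eqI mirror_mirror)
ultimately show ?thesis unfolding ctest_def
	using K(2) W compact_continuous_image[OF mirror_continuous K(1), of a] by (intro conjI exI[of _ "mirror a ` K"]) auto
qed

lemma wgrad_mirror:
assumes w: "wgrad UNIV u G" and s: "sqi u" "sqi G"
shows "wgrad UNIV (%x. u (mirror a x)) (%x. mirror 0 (G (mirror a x)))"
unfolding wgrad_def
proof (intro allI impI)
fix ps :: "R2 => real" and D h assume t: "ctest UNIV ps D"
have t': "ctest UNIV (%x. ps (mirror a x)) (%x. mirror 0 (D (mirror a x)))" by (rule ctest_mirror[OF t]) simp
have m: "(%x. u x * (mirror 0 (D (mirror a x)) *. mirror 0 h)) : BB" "(%x. (G x *. mirror 0 h) * ps (mirror a x)) : BB"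
	by (intro borel_measurable_times sqi_m s sqi_ic ctest_sqi[OF t'])+
have "(LI x. u (mirror a x) * (D x *. h)) = (LI x. u x * (mirror 0 (D (mirror a x)) *. mirror 0 h))"
	using mp_int[OF measure_pres_mirror[of a] m(1)] by (simp add: mirror_inner)
also have "... = - (LI x. (G x *. mirror 0 h) * ps (mirror a x))" by (rule wgradD[OF w t'])
also have "... = - (LI x. (mirror 0 (G (mirror a x)) *. h) * ps x)"
	using mp_int[OF measure_pres_mirror[of a] m(2)] by (simp add: mirror_inner)
finally show "(LI x. u (mirror a x) * (D x *. h)) = - (LI x. (mirror 0 (G (mirror a x)) *. h) * ps x)" .
qed

text \<open>Odd reflection across the wall turns the Dirichlet condition into an interior problem.\<close>

lemma half_gradient_bound:
fixes u f :: "R2 => real" and a sg R r :: real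
defines "H \<equiv> {x. 0 < sg * (fst x - a)}" and "B \<equiv> ball (a, 0::real) R"
assumes w: "wgrad UNIV u G" and s: "sqi u" "sqi G" "sqi f"
	and off: "!!x. x ~: H ==> G x = 0 & f x = 0"
	and weak: "!!th D. ctest B th D ==> (!!x. fst x = a ==> th x = 0) ==>
		(LI x. G x *. D x) = (LI x. f x * th x)"
	and r: "0 < r" "r < R / 4"
shows "(LI x. ind (cball (a, 0) r) x * (norm (G x))^2) <=
	8 * (r^2 * log_factor R r) * (32 * N2 (%x. ind B x * f x) + 88 * ((24 / R)^2 * N2 (%x. ind B x *R G x)))"
proof -
let ?R = "mirror a"
let ?f = "%x. ind B x * f x" and ?G = "%x. ind B x *R G x"
have Bb: "B : sets borel" by (simp add: B_def)
have sf: "sqi ?f" using sqi_ind[OF s(3) Bb] by simp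
have sG: "sqi ?G" by (rule sqi_ind[OF s(2) Bb])
have RB: "?R x : B \<longleftrightarrow> x : B" for x by (simp add: B_def dist_mirror)
have iRB: "ind B (?R x) = (ind B x :: real)" for x by (simp add: ind_def RB)
have RH: "x : H ==> ?R x ~: H" for x by (auto simp: H_def mirror_def algebra_simps)
have mR: "sqi v ==> sqi (%x. v (?R x))" for v :: "R2 => real" by (rule mp_sqi[OF measure_pres_mirror])
note s' = mR[OF s(1)] sqi_mirror(1)[OF s(2), of a] sqi_mirror(1)[OF sG, of a] mR[OF sf]
let ?u = "%x. u x - u (?R x)" and ?g = "%x. ?G x - mirror 0 (?G (?R x))" and ?F = "%x. ?f x - ?f (?R x)"
have "wgrad UNIV ?u (%x. G x - mirror 0 (G (?R x)))" by (rule wgrad_diff[OF w wgrad_mirror[OF w s(1,2)] s(1,2) s'(1,2)])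
then have w': "wgrad B ?u ?g"
proof (rule wgrad_cong_AE[OF wgrad_mono])
	show "AE x in lborel. x : B --> ?u x = ?u x & ?g x = G x - mirror 0 (G (?R x))" by (simp add: iRB)
qed (intro subset_UNIV sqi_m sqi_diff s s' sG)+
have weak': "(LI x. ?g x *. D x) = (LI x. ?F x * ph x)" if t: "ctest B ph D" for ph D
proof -
	have t2: "ctest B (%x. ph (?R x)) (%x. mirror 0 (D (?R x)))" by (rule ctest_mirror[OF t]) (simp add: RB)
	obtain K where K: "compact K" "K <= B" "!!x. x ~: K ==> ph x = 0" "!!x. x ~: K ==> D x = 0" using ctestE[OF t] by blast
	obtain K2 where K2: "compact K2" "K2 <= B" "!!x. x ~: K2 ==> ph (?R x) = 0" "!!x. x ~: K2 ==> mirror 0 (D (?R x)) = 0" using ctestE[OF t2] by blast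
	\<comment> \<open>Testing the odd reflection with \<open>ph\<close> amounts to testing the original
	  function with \<open>ph\<close> minus its reflection, which vanishes on the wall and is therefore
	  admissible in \<open>weak\<close>.\<close>
	have td: "ctest B (%x. ph x - ph (?R x)) (%x. D x - mirror 0 (D (?R x)))" unfolding ctest_def
		using c1_diff[OF ctest_c1[OF t] ctest_c1[OF t2]] K K2 by (intro conjI exI[of _ "K \<union> K2"]) auto
	have z: "fst x = a ==> ph x - ph (?R x) = 0" for x by (cases x) (simp add: mirror_def)
	have out: "x ~: B ==> ph x = 0 & ph (?R x) = 0 & D x = 0 & mirror 0 (D (?R x)) = 0" for x using K K2 by blast
	note tt = ctest_sqi[OF t] ctest_sqi[OF t2]
	have "(LI x. mirror 0 (?G (?R x)) *. D x) = (LI x. ?G x *. mirror 0 (D (?R x)))"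
		using mp_int[OF measure_pres_mirror[of a] borel_measurable_inner[OF sqi_m[OF sG] sqi_m[OF tt(4)]]] by (simp add: mirror_inner)
	then have "(LI x. ?g x *. D x) = (LI x. ?G x *. D x) - (LI x. ?G x *. mirror 0 (D (?R x)))"
		using LINT_inner_diff_left[OF sG s'(3) tt(2)] by simp
	also have "... = (LI x. ?G x *. (D x - mirror 0 (D (?R x))))"
		using i_inner[OF sG tt(2)] i_inner[OF sG tt(4)] by (simp add: inner_diff_right)
	also have "... = (LI x. G x *. (D x - mirror 0 (D (?R x))))"
	proof (rule icong)
		show "?G x *. (D x - mirror 0 (D (?R x))) = G x *. (D x - mirror 0 (D (?R x)))" for x using out[of x] by (cases "x : B") simp_all
	qed simp
	also have "... = (LI x. f x * (ph x - ph (?R x)))" by (rule weak[OF td z])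
	also have "... = (LI x. ?f x * (ph x - ph (?R x)))"
	proof (rule icong)
		show "f x * (ph x - ph (?R x)) = ?f x * (ph x - ph (?R x))" for x using out[of x] by (cases "x : B") simp_all
	qed simp
	also have "... = (LI x. ?f x * ph x) - (LI x. ?f x * ph (?R x))"
		using i_mult[OF sf tt(1)] i_mult[OF sf tt(3)] by (simp add: right_diff_distrib)
	also have "(LI x. ?f x * ph (?R x)) = (LI x. ?f (?R x) * ph x)"
		using mp_int[OF measure_pres_mirror[of a] borel_measurable_times[OF sqi_m[OF sf] sqi_m[OF tt(3)]]] by simp
	also have "(LI x. ?f x * ph x) - (LI x. ?f (?R x) * ph x) = (LI x. ?F x * ph x)"
		using i_mult[OF sf tt(1)] i_mult[OF s'(4) tt(1)] by (simp add: left_diff_distrib)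
	finally show ?thesis .
qed
have sg: "sqi ?g" by (rule sqi_diff[OF sG s'(3)])
\<comment> \<open>The reflected data have at most four times the squared norm, which turns the
  constants 8 and 22 of the interior estimate into 32 and 88.\<close>
have nf: "N2 ?F <= 4 * N2 ?f"
	using N2_add_le[OF sf sqi_uminus[OF s'(4)]] measure_pres_N2[OF measure_pres_mirror[of a] sf] by (simp add: N2_def)
have ng: "N2 ?g <= 4 * N2 ?G"
	using N2_add_le[OF sG sqi_uminus[OF s'(3)]] sqi_mirror(2)[OF sG, of a] by (simp add: N2_def)
have "(LI x. ind (cball (a, 0) r) x * (norm (G x))^2) <= (LI x. ind (cball (a, 0) r) x * (norm (?g x))^2)"
proof (rule integral_mono)
	have i: "Li (%x. ind (cball (a, 0) r) x * (norm (v x))^2)" if "sqi v" for v :: "R2 => R2"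
		using integrable_real_mult_indicator[OF _ sqi_i[OF that], of "cball (a, 0) r"] by (simp add: mult.commute)
	show "Li (%x. ind (cball (a, 0) r) x * (norm (G x))^2)" "Li (%x. ind (cball (a, 0) r) x * (norm (?g x))^2)"
		by (rule i[OF s(2)], rule i[OF sg])
	fix x
	show "ind (cball (a, 0) r) x * (norm (G x))^2 <= ind (cball (a, 0) r) x * (norm (?g x))^2"
	proof (cases "x : H & x : cball (a, 0) r")
		case True
		then have "x : B" using r by (simp add: B_def)
		moreover have "G (?R x) = 0" using off[OF RH] True by blast
		moreover have "mirror 0 0 = 0" by (simp add: mirror_def zero_prod_def)
		ultimately have "?g x = G x" by simp
		then show ?thesis by simp
	next
		case False
		then show ?thesis using off[of x] by (cases "x : H") auto
	qed
qed
also have "... <= 8 * (r^2 * log_factor R r) * (8 * N2 ?F + 22 * ((24 / R)^2 * N2 ?g))"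
	by (rule gradient_log_bound[of "(a, 0)" R, folded B_def, OF w' sqi_diff[OF s(1) s'(1)] sg sqi_diff[OF sf s'(4)] weak' r])
also have "... <= 8 * (r^2 * log_factor R r) * (32 * N2 ?f + 88 * ((24 / R)^2 * N2 ?G))"
proof (rule mlm)
	have "(24 / R)^2 * N2 ?g <= (24 / R)^2 * (4 * N2 ?G)" by (rule mlm[OF ng]) simp
	then show "8 * N2 ?F + 22 * ((24 / R)^2 * N2 ?g) <= 32 * N2 ?f + 88 * ((24 / R)^2 * N2 ?G)" using nf by simp
	have "1 <= 1 + 2 * R^2 / r^2" by simp
	then have "0 <= ln (1 + 2 * R^2 / r^2)" by (rule ln_ge_zero)
	then show "0 <= 8 * (r^2 * log_factor R r)" by (simp add: log_factor_def)
qed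
finally show ?thesis .
qed

text \<open>Sums the estimates at the individual windows: disjointness of the larger sets
  \<open>B k\<close> bounds the right-hand sides by one integral, so the constant does not grow with
  the number of windows. Finite unions come first, then dominated convergence.\<close>

lemma sum_disjoint_bound:
fixes T B :: "int => 'a::euclidean_space set" and a b :: "'a => real"
assumes T: "disjoint_family T" "!!k. T k : sets borel" and B: "disjoint_family B" "!!k. B k : sets borel"
	and a: "Li a" "!!x. 0 <= a x" and b: "Li b" "!!x. 0 <= b x" and C: "0 <= C"
	and le: "!!k. (LI x. ind (T k) x * a x) <= C * (LI x. ind (B k) x * b x)"
shows "(LI x. ind (\<Union>k. T k) x * a x) <= C * (LI x. b x)"
proof -
have ii: "Li (%x. ind A x * g x)" if "A : sets borel" "Li g" for A and g :: "'a => real"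
	using integrable_real_mult_indicator[OF _ that(2), of A] that(1) by (simp add: mult.commute)
define I where "I n = {- int n..int n}" for n
have eq: "(LI x. ind (\<Union>k\<in>I n. A k) x * g x) = (\<Sum>k\<in>I n. LI x. ind (A k) x * g x)"
	if A: "disjoint_family A" "!!k. A k : sets borel" and g: "Li g" for n A and g :: "'a => real"
proof -
	have "ind (\<Union>k\<in>I n. A k) x = (\<Sum>k\<in>I n. ind (A k) x :: real)" for x
		by (rule indicator_UN_disjoint) (use A(1) in \<open>auto simp: I_def disjoint_family_on_def\<close>)
	then have "(LI x. ind (\<Union>k\<in>I n. A k) x * g x) = (LI x. (\<Sum>k\<in>I n. ind (A k) x * g x))" by (simp add: sum_distrib_right)
	also have "... = (\<Sum>k\<in>I n. LI x. ind (A k) x * g x)" by (rule Bochner_Integration.integral_sum) (rule ii[OF A(2) g])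
	finally show ?thesis .
qed
have fin: "(LI x. ind (\<Union>k\<in>I n. T k) x * a x) <= C * (LI x. b x)" for n
proof -
	have "(LI x. ind (\<Union>k\<in>I n. T k) x * a x) <= C * (LI x. ind (\<Union>k\<in>I n. B k) x * b x)"
		unfolding eq[OF T a(1)] eq[OF B b(1)] sum_distrib_left by (rule sum_mono) (rule le)
	also have "... <= C * (LI x. b x)"
		by (intro mlm integral_mono ii b(1) C sets.countable_UN') (use B(2) b(2) in \<open>auto simp: ind_def I_def\<close>)
	finally show ?thesis .
qed
have "(%n. LI x. ind (\<Union>k\<in>I n. T k) x * a x) ----> (LI x. ind (\<Union>k. T k) x * a x)"
proof (rule integral_dominated_convergence[OF _ _ a(1)])
	have m: "(\<Union>k\<in>J. T k) : sets borel" for J :: "int set" by (intro sets.countable_UN') (use T(2) in auto)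
	show "(%x. ind (\<Union>k. T k) x * a x) : borel_measurable lborel" "(%x. ind (\<Union>k\<in>I n. T k) x * a x) : borel_measurable lborel" for n
		by (rule borel_measurable_integrable[OF ii[OF m a(1)]])+
	show "AE x in lborel. (%n. ind (\<Union>k\<in>I n. T k) x * a x) ----> ind (\<Union>k. T k) x * a x"
	proof (rule AE_I2)
		fix x
		show "(%n. ind (\<Union>k\<in>I n. T k) x * a x) ----> ind (\<Union>k. T k) x * a x"
		proof (cases "EX k. x : T k")
			case True
			then obtain k where k: "x : T k" by blast
			have "x : (\<Union>k\<in>I n. T k)" if "n >= nat (abs (k))" for n using that k by (auto simp: I_def intro!: bexI[of _ k])
			moreover have "x : (\<Union>k. T k)" using k by blast
			ultimately have "\<forall>\<^sub>F n in sequentially. ind (\<Union>k\<in>I n. T k) x * a x = ind (\<Union>k. T k) x * a x"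
				unfolding eventually_sequentially by (intro exI[of _ "nat (abs (k))"] allI impI) (simp only: indicator_simps)
			then show ?thesis by (rule tendsto_eventually)
		qed auto
	qed
	show "AE x in lborel. norm (ind (\<Union>k\<in>I n. T k) x * a x) <= a x" for n using a(2) by (auto simp: ind_def)
qed
then show ?thesis by (rule LIMSEQ_le_const2) (use fin in blast)
qed


section \<open>Estimates near the windows\<close>

text \<open>The Leibniz rule for triples: \<open>E\<close> is the gradient of the cutoff
  \<open>et\<close>.\<close>

definition mulc :: "(R2 => real) => (R2 => R2) => (R2 => C3) => R2 => C3" where
"mulc et E Ph x = et x *R Ph x + (0, fst (E x) *R fst (Ph x), snd (E x) *R fst (Ph x))"

lemma pr_gr_mulc: "pr c (mulc et E Ph) = (%x. et x * pr c Ph x)" "gr c (mulc et E Ph) = (%x. et x *R gr c Ph x + pr c Ph x *R E x)"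
by (auto simp: pr_def gr_def mulc_def fun_eq_iff inner_add_right prod_eq_iff)

lemma norm_second: "norm (0::complex, a *R f, b *R f :: complex) = norm (a, b) * norm f"
by (rule power2_eq_imp_eq) (simp_all add: norm_Pair pmd algebra_simps)

lemma sqi_second:
fixes Ph :: "R2 => C3"
assumes "sqi Ph" "c1 et E" "!!x. norm (E x) <= B"
shows "sqi (%x. (0::complex, fst (E x) *R fst (Ph x), snd (E x) *R fst (Ph x)))"
proof -
have cE: "continuous_on UNIV E" by (rule c1_contD[OF assms(2)])
have mE: "(%x. fst (E x)) : BB" "(%x. snd (E x)) : BB"
	by (intro bmc continuous_intros cE)+
note mP = triple_measurable(1)[OF sqi_m[OF assms(1)]]
show ?thesis
proof (rule sqi_bound[OF _ sqi_3(1)[OF assms(1)], of _ B])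
	show "(%x. (0::complex, fst (E x) *R fst (Ph x), snd (E x) *R fst (Ph x))) : BB"
		by (intro borel_measurable_Pair borel_measurable_const borel_measurable_scaleR mE mP)
	show "norm (0::complex, fst (E x) *R fst (Ph x), snd (E x) *R fst (Ph x)) <= B * norm (fst (Ph x))" for x
		unfolding norm_second using mrm[OF assms(3)[of x] norm_ge_zero] by simp
qed
qed

lemma sqi_mulc:
assumes "sqi Ph" "c1 et E" "!!x. abs (et x) <= 1" "!!x. norm (E x) <= B"
shows "sqi (mulc et E Ph)"
unfolding mulc_def[abs_def]
by (intro sqi_add sqi_second[OF assms(1,2,4)] sqi_bm[OF assms(1) bmc[OF c1_cont[OF assms(2)]] assms(3)])

lemma cgrad_mulc: "cgrad W Ph ==> sqi Ph ==> c1 et E ==> cgrad W (mulc et E Ph)"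
unfolding cgrad_def pr_gr_mulc by (intro allI wgrad_mult sqi_pr_gr) auto

lemma c1_translate: "c1 c C ==> c1 (%x. c (x - q)) (%x. C (x - q))"
proof -
assume c: "c1 c C"
have "((%x. c (x - q)) has_derivative (%h. C (x - q) *. h)) (at x)" for x
proof -
	have "((%x. x - q) has_derivative (%h. h)) (at x)" by (auto intro!: derivative_eq_intros)
	from has_derivative_compose[OF this, of c "%h. C (x - q) *. h"] show ?thesis using c1_der[OF c, of "x - q"] by simp
qed
moreover have "continuous_on UNIV (%x. C (x - q))"
	by (rule continuous_on_compose2[OF c1_contD[OF c]]) (auto intro!: continuous_intros)
ultimately show ?thesis by (simp add: c1_def)
qed

lemma c1_local:
assumes "!!x. EX r>0. EX f F. c1 f F & (ALL y:ball x r. g y = f y & G y = F y)"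
shows "c1 g G"
unfolding c1_def
proof (intro conjI allI)
fix x
obtain r f F where r: "r > 0" "c1 f F" "ALL y:ball x r. g y = f y & G y = F y" using assms[of x] by blast
have x: "x : ball x r" using r(1) by simp
show "(g has_derivative (%h. G x *. h)) (at x)"
	by (rule has_derivative_transform_within_open[OF _ open_ball x]) (use c1_der[OF r(2), of x] r(3) x in auto)
next
show "continuous_on UNIV G" unfolding continuous_on_eq_continuous_at[OF open_UNIV]
proof
	fix x
	obtain r f F where r: "r > 0" "c1 f F" "ALL y:ball x r. g y = f y & G y = F y" using assms[of x] by blast
	have "\<forall>\<^sub>F y in nhds x. F y = G y" using eventually_nhds_ball[OF r(1)] by (rule ev_mono) (use r(3) in simp)
	moreover have "isCont F x" using c1_contD[OF r(2)] by (simp add: continuous_on_eq_continuous_at)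
	ultimately show "isCont G x" using isCont_cong by blast
qed
qed

context cell_array
begin

lemma We_minus_one: "We (- 1) = UNIV" using abs_ge_zero[where 'a = real] by (auto simp: We_def intro: less_le_trans[of "- 1" 0])

text \<open>Near any point a function that vanishes off the array is the sum of its parts in two
  cells.\<close>

lemma cgrad_of_cuts:
assumes U: "sqi U" "!!x. x ~: Om ==> U x = 0" and c: "!!k. cgrad UNIV (cut k U)"
shows "cgrad UNIV U"
proof (rule cgrad_local[OF U(1)])
fix x
obtain j where j: "!!y k. y : ball x (d / 2) ==> y : Pk k ==> k = j - 1 \<or> k = j" using near_cells[of x] by blast
have s: "sqi (cut k U)" for k by (rule sqi_cut[OF U(1)])
have "U y = cut (j - 1) U y + cut j U y" if "y : ball x (d / 2)" for y
proof (cases "y : Om")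
	case True
	then obtain k where k: "y : Pk k" unfolding Om_def by blast
	have "k = j - 1 \<or> k = j" by (rule j[OF that k])
	then show ?thesis using k Pk_unique[of y "j - 1" j] by (auto simp: cut_def ind_def)
qed (use U(2) in \<open>simp add: cut_def\<close>)
then have "cgrad (ball x (d / 2)) U"
	by (intro cgrad_cong[OF cgrad_mono[OF cgrad_add[OF c[of "j - 1"] c[of j] s s]] _ sqi_add[OF s s] U(1)]) auto
then show "EX r>0. cgrad (ball x r) U" using d by (intro exI[of _ "d / 2"]) simp
qed

lemma S_I0:
assumes "sqi U" "!!x. x ~: Om ==> U x = 0" "!!k. cgrad UNIV (cut k U)"
shows "U : S e"
by (intro S_I assms(1) cgrad_mono[OF cgrad_of_cuts[OF assms]] cgrad_mono[OF assms(3)] subset_UNIV) (rule assms(2))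

lemma S_mono: assumes "U : S (- 1)" shows "U : S e"
using S_D[OF assms] unfolding We_minus_one by (intro S_I0) blast+

text \<open>A cutoff that vanishes near the closed windows leads into the form domain without
  windows: off the windows the parts in the cells are weakly differentiable by assumption, and near
  them the product is zero.\<close>

lemma mulc_in_S:
assumes U: "Ph : S e" and c: "c1 et E" and b: "!!x. abs (et x) <= 1" "!!x. norm (E x) <= B"
	and z: "!!x. x ~: We e ==> EX r>0. ALL y:ball x r. et y = 0 & E y = 0"
shows "mulc et E Ph : S (- 1)"
proof (rule S_I0)
note s = S_D(1)[OF U]
show sq: "sqi (mulc et E Ph)" by (rule sqi_mulc[OF s c b])
show "mulc et E Ph x = 0" if "x ~: Om" for x using S_D(2)[OF U that] by (simp add: mulc_def zero_prod_def)
fix k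
have ce: "cut k (mulc et E Ph) = mulc et E (cut k Ph)" by (auto simp: fun_eq_iff cut_def mulc_def ind_def zero_prod_def)
show "cgrad UNIV (cut k (mulc et E Ph))"
proof (rule cgrad_local[OF sqi_cut[OF sq]])
	fix x
	show "EX r>0. cgrad (ball x r) (cut k (mulc et E Ph))"
	proof (cases "x : We e")
		case True
		then obtain r where r: "r > 0" "ball x r <= We e" using open_We by (meson openE)
		then show ?thesis unfolding ce using cgrad_mono[OF cgrad_mulc[OF S_D(4)[OF U] sqi_cut[OF s] c] r(2)] by blast
	next
		case False
		then obtain r where r: "r > 0" "ALL y:ball x r. et y = 0 & E y = 0" using z by blast
		have "cgrad (ball x r) (cut k (mulc et E Ph))" by (rule cgrad_eq_0) (use r(2) in \<open>simp add: cut_def mulc_def zero_prod_def\<close>)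
		then show ?thesis using r(1) by blast
	qed
qed
qed

definition window :: "real => int => (R2) set" where
"window e k = {x. abs (fst x - of_int k * d) <= 3 * e & abs (snd x) <= 3 * e}"

lemma near_unique:
assumes "abs (t - of_int j * d) < d / 2" "abs (t - of_int k * d) < d / 2" shows "j = (k::int)"
proof -
have "abs (of_int j * d - of_int k * d) < d" using assms by linarith
then have "abs (real_of_int (j - k)) * d < 1 * d" using d by (simp add: abs_mult left_diff_distrib[symmetric])
then have "abs (real_of_int (j - k)) < 1" using d by (simp only: mult_less_cancel_right_pos)
then show ?thesis by linarith
qed

lemma round_near: "abs (t - of_int (round (t / d)) * d) <= d / 2"
proof -
have "abs (of_int (round (t / d)) - t / d) * d <= 1 / 2 * d" using d of_int_round_abs_le[of "t / d"] by (intro mrm) auto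
moreover have "abs (of_int (round (t / d)) - t / d) * d = abs ((of_int (round (t / d)) - t / d) * d)" using d by (simp add: abs_mult)
moreover have "(of_int (round (t / d)) - t / d) * d = of_int (round (t / d)) * d - t" using d by (simp add: field_simps)
ultimately show ?thesis by (simp add: abs_minus_commute)
qed

text \<open>One bump, centred at the window nearest to the point. The nearest window changes halfway
  between two windows, where every candidate is zero because \<open>3 * e\<close> is far below
  \<open>d / 2\<close>. The bump is \<open>ball_cutoff\<close> of radius \<open>4 * e\<close>, hence
  1 on discs of radius \<open>2 * e\<close>, 0 beyond \<open>3 * e\<close> and of slope at most
  \<open>3 / e\<close>.\<close>

lemma window_cutoff:
assumes e: "e > 0" "60 * e < d"
obtains et E where "c1 et E" "!!x. 0 <= et x" "!!x. et x <= 1" "!!x. norm (E x) <= 3 / e"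
	"!!x. x ~: (\<Union>k. window e k) ==> et x = 0 & E x = 0" "!!k x. x : ball (org k) (2 * e) ==> et x = 1 & E x = 0"
proof -
obtain c C where c: "c1 c C" "!!y. y : ball (0 :: R2) (4 * e / 2) ==> c y = 1" "!!y. y ~: cball 0 (3 * (4 * e) / 4) ==> c y = 0"
	"!!y. 0 <= c y" "!!y. c y <= 1" "!!y. norm (C y) <= 12 / (4 * e)"
	"!!y. y : ball 0 (4 * e / 2) ==> C y = 0" "!!y. y ~: cball 0 (3 * (4 * e) / 4) ==> C y = 0"
	by (rule ball_cutoff[of "4 * e" "0 :: R2"]) (use e in simp, rule that)
define R where "R x = round (fst x / d)" for x :: "R2"
define et where "et x = c (x - org (R x))" for x
define E where "E x = C (x - org (R x))" for x
have far: "c (x - org k) = 0 & C (x - org k) = 0" if "abs (fst x - of_int k * d) > 3 * e \<or> (abs (snd x)) > 3 * e" for x k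
proof -
	have "norm (x - org k) > 3 * e" using that norm_fst_le[of "fst (x - org k)" "snd (x - org k)"] norm_snd_le[of "snd (x - org k)" "fst (x - org k)"]
		by (auto simp: sub_org)
	then show ?thesis using c(3,8) by simp
qed
\<comment> \<open>If the nearest window differs for \<open>x\<close> and \<open>y\<close>, then
  \<open>y\<close> is far from both windows and the two candidates vanish.\<close>
have same: "c (y - org (R y)) = c (y - org (R x)) & C (y - org (R y)) = C (y - org (R x))" if y: "y : ball x (d / 8)" for x y
proof (cases "R y = R x")
	case False
	have ry: "abs (fst y - of_int (R y) * d) <= d / 2" and rx: "abs (fst x - of_int (R x) * d) <= d / 2" unfolding R_def by (rule round_near)+
	have "abs (fst y - fst x) < d / 8" using fst_ball(1)[OF y] .
	have "\<not> (abs (fst y - of_int (R x) * d)) <= 3 * e"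
	proof
		assume a: "abs (fst y - of_int (R x) * d) <= 3 * e"
		have "abs (of_int (R y) * d - of_int (R x) * d) < d" using a ry e by linarith
		then have "abs (real_of_int (R y - R x)) * d < 1 * d" using d by (simp add: abs_mult left_diff_distrib[symmetric])
		then have "abs (real_of_int (R y - R x)) < 1" using d by (simp only: mult_less_cancel_right_pos)
		then show False using False by linarith
	qed
	moreover have "\<not> (abs (fst y - of_int (R y) * d)) <= 3 * e"
	proof
		assume a: "abs (fst y - of_int (R y) * d) <= 3 * e"
		have "abs (of_int (R y) * d - of_int (R x) * d) < d" using a rx `abs (fst y - fst x) < d / 8` e by linarith
		then have "abs (real_of_int (R y - R x)) * d < 1 * d" using d by (simp add: abs_mult left_diff_distrib[symmetric])
		then have "abs (real_of_int (R y - R x)) < 1" using d by (simp only: mult_less_cancel_right_pos)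
		then show False using False by linarith
	qed
	ultimately show ?thesis using far by simp
qed simp
show thesis
proof (rule that[of et E])
	show "c1 et E"
	proof (rule c1_local)
		fix x
		show "EX r>0. EX f F. c1 f F & (ALL y:ball x r. et y = f y & E y = F y)"
			using d same[of _ x] c1_translate[OF c(1), of "org (R x)"] unfolding et_def E_def
			by (intro exI[of _ "d / 8"] conjI exI[of _ "%y. c (y - org (R x))"] exI[of _ "%y. C (y - org (R x))"]) auto
	qed
	show "0 <= et x" "et x <= 1" "norm (E x) <= 3 / e" for x using c(4,5,6) by (simp_all add: et_def E_def)
	show "et x = 0 & E x = 0" if "x ~: (\<Union>k. window e k)" for x
		unfolding et_def E_def by (rule far) (use that in \<open>auto simp: window_def not_le\<close>)
	show "et x = 1 & E x = 0" if x: "x : ball (org k) (2 * e)" for k x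
	proof -
		have "abs (fst x - of_int k * d) < 2 * e" using fst_ball(1)[OF x] by (simp add: org_def)
		moreover have "abs (fst x - of_int (R x) * d) <= d / 2" unfolding R_def by (rule round_near)
		ultimately have "abs (of_int (R x) * d - of_int k * d) < d" using e by linarith
		then have "abs (real_of_int (R x - k)) * d < 1 * d" using d by (simp add: abs_mult left_diff_distrib[symmetric])
		then have "abs (real_of_int (R x - k)) < 1" using d by (simp only: mult_less_cancel_right_pos)
		then have "R x = k" by linarith
		moreover have "x - org k : ball 0 (4 * e / 2)" using x by (simp add: dist_norm nmc)
		ultimately show ?thesis using c(2,7) by (simp add: et_def E_def)
	qed
qed
qed

text \<open>Within distance \<open>d\<close> of a wall at most the two adjacent cells contribute,
  and their parts have disjoint supports.\<close>

lemma split_cells: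
assumes "abs (fst x - of_int k * d) < d" and z: "!!x. x ~: Om ==> U x = 0"
shows "(pr c U x)^2 = (pr c (cut k U) x)^2 + (pr c (cut (k - 1) U) x)^2"
	"(norm (gr c U x))^2 = (norm (gr c (cut k U) x))^2 + (norm (gr c (cut (k - 1) U) x))^2"
proof -
have u: "x : Pk k ==> x ~: Pk (k - 1)" using Pk_unique[of x k "k - 1"] by auto
consider "x : Pk k" | "x : Pk (k - 1)" | "x ~: Om"
proof (cases "x : Om")
	case True
	then obtain j where j: "x : Pk j" unfolding Om_def by blast
	have "of_int j * d < (of_int k + 1) * d" "of_int k * d < (of_int j + 2) * d"
		using Pk_strip[OF j] assms(1) by (simp_all add: distrib_right abs_less_iff)
	then have "real_of_int j < real_of_int k + 1" "real_of_int k < real_of_int j + 2" using d by (simp_all add: mult_less_cancel_right)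
	then have "j = k \<or> j = k - 1" by linarith
	then show ?thesis using j that by blast
qed
then have "(pr c U x)^2 = (pr c (cut k U) x)^2 + (pr c (cut (k - 1) U) x)^2 &
	(norm (gr c U x))^2 = (norm (gr c (cut k U) x))^2 + (norm (gr c (cut (k - 1) U) x))^2"
proof cases
	case 1 then show ?thesis using u by (simp add: pr_gr_cut)
next
	case 2 then show ?thesis using u by (auto simp: pr_gr_cut ind_def)
next
	case 3 then show ?thesis using z[OF 3] by (simp add: pr_gr_cut pr_def gr_def zero_prod_def[symmetric])
qed
then show "(pr c U x)^2 = (pr c (cut k U) x)^2 + (pr c (cut (k - 1) U) x)^2"
	"(norm (gr c U x))^2 = (norm (gr c (cut k U) x))^2 + (norm (gr c (cut (k - 1) U) x))^2" by auto
qed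

lemma i_ind: "A : sets borel ==> Li g ==> Li (%x. ind A x * g x :: real)"
for A :: "(R2) set"
using integrable_real_mult_indicator[of A lborel g] by (simp add: mult.commute)

lemma split_integrals:
assumes A: "A : sets borel" "!!x. x : A ==> (abs (fst x - of_int k * d)) < d" and U: "sqi U" and z: "!!x. x ~: Om ==> U x = 0"
shows "(LI x. ind A x * (pr c U x)^2) = (LI x. ind A x * (pr c (cut k U) x)^2) + (LI x. ind A x * (pr c (cut (k - 1) U) x)^2)"
	"(LI x. ind A x * (norm (gr c U x))^2) = (LI x. ind A x * (norm (gr c (cut k U) x))^2) + (LI x. ind A x * (norm (gr c (cut (k - 1) U) x))^2)"
proof -
have i: "Li (%x. ind A x * (pr c (cut j U) x)^2)" "Li (%x. ind A x * (norm (gr c (cut j U) x))^2)" for j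
	using i_ind[OF A(1) sqi_i[OF sqi_pr_gr(1)[OF sqi_cut[OF U]]]] i_ind[OF A(1) sqi_i[OF sqi_pr_gr(2)[OF sqi_cut[OF U]]]] by simp_all
have p: "ind A x * (pr c U x)^2 = ind A x * (pr c (cut k U) x)^2 + ind A x * (pr c (cut (k - 1) U) x)^2"
	"ind A x * (norm (gr c U x))^2 = ind A x * (norm (gr c (cut k U) x))^2 + ind A x * (norm (gr c (cut (k - 1) U) x))^2" for x
	using split_cells[where x = x and c = c and k = k, OF A(2) z] by (cases "x : A"; simp)+
show "(LI x. ind A x * (pr c U x)^2) = (LI x. ind A x * (pr c (cut k U) x)^2) + (LI x. ind A x * (pr c (cut (k - 1) U) x)^2)"
	"(LI x. ind A x * (norm (gr c U x))^2) = (LI x. ind A x * (norm (gr c (cut k U) x))^2) + (LI x. ind A x * (norm (gr c (cut (k - 1) U) x))^2)"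
	unfolding p by (rule iadd[OF i(1) i(1)], rule iadd[OF i(2) i(2)])
qed

lemma org_balls: "disjoint_family (%k. cball (org k) r)" if "r < d / 2"
unfolding disjoint_family_on_def
proof (intro ballI impI, rule ccontr)
fix j k assume ne: "j ~= k" and "cball (org j) r Int cball (org k) r ~= {}"
then obtain x where x: "dist (org j) x <= r" "dist (org k) x <= r" by auto
have "abs (fst x - of_int i * d) < d / 2" if "dist (org i) x <= r" for i
	using dist_fst_le[of x "org i"] that `r < d / 2` by (simp add: org_def dist_real_def dist_commute)
then show False using near_unique[of "fst x" j k] x ne by blast
qed

lemma cball_org: "x : cball (org k) r ==> (abs (fst x - of_int k * d)) <= r"
using dist_fst_le[of x "org k"] by (simp add: org_def dist_real_def dist_commute)

lemma window_borel: "window e k : sets borel"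
proof -
have "window e k = {x. abs (fst x - of_int k * d) <= 3 * e} Int {x. abs (snd x) <= 3 * e}" by (auto simp: window_def)
then have "closed (window e k)" by (simp add: closed_Int closed_Collect_le continuous_intros)
then show ?thesis by simp
qed

text \<open>\<open>window_poincare\<close> is applied to each of the two parts adjacent to a window:
  each vanishes on the other side of the wall. The discs of radius \<open>30 * e\<close> are
  disjoint since \<open>60 * e < d\<close>.\<close>

lemma window_L2:
assumes e: "e > 0" "60 * e < d" and P: "Ph : S e"
shows "(LI x. ind (\<Union>k. window e k) x * (pr c Ph x)^2) <= 25000 * e^2 * N2 (gr c Ph)"
proof -
note s = S_D(1)[OF P] and z = S_D(2)[OF P]
have le: "(LI x. ind (window e k) x * (pr c Ph x)^2) <= 25000 * e^2 * (LI x. ind (cball (org k) (30 * e)) x * (norm (gr c Ph x))^2)" for k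
proof -
	have side: "(LI x. ind (window e k) x * (pr c (cut m Ph) x)^2) <=
		25000 * e^2 * (LI x. ind (cball (org k) (30 * e)) x * (norm (gr c (cut m Ph) x))^2)"
		if sg: "sg = 1 \<or> sg = - 1" and m: "!!x. x : Pk m ==> 0 < sg * (fst x - of_int k * d)" for sg m
	proof -
		have ip: "(x - org k) *. (sg, 0) = sg * (fst x - of_int k * d)" "(x - org k) *. (0, 1) = snd x" for x
			by (simp_all add: sub_org inner_prod_def)
		have ab: "abs (sg * t) = abs (t)" for t using sg by auto
		have "(LI x. ind {x. abs ((x - org k) *. (sg, 0)) <= 3 * e & abs ((x - org k) *. (0, 1)) <= 3 * e} x * (pr c (cut m Ph) x)^2) <=
			25000 * e^2 * (LI x. ind (cball (org k) (30 * e)) x * (norm (gr c (cut m Ph) x))^2)"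
		proof (rule window_poincare[where W = "We e" and h = "pr c (cut m Ph)" and G = "gr c (cut m Ph)" and q = "org k" and sg = sg and R = d and ep = e])
			show "open (We e)" "sqi (pr c (cut m Ph))" "sqi (gr c (cut m Ph))" "sg = 1 \<or> sg = - 1"
				by (rule open_We, rule sqi_pr_gr[OF sqi_cut[OF s]], rule sqi_pr_gr[OF sqi_cut[OF s]], rule sg)
			show "wgrad (We e) (pr c (cut m Ph)) (gr c (cut m Ph))" using S_D(4)[OF P, of m] by (simp add: cgrad_def)
			show "pr c (cut m Ph) x = 0" if "(x - org k) *. (sg, 0) <= 0" for x
				using m[of x] that unfolding ip by (auto simp: pr_gr_cut ind_def)
			show "x : We e" if x: "x : ball (org k) d" "(x - org k) *. (sg, 0) ~= 0 \<or> e < abs ((x - org k) *. (0, 1))" for x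
				unfolding We_def
			proof (intro CollectI allI impI)
				fix j assume j: "fst x = of_int j * d"
				have "abs (fst x - of_int k * d) < d" using fst_ball(1)[OF x(1)] by (simp add: org_def)
				then have "fst x = of_int k * d" using off_line[of "fst x" k j] j by auto
				then show "e < abs (snd x)" using x(2) unfolding ip by simp
			qed
		qed (use e in auto)
		then show ?thesis unfolding ip ab window_def .
	qed
	have w: "abs (fst x - of_int k * d) < d" if "x : window e k" for x using that e d by (simp add: window_def)
	have b: "abs (fst x - of_int k * d) < d" if "x : cball (org k) (30 * e)" for x using cball_org[OF that] e d by linarith
	have 1: "(LI x. ind (window e k) x * (pr c (cut k Ph) x)^2) <= 25000 * e^2 * (LI x. ind (cball (org k) (30 * e)) x * (norm (gr c (cut k Ph) x))^2)"
		by (rule side[of 1]) (use Pk_strip in auto)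
	have "0 < - 1 * (fst x - of_int k * d)" if "x : Pk (k - 1)" for x using Pk_strip[OF that] by simp
	then have 2: "(LI x. ind (window e k) x * (pr c (cut (k - 1) Ph) x)^2) <= 25000 * e^2 * (LI x. ind (cball (org k) (30 * e)) x * (norm (gr c (cut (k - 1) Ph) x))^2)"
		by (intro side[of "- 1"]) simp_all
	note e1 = split_integrals(1)[where A = "window e k" and k = k and c = c and U = Ph, OF window_borel w s z]
	note e2 = split_integrals(2)[where A = "cball (org k) (30 * e)" and k = k and c = c and U = Ph, OF borel_closed[OF closed_cball] b s z]
	have "L = L1 + L2 ==> B = N1 + N2 ==> L1 <= q * N1 ==> L2 <= q * N2 ==> L <= q * B"
		for L L1 L2 B N1 N2 q :: real by (simp add: distrib_left add_mono)
	from this[OF e1 e2 1 2] show ?thesis .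
qed
have "(LI x. ind (\<Union>k. window e k) x * (pr c Ph x)^2) <= 25000 * e^2 * (LI x. (norm (gr c Ph x))^2)"
proof (rule sum_disjoint_bound[OF _ window_borel org_balls _ _ _ _ _ _ le])
	show "disjoint_family (window e)" unfolding disjoint_family_on_def
	proof (intro ballI impI, rule ccontr)
		fix j k assume ne: "j ~= k" and "window e j Int window e k ~= {}"
		then obtain x where x: "x : window e j" "x : window e k" by blast
		show False using near_unique[of "fst x" j k] x e ne by (simp add: window_def)
	qed
	show "Li (%x. (pr c Ph x)^2)" using sqi_i[OF sqi_pr_gr(1)[OF s]] by simp
	show "Li (%x. (norm (gr c Ph x))^2)" by (rule sqi_i[OF sqi_pr_gr(2)[OF s]])
qed (use e in auto)
then show ?thesis by (simp add: N2_def)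
qed

text \<open>In each adjacent cell the part of \<open>U\<close> solves the equation with right-hand
  side \<open>F - v U\<close> in a half disc of radius \<open>R\<close> with zero data on the wall,
  and the reflection estimate applies. The choice of \<open>R\<close> makes the half discs lie in
  single cells and the discs disjoint.\<close>

lemma window_gradient:
fixes F :: "R2 => complex" and v :: "R2 => complex"
defines "R \<equiv> min (d / 2) x20"
assumes U: "U : S (- 1)" and F: "sqi F" and sv: "sqi (%x. pot (v x) (U x))"
	and weak: "!!Ph. Ph : S (- 1) ==> (LI x. pot (v x) (U x) *. Ph x) = (LI x. F x *. fst (Ph x))"
	and F0: "!!x. x ~: Om ==> F x = 0" and r: "0 < r" "r < R / 4"
shows "(LI x. ind (\<Union>k. cball (org k) r) x * (norm (gr c U x))^2) <=
	8 * (r^2 * log_factor R r) * (LI x. 32 * (c *. (F x - v x * fst (U x)))^2 + 88 * (24 / R)^2 * (norm (gr c U x))^2)"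
proof -
note s = S_D(1)[OF U] and z = S_D(2)[OF U]
define Y where "Y x = (F x - v x * fst (U x), 0 :: complex, 0 :: complex)" for x
have sf: "sqi (%x. F x - v x * fst (U x))" using sqi_diff[OF F sqi_3(1)[OF sv]] by (simp add: pot_def)
have sY: "sqi Y" unfolding Y_def[abs_def]
	by (rule sqi_bound[OF _ sf, of _ 1]) (use sqi_m[OF sf] in \<open>auto intro!: borel_measurable_Pair simp: norm_Pair\<close>)
have zY: "x ~: Om ==> Y x = 0" for x using F0 z by (simp add: Y_def zero_prod_def)
have Rd: "R <= d / 2" "R <= x20" "R > 0" using d x20 by (simp_all add: R_def)
have sc: "sqi (cut m U)" "sqi (cut m Y)" for m by (intro sqi_cut s sY)+
have L0: "0 <= 8 * (r^2 * log_factor R r)"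
proof -
	have "1 <= 1 + 2 * R^2 / r^2" by simp
	then have "0 <= ln (1 + 2 * R^2 / r^2)" by (rule ln_ge_zero)
	then show ?thesis by (simp add: log_factor_def)
qed
let ?b = "%x. 32 * (pr c Y x)^2 + 88 * (24 / R)^2 * (norm (gr c U x))^2"
have le: "(LI x. ind (cball (org k) r) x * (norm (gr c U x))^2) <= 8 * (r^2 * log_factor R r) * (LI x. ind (ball (org k) R) x * ?b x)" for k
proof -
	let ?N = "%m. 32 * (LI x. ind (ball (org k) R) x * (pr c (cut m Y) x)^2) + 88 * ((24 / R)^2 * (LI x. ind (ball (org k) R) x * (norm (gr c (cut m U) x))^2))"
	have side: "(LI x. ind (cball (org k) r) x * (norm (gr c (cut m U) x))^2) <= 8 * (r^2 * log_factor R r) * ?N m"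
		if sg: "sg = 1 \<or> sg = - 1" and m: "!!x. x : Pk m ==> 0 < sg * (fst x - of_int k * d)"
			and mB: "!!x. 0 < sg * (fst x - of_int k * d) ==> x : ball (org k) R ==> x : Pk m" for sg m
	proof -
		let ?H = "{x. 0 < sg * (fst x - of_int k * d)}"
		have o: "(of_int k * d, 0) = org k" by (simp add: org_def)
		have Hm: "?H : sets borel" by (intro borel_open open_Collect_less continuous_intros)
		have "(LI x. ind (cball (of_int k * d, 0) r) x * (norm (gr c (cut m U) x))^2) <=
			8 * (r^2 * log_factor R r) * (32 * N2 (%x. ind (ball (of_int k * d, 0) R) x * pr c (cut m Y) x) + 88 * ((24 / R)^2 * N2 (%x. ind (ball (of_int k * d, 0) R) x *R gr c (cut m U) x)))"
		proof (rule half_gradient_bound[where a = "of_int k * d" and sg = sg and u = "pr c (cut m U)" and G = "gr c (cut m U)" and f = "pr c (cut m Y)" and R = R and r = r])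
			show "sqi (pr c (cut m U))" "sqi (gr c (cut m U))" "sqi (pr c (cut m Y))" by (rule sqi_pr_gr[OF sc(1)], rule sqi_pr_gr[OF sc(1)], rule sqi_pr_gr[OF sc(2)])
			show "0 < r" "r < R / 4" by (rule r)+
			show "wgrad UNIV (pr c (cut m U)) (gr c (cut m U))" using S_D(4)[OF U, of m] unfolding We_minus_one by (simp add: cgrad_def)
			show "gr c (cut m U) x = 0 & pr c (cut m Y) x = 0" if "x ~: ?H" for x using m[of x] that by (auto simp: pr_gr_cut ind_def)
			fix th :: "R2 => real" and D assume t: "ctest (ball (of_int k * d, 0) R) th D" and tz: "!!x. fst x = of_int k * d ==> th x = 0"
			obtain K where K: "compact K" "K <= ball (org k) R" "!!x. x ~: K ==> th x = 0" "!!x. x ~: K ==> D x = 0" using ctestE[OF t[unfolded o]] by blast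
			have tU: "ctest UNIV th D" by (rule ctest_mono[OF t]) simp
			\<comment> \<open>The real test function \<open>th\<close> becomes a triple in the direction
			  \<open>c\<close>. Its restriction to the half plane lies in the form domain because
			  \<open>th\<close> vanishes on the wall.\<close>
			define Ps where "Ps x = (th x *R c, fst (D x) *R c, snd (D x) *R c)" for x
			define Ph where "Ph x = ind ?H x *R Ps x" for x
			have sPs: "sqi Ps" unfolding Ps_def[abs_def]
				by (rule sqi_continuous[OF _ K(1)]) (intro continuous_intros c1_cont[OF ctest_c1[OF t]] c1_contD[OF ctest_c1[OF t]], simp add: K(3,4) zero_prod_def)
			have sPh: "sqi Ph" unfolding Ph_def[abs_def] by (rule sqi_ind[OF sPs Hm])
			have Ph0: "x ~: Pk m ==> Ph x = 0" for x
			proof (cases "x : ?H & x : K")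
				case True
				then show "x ~: Pk m ==> Ph x = 0" using mB[of x] K(2) by blast
			next
				case False
				then show ?thesis using K(3,4)[of x] by (cases "x : ?H") (auto simp: Ph_def Ps_def zero_prod_def)
			qed
			have PhS: "Ph : S (- 1)"
			proof (rule S_I0[OF sPh])
				show "Ph x = 0" if "x ~: Om" for x by (rule Ph0) (use that in \<open>simp add: Om_def\<close>)
				fix j
				show "cgrad UNIV (cut j Ph)"
				proof (cases "j = m")
					case True
					have "cut m Ph = Ph" using Ph0 by (auto simp: fun_eq_iff cut_def ind_def)
					moreover have "cgrad UNIV Ph" unfolding cgrad_def
					proof
						fix c'
						have p: "pr c' Ph = (%x. (c' *. c) * (ind ?H x * th x))" "gr c' Ph = (%x. (c' *. c) *R (ind ?H x *R D x))"
							by (auto simp: fun_eq_iff pr_def gr_def Ph_def Ps_def prod_eq_iff)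
						show "wgrad UNIV (pr c' Ph) (gr c' Ph)" unfolding p by (rule wgrad_scale[OF half_extension[OF tU tz sg]])
					qed
					ultimately show ?thesis using True by simp
				next
					case False
					then have "cut j Ph x = 0" for x using Ph0[of x] Pk_unique[of x j m] by (auto simp: cut_def ind_def)
					then show ?thesis by (intro cgrad_eq_0)
				qed
			qed
			have Phm: "Ph x = ind (Pk m) x *R Ps x" for x using Ph0[of x] m[of x] by (auto simp: Ph_def ind_def)
			let ?J = "%x. (v x * fst (U x)) *. fst (Ph x)"
			have iJ: "Li ?J" using i_inner[OF sqi_3(1)[OF sv] sqi_3(1)[OF sPh]] by (simp add: pot_def)
			have "gr c (cut m U) x *. D x = pot (v x) (U x) *. Ph x - ?J x" for x
				by (simp add: pr_gr_cut gr_def inner_triple pot_def Phm Ps_def inner_prod_def inner_commute algebra_simps)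
			then have "(LI x. gr c (cut m U) x *. D x) = (LI x. F x *. fst (Ph x)) - (LI x. ?J x)"
				using i_inner[OF sv sPh] iJ weak[OF PhS] by simp
			moreover have "pr c (cut m Y) x * th x = F x *. fst (Ph x) - ?J x" for x
				by (simp add: pr_gr_cut pr_def Y_def Phm Ps_def idl inner_diff_right inner_commute algebra_simps)
			then have "(LI x. pr c (cut m Y) x * th x) = (LI x. F x *. fst (Ph x)) - (LI x. ?J x)"
				using i_inner[OF F sqi_3(1)[OF sPh]] iJ by simp
			ultimately show "(LI x. gr c (cut m U) x *. D x) = (LI x. pr c (cut m Y) x * th x)" by simp
		qed
		moreover have "(norm (ind A x * t))^2 = ind A x * t^2" "(norm (ind A x *R g))^2 = ind A x * (norm g)^2" for A and x :: "R2" and t :: real and g :: "R2"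
			by (simp_all add: ind_def)
		ultimately show ?thesis unfolding o N2_def by simp
	qed
	have w: "abs (fst x - of_int k * d) < d" if "x : cball (org k) r" for x using cball_org[OF that] r Rd d by linarith
	have b: "abs (fst x - of_int k * d) < d" if "x : ball (org k) R" for x using fst_ball(1)[OF that] Rd d by (simp add: org_def)
	have bs: "abs (snd x) < x20" if "x : ball (org k) R" for x using fst_ball(2)[OF that] Rd by (simp add: org_def)
	have 1: "(LI x. ind (cball (org k) r) x * (norm (gr c (cut k U) x))^2) <= 8 * (r^2 * log_factor R r) * ?N k"
	proof (rule side[of 1])
		show "0 < 1 * (fst x - of_int k * d)" if "x : Pk k" for x using Pk_strip[OF that] by simp
		show "x : Pk k" if "0 < 1 * (fst x - of_int k * d)" "x : ball (org k) R" for x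
			by (rule rectangle_k) (use that(1) b[OF that(2)] bs[OF that(2)] in \<open>simp_all add: distrib_right abs_less_iff\<close>)
	qed simp
	have 2: "(LI x. ind (cball (org k) r) x * (norm (gr c (cut (k - 1) U) x))^2) <= 8 * (r^2 * log_factor R r) * ?N (k - 1)"
	proof (rule side[of "- 1"])
		show "0 < - 1 * (fst x - of_int k * d)" if "x : Pk (k - 1)" for x using Pk_strip[OF that] by simp
		show "x : Pk (k - 1)" if "0 < - 1 * (fst x - of_int k * d)" "x : ball (org k) R" for x
			by (rule rectangle_k) (use that(1) b[OF that(2)] bs[OF that(2)] in \<open>simp_all add: left_diff_distrib abs_less_iff\<close>)
	qed simp
	note sp1 = split_integrals(1)[where A = "ball (org k) R" and k = k and c = c and U = Y, OF borel_open[OF open_ball] b sY zY]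
	note sp2 = split_integrals(2)[where A = "ball (org k) R" and k = k and c = c and U = U, OF borel_open[OF open_ball] b s z]
	have "(LI x. ind (ball (org k) R) x * ?b x) = (LI x. 32 * (ind (ball (org k) R) x * (pr c Y x)^2) + 88 * (24 / R)^2 * (ind (ball (org k) R) x * (norm (gr c U x))^2))"
		by (simp add: algebra_simps)
	also have "... = 32 * (LI x. ind (ball (org k) R) x * (pr c Y x)^2) + 88 * (24 / R)^2 * (LI x. ind (ball (org k) R) x * (norm (gr c U x))^2)"
		using i_ind[OF borel_open[OF open_ball] sqi_i[OF sqi_pr_gr(1)[OF sY]], of "org k" R c]
			i_ind[OF borel_open[OF open_ball] sqi_i[OF sqi_pr_gr(2)[OF s]], of "org k" R c] by simp
	also have "... = ?N k + ?N (k - 1)"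
	proof -
		have "X = X1 + X2 ==> Z = Z1 + Z2 ==> 32 * X + 88 * q * Z = (32 * X1 + 88 * (q * Z1)) + (32 * X2 + 88 * (q * Z2))"
			for X X1 X2 Z Z1 Z2 q :: real by (simp add: algebra_simps)
		from this[OF sp1 sp2] show ?thesis .
	qed
	finally have e: "(LI x. ind (ball (org k) R) x * ?b x) = ?N k + ?N (k - 1)" .
	have "L = L1 + L2 ==> B = N1 + N2 ==> L1 <= q * N1 ==> L2 <= q * N2 ==> L <= q * B"
		for L L1 L2 B N1 N2 q :: real by (simp add: distrib_left add_mono)
	from this[OF split_integrals(2)[where A = "cball (org k) r" and k = k and c = c and U = U, OF borel_closed[OF closed_cball] w s z] e 1 2] show ?thesis .
qed
have "(LI x. ind (\<Union>k. cball (org k) r) x * (norm (gr c U x))^2) <= 8 * (r^2 * log_factor R r) * (LI x. ?b x)"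
proof (rule sum_disjoint_bound[OF org_balls _ _ _ _ _ _ _ L0 le])
	show "r < d / 2" using r Rd d by linarith
	show "disjoint_family (%k. ball (org k) R)" unfolding disjoint_family_on_def
	proof (intro ballI impI, rule ccontr)
		fix j k assume ne: "j ~= k" and "ball (org j) R Int ball (org k) R ~= {}"
		then obtain x where x: "x : ball (org j) R" "x : ball (org k) R" by blast
		show False using near_unique[of "fst x" j k] fst_ball(1)[OF x(1)] fst_ball(1)[OF x(2)] Rd ne by (simp add: org_def)
	qed
	show "Li (%x. (norm (gr c U x))^2)" by (rule sqi_i[OF sqi_pr_gr(2)[OF s]])
	show "Li ?b" using sqi_i[OF sqi_pr_gr(2)[OF s, of c]] sqi_i[OF sqi_pr_gr(1)[OF sY, of c]] by simp
qed simp_all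
then show ?thesis by (simp add: Y_def pr_def)
qed

end


section \<open>Comparison of the resolvents\<close>

locale cell_potential = cell_array +
fixes V :: "R2 => real" and K :: real
assumes V_cont: "continuous_on Om V" and V_bound: "!!x. x : Om ==> (abs (V x)) <= K" and K0: "0 <= K"
begin

definition Vh :: "R2 => real" where "Vh x = ind Om x * V x"

definition z0 :: complex where "z0 = Complex 1 (K + 1)"

lemma dirichlet_rep_S: "e < x20 ==> dirichlet_rep (S e) (Oe e) V Vh K"
proof (intro dirichlet_rep.intro csS dirichlet_rep_axioms.intro)
assume e: "e < x20"
show "open (Oe e)" by (rule open_Oe[OF e])
show "Vh : BB"
	using borel_measurable_continuous_on_indicator[OF _ V_cont] open_Om by (simp add: Vh_def[abs_def])
show "abs (Vh x) <= K" for x using V_bound[of x] K0 by (simp add: Vh_def ind_def)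
show "AE x in lborel. x : Oe e --> V x = Vh x" using AE_Oe_Om[of e] by (rule ev_mono) (simp add: Vh_def)
show "U : S e ==> (%x. smul z (U x)) : S e" for U z by (rule S_smul)
show "U : S e ==> cgrad (Oe e) U" for U by (rule S_D(3))
show "U : S e ==> x ~: Oe e ==> U x = 0" for U x using S_D(2) Om_sub_Oe by blast
show "u : W12_0 (Oe e) \<longleftrightarrow> (EX U:S e. AE x in lborel. x : Oe e --> fst (U x) = u x)" for u by (rule W12_0_iff_S[OF e])
qed

text \<open>Coercivity after the rotation, by testing with \<open>cnj z0\<close> times the
  solution.\<close>

lemma energy_bound:
assumes e: "e < x20" and U: "U : S e" and F: "sqi F"
	and weak: "!!Ph. Ph : S e ==> (LI x. pot (cr (Vh x) - \<i>) (U x) *. Ph x) = (LI x. F x *. fst (Ph x))"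
shows "N2 U <= (cmod z0)^2 * N2 F"
proof -
interpret dirichlet_rep "S e" "Oe e" V Vh K by (rule dirichlet_rep_S[OF e])
note s = S_D(1)[OF U]
let ?Ph = "%x. smul (cnj z0) (U x)"
have "N2 U <= (LI x. F x *. fst (?Ph x))"
	using coercive[OF s] weak[OF S_smul[OF U]] by (simp add: z0_def[symmetric] smul_adjoint)
also have "... <= sqrt (N2 F) * sqrt (N2 (%x. fst (?Ph x)))"
	using abs_int_le[OF F sqi_3(1)[OF sqi_smul[OF s]]] by (rule abs_le_D1)
also have "... <= sqrt (N2 F) * sqrt ((cmod z0)^2 * N2 U)"
proof (intro mlm real_sqrt_le_mono)
	have "N2 (%x. fst (?Ph x)) <= N2 ?Ph" using N2_triple[OF sqi_smul[OF s, of "cnj z0"]] N2_nonneg[of "%x. fst (snd (?Ph x))"] N2_nonneg[of "%x. snd (snd (?Ph x))"] by linarith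
	then show "N2 (%x. fst (?Ph x)) <= (cmod z0)^2 * N2 U" by (simp add: N2_smul)
qed (simp add: N2_nonneg)
finally have le: "sqrt (N2 U) * sqrt (N2 U) <= (cmod z0 * sqrt (N2 F)) * sqrt (N2 U)"
	using N2_nonneg[of U] by (simp add: real_sqrt_mult mult_ac)
have "sqrt (N2 U) <= cmod z0 * sqrt (N2 F)"
proof (cases "N2 U = 0")
	case False
	then show ?thesis using mult_right_le_imp_le[OF le] N2_nonneg[of U] by simp
qed (simp add: N2_nonneg)
then have "(sqrt (N2 U))^2 <= (cmod z0 * sqrt (N2 F))^2" by (rule power_mono) (simp add: N2_nonneg)
then show ?thesis by (simp add: N2_nonneg pmd)
qed

text \<open>The two directions 1 and \<open>\<i>\<close> double 25000. The slope
  \<open>3 / e\<close> just compensates the factor \<open>e^2\<close> of the window estimate, which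
  leaves \<open>9 * 50000 = 450000\<close> and \<open>2 + 2 * 450000\<close> in total.\<close>

lemma cutoff_N2:
assumes e: "e > 0" "60 * e < d" and P: "Ph : S e" and c: "c1 et E" "!!x. abs (et x) <= 1" "!!x. norm (E x) <= 3 / e"
	and z: "!!x. x ~: (\<Union>k. window e k) ==> et x = 0 & E x = 0"
shows "N2 (%x. fst (mulc et E Ph x)) <= 50000 * e^2 * N2 Ph" "N2 (mulc et E Ph) <= 900002 * N2 Ph"
proof -
note s = S_D(1)[OF P]
let ?T = "\<Union>k. window e k"
have Tb: "?T : sets borel" by (intro sets.countable_UN') (auto simp: window_borel)
let ?h = "%x. ind ?T x *R fst (Ph x)"
have sh: "sqi ?h" by (rule sqi_ind[OF sqi_3(1)[OF s] Tb])
have i: "Li (%x. ind ?T x * (pr c Ph x)^2)" for c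
	using i_ind[OF Tb sqi_i[OF sqi_pr_gr(1)[OF s]]] by simp
have "(norm (?h x))^2 = ind ?T x * (pr 1 Ph x)^2 + ind ?T x * (pr \<i> Ph x)^2" for x
	by (simp add: ind_def pr_def inner_complex_def cmod_power2)
then have "N2 ?h = (LI x. ind ?T x * (pr 1 Ph x)^2) + (LI x. ind ?T x * (pr \<i> Ph x)^2)"
	unfolding N2_def using i by simp
also have "... <= 25000 * e^2 * N2 Ph + 25000 * e^2 * N2 Ph"
proof (rule add_mono; rule order_trans[OF window_L2[OF e P]])
	show "25000 * e^2 * N2 (gr 1 Ph) <= 25000 * e^2 * N2 Ph" "25000 * e^2 * N2 (gr \<i> Ph) <= 25000 * e^2 * N2 Ph"
		using N2_pr_gr_le(2)[OF s, of 1] N2_pr_gr_le(2)[OF s, of \<i>] by (auto intro!: mlm)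
qed
finally have h: "N2 ?h <= 50000 * e^2 * N2 Ph" by (simp add: mult_ac)
have sm: "sqi (mulc et E Ph)" by (rule sqi_mulc[OF s c])
have "N2 (%x. fst (mulc et E Ph x)) <= N2 ?h"
proof (rule N2_mono[OF sh sqi_m[OF sqi_3(1)[OF sm]]])
	fix x show "norm (fst (mulc et E Ph x)) <= norm (?h x)"
		using z[of x] mrm[OF c(2)[of x], of "norm (fst (Ph x))"] by (cases "x : ?T") (simp_all add: mulc_def)
qed
with h show "N2 (%x. fst (mulc et E Ph x)) <= 50000 * e^2 * N2 Ph" by simp
have s1: "sqi (%x. et x *R Ph x)" by (rule sqi_bm[OF s bmc[OF c1_cont[OF c(1)]] c(2)])
note s2 = sqi_second[OF s c(1,3)]
have a: "N2 (%x. et x *R Ph x) <= N2 Ph"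
	by (rule N2_mono[OF s sqi_m[OF s1]]) (use c(2) mrm[OF c(2) norm_ge_zero] in force)
have "N2 (%x. (0::complex, fst (E x) *R fst (Ph x), snd (E x) *R fst (Ph x))) <= N2 (%x. (3 / e) *R ?h x)"
proof (rule N2_mono[OF sqi_scaleR[OF sh] sqi_m[OF s2]])
	fix x show "norm (0::complex, fst (E x) *R fst (Ph x), snd (E x) *R fst (Ph x)) <= norm ((3 / e) *R ?h x)"
		unfolding norm_second using z[of x] e(1) mrm[OF c(3)[of x], of "norm (fst (Ph x))"] by (cases "x : ?T") simp_all
qed
also have "... = (3 / e)^2 * N2 ?h" by (rule N2_scaleR)
also have "... <= (3 / e)^2 * (50000 * e^2 * N2 Ph)" by (rule mlm[OF h]) simp
also have "... = 450000 * N2 Ph" using e(1) by (simp add: p2eq)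
finally have b: "N2 (%x. (0::complex, fst (E x) *R fst (Ph x), snd (E x) *R fst (Ph x))) <= 450000 * N2 Ph" .
show "N2 (mulc et E Ph) <= 900002 * N2 Ph"
	using N2_add_le[OF s1 s2] a b unfolding mulc_def[abs_def] by linarith
qed

text \<open>\<open>R0\<close> is the radius of the discs about the windows for the gradient
  estimate. For data of norm at most 1, \<open>M1\<close> bounds the squared norm of
  \<open>F - (V - \<i>) U\<close>, and \<open>M2\<close> bounds the integral on the right of the
  gradient estimate. \<open>C0\<close> collects the constants of the two remainder terms.\<close>

definition R0 :: real where "R0 = min (d / 2) x20"
definition M1 :: real where "M1 = 2 + 2 * (K + 1)^2 * (cmod z0)^2"
definition M2 :: real where "M2 = 32 * M1 + 88 * (24 / R0)^2 * (cmod z0)^2"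
definition C0 :: real where "C0 = cmod z0 * (sqrt (50000 * M1) + sqrt (1600 * M2 * 900002))"

text \<open>The remainder splits into a value term, where the cut test function is of size
  \<open>e\<close>, and a gradient term, where it is only bounded but the gradient of
  \<open>U\<close> near the windows is of size \<open>e |ln e|^(1/2)\<close>. One factor of the norm
  of the difference is cancelled at the end.\<close>

lemma difference_bound:
assumes e: "e > 0" "60 * e < d" "e < x20" "5 * e < R0 / 4" and l: "1 <= abs (ln e)" "log_factor R0 (5 * e) <= 4 * abs (ln e)"
	and F: "sqi F" "N2 F <= 1" "!!x. x ~: Om ==> F x = 0" and Ue: "Ue : S e" and U: "U : S (- 1)"
	and we: "!!Ph. Ph : S e ==> (LI x. pot (cr (Vh x) - \<i>) (Ue x) *. Ph x) = (LI x. F x *. fst (Ph x))"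
	and w: "!!Ph. Ph : S (- 1) ==> (LI x. pot (cr (Vh x) - \<i>) (U x) *. Ph x) = (LI x. F x *. fst (Ph x))"
shows "sqrt (N2 (%x. Ue x - U x)) <= C0 * e * sqrt (abs (ln e))"
proof -
interpret D: dirichlet_rep "S e" "Oe e" V Vh K by (rule dirichlet_rep_S[OF e(3)])
let ?v = "%x. cr (Vh x) - \<i>"
let ?W = "%x. Ue x - U x"
have WS: "?W : S e" by (rule D.S_diff[OF Ue S_mono[OF U]])
note sW = S_D(1)[OF WS] and sU = S_D(1)[OF U] and sUe = S_D(1)[OF Ue]
define Ph where "Ph x = smul (cnj z0) (?W x)" for x
have PS: "Ph : S e" unfolding Ph_def[abs_def] by (rule S_smul[OF WS])
note sP = S_D(1)[OF PS]
have NP: "N2 Ph = (cmod z0)^2 * N2 ?W" unfolding Ph_def[abs_def] by (simp add: N2_smul)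
obtain et E where c: "c1 et E" "!!x. 0 <= et x" "!!x. et x <= 1" "!!x. norm (E x) <= 3 / e"
	"!!x. x ~: (\<Union>k. window e k) ==> et x = 0 & E x = 0" "!!k x. x : ball (org k) (2 * e) ==> et x = 1 & E x = 0"
	using window_cutoff[OF e(1,2)] by metis
have c1: "abs (et x) <= 1" "abs (1 - et x) <= 1" for x using c(2,3)[of x] by auto
define P2 where "P2 = mulc et E Ph"
define P1 where "P1 = mulc (%x. 1 - et x) (%x. - E x) Ph"
have sP2: "sqi P2" unfolding P2_def by (rule sqi_mulc[OF sP c(1) c1(1) c(4)])
have P1S: "P1 : S (- 1)" unfolding P1_def
proof (rule mulc_in_S[OF PS])
	show "c1 (%x. 1 - et x) (%x. - E x)" using c1_diff[OF c1_const c(1), of 1] by simp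
	show "abs (1 - et x) <= 1" "norm (- E x) <= 3 / e" for x using c1(2) c(4) by simp_all
	fix x assume "x ~: We e"
	then obtain k where k: "fst x = of_int k * d" "abs (snd x) <= e" by (auto simp: We_def not_less)
	\<comment> \<open>The factor \<open>1 - et\<close> vanishes in an \<open>e\<close>-neighbourhood of
	  every closed window, as \<open>mulc_in_S\<close> demands.\<close>
	have "ball x e <= ball (org k) (2 * e)"
	proof
		fix y assume y: "y : ball x e"
		have "dist (org k) x <= e" using k by (cases x) (simp add: org_def dist_Pair_Pair dist_real_def)
		then show "y : ball (org k) (2 * e)" using y dist_triangle[of "org k" y x] by simp
	qed
	then show "EX r>0. ALL y:ball x r. 1 - et y = 0 & - E y = 0" using e(1) c(6) by (intro exI[of _ e]) auto
qed
note sP1 = S_D(1)[OF P1S]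
have split: "Ph x = P1 x + P2 x" for x by (simp add: P1_def P2_def mulc_def prod_eq_iff algebra_simps)
define Y where "Y x = F x - ?v x * fst (U x)" for x
have sV: "sqi (%x. pot (?v x) (U x))" by (rule D.sqi_sch[OF sU])
have svU: "sqi (%x. ?v x * fst (U x))" using sqi_3(1)[OF sV] by (simp add: pot_def)
have sY: "sqi Y" unfolding Y_def[abs_def] by (rule sqi_diff[OF F(1) svU])
have NU: "N2 U <= (cmod z0)^2"
	using energy_bound[OF _ U F(1) w] x20 mlm[OF F(2), of "(cmod z0)^2"] by simp
have NY: "N2 Y <= M1"
proof -
	have "N2 (%x. ?v x * fst (U x)) <= N2 (%x. (K + 1) *R U x)"
	proof (rule N2_mono[OF sqi_scaleR[OF sU] sqi_m[OF svU]])
		fix x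
		have "cmod (?v x) <= K + 1" using norm_triangle_ineq4[of "cr (Vh x)" \<i>] D.Vh_bound[of x] by simp
		then have "cmod (?v x) * cmod (fst (U x)) <= (K + 1) * norm (U x)" using K0 triple_norm_le(1) by (intro mult_mono) auto
		then show "norm (?v x * fst (U x)) <= norm ((K + 1) *R U x)" using K0 by (simp add: norm_mult)
	qed
	also have "... <= (K + 1)^2 * (cmod z0)^2" unfolding N2_scaleR using NU by (rule mlm) simp
	finally have "N2 (%x. ?v x * fst (U x)) <= (K + 1)^2 * (cmod z0)^2" .
	then show ?thesis using N2_add_le[OF F(1) sqi_uminus[OF svU]] F(2) by (simp add: Y_def[abs_def] M1_def N2_def)
qed
let ?T = "\<Union>k. window e k"
\<comment> \<open>The gradient of \<open>U\<close> restricted to the windows, with the value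
  component removed, since that component is part of \<open>Y\<close>.\<close>
define G where "G x = ind ?T x *R (0::complex, fst (snd (U x)), snd (snd (U x)))" for x
have Tb: "?T : sets borel" by (intro sets.countable_UN') (auto simp: window_borel)
have sG: "sqi G" unfolding G_def[abs_def]
proof (rule sqi_ind[OF sqi_bound[OF _ sU, of _ 1] Tb])
	show "(%x. (0::complex, fst (snd (U x)), snd (snd (U x)))) : BB"
		by (intro borel_measurable_Pair borel_measurable_const triple_measurable sqi_m[OF sU])
	show "norm (0::complex, fst (snd (U x)), snd (snd (U x))) <= 1 * norm (U x)" for x
	proof -
		have "norm (0::complex, fst (snd (U x)), snd (snd (U x))) <= norm (U x)"
			by (rule power2_le_imp_le) (simp_all add: norm_triple_sq norm_Pair del: prod.collapse)
		then show ?thesis by (simp only: mult_1)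
	qed
qed
have NG: "N2 G <= 1600 * M2 * (e^2 * abs (ln e))"
proof -
	let ?B = "\<Union>k. cball (org k) (5 * e)"
	\<comment> \<open>The windows are squares of half side \<open>3 * e\<close>, and
	  \<open>3 * sqrt 2 < 5\<close>.\<close>
	have TB: "?T <= ?B"
	proof
		fix x assume "x : ?T"
		then obtain k where k: "abs (fst x - of_int k * d) <= 3 * e" "abs (snd x) <= 3 * e" by (auto simp: window_def)
		have "(dist (org k) x)^2 = (fst x - of_int k * d)^2 + (snd x)^2"
			by (cases x) (simp add: org_def dist_Pair_Pair dist_real_def power2_commute)
		also have "... <= (3 * e)^2 + (3 * e)^2"       proof -
			have "t^2 <= (3 * e)^2" if "abs (t) <= 3 * e" for t using that e(1) abs_le_square_iff[of t "3 * e"] by simp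
			then show ?thesis using k by (intro add_mono) blast+
		qed
		also have "... <= (5 * e)^2" by (simp add: pmd)
		finally have "dist (org k) x <= 5 * e" by (rule power2_le_imp_le) (use e in simp)
		then show "x : ?B" by auto
	qed
	have Bb: "?B : sets borel" by (intro sets.countable_UN') auto
	have iB: "Li (%x. ind ?B x * (norm (gr c U x))^2)" for c
		by (rule i_ind[OF Bb sqi_i[OF sqi_pr_gr(2)[OF sU]]])
	have side: "(LI x. ind ?B x * (norm (gr c U x))^2) <= 800 * M2 * (e^2 * abs (ln e))" if c: "cmod c = 1" for c
	proof -
		have g: "(LI x. ind ?B x * (norm (gr c U x))^2) <= 8 * ((5 * e)^2 * log_factor R0 (5 * e)) *
				(LI x. 32 * (c *. (F x - ?v x * fst (U x)))^2 + 88 * (24 / R0)^2 * (norm (gr c U x))^2)"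
			unfolding R0_def by (rule window_gradient[OF U F(1) sV w F(3)]) (use e in \<open>simp_all add: R0_def\<close>)
		have b: "(LI x. 32 * (c *. (F x - ?v x * fst (U x)))^2 + 88 * (24 / R0)^2 * (norm (gr c U x))^2) <= M2"
		proof -
			have sc: "sqi (%x. c *. Y x)" using sqi_ic[OF sY, of c] by (simp add: inner_commute)
			have "N2 (%x. c *. Y x) <= N2 Y"
				by (rule N2_mono[OF sY sqi_m[OF sc]]) (use CS2[of c] c in force)
			then have a: "32 * N2 (%x. c *. Y x) <= 32 * M1" using NY by simp
			have "N2 (gr c U) <= (cmod z0)^2" using N2_pr_gr_le(2)[OF sU, of c] c NU by simp
			then have b: "88 * (24 / R0)^2 * N2 (gr c U) <= 88 * (24 / R0)^2 * (cmod z0)^2" by (rule mlm) simp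
			have "(LI x. 32 * (c *. Y x)^2 + 88 * (24 / R0)^2 * (norm (gr c U x))^2) = 32 * N2 (%x. c *. Y x) + 88 * (24 / R0)^2 * N2 (gr c U)"
				unfolding N2_def using sqi_i[OF sc] sqi_i[OF sqi_pr_gr(2)[OF sU, of c]] by simp
			then show ?thesis using a b by (simp add: Y_def M2_def)
		qed
		have L: "0 <= 8 * ((5 * e)^2 * (4 * abs (ln e)))" by simp
		have M: "0 <= M2" by (simp add: M1_def M2_def)
		have q: "8 * ((5 * e)^2 * log_factor R0 (5 * e)) <= 8 * ((5 * e)^2 * (4 * abs (ln e)))" using l(2) by (intro mlm) auto
		have i: "0 <= (LI x. 32 * (c *. (F x - ?v x * fst (U x)))^2 + 88 * (24 / R0)^2 * (norm (gr c U x))^2)" by (intro i_nn) simp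
		note g
		also note mult_mono[OF q b L i]
		\<comment> \<open>\<open>8 * 25 * 4 = 800\<close>; the two directions 1 and \<open>\<i>\<close>
		  make it 1600.\<close>
		also have "8 * ((5 * e)^2 * (4 * abs (ln e))) * M2 = 800 * M2 * (e^2 * abs (ln e))" by (simp add: pmd)
		finally show ?thesis .
	qed
	have "N2 G <= (LI x. ind ?B x * (norm (gr 1 U x))^2 + ind ?B x * (norm (gr \<i> U x))^2)"
		unfolding N2_def
	proof (rule integral_mono[OF sqi_i[OF sG] Bochner_Integration.integrable_add[OF iB iB]])
		fix x
		have "(norm (0::complex, fst (snd (U x)), snd (snd (U x))))^2 = (norm (gr 1 U x))^2 + (norm (gr \<i> U x))^2"
			by (simp add: gr_def norm_Pair inner_complex_def cmod_power2 del: prod.collapse)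
		note eq = this
		show "(norm (G x))^2 <= ind ?B x * (norm (gr 1 U x))^2 + ind ?B x * (norm (gr \<i> U x))^2"
		proof (cases "x : ?T")
			case True
			then have "x : ?B" using TB by blast
			then show ?thesis unfolding G_def indicator_simps(1)[OF True] indicator_simps(1)[OF `x : ?B`] scaleR_one eq by simp
		next
			case False
			show ?thesis unfolding G_def indicator_simps(2)[OF False] by simp
		qed
	qed
	also have "... = (LI x. ind ?B x * (norm (gr 1 U x))^2) + (LI x. ind ?B x * (norm (gr \<i> U x))^2)"
		by (rule iadd[OF iB iB])
	finally show ?thesis using side[of 1] side[of \<i>] by simp
qed
have "N2 ?W <= (LI x. pot (?v x) (?W x) *. Ph x)"
	using D.coercive[OF sW] by (simp add: z0_def[symmetric] smul_adjoint Ph_def)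
also have "... = (LI x. pot (?v x) (Ue x) *. Ph x) - (LI x. pot (?v x) (U x) *. Ph x)"
	using LINT_inner_diff_left[OF D.sqi_sch[OF sUe] sV sP] by (simp add: linear_diff[OF linear_pot])
also have "(LI x. pot (?v x) (U x) *. Ph x) = (LI x. pot (?v x) (U x) *. P1 x) + (LI x. pot (?v x) (U x) *. P2 x)"
	unfolding split inner_add_right by (rule iadd[OF i_inner[OF sV sP1] i_inner[OF sV sP2]])
also have "(LI x. pot (?v x) (Ue x) *. Ph x) = (LI x. F x *. fst (Ph x))" by (rule we[OF PS])
also have "(LI x. F x *. fst (Ph x)) = (LI x. F x *. fst (P1 x)) + (LI x. F x *. fst (P2 x))"
	unfolding split fst_add inner_add_right
	by (rule iadd[OF i_inner[OF F(1) sqi_3(1)[OF sP1]] i_inner[OF F(1) sqi_3(1)[OF sP2]]])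
\<comment> \<open>\<open>P1\<close> is a test function for both problems and cancels; only
  \<open>P2\<close>, supported in the windows, remains.\<close>
also have "(LI x. pot (?v x) (U x) *. P1 x) = (LI x. F x *. fst (P1 x))" by (rule w[OF P1S])
also have "(LI x. F x *. fst (P1 x)) + (LI x. F x *. fst (P2 x)) - ((LI x. F x *. fst (P1 x)) + (LI x. pot (?v x) (U x) *. P2 x))
	= (LI x. F x *. fst (P2 x) - pot (?v x) (U x) *. P2 x)"
	using i_inner[OF F(1) sqi_3(1)[OF sP2]] i_inner[OF sV sP2] by simp
also have "... = (LI x. Y x *. fst (P2 x) - G x *. P2 x)"
proof (rule icong)
	fix x
	have "P2 x = 0" if "x ~: ?T" using c(5)[OF that] by (simp add: P2_def mulc_def zero_prod_def)
	then show "F x *. fst (P2 x) - pot (?v x) (U x) *. P2 x = Y x *. fst (P2 x) - G x *. P2 x"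
		by (cases "x : ?T") (simp_all add: G_def Y_def pot_def inner_triple idl)
qed simp
also have "... = (LI x. Y x *. fst (P2 x)) - (LI x. G x *. P2 x)"
	using i_inner[OF sY sqi_3(1)[OF sP2]] i_inner[OF sG sP2] by simp
also have "... <= sqrt (N2 Y) * sqrt (N2 (%x. fst (P2 x))) + sqrt (N2 G) * sqrt (N2 P2)"
	using abs_int_le[OF sY sqi_3(1)[OF sP2]] abs_int_le[OF sG sP2] by linarith
also have "... <= sqrt M1 * sqrt (50000 * e^2 * N2 Ph) + sqrt (1600 * M2 * (e^2 * abs (ln e))) * sqrt (900002 * N2 Ph)"
	unfolding P2_def using cutoff_N2[OF e(1,2) PS c(1) c1(1) c(4,5)] NY NG
	by (intro add_mono mult_mono real_sqrt_le_mono) (auto simp: M1_def M2_def N2_nonneg)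
also have "... = (cmod z0 * (sqrt (50000 * M1) + sqrt (1600 * M2 * 900002) * sqrt (abs (ln e)))) * e * sqrt (N2 ?W)"
proof -
	have "sqrt M * sqrt (a * t^2 * (z^2 * n)) + sqrt (b * (t^2 * l)) * sqrt (p * (z^2 * n)) = (z * (sqrt (a * M) + sqrt (b * p) * sqrt l)) * t * sqrt n"
		if "0 <= z" "0 <= t" for M a b p t z l n :: real
		using that by (simp add: real_sqrt_mult algebra_simps)
	from this[OF norm_ge_zero less_imp_le[OF e(1)]] show ?thesis unfolding NP .
qed
also have "... <= (C0 * e * sqrt (abs (ln e))) * sqrt (N2 ?W)"
proof (rule mrm)
	\<comment> \<open>The value term has no logarithm; \<open>|ln e| >= 1\<close> subsumes it under the
	  gradient term.\<close>
	have "sqrt (50000 * M1) * 1 <= sqrt (50000 * M1) * sqrt (abs (ln e))" using l(1) by (intro mlm) (auto simp: M1_def)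
	then have "cmod z0 * (sqrt (50000 * M1) + sqrt (1600 * M2 * 900002) * sqrt (abs (ln e))) <= cmod z0 * (sqrt (50000 * M1) * sqrt (abs (ln e)) + sqrt (1600 * M2 * 900002) * sqrt (abs (ln e)))"
		by (intro mlm) auto
	then have "cmod z0 * (sqrt (50000 * M1) + sqrt (1600 * M2 * 900002) * sqrt (abs (ln e))) * e <= cmod z0 * (sqrt (50000 * M1) * sqrt (abs (ln e)) + sqrt (1600 * M2 * 900002) * sqrt (abs (ln e))) * e"
		using e(1) by (intro mrm) auto
	also have "... = C0 * e * sqrt (abs (ln e))" by (simp only: C0_def distrib_left distrib_right mult_ac)
	finally show "cmod z0 * (sqrt (50000 * M1) + sqrt (1600 * M2 * 900002) * sqrt (abs (ln e))) * e <= C0 * e * sqrt (abs (ln e))" .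
qed (simp add: N2_nonneg)
finally have le: "sqrt (N2 ?W) * sqrt (N2 ?W) <= (C0 * e * sqrt (abs (ln e))) * sqrt (N2 ?W)" using N2_nonneg[of ?W] by simp
show ?thesis
proof (cases "N2 ?W = 0")
	case True
	then show ?thesis using e(1) by (simp add: C0_def M1_def M2_def)
next
	case False
	then show ?thesis using mult_right_le_imp_le[OF le] N2_nonneg[of ?W] by simp
qed
qed

text \<open>Smallness of \<open>e\<close> against \<open>R^2\<close> bounds the argument of the
  logarithm by \<open>1 / e^3\<close>, hence the logarithm by \<open>3 |ln e|\<close>; the summand 1
  accounts for one more, as \<open>e < 1/3 < exp (-1)\<close>.\<close>

lemma log_factor_le:
assumes "0 < e" "e < 1 / 3" "e * (1 + R^2) <= 1"
shows "1 <= abs (ln e)" "log_factor R (5 * e) <= 4 * abs (ln e)"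
proof -
have "e * exp 1 <= 1 / 3 * exp 1" using assms(2) by (intro mrm) auto
then have "e * exp 1 < 1" using e_less_272 by linarith
then have "exp 1 < 1 / e" using assms(1) by (simp add: field_simps)
then have "1 < ln (1 / e)" using assms(1) by (metis exp_gt_zero ln_exp ln_less_cancel_iff zero_less_divide_1_iff)
then have l: "1 < - ln e" using assms(1) by (simp add: ln_div)
then show "1 <= abs (ln e)" by simp
have "e ^ 3 + 2 * R^2 / 25 * e <= 1"
proof -
	have "e ^ 3 <= e * 1" unfolding power3_eq_cube using assms mult_mono[of e 1 e 1] by (simp add: mult.assoc mlm)
	moreover have "2 * R^2 / 25 * e <= R^2 * e" using assms(1) by (intro mrm) auto
	ultimately show ?thesis using assms(3) by (simp add: algebra_simps)
qed
then have "(e ^ 3 + 2 * R^2 / 25 * e) / e ^ 3 <= 1 / e ^ 3" using assms(1) by (intro divide_right_mono) auto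
moreover have "(e ^ 3 + 2 * R^2 / 25 * e) / e ^ 3 = 1 + 2 * R^2 / (5 * e)^2"
	using assms(1) by (simp add: field_simps p2eq power3_eq_cube)
ultimately have "1 + 2 * R^2 / (5 * e)^2 <= 1 / e ^ 3" by simp
moreover have "0 < 1 + 2 * R^2 / (5 * e)^2" by (intro add_pos_nonneg) auto
ultimately have "ln (1 + 2 * R^2 / (5 * e)^2) <= ln (1 / e ^ 3)" using assms(1) by (simp add: ln_le_cancel_iff)
also have "... = - 3 * ln e" using assms(1) by (simp add: ln_div ln_realpow)
finally show "log_factor R (5 * e) <= 4 * abs (ln e)" using l by (simp add: log_factor_def)
qed

lemma Oe_minus_one: "Oe (- 1) = Om" by (auto simp: Oe_iff Om_def)

text \<open>Both resolvents are represented by triples with the same data \<open>F\<close>, as the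
  two domains differ by a null set, and the smaller form domain lies in the larger one.\<close>

lemma resolvent_difference:
assumes e: "0 < e" "60 * e < d" "e < x20" "5 * e < R0 / 4" "e < 1 / 3" "e * (1 + R0^2) <= 1"
	and f: "f : L2 Om" "L2_norm Om f <= 1"
defines "g \<equiv> %x. resolvent (Oe e) (dirichlet_schroedinger (Oe e) V) \<i> f x - zero_ext Om (resolvent Om (dirichlet_schroedinger Om V) \<i> f) x"
shows "g : W12 (Oe e)" "W12_norm (Oe e) g <= C0 * e * abs (ln e) powr (1 / 2)"
proof -
have m1: "- 1 < x20" using x20 by simp
interpret D: dirichlet_rep "S e" "Oe e" V Vh K by (rule dirichlet_rep_S[OF e(3)])
interpret D0: dirichlet_rep "S (- 1)" "Om" V Vh K using dirichlet_rep_S[OF m1] unfolding Oe_minus_one .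
obtain F where F: "rep Om f F" using ex_rep[OF _ D0.Qb, of f] f(1) by (auto simp: L2_def)
have sF: "sqi F" using rep_L2(1)[OF F D0.Qb] f(1) by simp
have NF: "N2 F <= 1" using f(2) N2_nonneg[of F] unfolding rep_L2(2)[OF F D0.Qb] by simp
have F0: "x ~: Om ==> F x = 0" for x using F unfolding rep_def by blast
have "AE x in lborel. x : Om --> F x = f x" using F by (simp only: rep_def)
with AE_Oe_Om[of e] have "AE x in lborel. x : Oe e --> F x = f x" by (rule ev2) blast
moreover have "x ~: Oe e ==> F x = 0" for x using F0 Om_sub_Oe by blast
ultimately have Fe: "rep (Oe e) f F" using sqi_m[OF sF] by (simp only: rep_def) blast
have fe: "f : L2 (Oe e)" using rep_L2(1)[OF Fe D.Qb] sF by simp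
obtain Ue where Ue: "Ue : S e" "is_rep (Oe e) (resolvent (Oe e) (dirichlet_schroedinger (Oe e) V) \<i> f) Ue"
	"!!Ph. Ph : S e ==> (LI x. pot (cr (Vh x) - \<i>) (Ue x) *. Ph x) = (LI x. F x *. fst (Ph x))"
	by (rule D.resolvent_rep[OF fe Fe]) (rule that)
obtain U where U: "U : S (- 1)" "is_rep Om (resolvent Om (dirichlet_schroedinger Om V) \<i> f) U"
	"!!Ph. Ph : S (- 1) ==> (LI x. pot (cr (Vh x) - \<i>) (U x) *. Ph x) = (LI x. F x *. fst (Ph x))"
	by (rule D0.resolvent_rep[OF f(1) F]) (rule that)
have WS: "(%x. Ue x - U x) : S e" by (rule D.S_diff[OF Ue(1) S_mono[OF U(1)]])
have a1: "AE x in lborel. x : Oe e --> fst (Ue x) = resolvent (Oe e) (dirichlet_schroedinger (Oe e) V) \<i> f x"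
	using Ue(2) by (simp only: is_rep_def rep_def)
have "AE x in lborel. x : Om --> fst (U x) = resolvent Om (dirichlet_schroedinger Om V) \<i> f x"
	using U(2) by (simp only: is_rep_def rep_def)
then have "AE x in lborel. fst (U x) = zero_ext Om (resolvent Om (dirichlet_schroedinger Om V) \<i> f) x"
	by (rule ev_mono) (use S_D(2)[OF U(1)] in \<open>simp add: zero_ext_def\<close>)
with a1 have ae: "AE x in lborel. x : Oe e --> fst (Ue x - U x) = g x"
	by (rule ev2) (simp add: g_def)
show "g : W12 (Oe e)" by (rule D.S_is_rep(1)[OF WS ae])
have "W12_norm (Oe e) g = sqrt (N2 (%x. Ue x - U x))" by (rule W12_norm_rep[OF D.openQ D.S_is_rep(2)[OF WS ae]])
also have "... <= C0 * e * sqrt (abs (ln e))"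
	by (rule difference_bound[OF e(1-4) log_factor_le[OF e(1,5,6)] sF NF F0 Ue(1) U(1) Ue(3) U(3)])
finally show "W12_norm (Oe e) g <= C0 * e * abs (ln e) powr (1 / 2)" by (simp add: powr_half_sqrt)
qed

end

text \<open>Periodicity moves every point to the basic cell, where beyond the height
  \<open>b\<close> the potential vanishes and the rest of the closure is compact.\<close>

lemma (in cell_array) potential_bounded:
assumes V: "continuous_on (closure Om) V" and per: "!!x. x : closure Om ==> V (fst x + d, snd x) = V x"
	and far: "!!x. x : closure Om ==> (abs (snd x)) > b ==> V x = 0"
obtains K :: real where "0 <= K" "!!x. x : Om ==> (abs (V x)) <= K"
proof -
let ?A = "closure Om Int ({0..d} \<times> {- b..b})"
have "compact ?A" by (rule closed_Int_compact[OF closed_closure compact_Times[OF compact_Icc compact_Icc]])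
then have "bounded (V ` ?A)"
	by (intro compact_imp_bounded compact_continuous_image continuous_on_subset[OF V]) auto
then obtain K where K: "K > 0" "!!x. x : ?A ==> (abs (V x)) <= K" unfolding bounded_pos by auto
have inO: "y + org k : Om" if "y : P" for y k using that by (auto simp: Om_def Pk_def intro!: exI[of _ k])
have step: "V (y + org (k + 1)) = V (y + org k)" if "y : P" for y k
proof -
	have "y + org (k + 1) = (fst (y + org k) + d, snd (y + org k))" by (simp add: org_def prod_eq_iff algebra_simps)
	then show ?thesis using per[OF subsetD[OF closure_subset inO[OF that, of k]]] by simp
qed
have shift: "V (y + org k) = V (y + org 0)" if "y : P" for y k
proof (induction k rule: int_induct[of _ 0])
	case (step1 i) then show ?case using step[OF that, of i] by simp
next
	case (step2 i) then show ?case using step[OF that, of "i - 1"] by simp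
qed simp
have "abs (V x) <= K" if "x : Om" for x
proof -
	obtain k where "x : Pk k" using `x : Om` unfolding Om_def by blast
	then have k: "x - org k : P" by (simp add: Pk_def)
	let ?y = "x - org k"
	have "?y + org 0 = ?y" by (simp add: org_def prod_eq_iff)
	then have eq: "V x = V ?y" and yO: "?y : closure Om" using shift[OF k, of k] inO[OF k, of 0] closure_subset by (simp, metis subsetD)
	show ?thesis
	proof (cases "abs (snd ?y) > b")
		case True then show ?thesis unfolding eq using far[OF yO] K(1) by simp
	next
		case False
		have "?y : {0..d} \<times> {- b..b}" using strip k False by (auto simp: mem_Times_iff)
		then show ?thesis unfolding eq by (intro K(2) IntI yO)
	qed
qed
with K(1) show thesis by (intro that[of K]) auto
qed


theorem theorem1:
  fixes P :: "(real \<times> real) set" and V :: "real \<times> real \<Rightarrow> real"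
    and d x2_inf x2_0 a_plus a_minus :: real
  assumes "open P" and "connected P" and "P \<noteq> {}" and "\<not> bounded P" and "Ck_boundary 3 P"
    and "d > 0" and "P \<subseteq> {x. 0 < fst x \<and> fst x < d}"
    and "x2_inf > 0"
    and "0 \<le> a_plus" and "a_plus + 1 \<le> d" and "0 \<le> a_minus" and "a_minus + 1 \<le> d"
    and "P \<inter> {x. snd x > x2_inf} = {x. a_plus < fst x \<and> fst x < a_plus + 1 \<and> snd x > x2_inf}"
    and "P \<inter> {x. - snd x > x2_inf} = {x. a_minus < fst x \<and> fst x < a_minus + 1 \<and> - snd x > x2_inf}"
    and "x2_0 > 0"
    and "frontier P \<inter> {x. \<bar>snd x\<bar> < x2_0} =
           {x. fst x = 0 \<and> \<bar>snd x\<bar> < x2_0} \<union> {x. fst x = d \<and> \<bar>snd x\<bar> < x2_0}"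
    and "smooth_on_closure (periodic_array P d) V"
    and "\<forall>x \<in> closure (periodic_array P d). V (fst x + d, snd x) = V x"
    and "\<forall>x \<in> closure (periodic_array P d). \<bar>snd x\<bar> > x2_inf \<longrightarrow> V x = 0"
  defines "\<Omega> \<equiv> periodic_array P d"
    and "\<Omega>e \<equiv> array_with_windows P d"
  defines "H0 \<equiv> dirichlet_schroedinger \<Omega> V"
    and "H \<equiv> \<lambda>\<epsilon>. dirichlet_schroedinger (\<Omega>e \<epsilon>) V"
  shows "\<exists>C \<epsilon>0. \<epsilon>0 > 0 \<and> (\<forall>\<epsilon>. 0 < \<epsilon> \<and> \<epsilon> < \<epsilon>0 \<longrightarrow>
           \<i> \<in> resolvent_set (\<Omega>e \<epsilon>) (H \<epsilon>) \<and> \<i> \<in> resolvent_set \<Omega> H0 \<and>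
           op_norm (L2 \<Omega>) (L2_norm \<Omega>) (W12 (\<Omega>e \<epsilon>)) (W12_norm (\<Omega>e \<epsilon>))
             (\<lambda>f x. resolvent (\<Omega>e \<epsilon>) (H \<epsilon>) \<i> f x - zero_ext \<Omega> (resolvent \<Omega> H0 \<i> f) x)
           \<le> ennreal (C * \<epsilon> * \<bar>ln \<epsilon>\<bar> powr (1 / 2)))"
proof -
interpret cell_array P d x2_0 by unfold_locales (fact assms)+
have cont: "continuous_on (closure Om) V" using assms(17) by (simp add: Om_eq smooth_on_closure_def)
obtain K where K: "0 <= K" "!!x. x : Om ==> (abs (V x)) <= K"
proof (rule potential_bounded[OF cont])
	show "V (fst x + d, snd x) = V x" if "x : closure Om" for x using assms(18) that unfolding Om_eq by blast
	show "V x = 0" if "x : closure Om" "x2_inf < abs (snd x)" for x using assms(19) that unfolding Om_eq by blast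
qed (rule that)
interpret cell_potential P d x2_0 V K
	by unfold_locales (fact continuous_on_subset[OF cont closure_subset] K)+
\<comment> \<open>\<open>d / 60\<close> separates the windows, \<open>x2_0\<close> keeps them in the
  straight part of the wall, \<open>R0 / 20\<close> places the discs of radius \<open>5 * e\<close>
  well inside those of radius \<open>R0\<close>, and the last two serve the logarithm.\<close>
define e0 where "e0 = Min {d / 60, x2_0, R0 / 20, 1 / 3, 1 / (1 + R0^2)}"
have R0: "0 < R0" using d x20 by (simp add: R0_def)
have q: "0 < 1 + R0^2" by (intro add_pos_nonneg) auto
have "0 < e0" using d x20 R0 q by (simp add: e0_def)
moreover have "\<i> : resolvent_set (\<Omega>e \<epsilon>) (H \<epsilon>) & \<i> : resolvent_set \<Omega> H0 &
	op_norm (L2 \<Omega>) (L2_norm \<Omega>) (W12 (\<Omega>e \<epsilon>)) (W12_norm (\<Omega>e \<epsilon>))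
		(%f x. resolvent (\<Omega>e \<epsilon>) (H \<epsilon>) \<i> f x - zero_ext \<Omega> (resolvent \<Omega> H0 \<i> f) x) <= ennreal (C0 * \<epsilon> * abs (ln \<epsilon>) powr (1 / 2))"
	if e: "0 < \<epsilon> & \<epsilon> < e0" for \<epsilon>
proof -
	have e': "0 < \<epsilon>" "60 * \<epsilon> < d" "\<epsilon> < x2_0" "5 * \<epsilon> < R0 / 4" "\<epsilon> < 1 / 3" "\<epsilon> < 1 / (1 + R0^2)"
		using e by (simp_all add: e0_def)
	have e6: "\<epsilon> * (1 + R0^2) <= 1" using e'(6) q by (simp add: less_divide_eq)
	have sets: "\<Omega> = Om" "\<Omega>e \<epsilon> = Oe \<epsilon>" "H \<epsilon> = dirichlet_schroedinger (Oe \<epsilon>) V" "H0 = dirichlet_schroedinger Om V"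
		by (simp_all add: \<Omega>_def \<Omega>e_def H_def H0_def Om_eq Oe_def)
	have "\<i> : resolvent_set (Oe \<epsilon>) (dirichlet_schroedinger (Oe \<epsilon>) V)"
		by (rule dirichlet_rep.i_in_resolvent_set[OF dirichlet_rep_S[OF e'(3)]])
	\<comment> \<open>The operator without windows is the instance with \<open>e = - 1\<close>.\<close>
	moreover have "\<i> : resolvent_set (Oe (- 1)) (dirichlet_schroedinger (Oe (- 1)) V)"
		by (rule dirichlet_rep.i_in_resolvent_set[OF dirichlet_rep_S]) (use x20 in simp)
	moreover have "op_norm (L2 Om) (L2_norm Om) (W12 (Oe \<epsilon>)) (W12_norm (Oe \<epsilon>))
		(%f x. resolvent (Oe \<epsilon>) (dirichlet_schroedinger (Oe \<epsilon>) V) \<i> f x - zero_ext Om (resolvent Om (dirichlet_schroedinger Om V) \<i> f) x)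
		<= ennreal (C0 * \<epsilon> * abs (ln \<epsilon>) powr (1 / 2))"
		unfolding op_norm_def
		by (rule SUP_least) (use resolvent_difference[OF e'(1-5) e6] in \<open>simp add: ennreal_leI\<close>)
	ultimately show ?thesis unfolding sets Oe_minus_one by blast
qed
ultimately show ?thesis by blast
qed

end
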